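(* Suppose that the force $F$ is continuous and bounded by $f$, and that the tensor field $T$ is continuous. Let $\rho^{in}\in\mathcal{P}_2(\mathbb{R}^2)$ and define $\rho^0_{ij}=\frac{1}{\Delta x\Delta y}\iint_{C_{ij}}\rho^{in}\,\mathrm{d}(x,y)$ for $(i,j)\in\mathbb{Z}^2$. Let $S>0$ be fixed, and suppose that the discretisation in time and space satisfies, for every $n$, $$\left(2f\left(\frac{1}{\Delta x}+\frac{1}{\Delta y}\right)+\delta r_n\left(\frac{1}{(\Delta x)^2}+\frac{1}{(\Delta y)^2}\right)\right)\Delta t^n\leq 1,\qquad r_n=\sup_{i,j}\rho_{ij}^n, \qquad (\ast)$$ where the $\rho_{ij}^n$ are obtained from the given $\rho_{ij}^0$ by the numerical scheme defined in the context. Then the reconstruction $\rho_\Delta$ converges weakly in $\mathcal{M}_b([0,S]\times\mathbb{R}^2)$ towards the solution $\rho$ of the anisotropic aggregation equation $$\partial_t\rho(t,(x,y))+\nabla\cdot\left[\rho(t,(x,y))\,(F(\cdot,T(x,y))\ast\rho(t,\cdot))(x,y)\right]=0,\qquad \rho|_{t=0}=\rho^{in},$$ as $\Delta=\max\{\Delta x,\Delta y\}$ and $\delta$ go to $0$, where for each $\Delta$ the sequence of time steps $\{\Delta t^n\}$ satisfies $(\ast)$.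
   Context: **Force.** $s=s(x,y)\in\mathbb{R}^2$ is a unit vector field on $\mathbb{R}^2$ and $l=l(x,y)$ a corresponding orthonormal vector field; the tensor field is $T(x,y)=\chi\, s(x,y)\otimes s(x,y)+l(x,y)\otimes l(x,y)$ with $\chi\in[0,1]$. For $v\in\mathbb{R}^2$ the force is $$F(v,T(x,y))=f_s(|v|)\,(s(x,y)\cdot v)\,s(x,y)+f_l(|v|)\,(l(x,y)\cdot v)\,l(x,y)$$ for scalar coefficient functions $f_s,f_l$. Write $F=(F_x,F_y)$ for its components; $f$ is a uniform bound: $|F|\leq f$. The convolution is $$(F(\cdot,T(x,y))\ast\rho)(x,y)=\int_{\mathbb{R}^2}F((x-w,y-z),T(x,y))\,\rho(w,z)\,\mathrm{d}(w,z)$$ (integration against $\rho$ if $\rho$ is a measure). **Scheme.** $\mathcal{P}_2(\mathbb{R}^2)$ is the space of probability measures with finite second moment. For $\Delta x,\Delta y>0$ set $x_i=i\Delta x$, $y_j=j\Delta y$, $C_{ij}=[x_i,x_{i+1})\times[y_j,y_{j+1})$, $i,j\in\mathbb{Z}$; time steps $\Delta t^n>0$, $t_n=\sum_{i=0}^{n-1}\Delta t^i$; diffusion parameter $\delta>0$. The integral of $\rho^{in}$ over $C_{ij}$ means the measure $\rho^{in}(C_{ij})$. Given $\rho_{ij}^n$, define $$\begin{aligned}\rho_{ij}^{n+1}&=\rho_{ij}^n-\frac{\Delta t^n}{\Delta x}\left((u_x)^n_{i+1/2,j}\rho^n_{i+1/2,j}-(u_x)^n_{i-1/2,j}\rho^n_{i-1/2,j}\right)-\frac{\Delta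 t^n}{\Delta y}\left((u_y)^n_{i,j+1/2}\rho^n_{i,j+1/2}-(u_y)^n_{i,j-1/2}\rho^n_{i,j-1/2}\right)\\&\quad+\frac{\Delta t^n}{2\Delta x}f\left(\rho_{i+1,j}^n-2\rho_{ij}^n+\rho_{i-1,j}^n\right)+\frac{\Delta t^n}{2\Delta y}f\left(\rho_{i,j+1}^n-2\rho_{ij}^n+\rho_{i,j-1}^n\right)\\&\quad+\frac{\delta\Delta t^n}{2(\Delta x)^2}\left((\rho_{i+1,j}^n)^2-2(\rho_{ij}^n)^2+(\rho_{i-1,j}^n)^2\right)+\frac{\delta\Delta t^n}{2(\Delta y)^2}\left((\rho_{i,j+1}^n)^2-2(\rho_{ij}^n)^2+(\rho_{i,j-1}^n)^2\right),\end{aligned}$$ where $\rho_{i+1/2,j}=\frac{\rho_{ij}+\rho_{i+1,j}}{2}$, $\rho_{i,j+1/2}=\frac{\rho_{ij}+\rho_{i,j+1}}{2}$, $(u_x)_{i+1/2,j}=\frac{(u_x)_{ij}+(u_x)_{i+1,j}}{2}$, $(u_y)_{i,j+1/2}=\frac{(u_y)_{ij}+(u_y)_{i,j+1}}{2}$ (at each time level $n$), and $$(u_x)_{ij}=\frac{1}{\Delta x\Delta y}\sum_{k,l}\rho_{kl}(F_x)_{ij}^{kl},\qquad (u_y)_{ij}=\frac{1}{\Delta x\Delta y}\sum_{k,l}\rho_{kl}(F_y)_{ij}^{kl},$$ $$(F_x)_{ij}^{kl}=\iint_{C_{kl}}\left(\iint_{C_{ij}}F_x((x-x',y-y'),T(x,y))\,\mathrm{d}(x,y)\right)\mathrm{d}(x',y'),$$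 and $(F_y)_{ij}^{kl}$ is defined in the same way with $F_y$ in place of $F_x$. **Reconstruction.** $\rho_\Delta(t,x,y)=\sum_{n\in\mathbb{N}}\sum_{i\in\mathbb{Z}}\sum_{j\in\mathbb{Z}}\rho_{ij}^n\,\chi_{[t_n,t_{n+1})\times C_{ij}}(t,x,y)$, where $\chi_A$ denotes the characteristic function of $A$ and $\mathbb{N}$ includes $0$; the time intervals are assumed to cover $[0,S]$, and $\rho_\Delta$ is regarded as a measure on $[0,S]\times\mathbb{R}^2$. **Topology.** $\mathcal{M}_b$ is the space of Borel measures of finite total variation, endowed with the weak topology $\sigma(\mathcal{M}_b,C_0)$, i.e. convergence of integrals against all $\phi\in C_0([0,S]\times\mathbb{R}^2)$. **Solution.** A solution $\rho$ is understood in the sense of distributions: for all smooth compactly supported test functions $\phi$ on $[0,S)\times\mathbb{R}^2$, $$\int_0^S\iint_{\mathbb{R}^2}\left[\partial_t\phi+\nabla\phi\cdot(F(\cdot,T(x,y))\ast\rho(t,\cdot))(x,y)\right]\rho(t,x,y)\,\mathrm{d}(x,y)\,\mathrm{d}t+\iint_{\mathbb{R}^2}\phi(0,x,y)\,\mathrm{d}\rho^{in}(x,y)=0.$$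
   Formalization: Since a merely continuous force allows several solutions, full convergence of the reconstruction is stated when the solution is unique (as a measure on [0,S]×R²); without uniqueness, a subsequence of every admissible sequence is shown to converge to a solution. *)

theory Defs
  imports "HOL-Probability.Probability"
begin

text \<open>
  Points of the plane are \<open>z :: real^2\<close> with coordinates \<open>z $ 1\<close> and \<open>z $ 2\<close>; space-time points
  are pairs \<open>(t, z) :: real \<times> (real^2)\<close>.
\<close>

section \<open>Force and tensor field\<close>

definition outer_product :: "real^'n \<Rightarrow> real^'m \<Rightarrow> real^'m^'n" where
  "outer_product a b = (\<chi> i j. a $ i * b $ j)"

definition tensor_field :: "real \<Rightarrow> (real^2 \<Rightarrow> real^2) \<Rightarrow> (real^2 \<Rightarrow> real^2) \<Rightarrow> real^2 \<Rightarrow> real^2^2" where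
  "tensor_field c s l z = c *\<^sub>R outer_product (s z) (s z) + outer_product (l z) (l z)"

definition force_convolution ::
    "(real^2 \<Rightarrow> real^2^2 \<Rightarrow> real^2) \<Rightarrow> (real^2 \<Rightarrow> real^2^2) \<Rightarrow> (real^2) measure \<Rightarrow> real^2 \<Rightarrow> real^2" where
  "force_convolution F T \<mu> z = (LINT w|\<mu>. F (z - w) (T z))"

section \<open>The numerical scheme\<close>

definition cell :: "real \<Rightarrow> real \<Rightarrow> int \<Rightarrow> int \<Rightarrow> (real^2) set" where
  "cell dx dy i j =
     {z. of_int i * dx \<le> z $ 1 \<and> z $ 1 < of_int (i + 1) * dx \<and>
         of_int j * dy \<le> z $ 2 \<and> z $ 2 < of_int (j + 1) * dy}"

text \<open>
  The index \<open>m :: 2\<close> selects the component: \<open>m = 1\<close> gives the quantities with subscript \<open>x\<close>,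
  \<open>m = 2\<close> those with subscript \<open>y\<close>.
\<close>

definition cell_force ::
    "(real^2 \<Rightarrow> real^2^2 \<Rightarrow> real^2) \<Rightarrow> (real^2 \<Rightarrow> real^2^2) \<Rightarrow> real \<Rightarrow> real \<Rightarrow>
     2 \<Rightarrow> int \<Rightarrow> int \<Rightarrow> int \<Rightarrow> int \<Rightarrow> real" where
  "cell_force F T dx dy m i j k l =
     (LINT w:cell dx dy k l|lborel. LINT z:cell dx dy i j|lborel. F (z - w) (T z) $ m)"

definition velocity ::
    "(real^2 \<Rightarrow> real^2^2 \<Rightarrow> real^2) \<Rightarrow> (real^2 \<Rightarrow> real^2^2) \<Rightarrow> real \<Rightarrow> real \<Rightarrow>
     (int \<Rightarrow> int \<Rightarrow> real) \<Rightarrow> 2 \<Rightarrow> int \<Rightarrow> int \<Rightarrow> real" where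
  "velocity F T dx dy \<rho> m i j =
     1 / (dx * dy) * (\<Sum>\<^sub>\<infinity>(k, l)\<in>UNIV. \<rho> k l * cell_force F T dx dy m i j k l)"

text \<open>
  \<open>flux_x \<dots> i j\<close> and \<open>flux_y \<dots> i j\<close> are the fluxes through the interfaces \<open>(i+1/2, j)\<close> and
  \<open>(i, j+1/2)\<close>; the interfaces \<open>(i-1/2, j)\<close> and \<open>(i, j-1/2)\<close> are those with index \<open>i - 1\<close> and
  \<open>j - 1\<close>, respectively.
\<close>

definition flux_x ::
    "(real^2 \<Rightarrow> real^2^2 \<Rightarrow> real^2) \<Rightarrow> (real^2 \<Rightarrow> real^2^2) \<Rightarrow> real \<Rightarrow> real \<Rightarrow>
     (int \<Rightarrow> int \<Rightarrow> real) \<Rightarrow> int \<Rightarrow> int \<Rightarrow> real" where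
  "flux_x F T dx dy \<rho> i j =
     (velocity F T dx dy \<rho> 1 i j + velocity F T dx dy \<rho> 1 (i + 1) j) / 2 *
     ((\<rho> i j + \<rho> (i + 1) j) / 2)"

definition flux_y ::
    "(real^2 \<Rightarrow> real^2^2 \<Rightarrow> real^2) \<Rightarrow> (real^2 \<Rightarrow> real^2^2) \<Rightarrow> real \<Rightarrow> real \<Rightarrow>
     (int \<Rightarrow> int \<Rightarrow> real) \<Rightarrow> int \<Rightarrow> int \<Rightarrow> real" where
  "flux_y F T dx dy \<rho> i j =
     (velocity F T dx dy \<rho> 2 i j + velocity F T dx dy \<rho> 2 i (j + 1)) / 2 *
     ((\<rho> i j + \<rho> i (j + 1)) / 2)"

definition scheme_step ::
    "(real^2 \<Rightarrow> real^2^2 \<Rightarrow> real^2) \<Rightarrow> (real^2 \<Rightarrow> real^2^2) \<Rightarrow> real \<Rightarrow> real \<Rightarrow> real \<Rightarrow> real \<Rightarrow> real \<Rightarrow>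
     (int \<Rightarrow> int \<Rightarrow> real) \<Rightarrow> int \<Rightarrow> int \<Rightarrow> real" where
  "scheme_step F T f dx dy \<delta> \<tau> \<rho> i j =
     \<rho> i j
     - \<tau> / dx * (flux_x F T dx dy \<rho> i j - flux_x F T dx dy \<rho> (i - 1) j)
     - \<tau> / dy * (flux_y F T dx dy \<rho> i j - flux_y F T dx dy \<rho> i (j - 1))
     + \<tau> / (2 * dx) * f * (\<rho> (i + 1) j - 2 * \<rho> i j + \<rho> (i - 1) j)
     + \<tau> / (2 * dy) * f * (\<rho> i (j + 1) - 2 * \<rho> i j + \<rho> i (j - 1))
     + \<delta> * \<tau> / (2 * dx^2) * ((\<rho> (i + 1) j)^2 - 2 * (\<rho> i j)^2 + (\<rho> (i - 1) j)^2)
     + \<delta> * \<tau> / (2 * dy^2) * ((\<rho> i (j + 1))^2 - 2 * (\<rho> i j)^2 + (\<rho> i (j - 1))^2)"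

primrec scheme ::
    "(real^2 \<Rightarrow> real^2^2 \<Rightarrow> real^2) \<Rightarrow> (real^2 \<Rightarrow> real^2^2) \<Rightarrow> real \<Rightarrow> (real^2) measure \<Rightarrow>
     real \<Rightarrow> real \<Rightarrow> real \<Rightarrow> (nat \<Rightarrow> real) \<Rightarrow> nat \<Rightarrow> int \<Rightarrow> int \<Rightarrow> real" where
  "scheme F T f \<rho>in dx dy \<delta> dt 0 =
     (\<lambda>i j. 1 / (dx * dy) * measure \<rho>in (cell dx dy i j))"
| "scheme F T f \<rho>in dx dy \<delta> dt (Suc n) =
     scheme_step F T f dx dy \<delta> (dt n) (scheme F T f \<rho>in dx dy \<delta> dt n)"

definition time_level :: "(nat \<Rightarrow> real) \<Rightarrow> nat \<Rightarrow> real" where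
  "time_level dt n = (\<Sum>i<n. dt i)"

text \<open>
  The positive reals \<open>dx\<close>, \<open>dy\<close>, \<open>\<delta>\<close>, \<open>dt n\<close> form an admissible discretisation up to the final
  time \<open>S\<close>: the time intervals cover \<open>{0..S}\<close> and the step size condition holds at every level.
\<close>

definition admissible_discretisation ::
    "(real^2 \<Rightarrow> real^2^2 \<Rightarrow> real^2) \<Rightarrow> (real^2 \<Rightarrow> real^2^2) \<Rightarrow> real \<Rightarrow> (real^2) measure \<Rightarrow> real \<Rightarrow>
     real \<Rightarrow> real \<Rightarrow> real \<Rightarrow> (nat \<Rightarrow> real) \<Rightarrow> bool" where
  "admissible_discretisation F T f \<rho>in S dx dy \<delta> dt \<longleftrightarrow>
     0 < dx \<and> 0 < dy \<and> 0 < \<delta> \<and> (\<forall>n. 0 < dt n) \<and>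
     {0..S} \<subseteq> (\<Union>n. {time_level dt n..<time_level dt (Suc n)}) \<and>
     (\<forall>n. (2 * f * (1 / dx + 1 / dy)
            + \<delta> * (SUP (i, j)\<in>UNIV. scheme F T f \<rho>in dx dy \<delta> dt n i j) * (1 / dx^2 + 1 / dy^2))
           * dt n \<le> 1)"

definition reconstruction ::
    "(real^2 \<Rightarrow> real^2^2 \<Rightarrow> real^2) \<Rightarrow> (real^2 \<Rightarrow> real^2^2) \<Rightarrow> real \<Rightarrow> (real^2) measure \<Rightarrow>
     real \<Rightarrow> real \<Rightarrow> real \<Rightarrow> (nat \<Rightarrow> real) \<Rightarrow> real \<Rightarrow> real^2 \<Rightarrow> real" where
  "reconstruction F T f \<rho>in dx dy \<delta> dt t z =
     (\<Sum>\<^sub>\<infinity>n. \<Sum>\<^sub>\<infinity>i. \<Sum>\<^sub>\<infinity>j. scheme F T f \<rho>in dx dy \<delta> dt n i j *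
        indicator ({time_level dt n..<time_level dt (Suc n)} \<times> cell dx dy i j) (t, z))"

text \<open>
  The reconstruction as a measure on \<open>{0..S} \<times> UNIV\<close>. The use of \<^const>\<open>ennreal\<close> loses nothing,
  because the step size condition keeps the scheme nonnegative.
\<close>

definition reconstruction_measure ::
    "(real^2 \<Rightarrow> real^2^2 \<Rightarrow> real^2) \<Rightarrow> (real^2 \<Rightarrow> real^2^2) \<Rightarrow> real \<Rightarrow> (real^2) measure \<Rightarrow> real \<Rightarrow>
     real \<Rightarrow> real \<Rightarrow> real \<Rightarrow> (nat \<Rightarrow> real) \<Rightarrow> (real \<times> (real^2)) measure" where
  "reconstruction_measure F T f \<rho>in S dx dy \<delta> dt =
     density (restrict_space lborel ({0..S} \<times> UNIV))
       (\<lambda>(t, z). ennreal (reconstruction F T f \<rho>in dx dy \<delta> dt t z))"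

section \<open>Measures and weak convergence\<close>

definition P2 :: "(real^2) measure set" where
  "P2 = {\<mu>. prob_space \<mu> \<and> sets \<mu> = sets borel \<and> integrable \<mu> (\<lambda>z. (norm z)^2)}"

text \<open>
  Measurable curves \<open>t \<mapsto> \<rho> t\<close> on \<open>{0..S}\<close> with values in \<^const>\<open>P2\<close>; such a curve is identified
  with the measure \<open>\<rho> t (dz) dt\<close> on \<open>{0..S} \<times> UNIV\<close>.
\<close>

definition P2_curve :: "real \<Rightarrow> (real \<Rightarrow> (real^2) measure) \<Rightarrow> bool" where
  "P2_curve S \<rho> \<longleftrightarrow>
     \<rho> \<in> measurable (restrict_space borel {0..S}) (subprob_algebra borel) \<and> (\<forall>t\<in>{0..S}. \<rho> t \<in> P2)"

definition spacetime_measure :: "real \<Rightarrow> (real \<Rightarrow> (real^2) measure) \<Rightarrow> (real \<times> (real^2)) measure" where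
  "spacetime_measure S \<rho> =
     restrict_space lborel {0..S} \<bind>
       (\<lambda>t. distr (\<rho> t) (restrict_space borel ({0..S} \<times> UNIV)) (\<lambda>z. (t, z)))"

definition C0_on :: "'a::topological_space set \<Rightarrow> ('a \<Rightarrow> real) set" where
  "C0_on X = {\<phi>. continuous_on X \<phi> \<and>
     (\<forall>\<epsilon>>0. \<exists>K. compact K \<and> K \<subseteq> X \<and> (\<forall>x\<in>X - K. \<bar>\<phi> x\<bar> < \<epsilon>))}"

definition weakly_converges_Mb ::
    "'a::topological_space set \<Rightarrow> (nat \<Rightarrow> 'a measure) \<Rightarrow> 'a measure \<Rightarrow> bool" where
  "weakly_converges_Mb X M \<mu> \<longleftrightarrow>
     (\<forall>k. finite_measure (M k) \<and> sets (M k) = sets (restrict_space borel X)) \<and>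
     finite_measure \<mu> \<and> sets \<mu> = sets (restrict_space borel X) \<and>
     (\<forall>\<phi>\<in>C0_on X. (\<lambda>k. LINT x|M k. \<phi> x) \<longlonglongrightarrow> (LINT x|\<mu>. \<phi> x))"

section \<open>Distributional solutions\<close>

primrec Ck :: "nat \<Rightarrow> ('a::euclidean_space \<Rightarrow> real) \<Rightarrow> bool" where
  "Ck 0 \<phi> \<longleftrightarrow> continuous_on UNIV \<phi>"
| "Ck (Suc k) \<phi> \<longleftrightarrow>
     (\<forall>x. \<phi> differentiable (at x)) \<and> (\<forall>v. Ck k (\<lambda>x. frechet_derivative \<phi> (at x) v))"

definition smooth :: "('a::euclidean_space \<Rightarrow> real) \<Rightarrow> bool" where
  "smooth \<phi> \<longleftrightarrow> (\<forall>k. Ck k \<phi>)"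

text \<open>
  Smooth compactly supported functions on \<open>{0..<S} \<times> UNIV\<close>, given by their smooth extensions to
  negative times; they need not vanish at time \<open>0\<close>.
\<close>

definition test_function :: "real \<Rightarrow> (real \<times> (real^2) \<Rightarrow> real) \<Rightarrow> bool" where
  "test_function S \<phi> \<longleftrightarrow>
     smooth \<phi> \<and> compact (closure {p. \<phi> p \<noteq> 0}) \<and> closure {p. \<phi> p \<noteq> 0} \<subseteq> {..<S} \<times> UNIV"

definition time_deriv :: "(real \<times> (real^2) \<Rightarrow> real) \<Rightarrow> real \<Rightarrow> real^2 \<Rightarrow> real" where
  "time_deriv \<phi> t z = deriv (\<lambda>\<tau>. \<phi> (\<tau>, z)) t"

definition space_grad :: "(real \<times> (real^2) \<Rightarrow> real) \<Rightarrow> real \<Rightarrow> real^2 \<Rightarrow> real^2" where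
  "space_grad \<phi> t z = (\<chi> m. frechet_derivative (\<lambda>y. \<phi> (t, y)) (at z) (axis m 1))"

definition aggregation_solution ::
    "(real^2 \<Rightarrow> real^2^2 \<Rightarrow> real^2) \<Rightarrow> (real^2 \<Rightarrow> real^2^2) \<Rightarrow> (real^2) measure \<Rightarrow> real \<Rightarrow>
     (real \<Rightarrow> (real^2) measure) \<Rightarrow> bool" where
  "aggregation_solution F T \<rho>in S \<rho> \<longleftrightarrow>
     P2_curve S \<rho> \<and>
     (\<forall>\<phi>. test_function S \<phi> \<longrightarrow>
        (LINT t:{0..S}|lborel. LINT z|\<rho> t.
            time_deriv \<phi> t z + space_grad \<phi> t z \<bullet> force_convolution F T (\<rho> t) z)
        + (LINT z|\<rho>in. \<phi> (0, z)) = 0)"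

text \<open>
  \<open>\<rho>\<close> is \<^emph>\<open>the\<close> solution: it is a solution, and every solution is the same measure on
  \<open>{0..S} \<times> UNIV\<close> (curves that differ only on a null set of times are not distinguished).
\<close>

definition the_aggregation_solution ::
    "(real^2 \<Rightarrow> real^2^2 \<Rightarrow> real^2) \<Rightarrow> (real^2 \<Rightarrow> real^2^2) \<Rightarrow> (real^2) measure \<Rightarrow> real \<Rightarrow>
     (real \<Rightarrow> (real^2) measure) \<Rightarrow> bool" where
  "the_aggregation_solution F T \<rho>in S \<rho> \<longleftrightarrow>
     aggregation_solution F T \<rho>in S \<rho> \<and>
     (\<forall>\<rho>'. aggregation_solution F T \<rho>in S \<rho>' \<longrightarrow> spacetime_measure S \<rho>' = spacetime_measure S \<rho>)"

end

theory Submission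
  imports Defs "HOL-Complex_Analysis.Great_Picard" "HOL-Real_Asymp.Real_Asymp"
begin

text \<open>
  Testing the scheme against smooth functions produces, besides consistency errors of the order of the
  mesh size, the diffusion term \<open>\<delta> \<Sum> \<tau> \<integral> \<rho>\<^sup>2\<close>. The step size condition alone does not
  make it small; an energy argument does. With \<open>\<psi>\<close> solving the discrete equation
  \<open>\<psi> - \<Delta>\<psi> = \<rho>\<close>, put \<open>E = \<integral> \<rho> \<psi>\<close>, \<open>Q = \<integral> \<rho>\<^sup>2\<close>. The discrete Ladyzhenskaya inequality gives \<open>E\<^sup>2 \<le> Q / 2\<close>,
  and one step of the scheme decreases \<open>E\<close> at least at rate \<open>\<delta> Q\<^sup>2 / 16\<close> up to transport errors. Since
  \<open>E\<close> is at most of the order of \<open>\<surd>Q\<close>, the function \<open>1 / (E + \<kappa>\<^sup>-\<^sup>2)\<close> then grows at a rate comparable to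
  \<open>\<delta> Q\<close> as soon as \<open>Q \<ge> \<kappa>\<^sup>-\<^sup>4\<close>; as it never exceeds \<open>\<kappa>\<^sup>2\<close>, the sum \<open>\<delta> \<Sum> \<tau> Q\<close> is small
  if \<open>\<kappa>\<^sup>4\<close> is a large multiple of \<open>\<delta>\<close>.

  Second moments are therefore bounded uniformly, and the reconstructions are equicontinuous in time up
  to a vanishing error. A subsequence converges at every time, tested against bounded continuous functions
  of two space points; this suffices to pass to the limit in the quadratic nonlocal flux. If the limit
  measure is unique, the whole sequence converges.
\<close>

section \<open>Summable lattice functions\<close>

text \<open>No relation between \<delta> and the mesh is available, and \<open>\<rho>in\<close> may
  have atoms: initial cell densities can be as large as 1/(dx dy), and the number of steps is
  unbounded. For small \<delta> and still smaller mesh, bounds of the density by its cell mass are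
  useless. The energy E is the discrete squared H^-1 norm, the natural one for diffusion of
  \<rho>^2: testing with the resolvent turns the diffusion into a gain of \<delta> times the sum of
  \<rho>^3. In the plane an atom has infinite H^-1 energy, so E at time 0 has no bound uniform in
  the mesh. This is why a reciprocal of the energy is used: E decays superlinearly and forgets its
  initial value, and 1 / (E + \<kappa>^-2) stays in a fixed interval whatever E was. The explicit
  time step costs energy of second order in the jump probabilities; the step size condition limits
  this cost to 3/4 of the gain. The force is only continuous, so no Lipschitz stability estimate can
  identify the limit. Instead, discrete and exact velocities are compared by a modulus of continuity
  that is uniform over all measures with a common second moment bound.\<close>

definition gint :: "(int \<Rightarrow> int \<Rightarrow> real) \<Rightarrow> bool" where
  "gint f \<longleftrightarrow> (\<lambda>p. f (fst p) (snd p)) summable_on UNIV"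

text \<open>Summation over all index pairs at once is unconditional, which for real values means
  absolute (\<open>gint_abs_iff\<close>). Shifts and the exchange of coordinates are then
  reindexings by bijections. A function that is not summable gets the value 0, so
  \<open>gsum_shift\<close>, \<open>gsum_swap\<close> and \<open>gsum_cmult\<close> hold without
  side conditions.\<close>

definition gsum :: "(int \<Rightarrow> int \<Rightarrow> real) \<Rightarrow> real" where
  "gsum f = (\<Sum>\<^sub>\<infinity>p. f (fst p) (snd p))"

lemma gint_abs_iff: "gint f \<longleftrightarrow> (\<lambda>p. norm (f (fst p) (snd p))) summable_on UNIV"
  unfolding gint_def by (rule summable_on_iff_abs_summable_on_real)

lemma gint_abs: "gint f \<Longrightarrow> gint (\<lambda>i j. \<bar>f i j\<bar>)"
  by (simp add: gint_abs_iff)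

lemma gint_add: "gint f \<Longrightarrow> gint g \<Longrightarrow> gint (\<lambda>i j. f i j + g i j)"
  unfolding gint_def by (rule summable_on_add)

lemma gint_uminus: "gint f \<Longrightarrow> gint (\<lambda>i j. - f i j)"
  unfolding gint_def by (simp add: summable_on_uminus)

lemma gint_diff: "gint f \<Longrightarrow> gint g \<Longrightarrow> gint (\<lambda>i j. f i j - g i j)"
  using gint_add[of f "\<lambda>i j. - g i j"] gint_uminus[of g] by simp

lemma gint_cmult: "gint f \<Longrightarrow> gint (\<lambda>i j. c * f i j)"
  unfolding gint_def by (rule summable_on_cmult_right)

lemma gint_bound:
  assumes "gint g" "\<And>i j. \<bar>f i j\<bar> \<le> g i j"
  shows "gint f"
proof -
  have "(\<lambda>p. norm (f (fst p) (snd p))) summable_on UNIV"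
    using assms(1) unfolding gint_def
    by (rule summable_on_comparison_test) (use assms(2) in auto)
  then show ?thesis by (simp add: gint_abs_iff)
qed

lemma gint_mult_bounded:
  assumes "gint f" "\<And>i j. \<bar>g i j\<bar> \<le> B"
  shows "gint (\<lambda>i j. f i j * g i j)" "gint (\<lambda>i j. g i j * f i j)"
proof -
  show 1: "gint (\<lambda>i j. f i j * g i j)"
    by (rule gint_bound[OF gint_cmult[OF gint_abs[OF assms(1)], of B]])
      (simp add: abs_mult mult.commute[of B] mult_left_mono assms(2))
  then show "gint (\<lambda>i j. g i j * f i j)" by (simp add: mult.commute)
qed

lemma gsum_add: "gint f \<Longrightarrow> gint g \<Longrightarrow> gsum (\<lambda>i j. f i j + g i j) = gsum f + gsum g"
  unfolding gint_def gsum_def by (rule infsum_add)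

lemma gsum_uminus: "gsum (\<lambda>i j. - f i j) = - gsum f"
  unfolding gsum_def by (rule infsum_uminus)

lemma gsum_diff: "gint f \<Longrightarrow> gint g \<Longrightarrow> gsum (\<lambda>i j. f i j - g i j) = gsum f - gsum g"
  using gsum_add[of f "\<lambda>i j. - g i j"] gint_uminus[of g] by (simp add: gsum_uminus)

lemma gsum_cmult: "gsum (\<lambda>i j. c * f i j) = c * gsum f"
  unfolding gsum_def by (rule infsum_cmult_right')

lemma gsum_mono:
  "gint f \<Longrightarrow> gint g \<Longrightarrow> (\<And>i j. f i j \<le> g i j) \<Longrightarrow> gsum f \<le> gsum g"
  unfolding gint_def gsum_def by (rule infsum_mono) auto

lemma gsum_nonneg: "(\<And>i j. 0 \<le> f i j) \<Longrightarrow> 0 \<le> gsum f"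
  unfolding gsum_def by (rule infsum_nonneg) auto

lemma abs_gsum_le:
  assumes "gint g" "\<And>i j. \<bar>f i j\<bar> \<le> g i j"
  shows "\<bar>gsum f\<bar> \<le> gsum g"
proof -
  have f: "gint f" by (rule gint_bound[OF assms])
  have "gsum f \<le> gsum g"
    by (rule gsum_mono[OF f assms(1)]) (use assms(2) abs_le_D1 in blast)
  moreover have "gsum (\<lambda>i j. - f i j) \<le> gsum g"
    by (rule gsum_mono[OF gint_uminus[OF f] assms(1)]) (use assms(2) abs_le_D2 in blast)
  ultimately show ?thesis by (simp add: gsum_uminus)
qed

lemma gint_swap: "gint (\<lambda>i j. f j i) \<longleftrightarrow> gint f"
  unfolding gint_def
  by (rule summable_on_reindex_bij_witness[where i = prod.swap and j = prod.swap]) auto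

lemma gsum_swap: "gsum (\<lambda>i j. f j i) = gsum f"
  unfolding gsum_def
  by (rule infsum_reindex_bij_witness[where i = prod.swap and j = prod.swap]) auto

lemma gint_shift: "gint (\<lambda>i j. f (i + a) (j + b)) \<longleftrightarrow> gint f"
  unfolding gint_def
  by (rule summable_on_reindex_bij_witness[where i = "\<lambda>p. (fst p - a, snd p - b)"
        and j = "\<lambda>p. (fst p + a, snd p + b)"]) auto

lemma gsum_shift: "gsum (\<lambda>i j. f (i + a) (j + b)) = gsum f"
  unfolding gsum_def
  by (rule infsum_reindex_bij_witness[where i = "\<lambda>p. (fst p - a, snd p - b)"
        and j = "\<lambda>p. (fst p + a, snd p + b)"]) auto

lemma gint_shifts:
  assumes "gint f"
  shows "gint (\<lambda>i j. f (i + 1) j)" "gint (\<lambda>i j. f (i - 1) j)"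
    "gint (\<lambda>i j. f i (j + 1))" "gint (\<lambda>i j. f i (j - 1))"
  using gint_shift[of f 1 0] gint_shift[of f "-1" 0] gint_shift[of f 0 1]
    gint_shift[of f 0 "-1"] assms by simp_all

lemma gsum_shifts:
  shows "gsum (\<lambda>i j. f (i + 1) j) = gsum f" "gsum (\<lambda>i j. f (i - 1) j) = gsum f"
    "gsum (\<lambda>i j. f i (j + 1)) = gsum f" "gsum (\<lambda>i j. f i (j - 1)) = gsum f"
  using gsum_shift[of f 1 0] gsum_shift[of f "-1" 0] gsum_shift[of f 0 1]
    gsum_shift[of f 0 "-1"] by simp_all

lemma le_gsum:
  assumes "gint f" "\<And>i j. 0 \<le> f i j"
  shows "f i j \<le> gsum f"
proof -
  have "sum (\<lambda>p. f (fst p) (snd p)) {(i, j)} \<le> gsum f"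
    unfolding gsum_def by (rule finite_sum_le_infsum) (use assms in \<open>auto simp: gint_def\<close>)
  then show ?thesis by simp
qed

lemma gint_bounded:
  assumes "gint f"
  shows "\<bar>f i j\<bar> \<le> gsum (\<lambda>i j. \<bar>f i j\<bar>)"
  by (rule le_gsum[OF gint_abs[OF assms]]) simp

text \<open>A summable lattice function is bounded by its own l1 norm, so it may serve as the
  bounded factor. All powers of a density are therefore summable.\<close>

lemma gint_mult: "gint f \<Longrightarrow> gint g \<Longrightarrow> gint (\<lambda>i j. f i j * g i j)"
  by (rule gint_mult_bounded(1)[where B = "gsum (\<lambda>i j. \<bar>g i j\<bar>)"]) (auto intro: gint_bounded)

lemma gint_power2: "gint f \<Longrightarrow> gint (\<lambda>i j. (f i j)\<^sup>2)"
  using gint_mult[of f f] by (simp add: power2_eq_square)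

lemma gsum_Cauchy_Schwarz:
  assumes f: "gint (\<lambda>i j. (f i j)\<^sup>2)" and g: "gint (\<lambda>i j. (g i j)\<^sup>2)"
  shows "gint (\<lambda>i j. f i j * g i j)"
    and "(gsum (\<lambda>i j. f i j * g i j))\<^sup>2 \<le> gsum (\<lambda>i j. (f i j)\<^sup>2) * gsum (\<lambda>i j. (g i j)\<^sup>2)"
proof -
  show fg: "gint (\<lambda>i j. f i j * g i j)"
  proof (rule gint_bound[OF gint_add[OF f g]])
    fix i j
    have "0 \<le> (\<bar>f i j\<bar> - \<bar>g i j\<bar>)\<^sup>2" "0 \<le> \<bar>f i j\<bar> * \<bar>g i j\<bar>" by simp_all
    then show "\<bar>f i j * g i j\<bar> \<le> (f i j)\<^sup>2 + (g i j)\<^sup>2"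
      unfolding abs_mult power2_diff power2_abs by linarith
  qed
  define X where "X = gsum (\<lambda>i j. f i j * g i j)"
  define A where "A = gsum (\<lambda>i j. (f i j)\<^sup>2)"
  define B where "B = gsum (\<lambda>i j. (g i j)\<^sup>2)"
  \<comment> \<open>Discriminant argument: the value of this nonnegative quadratic at t = - X / B
    gives the claim, and for B = 0 the function \<open>g\<close> vanishes identically.\<close>
  have quad: "0 \<le> A + 2 * t * X + t\<^sup>2 * B" for t
  proof -
    have "0 \<le> gsum (\<lambda>i j. (f i j + t * g i j)\<^sup>2)" by (rule gsum_nonneg) simp
    also have "\<dots> = gsum (\<lambda>i j. ((f i j)\<^sup>2 + (2 * t) * (f i j * g i j)) + t\<^sup>2 * (g i j)\<^sup>2)"
      by (intro arg_cong[where f = gsum] ext) (simp add: power2_eq_square algebra_simps)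
    also have "\<dots> = A + 2 * t * X + t\<^sup>2 * B"
      by (simp add: gsum_add gint_add gint_cmult f g fg gsum_cmult X_def A_def B_def)
    finally show ?thesis .
  qed
  have B: "0 \<le> B" unfolding B_def by (rule gsum_nonneg) simp
  have "X\<^sup>2 \<le> A * B"
  proof (cases "B = 0")
    case True
    have "g i j = 0" for i j
      using le_gsum[OF g, of i j] True by (simp add: B_def)
    then have "X = 0" by (simp add: X_def gsum_def)
    then show ?thesis using True by simp
  next
    case False
    then have "0 \<le> (A + 2 * (- X / B) * X + (- X / B)\<^sup>2 * B) * B"
      using quad[of "- X / B"] B by simp
    also have "\<dots> = A * B - X\<^sup>2" using False by (simp add: field_simps power2_eq_square)
    finally show ?thesis by simp
  qed
  then show "(gsum (\<lambda>i j. f i j * g i j))\<^sup>2 \<le> gsum (\<lambda>i j. (f i j)\<^sup>2) * gsum (\<lambda>i j. (g i j)\<^sup>2)"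
    by (simp add: X_def A_def B_def)
qed

section \<open>Variations along coordinate lines and a discrete Sobolev inequality\<close>

lemma gint_column:
  assumes "gint f"
  shows "(\<lambda>i. f i j) summable_on UNIV" "(\<lambda>j. \<Sum>\<^sub>\<infinity>i. f i j) summable_on UNIV"
    "(\<Sum>\<^sub>\<infinity>j. \<Sum>\<^sub>\<infinity>i. f i j) = gsum f"
proof -
  have *: "(\<lambda>p. f (snd p) (fst p)) summable_on (UNIV \<times> UNIV)"
    using assms gint_swap[of f] by (simp add: gint_def)
  then have **: "(\<lambda>(j, i). f i j) summable_on (Sigma UNIV (\<lambda>_. UNIV))"
    by (simp add: case_prod_beta')
  show "(\<lambda>i. f i j) summable_on UNIV"
    using summable_on_SigmaD1[OF **, of j] by simp
  show "(\<lambda>j. \<Sum>\<^sub>\<infinity>i. f i j) summable_on UNIV"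
    using summable_on_Sigma_banach[OF **] by simp
  show "(\<Sum>\<^sub>\<infinity>j. \<Sum>\<^sub>\<infinity>i. f i j) = gsum f"
    using infsum_Sigma'_banach[OF **] gsum_swap[of f] by (simp add: gsum_def case_prod_beta')
qed

text \<open>One-dimensional Sobolev embedding: telescope from \<open>i\<close> towards large
  indices, where the values tend to zero because they are summable along the line.\<close>

lemma le_column_variation:
  assumes w: "gint w" and w0: "\<And>i j. 0 \<le> w i j"
  shows "w i j \<le> (\<Sum>\<^sub>\<infinity>k. \<bar>w (k + 1) j - w k j\<bar>)"
proof -
  have "gint (\<lambda>k j. \<bar>w (k + 1) j - w k j\<bar>)"
    by (intro gint_abs gint_diff gint_shifts w)
  then have v: "(\<lambda>k. \<bar>w (k + 1) j - w k j\<bar>) summable_on UNIV" by (rule gint_column(1))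
  let ?V = "\<Sum>\<^sub>\<infinity>k. \<bar>w (k + 1) j - w k j\<bar>"
  have tele: "w i j \<le> w (i + int n) j + (\<Sum>k<n. \<bar>w (i + int k + 1) j - w (i + int k) j\<bar>)" for n
    by (induction n) (auto simp: algebra_simps)
  have "(\<Sum>k<n. \<bar>w (i + int k + 1) j - w (i + int k) j\<bar>) \<le> ?V" for n
  proof -
    have "(\<Sum>k<n. \<bar>w (i + int k + 1) j - w (i + int k) j\<bar>)
        = (\<Sum>k\<in>(\<lambda>k. i + int k) ` {..<n}. \<bar>w (k + 1) j - w k j\<bar>)"
      by (subst sum.reindex) (auto simp: inj_on_def)
    also have "\<dots> \<le> ?V" by (rule finite_sum_le_infsum[OF v]) auto
    finally show ?thesis .
  qed
  then have le: "w i j \<le> w (i + int n) j + ?V" for n using tele[of n] by (smt (verit))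
  have "(\<lambda>n. w (i + int n) j) summable_on (UNIV :: nat set)"
  proof -
    have "(\<lambda>i. w i j) summable_on (range (\<lambda>n. i + int n))"
      by (rule summable_on_subset_banach[OF gint_column(1)[OF w]]) auto
    then show ?thesis
      by (subst (asm) summable_on_reindex) (auto simp: inj_on_def o_def)
  qed
  then have "summable (\<lambda>n. w (i + int n) j)" by (rule summable_on_imp_summable)
  then have "(\<lambda>n. w (i + int n) j) \<longlonglongrightarrow> 0" by (rule summable_LIMSEQ_zero)
  then have "(\<lambda>n. w (i + int n) j + ?V) \<longlonglongrightarrow> 0 + ?V" by (intro tendsto_intros)
  then show ?thesis using le by (intro LIMSEQ_le_const[where a = "w i j"]) auto
qed

text \<open>This is the embedding of W^(1,1) into L2 in the plane. A value is bounded by the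
  variations along both coordinate lines through it. Each of these depends on one index only, so the
  sum of their product factorises.\<close>

lemma gsum_square_le_variations:
  assumes w: "gint w" and w0: "\<And>i j. 0 \<le> w i j"
  shows "gsum (\<lambda>i j. (w i j)\<^sup>2)
    \<le> gsum (\<lambda>i j. \<bar>w (i + 1) j - w i j\<bar>) * gsum (\<lambda>i j. \<bar>w i (j + 1) - w i j\<bar>)"
proof -
  define a where "a j = (\<Sum>\<^sub>\<infinity>k. \<bar>w (k + 1) j - w k j\<bar>)" for j
  define b where "b i = (\<Sum>\<^sub>\<infinity>k. \<bar>w i (k + 1) - w i k\<bar>)" for i
  have wa: "w i j \<le> a j" for i j
    unfolding a_def by (rule le_column_variation[OF w w0])
  have wb: "w i j \<le> b i" for i j
    unfolding b_def using le_column_variation[of "\<lambda>i j. w j i" j i] w w0 gint_swap[of w] by simp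
  have gx: "gint (\<lambda>i j. \<bar>w (i + 1) j - w i j\<bar>)" and gy: "gint (\<lambda>i j. \<bar>w j (i + 1) - w j i\<bar>)"
    using gint_shifts(3)[OF w] gint_swap[of "\<lambda>i j. \<bar>w i (j + 1) - w i j\<bar>"]
    by (auto intro!: gint_abs gint_diff gint_shifts w)
  have a: "a summable_on UNIV" "infsum a UNIV = gsum (\<lambda>i j. \<bar>w (i + 1) j - w i j\<bar>)"
    using gint_column(2,3)[OF gx] by (simp_all add: a_def[abs_def])
  have b: "b summable_on UNIV" "infsum b UNIV = gsum (\<lambda>i j. \<bar>w i (j + 1) - w i j\<bar>)"
    using gint_column(2,3)[OF gy] gsum_swap[of "\<lambda>i j. \<bar>w i (j + 1) - w i j\<bar>"]
    by (simp_all add: b_def[abs_def])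
  have a0: "0 \<le> a j" and b0: "0 \<le> b i" for i j
    using w0 wa wb order_trans by blast+
  show ?thesis unfolding gsum_def
  proof (rule infsum_le_finite_sums)
    show "(\<lambda>p. (w (fst p) (snd p))\<^sup>2) summable_on UNIV"
      using gint_power2[OF w] by (simp add: gint_def)
  next
    fix G :: "(int \<times> int) set" assume G: "finite G" "G \<subseteq> UNIV"
    \<comment> \<open>Enlarging \<open>G\<close> to a rectangle turns the double sum of
      \<open>b (fst p) * a (snd p)\<close> into a product of two single sums.\<close>
    have "(\<Sum>p\<in>G. (w (fst p) (snd p))\<^sup>2) \<le> (\<Sum>p\<in>fst ` G \<times> snd ` G. (w (fst p) (snd p))\<^sup>2)"
      by (rule sum_mono2) (use G in \<open>auto simp: rev_image_eqI\<close>)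
    also have "\<dots> \<le> (\<Sum>p\<in>fst ` G \<times> snd ` G. b (fst p) * a (snd p))"
      by (rule sum_mono) (use wa wb w0 b0 in \<open>auto simp: power2_eq_square intro!: mult_mono\<close>)
    also have "\<dots> = sum b (fst ` G) * sum a (snd ` G)"
      by (simp add: sum_product sum.cartesian_product case_prod_beta')
    also have "\<dots> \<le> infsum b UNIV * infsum a UNIV"
      by (intro mult_mono finite_sum_le_infsum sum_nonneg infsum_nonneg a b a0 b0)
        (use G a0 b0 in auto)
    finally show "(\<Sum>p\<in>G. (w (fst p) (snd p))\<^sup>2)
        \<le> (\<Sum>\<^sub>\<infinity>p. \<bar>w (fst p + 1) (snd p) - w (fst p) (snd p)\<bar>) *
          (\<Sum>\<^sub>\<infinity>p. \<bar>w (fst p) (snd p + 1) - w (fst p) (snd p)\<bar>)"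
      using a(2) b(2) by (simp add: gsum_def mult.commute)
  qed
qed

section \<open>The discrete resolvent\<close>

definition laplace :: "real \<Rightarrow> real \<Rightarrow> (int \<Rightarrow> int \<Rightarrow> real) \<Rightarrow> int \<Rightarrow> int \<Rightarrow> real" where
  "laplace dx dy g i j = (g (i + 1) j - 2 * g i j + g (i - 1) j) / dx\<^sup>2
     + (g i (j + 1) - 2 * g i j + g i (j - 1)) / dy\<^sup>2"

text \<open>The cell area dx dy is left out here and multiplied in where energies are
  formed.\<close>

definition dirichlet :: "real \<Rightarrow> real \<Rightarrow> (int \<Rightarrow> int \<Rightarrow> real) \<Rightarrow> real" where
  "dirichlet dx dy g = gsum (\<lambda>i j. ((g (i + 1) j - g i j) / dx)\<^sup>2)
     + gsum (\<lambda>i j. ((g i (j + 1) - g i j) / dy)\<^sup>2)"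

text \<open>Neumann series of the Jacobi iteration. With \<open>c\<close> the diagonal coefficient
  and \<open>N\<close> the weighted neighbour sum, the equation reads (1 + c) \<psi> = \<rho> + N
  \<psi>. The iterates \<open>s n\<close> of N / c all have the mass of \<rho>, and q = c / (1 + c)
  < 1, so the series \<open>P\<close> of the terms q^n s n converges geometrically; the solution is
  P / (1 + c).\<close>

lemma resolvent_exists:
  assumes dx: "0 < dx" and dy: "0 < dy"
    and \<rho>: "gint \<rho>" and nonneg: "\<And>i j. 0 \<le> \<rho> i j"
  shows "\<exists>\<psi>. gint \<psi> \<and> (\<forall>i j. \<psi> i j - laplace dx dy \<psi> i j = \<rho> i j)"
proof -
  define a where "a = 1 / dx\<^sup>2"
  define b where "b = 1 / dy\<^sup>2"
  define c where "c = 2 * a + 2 * b"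
  define q where "q = c / (1 + c)"
  define N where "N g i j = a * (g (i + 1) j + g (i - 1) j) + b * (g i (j + 1) + g i (j - 1))"
    for g :: "int \<Rightarrow> int \<Rightarrow> real" and i j
  define s where "s n = ((\<lambda>g i j. N g i j / c) ^^ n) \<rho>" for n
  have a: "0 < a" and b: "0 < b" using dx dy by (simp_all add: a_def b_def)
  have c: "0 < c" using a b by (simp add: c_def)
  have q: "0 < q" "q < 1" using c by (simp_all add: q_def)
  have s_0: "s 0 = \<rho>" and s_Suc: "s (Suc n) i j = N (s n) i j / c" for n i j
    by (simp_all add: s_def)
  have s_nonneg: "0 \<le> s n i j" for n i j
    by (induction n arbitrary: i j) (use a b c nonneg in \<open>auto simp: s_0 s_Suc N_def\<close>)
  have s: "gint (s n) \<and> gsum (s n) = gsum \<rho>" for n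
  proof (induction n)
    case (Suc n)
    then have g: "gint (s n)" by simp
    have eq: "s (Suc n) = (\<lambda>i j. a / c * (s n (i + 1) j + s n (i - 1) j)
        + b / c * (s n i (j + 1) + s n i (j - 1)))"
      by (intro ext) (simp add: s_Suc N_def add_divide_distrib)
    have "gint (s (Suc n))" unfolding eq
      by (intro gint_add gint_cmult gint_shifts g)
    moreover have "gsum (s (Suc n)) = a / c * (2 * gsum (s n)) + b / c * (2 * gsum (s n))"
      unfolding eq
      by (simp only: gsum_add gsum_cmult gsum_shifts[of "s n"] gint_add gint_cmult gint_shifts g
          mult_2)
    moreover have "\<dots> = (2 * a + 2 * b) / c * gsum (s n)"
      by (simp add: algebra_simps add_divide_distrib)
    moreover have "(2 * a + 2 * b) / c = 1" using c by (simp add: c_def)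
    ultimately show ?case using Suc by simp
  qed (simp add: s_0 \<rho>)
  define M where "M = gsum \<rho>"
  have s_le: "s n i j \<le> M" for n i j
    using le_gsum[of "s n" i j] s s_nonneg by (simp add: M_def)
  have M: "0 \<le> M" unfolding M_def by (rule gsum_nonneg) (rule nonneg)
  have geo: "summable (\<lambda>n. q ^ n * M)"
    using q by (intro summable_mult2 summable_geometric) simp
  define P where "P i j = (\<Sum>n. q ^ n * s n i j)" for i j
  have sm: "summable (\<lambda>n. q ^ n * s n i j)" for i j
    by (rule summable_comparison_test'[OF geo]) (use q s_nonneg s_le in \<open>simp add: mult_left_mono\<close>)
  then have P: "(\<lambda>n. q ^ n * s n i j) sums P i j" for i j
    unfolding P_def by (rule summable_sums)
  have P_nonneg: "0 \<le> P i j" for i j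
    unfolding P_def by (rule suminf_nonneg[OF sm]) (use q s_nonneg in simp)
  \<comment> \<open>A finite sum over cells is exchanged with the series in n; level n contributes
    at most q^n M because the iteration preserves mass.\<close>
  have gP: "gint P" unfolding gint_def
  proof (rule nonneg_bdd_above_summable_on)
    show "bdd_above (sum (\<lambda>p. P (fst p) (snd p)) ` {F. F \<subseteq> UNIV \<and> finite F})"
    proof (rule bdd_aboveI2)
      fix G :: "(int \<times> int) set" assume "G \<in> {F. F \<subseteq> UNIV \<and> finite F}"
      then have G: "finite G" by simp
      have "(\<Sum>p\<in>G. P (fst p) (snd p)) = (\<Sum>n. \<Sum>p\<in>G. q ^ n * s n (fst p) (snd p))"
        unfolding P_def by (rule suminf_sum[symmetric]) (rule sm)
      also have "\<dots> \<le> (\<Sum>n. q ^ n * M)"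
      proof (rule suminf_le[OF _ summable_sum[OF sm] geo])
        fix n
        have "(\<Sum>p\<in>G. s n (fst p) (snd p)) \<le> gsum (s n)"
          unfolding gsum_def
          by (rule finite_sum_le_infsum) (use s G s_nonneg in \<open>auto simp: gint_def\<close>)
        then show "(\<Sum>p\<in>G. q ^ n * s n (fst p) (snd p)) \<le> q ^ n * M"
          using s q by (simp add: sum_distrib_left[symmetric] M_def mult_left_mono)
      qed
      finally show "(\<Sum>p\<in>G. P (fst p) (snd p)) \<le> (\<Sum>n. q ^ n * M)" .
    qed
  qed (use P_nonneg in simp)
  have eqP: "P i j - \<rho> i j = N P i j / (1 + c)" for i j
  proof -
    have "(\<lambda>n. q ^ Suc n * s (Suc n) i j) sums (P i j - \<rho> i j)"
      using P[of i j] by (subst sums_Suc_iff) (simp add: s_0)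
    moreover have "(\<lambda>n. q ^ Suc n * s (Suc n) i j) = (\<lambda>n. N (\<lambda>i j. q ^ n * s n i j) i j / (1 + c))"
    proof
      fix n
      have "q ^ Suc n * s (Suc n) i j = q ^ n * N (s n) i j * (q / c)" by (simp add: s_Suc)
      also have "q / c = 1 / (1 + c)" using c by (simp add: q_def)
      also have "q ^ n * N (s n) i j = N (\<lambda>i j. q ^ n * s n i j) i j"
        by (simp add: N_def algebra_simps)
      finally show "q ^ Suc n * s (Suc n) i j = N (\<lambda>i j. q ^ n * s n i j) i j / (1 + c)" by simp
    qed
    moreover have "(\<lambda>n. N (\<lambda>i j. q ^ n * s n i j) i j / (1 + c)) sums (N P i j / (1 + c))"
      unfolding N_def by (intro sums_divide sums_add sums_mult P)
    ultimately show ?thesis using sums_unique2 by metis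
  qed
  let ?\<psi> = "\<lambda>i j. 1 / (1 + c) * P i j"
  have "?\<psi> i j - laplace dx dy ?\<psi> i j = \<rho> i j" for i j
  proof -
    have "?\<psi> i j - laplace dx dy ?\<psi> i j = ((1 + c) * P i j - N P i j) / (1 + c)"
    proof -
      have "laplace dx dy ?\<psi> i j = N ?\<psi> i j - c * ?\<psi> i j"
        by (simp add: laplace_def N_def a_def b_def c_def algebra_simps add_divide_distrib
            diff_divide_distrib)
      also have "N ?\<psi> i j = 1 / (1 + c) * N P i j"
        by (simp add: N_def algebra_simps add_divide_distrib)
      finally show ?thesis by (simp add: algebra_simps add_divide_distrib diff_divide_distrib)
    qed
    also have "N P i j = (1 + c) * (P i j - \<rho> i j)"
      using eqP[of i j] c by (simp add: field_simps)
    also have "((1 + c) * P i j - (1 + c) * (P i j - \<rho> i j)) / (1 + c) = \<rho> i j"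
      using c by (simp add: right_diff_distrib)
    finally show ?thesis .
  qed
  moreover have "gint ?\<psi>" by (rule gint_cmult[OF gP])
  ultimately show ?thesis by blast
qed

text \<open>Summation by parts on the whole lattice has no boundary terms: expand and shift the
  index in two of the products.\<close>

lemma gsum_by_parts_x:
  assumes u: "gint u" and v: "gint v"
  shows "gsum (\<lambda>i j. u i j * (2 * v i j - v (i + 1) j - v (i - 1) j))
    = gsum (\<lambda>i j. (u (i + 1) j - u i j) * (v (i + 1) j - v i j))"
proof -
  note g = gint_mult[OF u v] gint_mult[OF gint_shifts(1)[OF u] gint_shifts(1)[OF v]]
    gint_mult[OF u gint_shifts(1)[OF v]] gint_mult[OF gint_shifts(1)[OF u] v]
    gint_mult[OF u gint_shifts(2)[OF v]]
  have "gsum (\<lambda>i j. u i j * (2 * v i j - v (i + 1) j - v (i - 1) j))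
      = gsum (\<lambda>i j. 2 * (u i j * v i j) - u i j * v (i + 1) j - u i j * v (i - 1) j)"
    by (intro arg_cong[where f = gsum] ext) (simp add: algebra_simps)
  also have "\<dots> = 2 * gsum (\<lambda>i j. u i j * v i j) - gsum (\<lambda>i j. u i j * v (i + 1) j)
      - gsum (\<lambda>i j. u i j * v (i - 1) j)"
    by (simp add: gsum_diff gsum_cmult gint_diff gint_cmult g)
  also have "gsum (\<lambda>i j. u i j * v (i - 1) j) = gsum (\<lambda>i j. u (i + 1) j * v i j)"
    using gsum_shifts(1)[of "\<lambda>i j. u i j * v (i - 1) j"] by simp
  also have "2 * gsum (\<lambda>i j. u i j * v i j)
      = gsum (\<lambda>i j. u i j * v i j) + gsum (\<lambda>i j. u (i + 1) j * v (i + 1) j)"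
    using gsum_shifts(1)[of "\<lambda>i j. u i j * v i j"] by simp
  also have "gsum (\<lambda>i j. u i j * v i j) + gsum (\<lambda>i j. u (i + 1) j * v (i + 1) j)
      - gsum (\<lambda>i j. u i j * v (i + 1) j) - gsum (\<lambda>i j. u (i + 1) j * v i j)
    = gsum (\<lambda>i j. u i j * v i j + u (i + 1) j * v (i + 1) j
        - u i j * v (i + 1) j - u (i + 1) j * v i j)"
    by (simp add: gsum_diff gsum_add gint_diff gint_add g)
  also have "\<dots> = gsum (\<lambda>i j. (u (i + 1) j - u i j) * (v (i + 1) j - v i j))"
    by (intro arg_cong[where f = gsum] ext) (simp add: algebra_simps)
  finally show ?thesis .
qed

lemma gsum_by_parts_y:
  assumes "gint u" "gint v"
  shows "gsum (\<lambda>i j. u i j * (2 * v i j - v i (j + 1) - v i (j - 1)))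
    = gsum (\<lambda>i j. (u i (j + 1) - u i j) * (v i (j + 1) - v i j))"
proof -
  have "gsum (\<lambda>i j. u j i * (2 * v j i - v j (i + 1) - v j (i - 1)))
    = gsum (\<lambda>i j. (u j (i + 1) - u j i) * (v j (i + 1) - v j i))"
    using gsum_by_parts_x[of "\<lambda>i j. u j i" "\<lambda>i j. v j i"] assms gint_swap[of u] gint_swap[of v]
    by simp
  then show ?thesis
    using gsum_swap[of "\<lambda>i j. u i j * (2 * v i j - v i (j + 1) - v i (j - 1))"]
      gsum_swap[of "\<lambda>i j. (u i (j + 1) - u i j) * (v i (j + 1) - v i j)"] by simp
qed

lemma gsum_mult_laplace:
  assumes u: "gint u" and v: "gint v"
  shows "gsum (\<lambda>i j. u i j * (v i j - laplace dx dy v i j)) = gsum (\<lambda>i j. u i j * v i j)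
    + 1 / dx\<^sup>2 * gsum (\<lambda>i j. (u (i + 1) j - u i j) * (v (i + 1) j - v i j))
    + 1 / dy\<^sup>2 * gsum (\<lambda>i j. (u i (j + 1) - u i j) * (v i (j + 1) - v i j))"
proof -
  have "gsum (\<lambda>i j. u i j * (v i j - laplace dx dy v i j)) = gsum (\<lambda>i j. u i j * v i j
     + 1 / dx\<^sup>2 * (u i j * (2 * v i j - v (i + 1) j - v (i - 1) j))
     + 1 / dy\<^sup>2 * (u i j * (2 * v i j - v i (j + 1) - v i (j - 1))))"
    by (intro arg_cong[where f = gsum] ext)
      (simp add: laplace_def right_diff_distrib distrib_left add_divide_distrib diff_divide_distrib)
  also have "\<dots> = gsum (\<lambda>i j. u i j * v i j)
    + 1 / dx\<^sup>2 * gsum (\<lambda>i j. u i j * (2 * v i j - v (i + 1) j - v (i - 1) j))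
    + 1 / dy\<^sup>2 * gsum (\<lambda>i j. u i j * (2 * v i j - v i (j + 1) - v i (j - 1)))"
    by (subst gsum_add | intro gint_add gint_cmult gint_mult gint_diff gint_shifts u v
        | simp only: gsum_cmult)+
  finally show ?thesis
    by (simp only: gsum_by_parts_x[OF u v] gsum_by_parts_y[OF u v])
qed

text \<open>The bilinear form in \<open>gsum_mult_laplace\<close> is visibly symmetric. This
  self-adjointness is what produces the factor 2 in the first variation of the energy.\<close>

lemma resolvent_symmetric:
  assumes "gint u" "gint v"
  shows "gsum (\<lambda>i j. u i j * (v i j - laplace dx dy v i j))
       = gsum (\<lambda>i j. v i j * (u i j - laplace dx dy u i j))"
  by (simp only: gsum_mult_laplace assms mult.commute)

lemma dirichlet_energy:
  assumes "gint \<psi>"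
  shows "gsum (\<lambda>i j. \<psi> i j * (\<psi> i j - laplace dx dy \<psi> i j))
    = gsum (\<lambda>i j. (\<psi> i j)\<^sup>2) + dirichlet dx dy \<psi>"
proof -
  have "1 / d\<^sup>2 * gsum (\<lambda>i j. w i j * w i j) = gsum (\<lambda>i j. (w i j / d)\<^sup>2)" for w and d :: real
    unfolding gsum_cmult[symmetric]
    by (intro arg_cong[where f = gsum] ext) (simp add: power2_eq_square)
  then show ?thesis
    unfolding gsum_mult_laplace[OF assms assms] dirichlet_def
    by (simp add: power2_eq_square)
qed

text \<open>Apply \<open>gsum_square_le_variations\<close> to \<psi>^2. By Cauchy-Schwarz, the
  variation of \<psi>^2 in one direction is at most twice the l2 norm of \<psi> times the l2 norm of
  its difference. The arithmetic-geometric mean inequality then yields the factor 1/2.\<close>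

lemma ladyzhenskaya:
  assumes dx: "0 < dx" and dy: "0 < dy" and \<psi>: "gint \<psi>"
    and E: "E = gsum (\<lambda>i j. (\<psi> i j)\<^sup>2) + dirichlet dx dy \<psi>"
  shows "gsum (\<lambda>i j. (\<psi> i j) ^ 4) \<le> dx * dy * E\<^sup>2 / 2"
proof -
  define n2 where "n2 = gsum (\<lambda>i j. (\<psi> i j)\<^sup>2)"
  define gx where "gx = gsum (\<lambda>i j. ((\<psi> (i + 1) j - \<psi> i j) / dx)\<^sup>2)"
  define gy where "gy = gsum (\<lambda>i j. ((\<psi> i (j + 1) - \<psi> i j) / dy)\<^sup>2)"
  have nn: "0 \<le> n2" "0 \<le> gx" "0 \<le> gy"
    unfolding n2_def gx_def gy_def by (auto intro: gsum_nonneg)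
  have E': "E = n2 + gx + gy" by (simp add: E dirichlet_def n2_def gx_def gy_def)
  define X where "X = gsum (\<lambda>i j. \<bar>(\<psi> (i + 1) j)\<^sup>2 - (\<psi> i j)\<^sup>2\<bar>)"
  define Y where "Y = gsum (\<lambda>i j. \<bar>(\<psi> i (j + 1))\<^sup>2 - (\<psi> i j)\<^sup>2\<bar>)"
  have XY0: "0 \<le> X" "0 \<le> Y" unfolding X_def Y_def by (auto intro: gsum_nonneg)
  \<comment> \<open>Here \<open>u\<close> is a shift of \<psi>, with the same sum of squares
    \<open>n2\<close>. The difference of squares is factored, and the square of the sum costs at
    most 4 * n2.\<close>
  have est: "(gsum (\<lambda>i j. \<bar>(u i j)\<^sup>2 - (\<psi> i j)\<^sup>2\<bar>))\<^sup>2
      \<le> d\<^sup>2 * gsum (\<lambda>i j. ((u i j - \<psi> i j) / d)\<^sup>2) * (4 * n2)"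
    if u: "gint u" and un: "gsum (\<lambda>i j. (u i j)\<^sup>2) = n2" and d: "0 < d" for u d
  proof -
    have g1: "gint (\<lambda>i j. \<bar>u i j - \<psi> i j\<bar>\<^sup>2)"
      by (intro gint_power2 gint_abs gint_diff u \<psi>)
    have g2: "gint (\<lambda>i j. \<bar>u i j + \<psi> i j\<bar>\<^sup>2)"
      by (intro gint_power2 gint_abs gint_add u \<psi>)
    have "gsum (\<lambda>i j. \<bar>(u i j)\<^sup>2 - (\<psi> i j)\<^sup>2\<bar>) = gsum (\<lambda>i j. \<bar>u i j - \<psi> i j\<bar> * \<bar>u i j + \<psi> i j\<bar>)"
      by (intro arg_cong[where f = gsum] ext)
        (simp add: abs_mult[symmetric] power2_eq_square algebra_simps)
    then have "(gsum (\<lambda>i j. \<bar>(u i j)\<^sup>2 - (\<psi> i j)\<^sup>2\<bar>))\<^sup>2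
        \<le> gsum (\<lambda>i j. (u i j - \<psi> i j)\<^sup>2) * gsum (\<lambda>i j. (u i j + \<psi> i j)\<^sup>2)"
      using gsum_Cauchy_Schwarz(2)[OF g1 g2] by simp
    also have "gsum (\<lambda>i j. (u i j - \<psi> i j)\<^sup>2) = d\<^sup>2 * gsum (\<lambda>i j. ((u i j - \<psi> i j) / d)\<^sup>2)"
      unfolding gsum_cmult[symmetric] using d
      by (intro arg_cong[where f = gsum] ext) (simp add: power_divide)
    also have "gsum (\<lambda>i j. (u i j + \<psi> i j)\<^sup>2) \<le> gsum (\<lambda>i j. 2 * (u i j)\<^sup>2 + 2 * (\<psi> i j)\<^sup>2)"
    proof (rule gsum_mono)
      show "gint (\<lambda>i j. (u i j + \<psi> i j)\<^sup>2)" using g2 by simp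
      show "gint (\<lambda>i j. 2 * (u i j)\<^sup>2 + 2 * (\<psi> i j)\<^sup>2)"
        by (intro gint_add gint_cmult gint_power2 u \<psi>)
      show "(u i j + \<psi> i j)\<^sup>2 \<le> 2 * (u i j)\<^sup>2 + 2 * (\<psi> i j)\<^sup>2" for i j
        using sum_squares_bound[of "u i j" "\<psi> i j"] by (simp add: power2_sum)
    qed
    also have "\<dots> = 4 * n2"
      by (simp add: gsum_add gsum_cmult gint_cmult gint_power2 u \<psi> un n2_def)
    finally show ?thesis by (simp add: mult_left_mono gsum_nonneg)
  qed
  have X: "X\<^sup>2 \<le> dx\<^sup>2 * gx * (4 * n2)"
    unfolding X_def gx_def
    by (rule est) (use dx in \<open>auto intro: gint_shifts \<psi> simp: n2_def gsum_shifts(1)[of "\<lambda>i j. (\<psi> i j)\<^sup>2"]\<close>)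
  have Y: "Y\<^sup>2 \<le> dy\<^sup>2 * gy * (4 * n2)"
    unfolding Y_def gy_def
    by (rule est) (use dy in \<open>auto intro: gint_shifts \<psi> simp: n2_def gsum_shifts(3)[of "\<lambda>i j. (\<psi> i j)\<^sup>2"]\<close>)
  have "gsum (\<lambda>i j. (\<psi> i j) ^ 4) = gsum (\<lambda>i j. ((\<psi> i j)\<^sup>2)\<^sup>2)"
    by (intro arg_cong[where f = gsum] ext) (simp flip: power_mult)
  also have "\<dots> \<le> X * Y"
    unfolding X_def Y_def by (rule gsum_square_le_variations) (use gint_power2[OF \<psi>] in auto)
  also have "X * Y \<le> dx * dy * E\<^sup>2 / 2"
  proof (rule power2_le_imp_le)
    \<comment> \<open>Used twice: to replace gx * gy by the square of gx + gy, and to replace n2 *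
      (gx + gy) by the square of the total.\<close>
    have am: "4 * (x * y) \<le> (x + y)\<^sup>2" for x y :: real
      using sum_squares_bound[of x y] by (simp add: power2_sum)
    have "64 * (n2\<^sup>2 * (gx * gy)) \<le> 16 * (n2\<^sup>2 * (gx + gy)\<^sup>2)"
      using mult_left_mono[OF am[of gx gy], of "16 * n2\<^sup>2"] by simp
    also have "\<dots> = (4 * (n2 * (gx + gy)))\<^sup>2" by (simp add: power_mult_distrib)
    also have "\<dots> \<le> (E\<^sup>2)\<^sup>2"
      by (rule power_mono) (use am[of n2 "gx + gy"] nn in \<open>auto simp: E' add.assoc\<close>)
    finally have key: "64 * (n2\<^sup>2 * (gx * gy)) \<le> (E\<^sup>2)\<^sup>2" .
    have "(X * Y)\<^sup>2 \<le> (dx\<^sup>2 * gx * (4 * n2)) * (dy\<^sup>2 * gy * (4 * n2))"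
      unfolding power_mult_distrib by (intro mult_mono X Y) (use nn in auto)
    also have "\<dots> = (dx * dy)\<^sup>2 / 4 * (64 * (n2\<^sup>2 * (gx * gy)))"
      by (simp add: power2_eq_square)
    also have "\<dots> \<le> (dx * dy)\<^sup>2 / 4 * (E\<^sup>2)\<^sup>2"
      by (rule mult_left_mono[OF key]) simp
    finally show "(X * Y)\<^sup>2 \<le> (dx * dy * E\<^sup>2 / 2)\<^sup>2"
      by (simp add: power_divide power_mult_distrib)
  qed (use dx dy in simp)
  finally show ?thesis .
qed

text \<open>Let w be the sum of \<rho> \<psi>^2. Cauchy-Schwarz with weight \<rho> bounds e^2 by the
  sum of \<rho> times w, and \<open>ladyzhenskaya\<close> bounds w^2 by r2 * m * e^2 / 2. For mass
  one the two close up: (m e^2)^2 \<le> w^2 \<le> (r2 / 2) (m e^2), and a factor m e^2 cancels. The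
  bound on the sum of \<rho>^2 \<psi> pairs \<rho>^(3/2) with \<rho>^(1/2) \<psi>; the last claim
  interpolates L2 between mass and L3.\<close>

lemma resolvent_energy_bounds:
  assumes dx: "0 < dx" and dy: "0 < dy"
    and \<rho>: "gint \<rho>" and nonneg: "\<And>i j. 0 \<le> \<rho> i j" and mass: "dx * dy * gsum \<rho> = 1"
    and \<psi>: "gint \<psi>" and eq: "\<And>i j. \<psi> i j - laplace dx dy \<psi> i j = \<rho> i j"
    and E_def: "E = dx * dy * gsum (\<lambda>i j. \<rho> i j * \<psi> i j)"
    and Q_def: "Q = dx * dy * gsum (\<lambda>i j. (\<rho> i j)\<^sup>2)"
    and A_def: "A = dx * dy * gsum (\<lambda>i j. (\<rho> i j) ^ 3)"
  shows "0 \<le> E" "E\<^sup>2 \<le> Q / 2" "(dx * dy * gsum (\<lambda>i j. (\<rho> i j)\<^sup>2 * \<psi> i j))\<^sup>2 \<le> A * Q / 2"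
    "dx * dy * dirichlet dx dy \<psi> \<le> E" "Q\<^sup>2 \<le> A"
proof -
  define m where "m = dx * dy"
  define e where "e = gsum (\<lambda>i j. \<rho> i j * \<psi> i j)"
  define r2 where "r2 = gsum (\<lambda>i j. (\<rho> i j)\<^sup>2)"
  define r3 where "r3 = gsum (\<lambda>i j. (\<rho> i j) ^ 3)"
  define w where "w = gsum (\<lambda>i j. \<rho> i j * (\<psi> i j)\<^sup>2)"
  have m: "0 < m" using dx dy by (simp add: m_def)
  have e: "e = gsum (\<lambda>i j. (\<psi> i j)\<^sup>2) + dirichlet dx dy \<psi>"
    unfolding e_def using dirichlet_energy[OF \<psi>, of dx dy] by (simp add: eq mult.commute)
  have nn: "0 \<le> gsum (\<lambda>i j. (\<psi> i j)\<^sup>2)" "0 \<le> dirichlet dx dy \<psi>"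
    unfolding dirichlet_def by (auto intro!: gsum_nonneg add_nonneg_nonneg)
  have e0: "0 \<le> e" "dirichlet dx dy \<psi> \<le> e" using nn e by auto
  show "0 \<le> E" "dx * dy * dirichlet dx dy \<psi> \<le> E"
    using e0 m by (simp_all add: E_def e_def m_def mult_left_mono)
  have g2: "gint (\<lambda>i j. (\<rho> i j)\<^sup>2)" and gp2: "gint (\<lambda>i j. (\<psi> i j)\<^sup>2)"
    by (intro gint_power2 \<rho> \<psi>)+
  have g3: "gint (\<lambda>i j. (\<rho> i j) ^ 3)"
    using gint_mult[OF \<rho> g2] by (simp add: power3_eq_cube power2_eq_square mult.assoc)
  have g4: "gint (\<lambda>i j. (\<psi> i j) ^ 4)"
    using gint_power2[OF gp2] by (simp flip: power_mult)
  have gw: "gint (\<lambda>i j. \<rho> i j * (\<psi> i j)\<^sup>2)" by (intro gint_mult \<rho> gp2)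
  have mass': "m * gsum \<rho> = 1" using mass by (simp add: m_def)
  have r2: "0 \<le> r2" unfolding r2_def by (rule gsum_nonneg) simp
  have w0: "0 \<le> w" unfolding w_def by (rule gsum_nonneg) (use nonneg in auto)
  have w: "w\<^sup>2 \<le> r2 * (m * e\<^sup>2 / 2)"
  proof -
    have "w\<^sup>2 \<le> r2 * gsum (\<lambda>i j. (\<psi> i j) ^ 4)"
      unfolding w_def r2_def
      using gsum_Cauchy_Schwarz(2)[of \<rho> "\<lambda>i j. (\<psi> i j)\<^sup>2"] g2 g4 by (simp flip: power_mult)
    also have "\<dots> \<le> r2 * (m * e\<^sup>2 / 2)"
      unfolding m_def by (intro mult_left_mono r2 ladyzhenskaya[OF dx dy \<psi> e])
    finally show ?thesis .
  qed
  have sq: "(sqrt (\<rho> i j))\<^sup>2 = \<rho> i j" for i j by (simp add: nonneg)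
  have gsq: "gint (\<lambda>i j. (sqrt (\<rho> i j))\<^sup>2)" using \<rho> by (simp add: sq)
  have gsq3: "gint (\<lambda>i j. (sqrt (\<rho> i j) * \<rho> i j)\<^sup>2)"
    using g3 by (simp add: power_mult_distrib nonneg flip: power_Suc)
  have gsqw: "gint (\<lambda>i j. (sqrt (\<rho> i j) * \<psi> i j)\<^sup>2)"
    using gw by (simp add: power_mult_distrib nonneg)
  have ew: "e\<^sup>2 \<le> gsum \<rho> * w"
    using gsum_Cauchy_Schwarz(2)[OF gsq gsqw]
    by (simp add: power_mult_distrib nonneg e_def w_def mult.assoc[symmetric])
  have me2: "m * e\<^sup>2 \<le> r2 / 2"
  proof (cases "e = 0")
    case False
    then have ep: "0 < e\<^sup>2" by simp
    have "m * e\<^sup>2 \<le> m * gsum \<rho> * w" using ew m by (simp add: mult.assoc)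
    then have "m * e\<^sup>2 \<le> w" using mass' by simp
    then have "(m * e\<^sup>2)\<^sup>2 \<le> w\<^sup>2" by (rule power_mono) (use m in simp)
    also note w
    finally have "(m * e\<^sup>2) * (m * e\<^sup>2) \<le> (r2 / 2) * (m * e\<^sup>2)"
      by (simp add: power2_eq_square)
    then show ?thesis using ep m by (simp add: mult_le_cancel_right)
  qed (use r2 in simp)
  show "E\<^sup>2 \<le> Q / 2"
  proof -
    have "E\<^sup>2 = m * (m * e\<^sup>2)" by (simp add: E_def e_def m_def power2_eq_square)
    also have "\<dots> \<le> m * (r2 / 2)" using me2 m by simp
    finally show ?thesis by (simp add: Q_def r2_def m_def)
  qed
  have wr: "w \<le> r2 / 2"
  proof (rule power2_le_imp_le)
    have "w\<^sup>2 \<le> r2 * (r2 / 2 / 2)"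
      using order_trans[OF w mult_left_mono[OF _ r2, of "m * e\<^sup>2 / 2" "r2 / 2 / 2"]] me2 by simp
    then show "w\<^sup>2 \<le> (r2 / 2)\<^sup>2" by (simp add: power2_eq_square)
  qed (use r2 in simp)
  have r3: "0 \<le> r3" unfolding r3_def by (rule gsum_nonneg) (simp add: nonneg)
  have "(gsum (\<lambda>i j. (\<rho> i j)\<^sup>2 * \<psi> i j))\<^sup>2 \<le> r3 * w"
  proof -
    have "(\<lambda>i j. sqrt (\<rho> i j) * \<rho> i j * (sqrt (\<rho> i j) * \<psi> i j)) = (\<lambda>i j. (\<rho> i j)\<^sup>2 * \<psi> i j)"
    proof (intro ext)
      fix i j
      have "sqrt (\<rho> i j) * \<rho> i j * (sqrt (\<rho> i j) * \<psi> i j) = (sqrt (\<rho> i j))\<^sup>2 * \<rho> i j * \<psi> i j"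
        by (simp only: power2_eq_square ac_simps)
      then show "sqrt (\<rho> i j) * \<rho> i j * (sqrt (\<rho> i j) * \<psi> i j) = (\<rho> i j)\<^sup>2 * \<psi> i j"
        by (simp add: sq power2_eq_square nonneg)
    qed
    moreover have "(\<lambda>i j. (sqrt (\<rho> i j) * \<rho> i j)\<^sup>2) = (\<lambda>i j. (\<rho> i j) ^ 3)"
      by (intro ext) (simp add: power_mult_distrib nonneg power3_eq_cube power2_eq_square)
    moreover have "(\<lambda>i j. (sqrt (\<rho> i j) * \<psi> i j)\<^sup>2) = (\<lambda>i j. \<rho> i j * (\<psi> i j)\<^sup>2)"
      by (intro ext) (simp add: power_mult_distrib nonneg)
    ultimately show ?thesis
      using gsum_Cauchy_Schwarz(2)[OF gsq3 gsqw] by (simp add: r3_def w_def)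
  qed
  also have "\<dots> \<le> r3 * (r2 / 2)" by (rule mult_left_mono[OF wr r3])
  finally show "(dx * dy * gsum (\<lambda>i j. (\<rho> i j)\<^sup>2 * \<psi> i j))\<^sup>2 \<le> A * Q / 2"
    unfolding A_def Q_def r3_def[symmetric] r2_def[symmetric] m_def[symmetric] power_mult_distrib
    using m by (simp add: power2_eq_square)
  have "r2\<^sup>2 \<le> gsum \<rho> * r3"
  proof -
    have "(\<lambda>i j. sqrt (\<rho> i j) * (sqrt (\<rho> i j) * \<rho> i j)) = (\<lambda>i j. (\<rho> i j)\<^sup>2)"
      by (intro ext) (simp add: nonneg power2_eq_square mult.assoc[symmetric])
    moreover have "(\<lambda>i j. (sqrt (\<rho> i j) * \<rho> i j)\<^sup>2) = (\<lambda>i j. (\<rho> i j) ^ 3)"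
      by (intro ext) (simp add: power_mult_distrib nonneg power3_eq_cube power2_eq_square)
    ultimately show ?thesis
      using gsum_Cauchy_Schwarz(2)[OF gsq gsq3] by (simp add: r3_def r2_def nonneg)
  qed
  then have "m\<^sup>2 * r2\<^sup>2 \<le> (m * gsum \<rho>) * (m * r3)" using m by (simp add: power2_eq_square)
  then show "Q\<^sup>2 \<le> A"
    using mass' by (simp add: Q_def A_def r2_def r3_def m_def power_mult_distrib)
qed

section \<open>One step of the scheme\<close>

text \<open>
  The step is a random walk with jump probabilities \<open>pE\<close>, \<open>pW\<close>, \<open>pN\<close>, \<open>pS\<close>, which are nonnegative because the
  numerical viscosity \<open>f\<close> dominates the velocity; \<open>gen\<close> is its generator.
\<close>

locale upwind_step =
  fixes dx dy f \<delta> \<tau> :: real and \<rho> u v :: "int \<Rightarrow> int \<Rightarrow> real"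
  assumes dx: "0 < dx" and dy: "0 < dy" and f: "0 \<le> f" and \<delta>: "0 < \<delta>" and \<tau>: "0 < \<tau>"
    and \<rho>: "gint \<rho>" and \<rho>_nonneg: "\<And>i j. 0 \<le> \<rho> i j" and mass: "dx * dy * gsum \<rho> = 1"
    and u: "\<And>i j. \<bar>u i j\<bar> \<le> f" and v: "\<And>i j. \<bar>v i j\<bar> \<le> f"
    and cfl: "\<And>i j. (2 * f * (1 / dx + 1 / dy) + \<delta> * \<rho> i j * (1 / dx\<^sup>2 + 1 / dy\<^sup>2)) * \<tau> \<le> 1"
begin

definition "a_x = \<tau> / (2 * dx)"
definition "a_y = \<tau> / (2 * dy)"
definition "b_x = \<delta> * \<tau> / (2 * dx\<^sup>2)"
definition "b_y = \<delta> * \<tau> / (2 * dy\<^sup>2)"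

text \<open>\<open>u i j\<close> belongs to the interface (i + 1/2, j), so the other interface of
  the cell carries \<open>u (i - 1) j\<close>. The central flux gives half of its weight to each
  adjoining cell, and the viscosity \<open>f\<close> makes the resulting rate nonnegative. The
  quadratic diffusion is read as a linear one whose jump rate is proportional to the density in the
  departure cell.\<close>

definition "pE i j = a_x * (f + u i j) + b_x * \<rho> i j"
definition "pW i j = a_x * (f - u (i - 1) j) + b_x * \<rho> i j"
definition "pN i j = a_y * (f + v i j) + b_y * \<rho> i j"
definition "pS i j = a_y * (f - v i (j - 1)) + b_y * \<rho> i j"

definition new :: "int \<Rightarrow> int \<Rightarrow> real" where
  "new i j = \<rho> i j * (1 - pE i j - pW i j - pN i j - pS i j)
     + pW (i + 1) j * \<rho> (i + 1) j + pE (i - 1) j * \<rho> (i - 1) j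
     + pS i (j + 1) * \<rho> i (j + 1) + pN i (j - 1) * \<rho> i (j - 1)"

definition gen :: "(int \<Rightarrow> int \<Rightarrow> real) \<Rightarrow> int \<Rightarrow> int \<Rightarrow> real" where
  "gen \<Psi> i j = pE i j * (\<Psi> (i + 1) j - \<Psi> i j) + pW i j * (\<Psi> (i - 1) j - \<Psi> i j)
     + pN i j * (\<Psi> i (j + 1) - \<Psi> i j) + pS i j * (\<Psi> i (j - 1) - \<Psi> i j)"

lemma new_eq:
  "new i j = \<rho> i j
     - \<tau> / dx * (u i j * ((\<rho> i j + \<rho> (i + 1) j) / 2) - u (i - 1) j * ((\<rho> (i - 1) j + \<rho> i j) / 2))
     - \<tau> / dy * (v i j * ((\<rho> i j + \<rho> i (j + 1)) / 2) - v i (j - 1) * ((\<rho> i (j - 1) + \<rho> i j) / 2))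
     + \<tau> / (2 * dx) * f * (\<rho> (i + 1) j - 2 * \<rho> i j + \<rho> (i - 1) j)
     + \<tau> / (2 * dy) * f * (\<rho> i (j + 1) - 2 * \<rho> i j + \<rho> i (j - 1))
     + \<delta> * \<tau> / (2 * dx^2) * ((\<rho> (i + 1) j)^2 - 2 * (\<rho> i j)^2 + (\<rho> (i - 1) j)^2)
     + \<delta> * \<tau> / (2 * dy^2) * ((\<rho> i (j + 1))^2 - 2 * (\<rho> i j)^2 + (\<rho> i (j - 1))^2)"
proof -
  have "\<tau> / dx = 2 * a_x" "\<tau> / dy = 2 * a_y" by (simp_all add: a_x_def a_y_def)
  then show ?thesis
    unfolding a_x_def[symmetric] a_y_def[symmetric] b_x_def[symmetric] b_y_def[symmetric]
    by (simp add: new_def pE_def pW_def pN_def pS_def algebra_simps power2_eq_square add_divide_distrib)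
qed

lemma gen_split:
  "gen \<Psi> i j = a_x * (u i j * (\<Psi> (i + 1) j - \<Psi> i j) + u (i - 1) j * (\<Psi> i j - \<Psi> (i - 1) j))
     + a_y * (v i j * (\<Psi> i (j + 1) - \<Psi> i j) + v i (j - 1) * (\<Psi> i j - \<Psi> i (j - 1)))
     + (a_x * f + b_x * \<rho> i j) * (\<Psi> (i + 1) j - 2 * \<Psi> i j + \<Psi> (i - 1) j)
     + (a_y * f + b_y * \<rho> i j) * (\<Psi> i (j + 1) - 2 * \<Psi> i j + \<Psi> i (j - 1))"
  by (simp add: gen_def pE_def pW_def pN_def pS_def algebra_simps)

lemma coeff_nonneg: "0 < a_x" "0 < a_y" "0 < b_x" "0 < b_y"
  using dx dy \<delta> \<tau> by (simp_all add: a_x_def a_y_def b_x_def b_y_def)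

lemma shifted_velocity: "0 \<le> f + u i j" "0 \<le> f - u i j" "0 \<le> f + v i j" "0 \<le> f - v i j"
    "f + u i j \<le> 2 * f" "f - u i j \<le> 2 * f" "f + v i j \<le> 2 * f" "f - v i j \<le> 2 * f"
  using u[of i j] v[of i j] by (auto simp: abs_le_iff)

lemma prob_nonneg: "0 \<le> pE i j" "0 \<le> pW i j" "0 \<le> pN i j" "0 \<le> pS i j"
  using coeff_nonneg shifted_velocity \<rho>_nonneg[of i j]
  by (simp_all add: pE_def pW_def pN_def pS_def)

text \<open>The step size condition expresses this in the worst case. Velocities at opposite
  interfaces are unrelated, so f + u and f - u are both estimated by 2 f; this is the origin of the
  factor 2 f in the condition.\<close>

lemma prob_sum: "pE i j + pW i j + pN i j + pS i j \<le> 1"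
proof -
  have "pE i j + pW i j \<le> a_x * (2 * f) + a_x * (2 * f) + 2 * (b_x * \<rho> i j)"
    using mult_left_mono[OF shifted_velocity(5)[of i j], of a_x]
      mult_left_mono[OF shifted_velocity(6)[of "i - 1" j], of a_x] coeff_nonneg
    unfolding pE_def pW_def by linarith
  moreover have "pN i j + pS i j \<le> a_y * (2 * f) + a_y * (2 * f) + 2 * (b_y * \<rho> i j)"
    using mult_left_mono[OF shifted_velocity(7)[of i j], of a_y]
      mult_left_mono[OF shifted_velocity(8)[of i "j - 1"], of a_y] coeff_nonneg
    unfolding pN_def pS_def by linarith
  moreover have "a_x * (2 * f) + a_x * (2 * f) + 2 * (b_x * \<rho> i j)
      + (a_y * (2 * f) + a_y * (2 * f) + 2 * (b_y * \<rho> i j))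
    = (2 * f * (1 / dx + 1 / dy) + \<delta> * \<rho> i j * (1 / dx\<^sup>2 + 1 / dy\<^sup>2)) * \<tau>"
    by (simp add: a_x_def a_y_def b_x_def b_y_def algebra_simps)
  ultimately show ?thesis using cfl[of i j] by linarith
qed

lemma prob_abs_le: "\<bar>pE i j\<bar> \<le> 1" "\<bar>pW i j\<bar> \<le> 1" "\<bar>pN i j\<bar> \<le> 1" "\<bar>pS i j\<bar> \<le> 1"
  using prob_nonneg[of i j] prob_sum[of i j] by (auto simp: abs_le_iff)

lemma new_nonneg: "0 \<le> new i j"
  unfolding new_def
  using prob_nonneg \<rho>_nonneg prob_sum[of i j] by (intro add_nonneg_nonneg mult_nonneg_nonneg) auto

text \<open>Duality: shifting each jump back from its arrival cell to its departure cell moves the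
  step onto the test function. Summability of the five products is assumed instead of a bound on
  \<Psi>, because the second moment needs an unbounded \<Psi>.\<close>

lemma new_pairing:
  assumes c: "gint (\<lambda>i j. \<rho> i j * \<Psi> i j)"
    and e: "gint (\<lambda>i j. \<rho> i j * \<Psi> (i + 1) j)" and w: "gint (\<lambda>i j. \<rho> i j * \<Psi> (i - 1) j)"
    and n: "gint (\<lambda>i j. \<rho> i j * \<Psi> i (j + 1))" and s: "gint (\<lambda>i j. \<rho> i j * \<Psi> i (j - 1))"
  shows "gint (\<lambda>i j. new i j * \<Psi> i j)" "gint (\<lambda>i j. \<rho> i j * gen \<Psi> i j)"
    "gsum (\<lambda>i j. new i j * \<Psi> i j) = gsum (\<lambda>i j. \<rho> i j * \<Psi> i j) + gsum (\<lambda>i j. \<rho> i j * gen \<Psi> i j)"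
proof -
  define r where "r i j = 1 - pE i j - pW i j - pN i j - pS i j" for i j
  have r1: "\<bar>r i j\<bar> \<le> 1" for i j
    using prob_nonneg[of i j] prob_sum[of i j] by (auto simp: r_def abs_le_iff)
  have gc: "gint (\<lambda>i j. r i j * (\<rho> i j * \<Psi> i j))" by (rule gint_mult_bounded(2)[OF c r1])
  have ge: "gint (\<lambda>i j. pE i j * (\<rho> i j * \<Psi> (i + 1) j))"
    by (rule gint_mult_bounded(2)[OF e prob_abs_le(1)])
  have gw: "gint (\<lambda>i j. pW i j * (\<rho> i j * \<Psi> (i - 1) j))"
    by (rule gint_mult_bounded(2)[OF w prob_abs_le(2)])
  have gn: "gint (\<lambda>i j. pN i j * (\<rho> i j * \<Psi> i (j + 1)))"
    by (rule gint_mult_bounded(2)[OF n prob_abs_le(3)])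
  have gs: "gint (\<lambda>i j. pS i j * (\<rho> i j * \<Psi> i (j - 1)))"
    by (rule gint_mult_bounded(2)[OF s prob_abs_le(4)])
  note sh = gint_shifts(1)[OF gw, simplified] gint_shifts(2)[OF ge, simplified]
    gint_shifts(3)[OF gs, simplified] gint_shifts(4)[OF gn, simplified]
  have new: "(\<lambda>i j. new i j * \<Psi> i j) = (\<lambda>i j. r i j * (\<rho> i j * \<Psi> i j)
      + pW (i + 1) j * (\<rho> (i + 1) j * \<Psi> i j) + pE (i - 1) j * (\<rho> (i - 1) j * \<Psi> i j)
      + pS i (j + 1) * (\<rho> i (j + 1) * \<Psi> i j) + pN i (j - 1) * (\<rho> i (j - 1) * \<Psi> i j))"
    by (intro ext) (simp add: new_def r_def algebra_simps)
  show "gint (\<lambda>i j. new i j * \<Psi> i j)" unfolding new by (intro gint_add gc sh)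
  have gen: "(\<lambda>i j. \<rho> i j * gen \<Psi> i j) = (\<lambda>i j. r i j * (\<rho> i j * \<Psi> i j)
      + pW i j * (\<rho> i j * \<Psi> (i - 1) j) + pE i j * (\<rho> i j * \<Psi> (i + 1) j)
      + pS i j * (\<rho> i j * \<Psi> i (j - 1)) + pN i j * (\<rho> i j * \<Psi> i (j + 1)) - \<rho> i j * \<Psi> i j)"
    by (intro ext) (simp add: gen_def r_def algebra_simps)
  show "gint (\<lambda>i j. \<rho> i j * gen \<Psi> i j)"
    unfolding gen by (intro gint_diff gint_add gc ge gw gn gs c)
  show "gsum (\<lambda>i j. new i j * \<Psi> i j) = gsum (\<lambda>i j. \<rho> i j * \<Psi> i j) + gsum (\<lambda>i j. \<rho> i j * gen \<Psi> i j)"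
    unfolding new gen
    using gsum_shifts(1)[of "\<lambda>i j. pW i j * (\<rho> i j * \<Psi> (i - 1) j)"]
      gsum_shifts(2)[of "\<lambda>i j. pE i j * (\<rho> i j * \<Psi> (i + 1) j)"]
      gsum_shifts(3)[of "\<lambda>i j. pS i j * (\<rho> i j * \<Psi> i (j - 1))"]
      gsum_shifts(4)[of "\<lambda>i j. pN i j * (\<rho> i j * \<Psi> i (j + 1))"]
    by (simp add: gsum_add gsum_diff gint_add gc ge gw gn gs sh c)
qed

lemma new_pairing_bounded:
  assumes "\<And>i j. \<bar>\<Psi> i j\<bar> \<le> B"
  shows "gint (\<lambda>i j. new i j * \<Psi> i j)" "gint (\<lambda>i j. \<rho> i j * gen \<Psi> i j)"
    "gsum (\<lambda>i j. new i j * \<Psi> i j) = gsum (\<lambda>i j. \<rho> i j * \<Psi> i j) + gsum (\<lambda>i j. \<rho> i j * gen \<Psi> i j)"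
  by (rule new_pairing; rule gint_mult_bounded(1)[OF \<rho>, where B = B]; rule assms)+

lemma new_gint: "gint new"
  using new_pairing_bounded(1)[of "\<lambda>_ _. 1" 1] by simp

lemma new_mass: "dx * dy * gsum new = 1"
  using new_pairing_bounded(3)[of "\<lambda>_ _. 1" 1] mass by (simp add: gen_def gsum_def)

text \<open>The sum over cells is regrouped by edges: an edge carries its net flow times the
  difference of \<eta> across it. In this form it can be estimated against the Dirichlet sum of
  \<eta>.\<close>

lemma gsum_gen_flux:
  assumes \<eta>: "gint \<eta>"
  shows "gsum (\<lambda>i j. \<rho> i j * gen \<eta> i j)
    = gsum (\<lambda>i j. (pE i j * \<rho> i j - pW (i + 1) j * \<rho> (i + 1) j) * (\<eta> (i + 1) j - \<eta> i j))
    + gsum (\<lambda>i j. (pN i j * \<rho> i j - pS i (j + 1) * \<rho> i (j + 1)) * (\<eta> i (j + 1) - \<eta> i j))"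
proof -
  have p\<rho>: "gint (\<lambda>i j. pE i j * \<rho> i j)" "gint (\<lambda>i j. pW i j * \<rho> i j)"
    "gint (\<lambda>i j. pN i j * \<rho> i j)" "gint (\<lambda>i j. pS i j * \<rho> i j)"
    by (rule gint_mult_bounded(2)[OF \<rho>] prob_abs_le)+
  have ge: "gint (\<lambda>i j. pE i j * \<rho> i j * (\<eta> (i + 1) j - \<eta> i j))"
    and gw: "gint (\<lambda>i j. pW i j * \<rho> i j * (\<eta> (i - 1) j - \<eta> i j))"
    and gn: "gint (\<lambda>i j. pN i j * \<rho> i j * (\<eta> i (j + 1) - \<eta> i j))"
    and gs: "gint (\<lambda>i j. pS i j * \<rho> i j * (\<eta> i (j - 1) - \<eta> i j))"
    by (intro gint_mult gint_diff gint_shifts \<eta> p\<rho>)+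
  note sh = gint_shifts(1)[OF gw, simplified] gint_shifts(3)[OF gs, simplified]
  have "gsum (\<lambda>i j. \<rho> i j * gen \<eta> i j) = gsum (\<lambda>i j. pE i j * \<rho> i j * (\<eta> (i + 1) j - \<eta> i j)
      + pW i j * \<rho> i j * (\<eta> (i - 1) j - \<eta> i j) + pN i j * \<rho> i j * (\<eta> i (j + 1) - \<eta> i j)
      + pS i j * \<rho> i j * (\<eta> i (j - 1) - \<eta> i j))"
    by (intro arg_cong[where f = gsum] ext) (simp add: gen_def algebra_simps)
  also have "\<dots> = gsum (\<lambda>i j. pE i j * \<rho> i j * (\<eta> (i + 1) j - \<eta> i j))
      + gsum (\<lambda>i j. pW (i + 1) j * \<rho> (i + 1) j * (\<eta> i j - \<eta> (i + 1) j))
      + gsum (\<lambda>i j. pN i j * \<rho> i j * (\<eta> i (j + 1) - \<eta> i j))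
      + gsum (\<lambda>i j. pS i (j + 1) * \<rho> i (j + 1) * (\<eta> i j - \<eta> i (j + 1)))"
    using gsum_shifts(1)[of "\<lambda>i j. pW i j * \<rho> i j * (\<eta> (i - 1) j - \<eta> i j)"]
      gsum_shifts(3)[of "\<lambda>i j. pS i j * \<rho> i j * (\<eta> i (j - 1) - \<eta> i j)"]
    by (simp add: gsum_add gint_add ge gw gn gs)
  also have "\<dots> = gsum (\<lambda>i j. pE i j * \<rho> i j * (\<eta> (i + 1) j - \<eta> i j)
        + pW (i + 1) j * \<rho> (i + 1) j * (\<eta> i j - \<eta> (i + 1) j))
      + gsum (\<lambda>i j. pN i j * \<rho> i j * (\<eta> i (j + 1) - \<eta> i j)
        + pS i (j + 1) * \<rho> i (j + 1) * (\<eta> i j - \<eta> i (j + 1)))"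
    using ge gn sh by (simp add: gsum_add)
  also have "(\<lambda>i j. pE i j * \<rho> i j * (\<eta> (i + 1) j - \<eta> i j)
        + pW (i + 1) j * \<rho> (i + 1) j * (\<eta> i j - \<eta> (i + 1) j))
      = (\<lambda>i j. (pE i j * \<rho> i j - pW (i + 1) j * \<rho> (i + 1) j) * (\<eta> (i + 1) j - \<eta> i j))"
    by (intro ext) (simp add: algebra_simps)
  also have "(\<lambda>i j. pN i j * \<rho> i j * (\<eta> i (j + 1) - \<eta> i j)
        + pS i (j + 1) * \<rho> i (j + 1) * (\<eta> i j - \<eta> i (j + 1)))
      = (\<lambda>i j. (pN i j * \<rho> i j - pS i (j + 1) * \<rho> i (j + 1)) * (\<eta> i (j + 1) - \<eta> i j))"
    by (intro ext) (simp add: algebra_simps)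
  finally show ?thesis .
qed

text \<open>Replace both mesh widths in the step size condition by the larger one h and drop the
  diffusive part; what remains is 4 f \<tau> / h \<le> 1.\<close>

lemma step_times_speed: "\<tau> * f \<le> max dx dy / 4"
proof -
  define h where "h = max dx dy"
  have h: "0 < h" "dx \<le> h" "dy \<le> h" using dx by (auto simp: h_def)
  then have "1 / h \<le> 1 / dx" "1 / h \<le> 1 / dy" using dx dy by (simp_all add: frac_le)
  then have "2 * f * (1 / h + 1 / h) * \<tau> \<le> 2 * f * (1 / dx + 1 / dy) * \<tau>"
    using f \<tau> by (intro mult_right_mono mult_left_mono add_mono) auto
  also have "\<dots> \<le> (2 * f * (1 / dx + 1 / dy) + \<delta> * \<rho> 0 0 * (1 / dx\<^sup>2 + 1 / dy\<^sup>2)) * \<tau>"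
    using \<tau> \<delta> \<rho>_nonneg[of 0 0] by (intro mult_right_mono) auto
  also have "\<dots> \<le> 1" by (rule cfl)
  finally show ?thesis using h by (simp add: h_def[symmetric] field_simps)
qed

lemma diffusive_cfl: "\<delta> * \<tau> * \<rho> i j * (1 / dx\<^sup>2 + 1 / dy\<^sup>2) \<le> 1"
proof -
  have "0 \<le> 2 * f * (1 / dx + 1 / dy) * \<tau>" using f \<tau> dx dy by simp
  then show ?thesis using cfl[of i j] by (simp add: algebra_simps)
qed

text \<open>Young's inequality with the conjugate weights 3 and 3/2 keeps the diffusive coefficient
  at 3/4. Being below 1, it can be absorbed by the gain in \<open>energy_first_variation\<close>.
  Squares are reduced to first powers by \<open>diffusive_cfl\<close> for the diffusive part and by
  \<open>step_times_speed\<close> for the drift.\<close>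

lemma prob_squares:
  "dx\<^sup>2 * ((pE i j)\<^sup>2 + (pW i j)\<^sup>2) + dy\<^sup>2 * ((pN i j)\<^sup>2 + (pS i j)\<^sup>2)
    \<le> 3 / 4 * (\<delta> * \<tau> * \<rho> i j) + 3 * \<tau> * f * max dx dy"
proof -
  let ?b = "\<delta> * \<tau> * \<rho> i j"
  have b: "0 \<le> ?b" using \<delta> \<tau> \<rho>_nonneg by simp
  have est: "d\<^sup>2 * (\<tau> / (2 * d) * w + \<delta> * \<tau> / (2 * d\<^sup>2) * \<rho> i j)\<^sup>2
      \<le> 3 * (\<tau> * f)\<^sup>2 + 3 / 8 * (?b\<^sup>2 / d\<^sup>2)"
    if d: "0 < d" and w: "0 \<le> w" "w \<le> 2 * f" for d w
  proof -
    have sq: "(x + y)\<^sup>2 \<le> 3 * x\<^sup>2 + 3 / 2 * y\<^sup>2" for x y :: real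
    proof -
      have "0 \<le> (2 * x - y)\<^sup>2" by simp
      then show ?thesis by (simp add: power2_eq_square algebra_simps)
    qed
    have "d\<^sup>2 * (\<tau> / (2 * d) * w + \<delta> * \<tau> / (2 * d\<^sup>2) * \<rho> i j)\<^sup>2
        = (\<tau> / 2 * w + ?b / (2 * d))\<^sup>2"
      using d by (simp add: power2_eq_square field_simps)
    also have "\<dots> \<le> 3 * (\<tau> / 2 * w)\<^sup>2 + 3 / 2 * (?b / (2 * d))\<^sup>2" by (rule sq)
    also have "(\<tau> / 2 * w)\<^sup>2 \<le> (\<tau> * f)\<^sup>2"
      using w \<tau> by (intro power_mono) auto
    finally show ?thesis by (simp add: power_divide power_mult_distrib)
  qed
  have "dx\<^sup>2 * (pE i j)\<^sup>2 + dx\<^sup>2 * (pW i j)\<^sup>2 \<le> 6 * (\<tau> * f)\<^sup>2 + 3 / 4 * (?b\<^sup>2 / dx\<^sup>2)"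
    using est[OF dx shifted_velocity(1,5)[of i j]] est[OF dx shifted_velocity(2,6)[of "i - 1" j]]
    by (simp add: pE_def pW_def a_x_def b_x_def)
  moreover have "dy\<^sup>2 * (pN i j)\<^sup>2 + dy\<^sup>2 * (pS i j)\<^sup>2 \<le> 6 * (\<tau> * f)\<^sup>2 + 3 / 4 * (?b\<^sup>2 / dy\<^sup>2)"
    using est[OF dy shifted_velocity(3,7)[of i j]] est[OF dy shifted_velocity(4,8)[of i "j - 1"]]
    by (simp add: pN_def pS_def a_y_def b_y_def)
  moreover have "?b\<^sup>2 / dx\<^sup>2 + ?b\<^sup>2 / dy\<^sup>2 \<le> ?b"
    using mult_left_mono[OF diffusive_cfl[of i j] b] by (simp add: power2_eq_square algebra_simps)
  moreover have "12 * (\<tau> * f)\<^sup>2 \<le> 3 * \<tau> * f * max dx dy"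
    using mult_left_mono[OF step_times_speed, of "12 * (\<tau> * f)"] f \<tau> by (simp add: power2_eq_square)
  ultimately show ?thesis unfolding distrib_left by linarith
qed

text \<open>The diffusive part of the generator is \<delta> \<tau> \<rho> / 2 times the Laplacian of
  \<psi>, which the resolvent equation replaces by \<psi> - \<rho>. The resulting negative square is
  the source of all dissipation; the drift is merely estimated by first differences.\<close>

lemma gen_bound:
  assumes \<psi>: "\<psi> i j - laplace dx dy \<psi> i j = \<rho> i j"
  shows "gen \<psi> i j \<le> \<tau> * f * (\<bar>(\<psi> (i + 1) j - \<psi> i j) / dx\<bar> + \<bar>(\<psi> i j - \<psi> (i - 1) j) / dx\<bar>
      + \<bar>(\<psi> i (j + 1) - \<psi> i j) / dy\<bar> + \<bar>(\<psi> i j - \<psi> i (j - 1)) / dy\<bar>)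
      + \<delta> * \<tau> / 2 * (\<rho> i j * \<psi> i j - (\<rho> i j)\<^sup>2)"
proof -
  let ?E = "\<psi> (i + 1) j - \<psi> i j" and ?W = "\<psi> i j - \<psi> (i - 1) j"
    and ?N = "\<psi> i (j + 1) - \<psi> i j" and ?S = "\<psi> i j - \<psi> i (j - 1)"
  have drift: "\<tau> / (2 * d) * (w * e) \<le> \<tau> * f * \<bar>e / d\<bar>"
    if "0 < d" "0 \<le> w" "w \<le> 2 * f" for d w e
  proof -
    have "\<tau> / (2 * d) * (w * e) \<le> \<tau> / (2 * d) * (w * \<bar>e\<bar>)"
      using that \<tau> by (intro mult_left_mono) auto
    also have "\<dots> \<le> \<tau> / (2 * d) * ((2 * f) * \<bar>e\<bar>)"
      using that \<tau> by (intro mult_left_mono mult_right_mono) auto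
    finally show ?thesis using that by simp
  qed
  have "b_x * (?E - ?W) + b_y * (?N - ?S) = \<delta> * \<tau> / 2 * laplace dx dy \<psi> i j"
    by (simp add: laplace_def b_x_def b_y_def algebra_simps add_divide_distrib diff_divide_distrib)
  moreover have "laplace dx dy \<psi> i j = \<psi> i j - \<rho> i j" using \<psi> by simp
  ultimately have lap: "b_x * (?E - ?W) + b_y * (?N - ?S) = \<delta> * \<tau> / 2 * (\<psi> i j - \<rho> i j)"
    by simp
  have "gen \<psi> i j = a_x * ((f + u i j) * ?E) + a_x * ((f - u (i - 1) j) * (- ?W))
      + a_y * ((f + v i j) * ?N) + a_y * ((f - v i (j - 1)) * (- ?S))
      + \<rho> i j * (b_x * (?E - ?W) + b_y * (?N - ?S))"
    by (simp add: gen_def pE_def pW_def pN_def pS_def algebra_simps)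
  moreover have "a_x * ((f + u i j) * ?E) \<le> \<tau> * f * \<bar>?E / dx\<bar>"
    unfolding a_x_def by (rule drift shifted_velocity dx)+
  moreover have "a_x * ((f - u (i - 1) j) * (- ?W)) \<le> \<tau> * f * \<bar>?W / dx\<bar>"
    using drift[OF dx shifted_velocity(2,6)[of "i - 1" j], of "- ?W"]
    by (simp only: a_x_def minus_divide_left[symmetric] abs_minus_cancel)
  moreover have "a_y * ((f + v i j) * ?N) \<le> \<tau> * f * \<bar>?N / dy\<bar>"
    unfolding a_y_def by (rule drift shifted_velocity dy)+
  moreover have "a_y * ((f - v i (j - 1)) * (- ?S)) \<le> \<tau> * f * \<bar>?S / dy\<bar>"
    using drift[OF dy shifted_velocity(4,8)[of i "j - 1"], of "- ?S"]
    by (simp only: a_y_def minus_divide_left[symmetric] abs_minus_cancel)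
  moreover have "\<rho> i j * (b_x * (?E - ?W) + b_y * (?N - ?S))
      = \<delta> * \<tau> / 2 * (\<rho> i j * \<psi> i j - (\<rho> i j)\<^sup>2)"
    unfolding lap by (simp add: power2_eq_square algebra_simps diff_divide_distrib)
  ultimately have "gen \<psi> i j \<le> \<tau> * f * \<bar>?E / dx\<bar> + \<tau> * f * \<bar>?W / dx\<bar> + \<tau> * f * \<bar>?N / dy\<bar>
      + \<tau> * f * \<bar>?S / dy\<bar> + \<delta> * \<tau> / 2 * (\<rho> i j * \<psi> i j - (\<rho> i j)\<^sup>2)"
    by (simp only: add_mono order_refl)
  then show ?thesis by (simp only: distrib_left)
qed

text \<open>Multiply \<open>gen_bound\<close> by 2 \<rho> and split density times difference
  quotient by Young's inequality with weight \<kappa>. Four difference quotients per cell give 4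
  \<kappa>; every edge is met from both of its cells, which gives 2 / \<kappa>.\<close>

lemma energy_first_variation:
  assumes \<psi>: "gint \<psi>" and eq: "\<And>i j. \<psi> i j - laplace dx dy \<psi> i j = \<rho> i j" and \<kappa>: "0 < \<kappa>"
  shows "2 * gsum (\<lambda>i j. \<rho> i j * gen \<psi> i j)
    \<le> \<tau> * f * (4 * \<kappa> * gsum (\<lambda>i j. (\<rho> i j)\<^sup>2) + 2 / \<kappa> * dirichlet dx dy \<psi>)
      + \<delta> * \<tau> * (gsum (\<lambda>i j. (\<rho> i j)\<^sup>2 * \<psi> i j) - gsum (\<lambda>i j. (\<rho> i j) ^ 3))"
proof -
  define Dx where "Dx i j = ((\<psi> (i + 1) j - \<psi> i j) / dx)\<^sup>2" for i j
  define Dy where "Dy i j = ((\<psi> i (j + 1) - \<psi> i j) / dy)\<^sup>2" for i j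
  have "Dx = (\<lambda>i j. (1 / dx * (\<psi> (i + 1) j - \<psi> i j))\<^sup>2)" "Dy = (\<lambda>i j. (1 / dy * (\<psi> i (j + 1) - \<psi> i j))\<^sup>2)"
    by (intro ext, simp add: Dx_def Dy_def)+
  then have gD: "gint Dx" "gint Dy"
    by (simp_all only:) (intro gint_power2 gint_cmult gint_diff gint_shifts \<psi>)+
  have dir: "dirichlet dx dy \<psi> = gsum Dx + gsum Dy"
    by (simp add: dirichlet_def Dx_def[abs_def] Dy_def[abs_def])
  have g2: "gint (\<lambda>i j. (\<rho> i j)\<^sup>2)" by (rule gint_power2[OF \<rho>])
  have g2\<psi>: "gint (\<lambda>i j. (\<rho> i j)\<^sup>2 * \<psi> i j)" by (intro gint_mult g2 \<psi>)
  have g3: "gint (\<lambda>i j. (\<rho> i j) ^ 3)"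
    using gint_mult[OF \<rho> g2] by (simp add: power3_eq_cube power2_eq_square mult.assoc)
  have \<psi>_bd: "\<bar>\<psi> i j\<bar> \<le> gsum (\<lambda>i j. \<bar>\<psi> i j\<bar>)" for i j by (rule gint_bounded[OF \<psi>])
  have young: "2 * (r * \<bar>x\<bar>) \<le> \<kappa> * r\<^sup>2 + 1 / \<kappa> * x\<^sup>2" for r x :: real
  proof -
    have "0 \<le> (\<kappa> * r - \<bar>x\<bar>)\<^sup>2 / \<kappa>" using \<kappa> by simp
    also have "(\<kappa> * r - \<bar>x\<bar>)\<^sup>2 / \<kappa> = \<kappa> * r\<^sup>2 + 1 / \<kappa> * x\<^sup>2 - 2 * (r * \<bar>x\<bar>)"
      using \<kappa> by (simp add: power2_diff power_mult_distrib field_simps power2_eq_square)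
    finally show ?thesis by simp
  qed
  let ?R = "\<lambda>i j. \<tau> * f * (4 * \<kappa> * (\<rho> i j)\<^sup>2 + 1 / \<kappa> * (Dx i j + Dx (i - 1) j + Dy i j + Dy i (j - 1)))
      + \<delta> * \<tau> * ((\<rho> i j)\<^sup>2 * \<psi> i j - (\<rho> i j) ^ 3)"
  have gR: "gint ?R"
    by (intro gint_add gint_cmult gint_diff gint_shifts(2)[OF gD(1)] gint_shifts(4)[OF gD(2)] gD g2 g2\<psi> g3)
  have pt: "2 * (\<rho> i j * gen \<psi> i j) \<le> ?R i j" for i j
  proof -
    have "2 * (\<rho> i j * gen \<psi> i j) \<le> 2 * (\<rho> i j *
      (\<tau> * f * (\<bar>(\<psi> (i + 1) j - \<psi> i j) / dx\<bar> + \<bar>(\<psi> i j - \<psi> (i - 1) j) / dx\<bar>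
      + \<bar>(\<psi> i (j + 1) - \<psi> i j) / dy\<bar> + \<bar>(\<psi> i j - \<psi> i (j - 1)) / dy\<bar>)
      + \<delta> * \<tau> / 2 * (\<rho> i j * \<psi> i j - (\<rho> i j)\<^sup>2)))"
      by (intro mult_left_mono gen_bound eq \<rho>_nonneg) simp
    also have "\<dots> = \<tau> * f * (2 * (\<rho> i j * \<bar>(\<psi> (i + 1) j - \<psi> i j) / dx\<bar>)
      + 2 * (\<rho> i j * \<bar>(\<psi> i j - \<psi> (i - 1) j) / dx\<bar>)
      + 2 * (\<rho> i j * \<bar>(\<psi> i (j + 1) - \<psi> i j) / dy\<bar>) + 2 * (\<rho> i j * \<bar>(\<psi> i j - \<psi> i (j - 1)) / dy\<bar>))
      + \<delta> * \<tau> * ((\<rho> i j)\<^sup>2 * \<psi> i j - (\<rho> i j) ^ 3)"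
      by (simp only: distrib_left right_diff_distrib power2_eq_square power3_eq_cube)
        (simp add: algebra_simps)
    also have "\<dots> \<le> \<tau> * f * ((\<kappa> * (\<rho> i j)\<^sup>2 + 1 / \<kappa> * Dx i j) + (\<kappa> * (\<rho> i j)\<^sup>2 + 1 / \<kappa> * Dx (i - 1) j)
      + (\<kappa> * (\<rho> i j)\<^sup>2 + 1 / \<kappa> * Dy i j) + (\<kappa> * (\<rho> i j)\<^sup>2 + 1 / \<kappa> * Dy i (j - 1)))
      + \<delta> * \<tau> * ((\<rho> i j)\<^sup>2 * \<psi> i j - (\<rho> i j) ^ 3)"
    proof -
      have "2 * (\<rho> i j * \<bar>(\<psi> (i + 1) j - \<psi> i j) / dx\<bar>) \<le> \<kappa> * (\<rho> i j)\<^sup>2 + 1 / \<kappa> * Dx i j"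
        "2 * (\<rho> i j * \<bar>(\<psi> i (j + 1) - \<psi> i j) / dy\<bar>) \<le> \<kappa> * (\<rho> i j)\<^sup>2 + 1 / \<kappa> * Dy i j"
        unfolding Dx_def Dy_def by (rule young)+
      moreover
      have "2 * (\<rho> i j * \<bar>(\<psi> i j - \<psi> (i - 1) j) / dx\<bar>) \<le> \<kappa> * (\<rho> i j)\<^sup>2 + 1 / \<kappa> * Dx (i - 1) j"
        "2 * (\<rho> i j * \<bar>(\<psi> i j - \<psi> i (j - 1)) / dy\<bar>) \<le> \<kappa> * (\<rho> i j)\<^sup>2 + 1 / \<kappa> * Dy i (j - 1)"
        unfolding Dx_def Dy_def diff_add_cancel by (rule young)+
      moreover have "0 \<le> \<tau> * f" using \<tau> f by simp
      ultimately show ?thesis by (intro add_right_mono mult_left_mono add_mono)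
    qed
    also have "\<dots> = ?R i j" by (simp add: algebra_simps)
    finally show ?thesis .
  qed
  have "2 * gsum (\<lambda>i j. \<rho> i j * gen \<psi> i j) = gsum (\<lambda>i j. 2 * (\<rho> i j * gen \<psi> i j))"
    by (rule gsum_cmult[symmetric])
  also have "\<dots> \<le> gsum ?R"
    by (rule gsum_mono[OF gint_cmult[OF new_pairing_bounded(2)[OF \<psi>_bd]] gR pt])
  also have "gsum ?R = \<tau> * f * (4 * \<kappa> * gsum (\<lambda>i j. (\<rho> i j)\<^sup>2)
      + 1 / \<kappa> * (gsum Dx + gsum Dx + gsum Dy + gsum Dy))
      + \<delta> * \<tau> * (gsum (\<lambda>i j. (\<rho> i j)\<^sup>2 * \<psi> i j) - gsum (\<lambda>i j. (\<rho> i j) ^ 3))"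
    by (simp only: gsum_add gsum_diff gsum_cmult gsum_shifts(2)[of Dx] gsum_shifts(4)[of Dy]
        gint_add gint_cmult gint_diff gint_shifts(2)[OF gD(1)] gint_shifts(4)[OF gD(2)] gD g2 g2\<psi> g3)
  finally show ?thesis by (simp add: dir algebra_simps add_divide_distrib)
qed

text \<open>The left side \<open>X\<close> equals the pairing of the increment with its own
  resolvent \<eta>, hence dominates the Dirichlet sum of \<eta>. Written over edges,
  \<open>X\<close> is at most half the squared flows plus half that Dirichlet sum. Absorbing the
  second half into \<open>X\<close> leaves only squared flows, for which \<open>prob_squares\<close>
  is available.\<close>

lemma energy_second_variation:
  assumes \<eta>: "gint \<eta>" and eq: "\<And>i j. \<eta> i j - laplace dx dy \<eta> i j = new i j - \<rho> i j"
  shows "gsum (\<lambda>i j. \<rho> i j * gen \<eta> i j)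
    \<le> 3 / 4 * (\<delta> * \<tau> * gsum (\<lambda>i j. (\<rho> i j) ^ 3)) + 3 * \<tau> * f * max dx dy * gsum (\<lambda>i j. (\<rho> i j)\<^sup>2)"
proof -
  define X where "X = gsum (\<lambda>i j. \<rho> i j * gen \<eta> i j)"
  define a where "a i j = pE i j * \<rho> i j" for i j
  define b where "b i j = pW i j * \<rho> i j" for i j
  define c where "c i j = pN i j * \<rho> i j" for i j
  define d where "d i j = pS i j * \<rho> i j" for i j
  have g: "gint a" "gint b" "gint c" "gint d"
    unfolding a_def b_def c_def d_def by (rule gint_mult_bounded(2)[OF \<rho>] prob_abs_le)+
  have nn: "0 \<le> a i j" "0 \<le> b i j" "0 \<le> c i j" "0 \<le> d i j" for i j
    by (simp_all add: a_def b_def c_def d_def prob_nonneg \<rho>_nonneg)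
  have half: "gsum (\<lambda>i j. (p i j - q i j) * (e i j - \<eta> i j))
      \<le> h\<^sup>2 / 2 * (gsum (\<lambda>i j. (p i j)\<^sup>2) + gsum (\<lambda>i j. (q i j)\<^sup>2))
        + 1 / 2 * gsum (\<lambda>i j. ((e i j - \<eta> i j) / h)\<^sup>2)"
    if p: "gint p" "\<And>i j. 0 \<le> p i j" and q: "gint q" "\<And>i j. 0 \<le> q i j" and e: "gint e" and h: "0 < h"
    for p q e h
  proof -
    have D: "(\<lambda>i j. ((e i j - \<eta> i j) / h)\<^sup>2) = (\<lambda>i j. (1 / h * (e i j - \<eta> i j))\<^sup>2)" by simp
    have gD: "gint (\<lambda>i j. ((e i j - \<eta> i j) / h)\<^sup>2)"
      unfolding D by (intro gint_power2 gint_cmult gint_diff e \<eta>)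
    have g2: "gint (\<lambda>i j. (p i j)\<^sup>2)" "gint (\<lambda>i j. (q i j)\<^sup>2)" by (intro gint_power2 p q)+
    have "gsum (\<lambda>i j. (p i j - q i j) * (e i j - \<eta> i j))
      \<le> gsum (\<lambda>i j. h\<^sup>2 / 2 * ((p i j)\<^sup>2 + (q i j)\<^sup>2) + 1 / 2 * ((e i j - \<eta> i j) / h)\<^sup>2)"
    proof (rule gsum_mono)
      show "gint (\<lambda>i j. (p i j - q i j) * (e i j - \<eta> i j))" by (intro gint_mult gint_diff p q e \<eta>)
      show "gint (\<lambda>i j. h\<^sup>2 / 2 * ((p i j)\<^sup>2 + (q i j)\<^sup>2) + 1 / 2 * ((e i j - \<eta> i j) / h)\<^sup>2)"
        by (intro gint_add gint_cmult g2 gD)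
      fix i j
      have "(p i j - q i j) * (e i j - \<eta> i j) = (h * (p i j - q i j)) * ((e i j - \<eta> i j) / h)"
        using h by simp
      also have "2 * \<dots> \<le> (h * (p i j - q i j))\<^sup>2 + ((e i j - \<eta> i j) / h)\<^sup>2"
        using sum_squares_bound[of "h * (p i j - q i j)" "(e i j - \<eta> i j) / h"]
        by (simp only: mult.assoc)
      \<comment> \<open>Both flows are nonnegative, so the cross term of (p - q)^2 has the
        favourable sign and no factor 2 is lost.\<close>
      also have "(h * (p i j - q i j))\<^sup>2 \<le> h\<^sup>2 * ((p i j)\<^sup>2 + (q i j)\<^sup>2)"
        unfolding power_mult_distrib using p(2)[of i j] q(2)[of i j]
        by (intro mult_left_mono) (auto simp: power2_diff)
      finally show "(p i j - q i j) * (e i j - \<eta> i j)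
          \<le> h\<^sup>2 / 2 * ((p i j)\<^sup>2 + (q i j)\<^sup>2) + 1 / 2 * ((e i j - \<eta> i j) / h)\<^sup>2" by simp
    qed
    also have "\<dots> = h\<^sup>2 / 2 * (gsum (\<lambda>i j. (p i j)\<^sup>2) + gsum (\<lambda>i j. (q i j)\<^sup>2))
        + 1 / 2 * gsum (\<lambda>i j. ((e i j - \<eta> i j) / h)\<^sup>2)"
      by (simp only: gsum_add gsum_cmult gint_add gint_cmult g2 gD)
    finally show ?thesis .
  qed
  have "X = gsum (\<lambda>i j. (a i j - b (i + 1) j) * (\<eta> (i + 1) j - \<eta> i j))
      + gsum (\<lambda>i j. (c i j - d i (j + 1)) * (\<eta> i (j + 1) - \<eta> i j))"
    unfolding X_def gsum_gen_flux[OF \<eta>] by (simp add: a_def b_def c_def d_def)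
  also have "\<dots> \<le> (dx\<^sup>2 / 2 * (gsum (\<lambda>i j. (a i j)\<^sup>2) + gsum (\<lambda>i j. (b (i + 1) j)\<^sup>2))
        + 1 / 2 * gsum (\<lambda>i j. ((\<eta> (i + 1) j - \<eta> i j) / dx)\<^sup>2))
      + (dy\<^sup>2 / 2 * (gsum (\<lambda>i j. (c i j)\<^sup>2) + gsum (\<lambda>i j. (d i (j + 1))\<^sup>2))
        + 1 / 2 * gsum (\<lambda>i j. ((\<eta> i (j + 1) - \<eta> i j) / dy)\<^sup>2))"
    by (intro add_mono half g gint_shifts nn \<eta> dx dy)
  also have "\<dots> = (dx\<^sup>2 * (gsum (\<lambda>i j. (a i j)\<^sup>2) + gsum (\<lambda>i j. (b i j)\<^sup>2))
      + dy\<^sup>2 * (gsum (\<lambda>i j. (c i j)\<^sup>2) + gsum (\<lambda>i j. (d i j)\<^sup>2))) / 2 + dirichlet dx dy \<eta> / 2"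
    using gsum_shifts(1)[of "\<lambda>i j. (b i j)\<^sup>2"] gsum_shifts(3)[of "\<lambda>i j. (d i j)\<^sup>2"]
    by (simp add: dirichlet_def add_divide_distrib)
  finally have X1: "X \<le> (dx\<^sup>2 * (gsum (\<lambda>i j. (a i j)\<^sup>2) + gsum (\<lambda>i j. (b i j)\<^sup>2))
      + dy\<^sup>2 * (gsum (\<lambda>i j. (c i j)\<^sup>2) + gsum (\<lambda>i j. (d i j)\<^sup>2))) / 2 + dirichlet dx dy \<eta> / 2" .
  have X2: "dirichlet dx dy \<eta> \<le> X"
  proof -
    have \<eta>_bd: "\<bar>\<eta> i j\<bar> \<le> gsum (\<lambda>i j. \<bar>\<eta> i j\<bar>)" for i j by (rule gint_bounded[OF \<eta>])
    have "X = gsum (\<lambda>i j. new i j * \<eta> i j) - gsum (\<lambda>i j. \<rho> i j * \<eta> i j)"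
      unfolding X_def using new_pairing_bounded(3)[OF \<eta>_bd] by simp
    also have "\<dots> = gsum (\<lambda>i j. new i j * \<eta> i j - \<rho> i j * \<eta> i j)"
      by (rule gsum_diff[symmetric]) (intro gint_mult new_gint \<rho> \<eta>)+
    also have "\<dots> = gsum (\<lambda>i j. \<eta> i j * (\<eta> i j - laplace dx dy \<eta> i j))"
      by (intro arg_cong[where f = gsum] ext) (simp add: eq algebra_simps)
    also have "\<dots> = gsum (\<lambda>i j. (\<eta> i j)\<^sup>2) + dirichlet dx dy \<eta>" by (rule dirichlet_energy[OF \<eta>])
    finally show ?thesis using gsum_nonneg[of "\<lambda>i j. (\<eta> i j)\<^sup>2"] by simp
  qed
  have g2: "gint (\<lambda>i j. (a i j)\<^sup>2)" "gint (\<lambda>i j. (b i j)\<^sup>2)" "gint (\<lambda>i j. (c i j)\<^sup>2)" "gint (\<lambda>i j. (d i j)\<^sup>2)"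
    by (intro gint_power2 g)+
  have gr2: "gint (\<lambda>i j. (\<rho> i j)\<^sup>2)" by (rule gint_power2[OF \<rho>])
  have gr3: "gint (\<lambda>i j. (\<rho> i j) ^ 3)"
    using gint_mult[OF \<rho> gr2] by (simp add: power3_eq_cube power2_eq_square mult.assoc)
  have "dx\<^sup>2 * (gsum (\<lambda>i j. (a i j)\<^sup>2) + gsum (\<lambda>i j. (b i j)\<^sup>2))
      + dy\<^sup>2 * (gsum (\<lambda>i j. (c i j)\<^sup>2) + gsum (\<lambda>i j. (d i j)\<^sup>2))
    = gsum (\<lambda>i j. dx\<^sup>2 * ((a i j)\<^sup>2 + (b i j)\<^sup>2) + dy\<^sup>2 * ((c i j)\<^sup>2 + (d i j)\<^sup>2))"
    by (simp only: gsum_add gsum_cmult gint_add gint_cmult g2)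
  also have "\<dots> \<le> gsum (\<lambda>i j. 3 / 4 * (\<delta> * \<tau> * (\<rho> i j) ^ 3) + 3 * \<tau> * f * max dx dy * (\<rho> i j)\<^sup>2)"
  proof (rule gsum_mono)
    show "gint (\<lambda>i j. dx\<^sup>2 * ((a i j)\<^sup>2 + (b i j)\<^sup>2) + dy\<^sup>2 * ((c i j)\<^sup>2 + (d i j)\<^sup>2))"
      by (intro gint_add gint_cmult g2)
    show "gint (\<lambda>i j. 3 / 4 * (\<delta> * \<tau> * (\<rho> i j) ^ 3) + 3 * \<tau> * f * max dx dy * (\<rho> i j)\<^sup>2)"
      by (intro gint_add gint_cmult gr2 gr3)
    fix i j
    have "dx\<^sup>2 * ((a i j)\<^sup>2 + (b i j)\<^sup>2) + dy\<^sup>2 * ((c i j)\<^sup>2 + (d i j)\<^sup>2)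
      = (\<rho> i j)\<^sup>2 * (dx\<^sup>2 * ((pE i j)\<^sup>2 + (pW i j)\<^sup>2) + dy\<^sup>2 * ((pN i j)\<^sup>2 + (pS i j)\<^sup>2))"
      by (simp add: a_def b_def c_def d_def power_mult_distrib algebra_simps)
    also have "\<dots> \<le> (\<rho> i j)\<^sup>2 * (3 / 4 * (\<delta> * \<tau> * \<rho> i j) + 3 * \<tau> * f * max dx dy)"
      by (rule mult_left_mono[OF prob_squares]) simp
    finally show "dx\<^sup>2 * ((a i j)\<^sup>2 + (b i j)\<^sup>2) + dy\<^sup>2 * ((c i j)\<^sup>2 + (d i j)\<^sup>2)
      \<le> 3 / 4 * (\<delta> * \<tau> * (\<rho> i j) ^ 3) + 3 * \<tau> * f * max dx dy * (\<rho> i j)\<^sup>2"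
      by (simp add: algebra_simps power2_eq_square power3_eq_cube)
  qed
  also have "\<dots> = 3 / 4 * (\<delta> * \<tau> * gsum (\<lambda>i j. (\<rho> i j) ^ 3)) + 3 * \<tau> * f * max dx dy * gsum (\<lambda>i j. (\<rho> i j)\<^sup>2)"
    by (simp only: gsum_add gsum_cmult gint_cmult gr2 gr3)
  finally have R: "dx\<^sup>2 * (gsum (\<lambda>i j. (a i j)\<^sup>2) + gsum (\<lambda>i j. (b i j)\<^sup>2))
      + dy\<^sup>2 * (gsum (\<lambda>i j. (c i j)\<^sup>2) + gsum (\<lambda>i j. (d i j)\<^sup>2))
    \<le> 3 / 4 * (\<delta> * \<tau> * gsum (\<lambda>i j. (\<rho> i j) ^ 3)) + 3 * \<tau> * f * max dx dy * gsum (\<lambda>i j. (\<rho> i j)\<^sup>2)" .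
  have "z \<le> r \<Longrightarrow> x \<le> z / 2 + y / 2 \<Longrightarrow> y \<le> x \<Longrightarrow> x \<le> r" for x y z r :: real
    by linarith
  from this[OF R X1 X2] show ?thesis by (simp only: X_def)
qed

end

context upwind_step
begin

section \<open>Energy and dissipation\<close>

text \<open>By symmetry of the resolvent, E' - E is twice the first-order term plus the energy of
  the increment. The cubic sum \<open>A\<close> enters with the factor - \<delta> from the former
  and 3/4 \<delta> from the latter, and \<open>Z\<close> costs a further \<delta> / 8. What is left
  is at most - \<delta> Q^2 / 8; half of it pays for the terms linear in \<open>Q\<close>, whose
  coefficients are collected in \<open>B\<close>.\<close>

lemma energy_decay:
  assumes \<psi>: "gint \<psi>" and eq: "\<And>i j. \<psi> i j - laplace dx dy \<psi> i j = \<rho> i j"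
    and \<psi>': "gint \<psi>'" and eq': "\<And>i j. \<psi>' i j - laplace dx dy \<psi>' i j = new i j"
    and \<kappa>: "0 < \<kappa>"
    and E_def: "E = dx * dy * gsum (\<lambda>i j. \<rho> i j * \<psi> i j)"
    and E'_def: "E' = dx * dy * gsum (\<lambda>i j. new i j * \<psi>' i j)"
    and Q_def: "Q = dx * dy * gsum (\<lambda>i j. (\<rho> i j)\<^sup>2)"
    and B_def: "B = \<delta> + 5 * f * \<kappa> + 3 * f * max dx dy"
  shows "E' \<le> E + \<tau> * (4 * B\<^sup>2 / \<delta> + f / \<kappa> ^ 3 - \<delta> * Q\<^sup>2 / 16)"
proof -
  define m where "m = dx * dy"
  define A where "A = m * gsum (\<lambda>i j. (\<rho> i j) ^ 3)"
  define Z where "Z = m * gsum (\<lambda>i j. (\<rho> i j)\<^sup>2 * \<psi> i j)"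
  define \<eta> where "\<eta> i j = \<psi>' i j - \<psi> i j" for i j
  have m: "0 < m" using dx dy by (simp add: m_def)
  have \<eta>: "gint \<eta>" unfolding \<eta>_def by (intro gint_diff \<psi> \<psi>')
  have eq\<eta>: "\<eta> i j - laplace dx dy \<eta> i j = new i j - \<rho> i j" for i j
    unfolding eq[symmetric] eq'[symmetric]
    by (simp add: \<eta>_def laplace_def algebra_simps add_divide_distrib diff_divide_distrib)
  note bd = new_pairing_bounded(3)[OF gint_bounded]
  have new_\<psi>': "gsum (\<lambda>i j. new i j * \<psi>' i j) = gsum (\<lambda>i j. new i j * \<psi> i j) + gsum (\<lambda>i j. new i j * \<eta> i j)"
  proof -
    have "(\<lambda>i j. new i j * \<psi>' i j) = (\<lambda>i j. new i j * \<psi> i j + new i j * \<eta> i j)"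
      by (intro ext) (simp add: \<eta>_def algebra_simps)
    then show ?thesis by (simp add: gsum_add gint_mult new_gint \<psi> \<eta>)
  qed
  have \<rho>\<eta>: "gsum (\<lambda>i j. \<rho> i j * \<eta> i j) = gsum (\<lambda>i j. \<rho> i j * gen \<psi> i j)"
  proof -
    have "gsum (\<lambda>i j. \<rho> i j * \<eta> i j) = gsum (\<lambda>i j. \<psi> i j * (new i j - \<rho> i j))"
      using resolvent_symmetric[OF \<eta> \<psi>, of dx dy] by (simp add: eq eq\<eta> mult.commute)
    also have "\<dots> = gsum (\<lambda>i j. new i j * \<psi> i j - \<rho> i j * \<psi> i j)"
      by (intro arg_cong[where f = gsum] ext) (simp add: algebra_simps)
    also have "\<dots> = gsum (\<lambda>i j. \<rho> i j * gen \<psi> i j)"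
      using bd[OF \<psi>] by (simp add: gsum_diff gint_mult new_gint \<rho> \<psi>)
    finally show ?thesis .
  qed
  have "E' = E + m * (2 * gsum (\<lambda>i j. \<rho> i j * gen \<psi> i j)) + m * gsum (\<lambda>i j. \<rho> i j * gen \<eta> i j)"
    unfolding E'_def E_def new_\<psi>' bd[OF \<psi>] bd[OF \<eta>] \<rho>\<eta> m_def by (simp add: algebra_simps)
  also have "\<dots> \<le> E + m * (\<tau> * f * (4 * \<kappa> * gsum (\<lambda>i j. (\<rho> i j)\<^sup>2) + 2 / \<kappa> * dirichlet dx dy \<psi>)
      + \<delta> * \<tau> * (gsum (\<lambda>i j. (\<rho> i j)\<^sup>2 * \<psi> i j) - gsum (\<lambda>i j. (\<rho> i j) ^ 3)))
      + m * (3 / 4 * (\<delta> * \<tau> * gsum (\<lambda>i j. (\<rho> i j) ^ 3)) + 3 * \<tau> * f * max dx dy * gsum (\<lambda>i j. (\<rho> i j)\<^sup>2))"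
    using m by (intro add_mono mult_left_mono order_refl energy_first_variation[OF \<psi> eq \<kappa>]
        energy_second_variation[OF \<eta> eq\<eta>]) auto
  also have "\<dots> = E + \<tau> * (f * (4 * \<kappa> * Q + 2 / \<kappa> * (m * dirichlet dx dy \<psi>))
      + \<delta> * (Z - A) + 3 / 4 * (\<delta> * A) + 3 * f * max dx dy * Q)"
    unfolding Q_def Z_def A_def m_def by (simp add: algebra_simps)
  finally have step: "E' \<le> E + \<tau> * (f * (4 * \<kappa> * Q + 2 / \<kappa> * (m * dirichlet dx dy \<psi>))
      + \<delta> * (Z - A) + 3 / 4 * (\<delta> * A) + 3 * f * max dx dy * Q)" .
  note bounds = resolvent_energy_bounds[OF dx dy \<rho> \<rho>_nonneg mass \<psi> eq E_def Q_def refl,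
      folded m_def, folded A_def Z_def]
  have A0: "0 \<le> A" and Q0: "0 \<le> Q"
    using m by (auto simp: A_def Q_def m_def[symmetric] \<rho>_nonneg intro!: mult_nonneg_nonneg gsum_nonneg)
  \<comment> \<open>A * Q / 2, the available bound for Z^2, is exactly the difference of the squares
    of A / 8 + Q and A / 8 - Q.\<close>
  have Z: "Z \<le> A / 8 + Q"
  proof (rule power2_le_imp_le)
    have "0 \<le> (A / 8 - Q)\<^sup>2" by simp
    then show "Z\<^sup>2 \<le> (A / 8 + Q)\<^sup>2"
      using bounds(3) by (simp add: power2_eq_square algebra_simps)
  qed (use A0 Q0 in simp)
  \<comment> \<open>The Dirichlet sum is at most E, and E^2 is at most Q. A Young inequality with
    \<kappa> turns the term with 2 / \<kappa> into one more \<kappa> * Q and the constant 1 /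
    \<kappa>^3; this explains the 5 in \<open>B\<close>.\<close>
  have "f * (4 * \<kappa> * Q + 2 / \<kappa> * (m * dirichlet dx dy \<psi>)) \<le> f * (5 * \<kappa> * Q + 1 / \<kappa> ^ 3)" (is "?L \<le> _")
  proof (intro mult_left_mono f)
    have "0 \<le> (\<kappa> * E - 1 / \<kappa>)\<^sup>2" by simp
    then have "2 * E \<le> \<kappa>\<^sup>2 * E\<^sup>2 + 1 / \<kappa>\<^sup>2"
      using \<kappa> by (simp add: power2_diff power_mult_distrib power_divide)
    also have "\<dots> \<le> \<kappa>\<^sup>2 * Q + 1 / \<kappa>\<^sup>2"
      using bounds(2) Q0 by (intro add_right_mono mult_left_mono) auto
    finally have "2 * (m * dirichlet dx dy \<psi>) \<le> \<kappa>\<^sup>2 * Q + 1 / \<kappa>\<^sup>2" using bounds(4) by linarith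
    then have "2 * (m * dirichlet dx dy \<psi>) / \<kappa> \<le> (\<kappa>\<^sup>2 * Q + 1 / \<kappa>\<^sup>2) / \<kappa>"
      using \<kappa> by (intro divide_right_mono) auto
    also have "\<dots> = \<kappa> * Q + 1 / \<kappa> ^ 3"
      using \<kappa> by (simp add: add_divide_distrib power2_eq_square power3_eq_cube)
    finally show "4 * \<kappa> * Q + 2 / \<kappa> * (m * dirichlet dx dy \<psi>) \<le> 5 * \<kappa> * Q + 1 / \<kappa> ^ 3"
      by (simp add: algebra_simps)
  qed
  moreover have "\<delta> * (Z - A) + 3 / 4 * (\<delta> * A) \<le> \<delta> * Q - \<delta> * Q\<^sup>2 / 8"
  proof -
    have "\<delta> * Z \<le> \<delta> * (A / 8 + Q)" "\<delta> * Q\<^sup>2 \<le> \<delta> * A"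
      using \<delta> by (intro mult_left_mono Z bounds(5); simp)+
    then show ?thesis unfolding distrib_left right_diff_distrib by linarith
  qed
  moreover have "B * Q \<le> \<delta> * Q\<^sup>2 / 16 + 4 * B\<^sup>2 / \<delta>"
  proof -
    have "0 \<le> (\<delta> * Q - 8 * B)\<^sup>2 / (16 * \<delta>)" using \<delta> by simp
    also have "(\<delta> * Q - 8 * B)\<^sup>2 / (16 * \<delta>) = \<delta> * Q\<^sup>2 / 16 + 4 * B\<^sup>2 / \<delta> - B * Q"
      using \<delta> by (simp add: field_simps power2_eq_square)
    finally show ?thesis by simp
  qed
  moreover have "B * Q = \<delta> * Q + f * (5 * \<kappa> * Q) + 3 * f * max dx dy * Q"
    by (simp add: B_def algebra_simps)
  moreover have "f * (5 * \<kappa> * Q + 1 / \<kappa> ^ 3) = f * (5 * \<kappa> * Q) + f / \<kappa> ^ 3"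
    by (simp add: distrib_left)
  ultimately have "f * (4 * \<kappa> * Q + 2 / \<kappa> * (m * dirichlet dx dy \<psi>))
      + \<delta> * (Z - A) + 3 / 4 * (\<delta> * A) + 3 * f * max dx dy * Q
    \<le> 4 * B\<^sup>2 / \<delta> + f / \<kappa> ^ 3 - \<delta> * Q\<^sup>2 / 16"
    by linarith
  then show ?thesis using step mult_left_mono[of _ _ \<tau>] \<tau> by (smt (verit))
qed

text \<open>Convexity of the reciprocal bounds the growth of 1 / (E + Y) from below by (E - E') / (E
  + Y)^2, also in a step where the energy increases. Since (E + Y)^2 \<le> 2 (Q + Y^2), dividing the
  rate \<delta> Q^2 / 16 by it leaves at least \<delta> (Q - Y^2) / 32. Quadratic decay is thus
  traded for the linear quantity \<delta> Q that occurs in the consistency error.\<close>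

lemma dissipation_step:
  assumes \<psi>: "gint \<psi>" and eq: "\<And>i j. \<psi> i j - laplace dx dy \<psi> i j = \<rho> i j"
    and \<psi>': "gint \<psi>'" and eq': "\<And>i j. \<psi>' i j - laplace dx dy \<psi>' i j = new i j"
    and \<kappa>: "0 < \<kappa>"
    and E_def: "E = dx * dy * gsum (\<lambda>i j. \<rho> i j * \<psi> i j)"
    and E'_def: "E' = dx * dy * gsum (\<lambda>i j. new i j * \<psi>' i j)"
    and Q_def: "Q = dx * dy * gsum (\<lambda>i j. (\<rho> i j)\<^sup>2)"
    and B_def: "B = \<delta> + 5 * f * \<kappa> + 3 * f * max dx dy"
  shows "\<delta> * \<tau> * Q \<le> \<tau> * (\<delta> / \<kappa> ^ 4)
    + 32 * (1 / (E' + 1 / \<kappa>\<^sup>2) - 1 / (E + 1 / \<kappa>\<^sup>2) + \<tau> * (4 * B\<^sup>2 * \<kappa> ^ 4 / \<delta> + f * \<kappa>))"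
proof -
  define Y where "Y = 1 / \<kappa>\<^sup>2"
  define D where "D = 4 * B\<^sup>2 / \<delta> + f / \<kappa> ^ 3"
  have Y: "0 < Y" using \<kappa> by (simp add: Y_def)
  have D: "0 \<le> D" using \<delta> f \<kappa> by (simp add: D_def)
  note bounds = resolvent_energy_bounds[OF dx dy \<rho> \<rho>_nonneg mass \<psi> eq E_def Q_def refl]
  note bounds' = resolvent_energy_bounds[OF dx dy new_gint new_nonneg new_mass \<psi>' eq' E'_def refl refl]
  have E: "0 \<le> E" and E': "0 \<le> E'" using bounds(1) bounds'(1) .
  have Q: "0 \<le> Q" using bounds(2) zero_le_power2[of E] by linarith
  have decay: "E' - E \<le> \<tau> * (D - \<delta> * Q\<^sup>2 / 16)"
    using energy_decay[OF \<psi> eq \<psi>' eq' \<kappa> E_def E'_def Q_def B_def] by (simp add: D_def)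
  have "(E - E') / (E + Y)\<^sup>2 \<le> 1 / (E' + Y) - 1 / (E + Y)"
  proof -
    have pos: "0 < E + Y" "0 < E' + Y" using E E' Y by auto
    have "1 / (E' + Y) - 1 / (E + Y) - (E - E') / (E + Y)\<^sup>2 = (E - E')\<^sup>2 / ((E' + Y) * (E + Y)\<^sup>2)"
      using pos by (simp add: divide_simps power2_eq_square) (simp add: algebra_simps)
    also have "\<dots> \<ge> 0" using pos by simp
    finally show ?thesis by simp
  qed
  moreover have "\<tau> * (\<delta> * (Q - Y\<^sup>2) / 32 - D / Y\<^sup>2) \<le> (E - E') / (E + Y)\<^sup>2"
  proof -
    have EY: "0 < (E + Y)\<^sup>2" using E Y by simp
    have EY2: "(E + Y)\<^sup>2 \<le> 2 * (Q + Y\<^sup>2)"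
      using sum_squares_bound[of E Y] bounds(2) Q by (simp add: power2_sum)
    \<comment> \<open>For Q \<le> Y^2 the left side is not positive; otherwise use (Q - Y^2) (Q +
      Y^2) \<le> Q^2.\<close>
    have "\<delta> * (Q - Y\<^sup>2) / 32 \<le> \<delta> * Q\<^sup>2 / 16 / (E + Y)\<^sup>2"
    proof (cases "Q \<le> Y\<^sup>2")
      case True
      then have "\<delta> * (Q - Y\<^sup>2) / 32 \<le> 0" using \<delta> by (simp add: mult_le_0_iff)
      also have "0 \<le> \<delta> * Q\<^sup>2 / 16 / (E + Y)\<^sup>2" using \<delta> by simp
      finally show ?thesis .
    next
      case False
      have "(Q - Y\<^sup>2) * (E + Y)\<^sup>2 \<le> (Q - Y\<^sup>2) * (2 * (Q + Y\<^sup>2))"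
        using False EY2 by (intro mult_left_mono) auto
      also have "\<dots> \<le> 2 * Q\<^sup>2" using Y by (simp add: algebra_simps power2_eq_square)
      finally have "\<delta> * (Q - Y\<^sup>2) / 32 * (E + Y)\<^sup>2 \<le> \<delta> * Q\<^sup>2 / 16"
        using mult_left_mono[of _ "2 * Q\<^sup>2" "\<delta> / 32"] \<delta> by simp
      then show ?thesis using EY by (simp add: pos_le_divide_eq)
    qed
    moreover have "D / (E + Y)\<^sup>2 \<le> D / Y\<^sup>2"
      using D E Y by (intro divide_left_mono power_mono) auto
    ultimately have "\<delta> * (Q - Y\<^sup>2) / 32 - D / Y\<^sup>2 \<le> (\<delta> * Q\<^sup>2 / 16 - D) / (E + Y)\<^sup>2"
      by (simp add: diff_divide_distrib)
    then have "\<tau> * (\<delta> * (Q - Y\<^sup>2) / 32 - D / Y\<^sup>2) \<le> \<tau> * ((\<delta> * Q\<^sup>2 / 16 - D) / (E + Y)\<^sup>2)"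
      using \<tau> by (intro mult_left_mono) auto
    also have "\<dots> = (\<tau> * (\<delta> * Q\<^sup>2 / 16 - D)) / (E + Y)\<^sup>2" by simp
    also have "\<dots> \<le> (E - E') / (E + Y)\<^sup>2"
      using decay EY by (intro divide_right_mono) (auto simp: algebra_simps)
    finally show ?thesis .
  qed
  ultimately have "\<tau> * (\<delta> * (Q - Y\<^sup>2) / 32 - D / Y\<^sup>2) \<le> 1 / (E' + Y) - 1 / (E + Y)" by linarith
  moreover have "D / Y\<^sup>2 = 4 * B\<^sup>2 * \<kappa> ^ 4 / \<delta> + f * \<kappa>"
    using \<kappa> by (simp add: D_def Y_def power_divide add_divide_distrib power2_eq_square power3_eq_cube
        power4_eq_xxxx distrib_right)
  moreover have "Y\<^sup>2 = 1 / \<kappa> ^ 4" by (simp add: Y_def power_divide flip: power_mult)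
  ultimately have "\<tau> * (\<delta> * (Q - 1 / \<kappa> ^ 4) / 32 - (4 * B\<^sup>2 * \<kappa> ^ 4 / \<delta> + f * \<kappa>))
      \<le> 1 / (E' + 1 / \<kappa>\<^sup>2) - 1 / (E + 1 / \<kappa>\<^sup>2)" by (simp add: Y_def)
  then have "32 * (\<tau> * (\<delta> * (Q - 1 / \<kappa> ^ 4) / 32 - (4 * B\<^sup>2 * \<kappa> ^ 4 / \<delta> + f * \<kappa>)))
      \<le> 32 * (1 / (E' + 1 / \<kappa>\<^sup>2) - 1 / (E + 1 / \<kappa>\<^sup>2))" by simp
  moreover have "32 * (\<tau> * (\<delta> * (Q - 1 / \<kappa> ^ 4) / 32 - (4 * B\<^sup>2 * \<kappa> ^ 4 / \<delta> + f * \<kappa>)))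
      = \<delta> * \<tau> * Q - \<tau> * (\<delta> / \<kappa> ^ 4) - 32 * (\<tau> * (4 * B\<^sup>2 * \<kappa> ^ 4 / \<delta> + f * \<kappa>))"
    by (simp add: algebra_simps diff_divide_distrib)
  ultimately show ?thesis by (simp only: distrib_left)
qed

text \<open>\<Psi> is the squared position of the lower left corner of a cell. Drift changes it by a
  cross term, estimated with 2 |x| \<le> 1 + x^2, and by terms of the order of the mesh. Diffusion
  contributes exactly 2 \<delta> \<tau> \<rho> per cell, and its pairing with \<rho> is the
  dissipated quantity; the moment bound therefore rests on the energy estimate.\<close>

lemma moment_step:
  defines "\<Psi> \<equiv> \<lambda>i j. (real_of_int i * dx)\<^sup>2 + (real_of_int j * dy)\<^sup>2"
  assumes g: "gint (\<lambda>i j. \<rho> i j * \<Psi> i j)"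
  shows "gint (\<lambda>i j. new i j * \<Psi> i j)"
    "dx * dy * gsum (\<lambda>i j. new i j * \<Psi> i j)
      \<le> dx * dy * gsum (\<lambda>i j. \<rho> i j * \<Psi> i j)
        + \<tau> * f * (dx * dy * gsum (\<lambda>i j. \<rho> i j * \<Psi> i j) + 2 + 4 * max dx dy)
        + 2 * \<delta> * \<tau> * (dx * dy * gsum (\<lambda>i j. (\<rho> i j)\<^sup>2))"
proof -
  let ?C = "\<lambda>i j. 2 * (\<rho> i j * \<Psi> i j) + 2 * (dx\<^sup>2 + dy\<^sup>2) * \<rho> i j"
  have gC: "gint ?C" by (intro gint_add gint_cmult g \<rho>)
  have sq: "(x + y)\<^sup>2 \<le> 2 * x\<^sup>2 + 2 * y\<^sup>2" for x y :: real
    using sum_squares_bound[of x y] by (simp add: power2_sum)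
  \<comment> \<open>A shift by one cell at most doubles \<Psi> up to an additive constant. This
    supplies the summability conditions of \<open>new_pairing\<close>.\<close>
  have shift: "gint (\<lambda>i j. \<rho> i j * \<Psi> (i + a) (j + b))" if "\<bar>a\<bar> \<le> 1" "\<bar>b\<bar> \<le> 1" for a b
  proof (rule gint_bound[OF gC])
    fix i j
    have ab: "(real_of_int a)\<^sup>2 \<le> 1" "(real_of_int b)\<^sup>2 \<le> 1"
      using that by (auto simp: abs_square_le_1 simp flip: of_int_abs)
    have "(real_of_int (i + a) * dx)\<^sup>2 \<le> 2 * (real_of_int i * dx)\<^sup>2 + 2 * (real_of_int a * dx)\<^sup>2"
      "(real_of_int (j + b) * dy)\<^sup>2 \<le> 2 * (real_of_int j * dy)\<^sup>2 + 2 * (real_of_int b * dy)\<^sup>2"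
      using sq[of "real_of_int i * dx" "real_of_int a * dx"] sq[of "real_of_int j * dy" "real_of_int b * dy"]
      by (simp_all add: algebra_simps)
    moreover have "(real_of_int a * dx)\<^sup>2 \<le> dx\<^sup>2" "(real_of_int b * dy)\<^sup>2 \<le> dy\<^sup>2"
      using ab by (auto simp: power_mult_distrib mult_left_le_one_le)
    ultimately have "\<Psi> (i + a) (j + b) \<le> 2 * \<Psi> i j + 2 * (dx\<^sup>2 + dy\<^sup>2)"
      by (simp add: \<Psi>_def)
    then have "\<rho> i j * \<Psi> (i + a) (j + b) \<le> \<rho> i j * (2 * \<Psi> i j + 2 * (dx\<^sup>2 + dy\<^sup>2))"
      by (rule mult_left_mono) (rule \<rho>_nonneg)
    moreover have "0 \<le> \<rho> i j * \<Psi> (i + a) (j + b)" by (simp add: \<Psi>_def \<rho>_nonneg)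
    ultimately show "\<bar>\<rho> i j * \<Psi> (i + a) (j + b)\<bar> \<le> ?C i j" by (simp add: algebra_simps)
  qed
  note sh = shift[of 1 0, simplified] shift[of "-1" 0, simplified] shift[of 0 1, simplified]
    shift[of 0 "-1", simplified]
  note pair = new_pairing[OF g sh]
  show "gint (\<lambda>i j. new i j * \<Psi> i j)" by (rule pair(1))
  have one: "x2 * (a * d * (u' + u'')) + d\<^sup>2 * (a * (2 * f + u' - u'') + 2 * b)
      \<le> \<tau> * f * (1 + y\<^sup>2) + 2 * \<tau> * f * d + \<delta> * \<tau> * r"
    if x2: "x2 / 2 = y" and a: "a = \<tau> / (2 * d)" and b: "b = \<delta> * \<tau> / (2 * d\<^sup>2) * r" and d: "0 < d"
      and u': "\<bar>u'\<bar> \<le> f" and u'': "\<bar>u''\<bar> \<le> f" for x2 y a b d u' u'' r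
  proof -
    have "x2 * (a * d * (u' + u'')) \<le> \<bar>x2\<bar> * (a * d * (2 * f))"
    proof -
      have "\<bar>u' + u''\<bar> \<le> 2 * f" using u' u'' by linarith
      then have "\<bar>x2 * (a * d * (u' + u''))\<bar> \<le> \<bar>x2\<bar> * (a * d * (2 * f))"
        using a d \<tau> unfolding abs_mult by (intro mult_mono) auto
      then show ?thesis by linarith
    qed
    also have "\<dots> = \<tau> * f * \<bar>x2\<bar>" using a d by simp
    also have "\<dots> \<le> \<tau> * f * (1 + (x2 / 2)\<^sup>2)"
    proof -
      have "0 \<le> (1 - \<bar>x2\<bar> / 2)\<^sup>2" by simp
      then have "\<bar>x2\<bar> \<le> 1 + (x2 / 2)\<^sup>2" by (simp add: power2_diff power_divide)
      then show ?thesis using \<tau> f by (intro mult_left_mono) auto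
    qed
    finally have 1: "x2 * (a * d * (u' + u'')) \<le> \<tau> * f * (1 + (x2 / 2)\<^sup>2)" .
    have "d\<^sup>2 * (a * (2 * f + u' - u'')) \<le> d\<^sup>2 * (a * (4 * f))"
      using u' u'' a d \<tau> by (intro mult_left_mono) auto
    also have "\<dots> = 2 * \<tau> * f * d" using a d by (simp add: power2_eq_square)
    finally have 2: "d\<^sup>2 * (a * (2 * f + u' - u'')) \<le> 2 * \<tau> * f * d" .
    have 3: "d\<^sup>2 * (2 * b) = \<delta> * \<tau> * r" using b d by simp
    show ?thesis using 1 2 3 by (simp add: distrib_left x2)
  qed
  have gen: "gen \<Psi> i j \<le> \<tau> * f * (\<Psi> i j + 2 + 4 * max dx dy) + 2 * \<delta> * \<tau> * \<rho> i j" for i j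
  proof -
    have "gen \<Psi> i j
      = ((2 * (real_of_int i * dx)) * (a_x * dx * (u i j + u (i - 1) j))
          + dx\<^sup>2 * (a_x * (2 * f + u i j - u (i - 1) j) + 2 * (b_x * \<rho> i j)))
      + ((2 * (real_of_int j * dy)) * (a_y * dy * (v i j + v i (j - 1)))
          + dy\<^sup>2 * (a_y * (2 * f + v i j - v i (j - 1)) + 2 * (b_y * \<rho> i j)))"
      by (simp add: gen_def pE_def pW_def pN_def pS_def \<Psi>_def power2_eq_square algebra_simps)
    also have "\<dots> \<le> (\<tau> * f * (1 + (real_of_int i * dx)\<^sup>2) + 2 * \<tau> * f * dx + \<delta> * \<tau> * \<rho> i j)
        + (\<tau> * f * (1 + (real_of_int j * dy)\<^sup>2) + 2 * \<tau> * f * dy + \<delta> * \<tau> * \<rho> i j)"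
      by (intro add_mono one) (simp_all add: a_x_def b_x_def a_y_def b_y_def dx dy u v)
    also have "\<dots> = \<tau> * f * (\<Psi> i j + 2 + 2 * (dx + dy)) + 2 * \<delta> * \<tau> * \<rho> i j"
      by (simp add: \<Psi>_def algebra_simps)
    also have "\<dots> \<le> \<tau> * f * (\<Psi> i j + 2 + 4 * max dx dy) + 2 * \<delta> * \<tau> * \<rho> i j"
      using \<tau> f by (intro add_right_mono mult_left_mono) auto
    finally show ?thesis .
  qed
  have g2: "gint (\<lambda>i j. (\<rho> i j)\<^sup>2)" by (rule gint_power2[OF \<rho>])
  let ?h = "2 + 4 * max dx dy"
  have "gsum (\<lambda>i j. \<rho> i j * gen \<Psi> i j)
      \<le> gsum (\<lambda>i j. \<tau> * f * (\<rho> i j * \<Psi> i j + ?h * \<rho> i j) + 2 * \<delta> * \<tau> * (\<rho> i j)\<^sup>2)"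
  proof (rule gsum_mono[OF pair(2)])
    show "gint (\<lambda>i j. \<tau> * f * (\<rho> i j * \<Psi> i j + ?h * \<rho> i j) + 2 * \<delta> * \<tau> * (\<rho> i j)\<^sup>2)"
      by (intro gint_add gint_cmult g \<rho> g2)
    show "\<rho> i j * gen \<Psi> i j \<le> \<tau> * f * (\<rho> i j * \<Psi> i j + ?h * \<rho> i j) + 2 * \<delta> * \<tau> * (\<rho> i j)\<^sup>2" for i j
      using mult_left_mono[OF gen \<rho>_nonneg[of i j]] by (simp add: algebra_simps power2_eq_square)
  qed
  also have "\<dots> = \<tau> * f * (gsum (\<lambda>i j. \<rho> i j * \<Psi> i j) + ?h * gsum \<rho>) + 2 * \<delta> * \<tau> * gsum (\<lambda>i j. (\<rho> i j)\<^sup>2)"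
    by (simp only: gsum_add gsum_cmult gint_add gint_cmult g \<rho> g2)
  finally have le: "gsum (\<lambda>i j. \<rho> i j * gen \<Psi> i j)
    \<le> \<tau> * f * (gsum (\<lambda>i j. \<rho> i j * \<Psi> i j) + ?h * gsum \<rho>) + 2 * \<delta> * \<tau> * gsum (\<lambda>i j. (\<rho> i j)\<^sup>2)" .
  have "dx * dy * gsum (\<lambda>i j. new i j * \<Psi> i j)
    \<le> dx * dy * (gsum (\<lambda>i j. \<rho> i j * \<Psi> i j) + (\<tau> * f * (gsum (\<lambda>i j. \<rho> i j * \<Psi> i j) + ?h * gsum \<rho>)
      + 2 * \<delta> * \<tau> * gsum (\<lambda>i j. (\<rho> i j)\<^sup>2)))"
    unfolding pair(3) using le dx dy by (intro mult_left_mono) auto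
  also have "\<dots> = dx * dy * gsum (\<lambda>i j. \<rho> i j * \<Psi> i j)
        + \<tau> * f * (dx * dy * gsum (\<lambda>i j. \<rho> i j * \<Psi> i j) + ?h * (dx * dy * gsum \<rho>))
        + 2 * \<delta> * \<tau> * (dx * dy * gsum (\<lambda>i j. (\<rho> i j)\<^sup>2))"
    by (simp only: distrib_left ac_simps)
  finally show "dx * dy * gsum (\<lambda>i j. new i j * \<Psi> i j)
      \<le> dx * dy * gsum (\<lambda>i j. \<rho> i j * \<Psi> i j)
        + \<tau> * f * (dx * dy * gsum (\<lambda>i j. \<rho> i j * \<Psi> i j) + 2 + 4 * max dx dy)
        + 2 * \<delta> * \<tau> * (dx * dy * gsum (\<lambda>i j. (\<rho> i j)\<^sup>2))"
    by (simp only: mass mult_1_right add.assoc)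
qed

end

section \<open>Summation over the time levels\<close>

definition grid_l2 :: "real \<Rightarrow> real \<Rightarrow> (int \<Rightarrow> int \<Rightarrow> real) \<Rightarrow> real" where
  "grid_l2 dx dy \<rho> = dx * dy * gsum (\<lambda>i j. (\<rho> i j)\<^sup>2)"

definition grid_moment :: "real \<Rightarrow> real \<Rightarrow> (int \<Rightarrow> int \<Rightarrow> real) \<Rightarrow> real" where
  "grid_moment dx dy \<rho> = dx * dy * gsum (\<lambda>i j. \<rho> i j * ((real_of_int i * dx)\<^sup>2 + (real_of_int j * dy)\<^sup>2))"

text \<open>The reciprocals \<open>w n\<close> telescope and lie between 0 and \<kappa>^2. The
  initial energy enters only through 0 \<le> w 0, so the estimate is uniform over all initial
  densities of mass one, however concentrated.\<close>

lemma dissipation_sum: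
  assumes step: "\<And>n. n < N \<Longrightarrow> upwind_step dx dy f \<delta> (dt n) (\<rho> n) (u n) (v n)"
    and next_eq: "\<And>n. n < N \<Longrightarrow> \<rho> (Suc n) = upwind_step.new dx dy f \<delta> (dt n) (\<rho> n) (u n) (v n)"
    and \<kappa>: "0 < \<kappa>" and B_def: "B = \<delta> + 5 * f * \<kappa> + 3 * f * max dx dy"
  shows "(\<Sum>n<N. \<delta> * dt n * grid_l2 dx dy (\<rho> n))
    \<le> (\<Sum>n<N. dt n) * (\<delta> / \<kappa> ^ 4 + 32 * (4 * B\<^sup>2 * \<kappa> ^ 4 / \<delta> + f * \<kappa>)) + 32 * \<kappa>\<^sup>2"
proof (cases N)
  case (Suc N')
  \<comment> \<open>Steps are indexed by n < N, but the telescoping sum also needs a resolvent at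
    level N; the density there inherits its properties from the preceding step.\<close>
  have props: "0 < dx \<and> 0 < dy \<and> gint (\<rho> n) \<and> (\<forall>i j. 0 \<le> \<rho> n i j) \<and> dx * dy * gsum (\<rho> n) = 1" if "n \<le> N" for n
  proof (cases "n < N")
    case True
    then interpret upwind_step dx dy f \<delta> "dt n" "\<rho> n" "u n" "v n" by (rule step)
    show ?thesis using dx dy \<rho> \<rho>_nonneg mass by blast
  next
    case False
    then have n: "n = Suc N'" using that Suc by simp
    interpret upwind_step dx dy f \<delta> "dt N'" "\<rho> N'" "u N'" "v N'" by (rule step) (simp add: Suc)
    show ?thesis using dx dy new_gint new_nonneg new_mass next_eq[of N'] Suc n by simp
  qed
  then have "\<forall>n\<in>{..N}. \<exists>\<psi>. gint \<psi> \<and> (\<forall>i j. \<psi> i j - laplace dx dy \<psi> i j = \<rho> n i j)"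
    by (intro ballI resolvent_exists) auto
  then obtain \<psi> where "\<forall>n\<in>{..N}. gint (\<psi> n) \<and> (\<forall>i j. \<psi> n i j - laplace dx dy (\<psi> n) i j = \<rho> n i j)"
    by (rule bchoice[THEN exE])
  then have \<psi>: "gint (\<psi> n)" and eq: "\<psi> n i j - laplace dx dy (\<psi> n) i j = \<rho> n i j" if "n \<le> N" for n i j
    using that by auto
  define E where "E n = dx * dy * gsum (\<lambda>i j. \<rho> n i j * \<psi> n i j)" for n
  define w where "w n = 1 / (E n + 1 / \<kappa>\<^sup>2)" for n
  define K where "K = 4 * B\<^sup>2 * \<kappa> ^ 4 / \<delta> + f * \<kappa>"
  have E: "0 \<le> E n" if "n \<le> N" for n
    by (rule resolvent_energy_bounds(1)[OF _ _ _ _ _ \<psi>[OF that] eq[OF that] E_def refl refl])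
      (use props[OF that] in auto)
  have "\<delta> * dt n * grid_l2 dx dy (\<rho> n) \<le> dt n * (\<delta> / \<kappa> ^ 4) + 32 * (w (Suc n) - w n + dt n * K)"
    if n: "n < N" for n
  proof -
    interpret upwind_step dx dy f \<delta> "dt n" "\<rho> n" "u n" "v n" by (rule step[OF n])
    show ?thesis
      unfolding w_def K_def
      by (rule dissipation_step[OF \<psi> eq \<psi> eq[of "Suc n", unfolded next_eq[OF n]] \<kappa> E_def _ grid_l2_def B_def])
        (use n in \<open>auto simp: E_def next_eq\<close>)
  qed
  then have "(\<Sum>n<N. \<delta> * dt n * grid_l2 dx dy (\<rho> n))
      \<le> (\<Sum>n<N. dt n * (\<delta> / \<kappa> ^ 4) + 32 * (w (Suc n) - w n + dt n * K))"
    by (intro sum_mono) auto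
  also have "\<dots> = (\<Sum>n<N. dt n) * (\<delta> / \<kappa> ^ 4 + 32 * K) + 32 * (w N - w 0)"
    unfolding sum.distrib sum_distrib_left[symmetric] sum_distrib_right[symmetric] sum_lessThan_telescope
    by (simp add: algebra_simps)
  also have "w N - w 0 \<le> \<kappa>\<^sup>2"
  proof -
    have "0 \<le> w 0" using E[of 0] by (simp add: w_def)
    moreover have "w N \<le> 1 / (1 / \<kappa>\<^sup>2)"
      unfolding w_def using E[of N] \<kappa>
      by (intro divide_left_mono) (auto intro!: mult_pos_pos divide_pos_pos add_nonneg_pos)
    ultimately show ?thesis using \<kappa> by simp
  qed
  finally show ?thesis by (simp add: K_def)
qed simp

text \<open>Discrete Gronwall argument with 1 + f \<tau> \<le> exp (f \<tau>). Each source term is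
  pulled under the exponential factor, which is at least 1.\<close>

lemma moment_sum:
  assumes step: "\<And>n. n < N \<Longrightarrow> upwind_step dx dy f \<delta> (dt n) (\<rho> n) (u n) (v n)"
    and next_eq: "\<And>n. n < N \<Longrightarrow> \<rho> (Suc n) = upwind_step.new dx dy f \<delta> (dt n) (\<rho> n) (u n) (v n)"
    and g0: "gint (\<lambda>i j. \<rho> 0 i j * ((real_of_int i * dx)\<^sup>2 + (real_of_int j * dy)\<^sup>2))"
    and V0: "0 \<le> grid_moment dx dy (\<rho> 0)"
  shows "n \<le> N \<Longrightarrow> gint (\<lambda>i j. \<rho> n i j * ((real_of_int i * dx)\<^sup>2 + (real_of_int j * dy)\<^sup>2)) \<and>
    grid_moment dx dy (\<rho> n) \<le> exp (f * (\<Sum>i<n. dt i)) * (grid_moment dx dy (\<rho> 0)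
      + f * (\<Sum>i<n. dt i) * (2 + 4 * max dx dy) + 2 * (\<Sum>i<n. \<delta> * dt i * grid_l2 dx dy (\<rho> i)))"
proof (induction n)
  case 0
  then show ?case using g0 by simp
next
  case (Suc n)
  then have n: "n < N" by simp
  interpret upwind_step dx dy f \<delta> "dt n" "\<rho> n" "u n" "v n" by (rule step[OF n])
  define t where "t = (\<Sum>i<n. dt i)"
  define h where "h = 2 + 4 * max dx dy"
  define W where "W = grid_moment dx dy (\<rho> 0) + f * t * h
      + 2 * (\<Sum>i<n. \<delta> * dt i * grid_l2 dx dy (\<rho> i))"
  let ?Q = "grid_l2 dx dy (\<rho> n)"
  have IH: "gint (\<lambda>i j. \<rho> n i j * ((real_of_int i * dx)\<^sup>2 + (real_of_int j * dy)\<^sup>2))"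
    "grid_moment dx dy (\<rho> n) \<le> exp (f * t) * W"
    using Suc by (simp_all add: t_def h_def W_def)
  have t: "0 \<le> t" unfolding t_def
    using n upwind_step.\<tau>[OF step] by (intro sum_nonneg less_imp_le) auto
  have h: "0 \<le> h" using dx by (simp add: h_def)
  have Q: "0 \<le> ?Q" using dx dy by (auto simp: grid_l2_def intro!: mult_nonneg_nonneg gsum_nonneg)
  have "grid_moment dx dy (\<rho> (Suc n)) \<le> grid_moment dx dy (\<rho> n)
      + dt n * f * (grid_moment dx dy (\<rho> n) + h) + 2 * \<delta> * dt n * ?Q"
    using moment_step(2)[OF IH(1)] by (simp add: next_eq[OF n] grid_moment_def grid_l2_def h_def add.assoc)
  also have "\<dots> = (1 + f * dt n) * grid_moment dx dy (\<rho> n) + (f * dt n * h + 2 * \<delta> * dt n * ?Q)"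
    by (simp add: algebra_simps)
  also have "\<dots> \<le> exp (f * dt n) * (exp (f * t) * W) + exp (f * (t + dt n)) * (f * dt n * h + 2 * \<delta> * dt n * ?Q)"
  proof (intro add_mono)
    show "(1 + f * dt n) * grid_moment dx dy (\<rho> n) \<le> exp (f * dt n) * (exp (f * t) * W)"
      using f \<tau> IH(2) dx dy \<rho>_nonneg
      by (intro mult_mono exp_ge_add_one_self)
        (auto simp: grid_moment_def intro!: mult_nonneg_nonneg gsum_nonneg)
    have "1 \<le> exp (f * (t + dt n))" using f t \<tau> by simp
    then show "f * dt n * h + 2 * \<delta> * dt n * ?Q \<le> exp (f * (t + dt n)) * (f * dt n * h + 2 * \<delta> * dt n * ?Q)"
      using mult_right_mono[of 1 "exp (f * (t + dt n))" "f * dt n * h + 2 * \<delta> * dt n * ?Q"] f \<tau> h \<delta> Q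
      by simp
  qed
  also have "\<dots> = exp (f * (t + dt n)) * (W + (f * dt n * h + 2 * \<delta> * dt n * ?Q))"
    by (simp add: exp_add algebra_simps)
  finally have "grid_moment dx dy (\<rho> (Suc n)) \<le> exp (f * (\<Sum>i<Suc n. dt i)) * (grid_moment dx dy (\<rho> 0)
      + f * (\<Sum>i<Suc n. dt i) * h + 2 * (\<Sum>i<Suc n. \<delta> * dt i * grid_l2 dx dy (\<rho> i)))"
    by (simp add: W_def t_def algebra_simps)
  then show ?case
    using moment_step(1)[OF IH(1)] by (simp add: next_eq[OF n] h_def)
qed

section \<open>Compactness of measures with bounded second moments\<close>

text \<open>
  The plane is encoded injectively in the line by the ternary digits \<open>enc_bit\<close>, which record the comparisons of both
  coordinates with the rationals. This reduces Skorokhod's representation on the plane to the one on the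
  real line available in the library.
\<close>

definition qenum :: "nat \<Rightarrow> real" where "qenum = from_nat_into \<rat>"

lemma range_qenum: "range qenum = \<rat>"
  unfolding qenum_def by (rule range_from_nat_into) (auto intro: countable_rat)

text \<open>Even digits serve the first coordinate and odd digits the second; both run through the
  same enumeration of the rationals.\<close>

definition enc_bit :: "nat \<Rightarrow> real^2 \<Rightarrow> nat" where
  "enc_bit m z = of_bool (qenum (m div 2) < (if even m then z $ 1 else z $ 2))"

text \<open>Digits 0 and 1 in base 3 leave gaps: the tail after a digit is worth at most half a unit
  of that digit. Hence digits can be read off from the sum, and sums that are close agree in their
  leading digits.\<close>

definition enc :: "real^2 \<Rightarrow> real" where
  "enc z = (\<Sum>m. enc_bit m z * (1 / 3) ^ m)"

fun enc_prefix :: "nat \<Rightarrow> real^2 \<Rightarrow> int" where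
  "enc_prefix 0 z = int (enc_bit 0 z)"
| "enc_prefix (Suc m) z = 3 * enc_prefix m z + int (enc_bit (Suc m) z)"

lemma enc_bit_le: "enc_bit m z \<le> 1"
  by (simp add: enc_bit_def)

lemma enc_prefix_mod: "enc_prefix m z mod 3 = int (enc_bit m z)"
proof -
  have bit: "enc_bit m z = 0 \<or> enc_bit m z = 1" by (simp add: enc_bit_def)
  show ?thesis
  proof (cases m)
    case (Suc n)
    then have "enc_prefix m z mod 3 = (3 * enc_prefix n z + int (enc_bit m z)) mod 3" by simp
    also have "\<dots> = int (enc_bit m z) mod 3" by (rule mod_mult_self4)
    finally show ?thesis using bit by auto
  qed (use bit in auto)
qed

lemma enc_summable: "summable (\<lambda>m. enc_bit (m + k) z * (1 / 3 :: real) ^ m)"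
  by (rule summable_comparison_test'[OF summable_geometric[of "1 / 3 :: real"]])
    (use enc_bit_le in \<open>auto simp: mult_le_cancel_right1\<close>)

lemma enc_split:
  obtains t where "3 ^ m * enc z = real_of_int (enc_prefix m z) + t" "0 \<le> t" "t \<le> 1 / 2"
proof -
  define t where "t = (\<Sum>k. enc_bit (k + Suc m) z * (1 / 3) ^ k) / (3 :: real)"
  have "(\<Sum>k. enc_bit (k + Suc m) z * (1 / 3 :: real) ^ k) \<le> (\<Sum>k. (1 / 3 :: real) ^ k)"
    by (rule suminf_le[OF _ enc_summable]) (use enc_bit_le in \<open>auto simp: mult_le_cancel_right1\<close>)
  then have "t \<le> 1 / 2" by (simp add: t_def suminf_geometric)
  moreover have "0 \<le> t" unfolding t_def
    by (intro divide_nonneg_pos suminf_nonneg[OF enc_summable]) auto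
  moreover have "3 ^ m * enc z = real_of_int (enc_prefix m z) + t"
  proof -
    have "enc z = (\<Sum>k. enc_bit (k + Suc m) z * (1 / 3) ^ (k + Suc m))
        + (\<Sum>k<Suc m. enc_bit k z * (1 / 3) ^ k)"
      unfolding enc_def using enc_summable[of 0 z] by (intro suminf_split_initial_segment) simp
    also have "(\<Sum>k. enc_bit (k + Suc m) z * (1 / 3 :: real) ^ (k + Suc m))
        = (\<Sum>k. (1 / 3) ^ Suc m * (enc_bit (k + Suc m) z * (1 / 3) ^ k))"
      by (simp add: power_add mult_ac)
    also have "\<dots> = (1 / 3) ^ Suc m * (\<Sum>k. enc_bit (k + Suc m) z * (1 / 3) ^ k)"
      by (rule suminf_mult[OF enc_summable])
    finally have "3 ^ m * enc z = t + 3 ^ m * (\<Sum>k<Suc m. enc_bit k z * (1 / 3) ^ k)"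
      by (simp add: t_def power_divide distrib_left)
    moreover have "3 ^ m * (\<Sum>k<Suc m. enc_bit k z * (1 / 3) ^ k) = real_of_int (enc_prefix m z)"
      by (induction m) (simp_all add: distrib_left power_divide mult.assoc)
    ultimately show ?thesis by simp
  qed
  ultimately show thesis using that by blast
qed

lemma enc_range: "0 \<le> enc z" "enc z \<le> 3 / 2"
proof -
  obtain t where "3 ^ 0 * enc z = real_of_int (enc_prefix 0 z) + t" "0 \<le> t" "t \<le> 1 / 2"
    by (rule enc_split)
  then show "0 \<le> enc z" "enc z \<le> 3 / 2" using enc_bit_le[of 0 z] by auto
qed

text \<open>After scaling by 3^m the codes differ by less than 1/2 and their tails by at most 1/2,
  so the integer prefixes differ by less than 1.\<close>

lemma enc_bit_eqI:
  assumes "\<bar>enc z - enc z'\<bar> < (1 / 3) ^ m / 2"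
  shows "enc_bit m z = enc_bit m z'"
proof -
  obtain t where t: "3 ^ m * enc z = real_of_int (enc_prefix m z) + t" "0 \<le> t" "t \<le> 1 / 2"
    by (rule enc_split)
  obtain t' where t': "3 ^ m * enc z' = real_of_int (enc_prefix m z') + t'" "0 \<le> t'" "t' \<le> 1 / 2"
    by (rule enc_split)
  have "\<bar>3 ^ m * enc z - 3 ^ m * enc z'\<bar> < 1 / 2"
  proof -
    have "\<bar>3 ^ m * enc z - 3 ^ m * enc z'\<bar> = 3 ^ m * \<bar>enc z - enc z'\<bar>"
      by (simp add: abs_mult flip: right_diff_distrib)
    also have "\<dots> < 3 ^ m * ((1 / 3) ^ m / 2)" using assms by (intro mult_strict_left_mono) auto
    finally show ?thesis by (simp add: power_divide)
  qed
  then have "\<bar>real_of_int (enc_prefix m z - enc_prefix m z')\<bar> < 1"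
    using t(2,3) t'(2,3) unfolding t(1) t'(1) of_int_diff by linarith
  then have "enc_prefix m z = enc_prefix m z'" by linarith
  then show ?thesis using enc_prefix_mod[of m z] enc_prefix_mod[of m z'] by simp
qed

lemma floor_enc: "\<lfloor>3 ^ m * enc z\<rfloor> = enc_prefix m z"
proof -
  obtain t where "3 ^ m * enc z = real_of_int (enc_prefix m z) + t" "0 \<le> t" "t \<le> 1 / 2"
    by (rule enc_split)
  then show ?thesis by (intro floor_unique) auto
qed

lemma enc_measurable [measurable]: "enc \<in> borel_measurable borel"
  unfolding enc_def enc_bit_def by measurable

text \<open>A coordinate is the supremum of the rationals below it, and the digit 1 marks these
  rationals. The supremum is taken in the extended reals, where it exists for every
  \<open>y\<close>, code or not, and is measurable as a supremum over countably many
  indices.\<close>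

definition dec :: "real \<Rightarrow> real^2" where
  "dec y = (\<chi> i. real_of_ereal (SUP n. if \<lfloor>3 ^ (2 * n + (if i = 1 then 0 else 1)) * y\<rfloor> mod 3 = 1
     then ereal (qenum n) else - \<infinity>))"

lemma SUP_qenum_below: "(SUP n. if qenum n < x then ereal (qenum n) else - \<infinity>) = ereal x"
proof (rule antisym)
  show "(SUP n. if qenum n < x then ereal (qenum n) else - \<infinity>) \<le> ereal x"
    by (rule SUP_least) auto
  show "ereal x \<le> (SUP n. if qenum n < x then ereal (qenum n) else - \<infinity>)"
  proof (rule dense_le)
    fix y :: ereal assume y: "y < ereal x"
    then obtain q where q: "y < ereal q" "q < x" "q \<in> \<rat>"
    proof (cases y)
      case (real r)
      then obtain q where "r < q" "q < x" "q \<in> \<rat>" using y Rats_dense_in_real[of r x] by auto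
      then show ?thesis using that real by auto
    next
      case MInf
      obtain q where "x - 1 < q" "q < x" "q \<in> \<rat>" using Rats_dense_in_real[of "x - 1" x] by auto
      then show ?thesis using that MInf by auto
    qed auto
    then obtain n where "q = qenum n" using range_qenum by (metis imageE)
    then have "ereal q \<le> (SUP n. if qenum n < x then ereal (qenum n) else - \<infinity>)"
      using q by (intro SUP_upper2[of n]) auto
    then show "y \<le> (SUP n. if qenum n < x then ereal (qenum n) else - \<infinity>)" using q by simp
  qed
qed

lemma dec_enc: "dec (enc z) = z"
proof -
  have "dec (enc z) $ i = z $ i" for i
  proof -
    have "(\<lfloor>3 ^ (2 * n + (if i = 1 then 0 else 1)) * enc z\<rfloor> mod 3 = 1) = (qenum n < z $ i)" for n
      unfolding floor_enc enc_prefix_mod using exhaust_2[of i] by (auto simp: enc_bit_def)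
    then show ?thesis by (simp only: dec_def vec_lambda_beta SUP_qenum_below real_of_ereal.simps)
  qed
  then show ?thesis by (simp add: vec_eq_iff)
qed

lemma dec_measurable [measurable]: "dec \<in> borel_measurable borel"
proof -
  have "(\<lambda>y. dec y $ i) \<in> borel_measurable borel" for i
    unfolding dec_def vec_lambda_beta by measurable
  then show ?thesis
    by (subst borel_measurable_euclidean_space) (auto simp: Basis_vec_def inner_axis)
qed

text \<open>Each rational is eventually on one side of the sequence, so the limit is the Dedekind
  cut \<open>A\<close>. Being bounded infinitely often already keeps the cut from being empty or all
  of the rationals.\<close>

lemma rational_cuts_convergent:
  fixes x :: "nat \<Rightarrow> real"
  assumes cut: "\<And>q. q \<in> \<rat> \<Longrightarrow> \<exists>b. \<forall>\<^sub>F k in sequentially. (q < x k) = b"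
    and bound: "\<exists>\<^sub>F k in sequentially. \<bar>x k\<bar> \<le> c"
  shows "convergent x"
proof -
  have dich: "(\<forall>\<^sub>F k in sequentially. q < x k) \<or> (\<forall>\<^sub>F k in sequentially. x k \<le> q)" if "q \<in> \<rat>" for q
    using cut[OF that] by (metis (mono_tags, lifting) eventually_mono linorder_not_less)
  define A where "A = {q \<in> \<rat>. \<forall>\<^sub>F k in sequentially. q < x k}"
  have up: "q \<le> c" if "q \<in> A" for q
  proof (rule ccontr)
    assume "\<not> q \<le> c"
    have "\<forall>\<^sub>F k in sequentially. q < x k" using that by (simp add: A_def)
    then have "\<exists>\<^sub>F k in sequentially. \<bar>x k\<bar> \<le> c \<and> q < x k" by (rule frequently_eventually_frequently[OF bound])
    then obtain k where "\<bar>x k\<bar> \<le> c" "q < x k" by (auto dest: frequently_ex)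
    then show False using \<open>\<not> q \<le> c\<close> by auto
  qed
  obtain q0 where q0: "q0 \<in> \<rat>" "q0 < - c" using Rats_dense_in_real[of "- c - 1" "- c"] by auto
  have "q0 \<in> A"
  proof (rule ccontr)
    assume "q0 \<notin> A"
    then have "\<forall>\<^sub>F k in sequentially. x k \<le> q0" using dich[OF q0(1)] q0 by (auto simp: A_def)
    then have "\<exists>\<^sub>F k in sequentially. \<bar>x k\<bar> \<le> c \<and> x k \<le> q0" by (rule frequently_eventually_frequently[OF bound])
    then obtain k where "\<bar>x k\<bar> \<le> c" "x k \<le> q0" by (auto dest: frequently_ex)
    then show False using q0 by auto
  qed
  have bdd: "bdd_above A" by (rule bdd_aboveI) (rule up)
  have "x \<longlonglongrightarrow> Sup A"
  proof (rule order_tendstoI)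
    fix a assume "a < Sup A"
    then obtain q where "q \<in> A" "a < q" using less_cSup_iff[of A a] bdd \<open>q0 \<in> A\<close> by auto
    then show "\<forall>\<^sub>F k in sequentially. a < x k"
      by (auto simp: A_def elim: eventually_mono)
  next
    fix a assume "Sup A < a"
    then obtain q where q: "q \<in> \<rat>" "Sup A < q" "q < a" using Rats_dense_in_real by blast
    then have "q \<notin> A" using cSup_upper[OF _ bdd, of q] by auto
    then have "\<forall>\<^sub>F k in sequentially. x k \<le> q" using dich[OF q(1)] q by (auto simp: A_def)
    then show "\<forall>\<^sub>F k in sequentially. x k < a"
      by (rule eventually_mono) (use q in auto)
  qed
  then show ?thesis by (rule convergentI)
qed

text \<open>The encoding is discontinuous, but convergence of the codes freezes every digit, that
  is, every comparison of a coordinate with a rational. The boundedness is required only infinitely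
  often because this is what Fatou's lemma will provide.\<close>

lemma enc_convergent:
  assumes conv: "convergent (\<lambda>k. enc (z k))" and bound: "\<exists>\<^sub>F k in sequentially. norm (z k) \<le> c"
  shows "convergent z"
proof -
  have bits: "\<exists>b. \<forall>\<^sub>F k in sequentially. (enc_bit m (z k) = 1) = b" for m
  proof -
    have "Cauchy (\<lambda>k. enc (z k))" using conv by (rule convergent_Cauchy)
    then obtain K where K: "\<And>k l. k \<ge> K \<Longrightarrow> l \<ge> K \<Longrightarrow> \<bar>enc (z k) - enc (z l)\<bar> < (1 / 3) ^ m / 2"
      by (metis Cauchy_def dist_real_def half_gt_zero zero_less_divide_1_iff zero_less_numeral zero_less_power)
    have "(enc_bit m (z k) = 1) = (enc_bit m (z K) = 1)" if "k \<ge> K" for k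
      by (simp only: enc_bit_eqI[OF K[OF that order_refl]])
    then show ?thesis unfolding eventually_sequentially by (intro exI allI impI)
  qed
  have coord: "convergent (\<lambda>k. z k $ i)" for i
  proof (rule rational_cuts_convergent)
    fix q :: real assume "q \<in> \<rat>"
    then obtain n where n: "q = qenum n" using range_qenum by (metis imageE)
    show "\<exists>b. \<forall>\<^sub>F k in sequentially. (q < z k $ i) = b"
      using bits[of "2 * n + (if i = 1 then 0 else 1)"] exhaust_2[of i]
      by (auto simp: enc_bit_def n simp del: One_nat_def)
  next
    show "\<exists>\<^sub>F k in sequentially. \<bar>z k $ i\<bar> \<le> c"
      using bound by (rule frequently_elim1) (use component_le_norm_cart order_trans in blast)
  qed
  then have "(\<lambda>k. z k $ i) \<longlonglongrightarrow> lim (\<lambda>k. z k $ i)" for i by (simp add: convergent_LIMSEQ_iff)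
  then have "z \<longlonglongrightarrow> (\<chi> i. lim (\<lambda>k. z k $ i))" by (intro vec_tendstoI) simp
  then show ?thesis by (rule convergentI)
qed

text \<open>The second point is an independent copy of the first, obtained by integrating over
  \<open>\<Omega>\<close> once more. Dominated convergence is applied in the inner and then in the
  outer integral.\<close>

lemma iterated_integral_tendsto:
  fixes H :: "real^2 \<Rightarrow> real^2 \<Rightarrow> real"
  assumes \<Omega>: "prob_space \<Omega>" and Z [measurable]: "\<And>k. Z k \<in> borel_measurable \<Omega>" and W [measurable]: "W \<in> borel_measurable \<Omega>"
    and conv: "AE \<omega> in \<Omega>. (\<lambda>k. Z k \<omega>) \<longlonglongrightarrow> W \<omega>"
    and H: "continuous_on UNIV (\<lambda>p. H (fst p) (snd p))" and B: "\<And>z w. \<bar>H z w\<bar> \<le> B"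
  shows "(\<lambda>k. LINT z|distr \<Omega> borel (Z k). LINT w|distr \<Omega> borel (Z k). H z w)
    \<longlonglongrightarrow> (LINT z|distr \<Omega> borel W. LINT w|distr \<Omega> borel W. H z w)"
proof -
  interpret prob_space \<Omega> by fact
  have Hm: "(\<lambda>p. H (fst p) (snd p)) \<in> borel_measurable (borel \<Otimes>\<^sub>M borel)"
    using borel_measurable_continuous_onI[OF H] by (simp only: borel_prod)
  have H2: "(\<lambda>(x, y). H (f x) (g y)) \<in> borel_measurable (M \<Otimes>\<^sub>M N)"
    if [measurable]: "f \<in> borel_measurable M" "g \<in> borel_measurable N"
    for f g and M :: "'c measure" and N :: "'d measure"
  proof -
    have "(\<lambda>p. (f (fst p), g (snd p))) \<in> measurable (M \<Otimes>\<^sub>M N) (borel \<Otimes>\<^sub>M borel)" by measurable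
    from measurable_compose[OF this Hm] show ?thesis by (simp add: case_prod_beta')
  qed
  have H1: "(\<lambda>y. H a (g y)) \<in> borel_measurable M"
    if [measurable]: "g \<in> borel_measurable M" for a g and M :: "'c measure"
  proof -
    have "(\<lambda>y. (a, g y)) \<in> measurable M (borel \<Otimes>\<^sub>M borel)" by measurable
    from measurable_compose[OF this Hm] show ?thesis by simp
  qed
  have eq: "(LINT z|distr \<Omega> borel f. LINT w|distr \<Omega> borel f. H z w) = (LINT \<omega>|\<Omega>. LINT \<omega>'|\<Omega>. H (f \<omega>) (f \<omega>'))"
    if [measurable]: "f \<in> borel_measurable \<Omega>" for f
  proof -
    interpret D: prob_space "distr \<Omega> borel f" by (rule prob_space_distr) simp
    have "(\<lambda>z. LINT w|distr \<Omega> borel f. H z w) \<in> borel_measurable borel"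
      by (rule D.borel_measurable_lebesgue_integral) (rule H2; simp)
    then have "(LINT z|distr \<Omega> borel f. LINT w|distr \<Omega> borel f. H z w)
        = (LINT \<omega>|\<Omega>. LINT w|distr \<Omega> borel f. H (f \<omega>) w)"
      by (intro integral_distr) simp_all
    also have "\<dots> = (LINT \<omega>|\<Omega>. LINT \<omega>'|\<Omega>. H (f \<omega>) (f \<omega>'))"
      by (intro Bochner_Integration.integral_cong refl integral_distr H1) simp_all
    finally show ?thesis .
  qed
  have lim2: "(\<lambda>k. H (Z k \<omega>) (Z k \<omega>')) \<longlonglongrightarrow> H (W \<omega>) (W \<omega>')"
    if "(\<lambda>k. Z k \<omega>) \<longlonglongrightarrow> W \<omega>" "(\<lambda>k. Z k \<omega>') \<longlonglongrightarrow> W \<omega>'" for \<omega> \<omega>'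
    using continuous_on_tendsto_compose[OF H tendsto_Pair[OF that]] by simp
  have inner: "(\<lambda>k. LINT \<omega>'|\<Omega>. H (Z k \<omega>) (Z k \<omega>')) \<longlonglongrightarrow> (LINT \<omega>'|\<Omega>. H (W \<omega>) (W \<omega>'))"
    if \<omega>: "(\<lambda>k. Z k \<omega>) \<longlonglongrightarrow> W \<omega>" for \<omega>
    by (rule integral_dominated_convergence[where w = "\<lambda>_. B"])
      (use conv B lim2[OF \<omega>] in \<open>auto intro: H1\<close>)
  have Bint: "\<bar>LINT \<omega>'|\<Omega>. g \<omega>'\<bar> \<le> B" if "\<And>\<omega>'. \<bar>g \<omega>'\<bar> \<le> B" for g
  proof -
    have B0: "0 \<le> B" using B[of 0 0] by linarith
    have "\<bar>LINT \<omega>'|\<Omega>. g \<omega>'\<bar> \<le> (LINT \<omega>'|\<Omega>. B)"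
    proof (cases "integrable \<Omega> g")
      case True
      then show ?thesis
        using that by (intro integral_abs_bound[THEN order_trans] integral_mono) auto
    qed (use B0 in \<open>auto simp: not_integrable_integral_eq prob_space\<close>)
    then show ?thesis by (simp add: prob_space)
  qed
  have "(\<lambda>k. LINT \<omega>|\<Omega>. LINT \<omega>'|\<Omega>. H (Z k \<omega>) (Z k \<omega>')) \<longlonglongrightarrow> (LINT \<omega>|\<Omega>. LINT \<omega>'|\<Omega>. H (W \<omega>) (W \<omega>'))"
  proof (rule integral_dominated_convergence[where w = "\<lambda>_. B"])
    show "(\<lambda>\<omega>. LINT \<omega>'|\<Omega>. H (W \<omega>) (W \<omega>')) \<in> borel_measurable \<Omega>"
      by (rule borel_measurable_lebesgue_integral) (rule H2; simp)
    show "(\<lambda>\<omega>. LINT \<omega>'|\<Omega>. H (Z k \<omega>) (Z k \<omega>')) \<in> borel_measurable \<Omega>" for k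
      by (rule borel_measurable_lebesgue_integral) (rule H2; simp)
    show "AE \<omega> in \<Omega>. (\<lambda>k. LINT \<omega>'|\<Omega>. H (Z k \<omega>) (Z k \<omega>')) \<longlonglongrightarrow> (LINT \<omega>'|\<Omega>. H (W \<omega>) (W \<omega>'))"
      using conv by eventually_elim (rule inner)
    show "AE \<omega> in \<Omega>. norm (LINT \<omega>'|\<Omega>. H (Z k \<omega>) (Z k \<omega>')) \<le> B" for k
      using Bint B by auto
  qed simp
  then show ?thesis by (simp add: eq)
qed

text \<open>For probability measures this is narrow convergence of the squares of the measures,
  written with iterated integrals. Tests that ignore the second point give narrow convergence
  itself; two points are needed because the flux is quadratic in the measure.\<close>

definition product_converges :: "(nat \<Rightarrow> (real^2) measure) \<Rightarrow> (real^2) measure \<Rightarrow> bool" where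
  "product_converges \<mu> \<nu> \<longleftrightarrow> (\<forall>(H :: real^2 \<Rightarrow> real^2 \<Rightarrow> real) B.
     continuous_on UNIV (\<lambda>p. H (fst p) (snd p)) \<longrightarrow> (\<forall>z w. \<bar>H z w\<bar> \<le> B) \<longrightarrow>
     (\<lambda>k. LINT z|\<mu> k. LINT w|\<mu> k. H z w) \<longlonglongrightarrow> (LINT z|\<nu>. LINT w|\<nu>. H z w))"

text \<open>The codes lie in a bounded interval, so their tightness is automatic. The moment bound
  acts afterwards: by Fatou's lemma the lower limit of the squared norms is finite almost surely, so
  \<open>enc_convergent\<close> gives almost sure convergence in the plane, and a second use of
  lower limits carries the bound \<open>C\<close> to the limit law.\<close>

theorem second_moment_compactness:
  fixes \<mu> :: "nat \<Rightarrow> (real^2) measure"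
  assumes P2: "\<And>k. \<mu> k \<in> P2" and C: "\<And>k. (LINT z|\<mu> k. (norm z)\<^sup>2) \<le> C"
  shows "\<exists>r \<nu>. strict_mono (r :: nat \<Rightarrow> nat) \<and> \<nu> \<in> P2 \<and> (LINT z|\<nu>. (norm z)\<^sup>2) \<le> C \<and>
    product_converges (\<lambda>k. \<mu> (r k)) \<nu>"
proof -
  have prob: "prob_space (\<mu> k)" and sets [measurable_cong]: "sets (\<mu> k) = sets borel"
    and int: "integrable (\<mu> k) (\<lambda>z. (norm z)\<^sup>2)" for k
    using P2[of k] by (auto simp: P2_def)
  define \<mu>' where "\<mu>' k = distr (\<mu> k) borel enc" for k
  have real: "real_distribution (\<mu>' k)" for k
    unfolding \<mu>'_def using prob[of k]
    by (intro real_distribution.intro prob_space.prob_space_distr real_distribution_axioms.intro) auto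
  have meas1: "measure (\<mu>' k) {- 1<..2} = 1" for k
  proof -
    interpret prob_space "\<mu> k" by (rule prob)
    have "measure (\<mu>' k) {- 1<..2} = measure (\<mu> k) (enc -` {- 1<..2} \<inter> space (\<mu> k))"
      unfolding \<mu>'_def by (rule measure_distr) auto
    also have "enc -` {- 1<..2} \<inter> space (\<mu> k) = space (\<mu> k)"
    proof -
      have "- 1 < enc z \<and> enc z \<le> 2" for z using enc_range[of z] by linarith
      then show ?thesis by auto
    qed
    finally show ?thesis by (simp add: prob_space)
  qed
  have "tight \<mu>'"
    unfolding tight_def
  proof (intro conjI allI impI real)
    fix \<epsilon> :: real assume "0 < \<epsilon>"
    then show "\<exists>a b. a < b \<and> (\<forall>n. 1 - \<epsilon> < measure (\<mu>' n) {a<..b})"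
      by (intro exI[of _ "- 1"] exI[of _ 2]) (simp add: meas1)
  qed
  then obtain r M where r: "strict_mono r" and M: "real_distribution M" and wc: "weak_conv_m (\<mu>' \<circ> id \<circ> r) M"
    using tight_imp_convergent_subsubsequence[of \<mu>' id] strict_mono_id by (auto simp: id_def)
  have real': "real_distribution ((\<mu>' \<circ> id \<circ> r) n)" for n by (simp add: real)
  obtain \<Omega> :: "real measure" and Ys Y where sk: "prob_space \<Omega> \<and> (\<forall>n. Ys n \<in> borel_measurable \<Omega>)
      \<and> (\<forall>n. distr \<Omega> borel (Ys n) = (\<mu>' \<circ> id \<circ> r) n) \<and> Y \<in> measurable \<Omega> lborel
      \<and> distr \<Omega> borel Y = M \<and> (\<forall>x\<in>space \<Omega>. (\<lambda>n. Ys n x) \<longlonglongrightarrow> Y x)"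
    using Skorohod[OF real' M wc] by blast
  have \<Omega>: "prob_space \<Omega>"
    and Ys [measurable]: "\<And>n. Ys n \<in> borel_measurable \<Omega>"
    and Ysd: "\<And>n. distr \<Omega> borel (Ys n) = \<mu>' (r n)"
    and Yc: "\<And>x. x \<in> space \<Omega> \<Longrightarrow> (\<lambda>n. Ys n x) \<longlonglongrightarrow> Y x"
    using sk by simp_all
  interpret prob_space \<Omega> by fact
  define Z where "Z k \<omega> = dec (Ys k \<omega>)" for k \<omega>
  have Z [measurable]: "Z k \<in> borel_measurable \<Omega>" for k unfolding Z_def by measurable
  have Zd: "distr \<Omega> borel (Z k) = \<mu> (r k)" for k
  proof -
    have "distr \<Omega> borel (Z k) = distr (distr \<Omega> borel (Ys k)) borel dec"
      by (subst distr_distr) (simp_all add: Z_def[abs_def] comp_def)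
    also have "\<dots> = distr (\<mu> (r k)) borel (dec \<circ> enc)"
      unfolding Ysd \<mu>'_def by (rule distr_distr) auto
    also have "\<dots> = distr (\<mu> (r k)) (\<mu> (r k)) (\<lambda>x. x)"
      by (intro distr_cong) (simp_all add: sets dec_enc)
    finally show ?thesis by simp
  qed
  \<comment> \<open>The Skorokhod variables are codes only almost surely: their laws are images of
    measures under \<open>enc\<close>.\<close>
  have encZ: "AE \<omega> in \<Omega>. enc (Z k \<omega>) = Ys k \<omega>" for k
  proof -
    have "AE y in distr (\<mu> (r k)) borel enc. enc (dec y) = y"
      by (subst AE_distr_iff) (simp_all add: dec_enc)
    then have "AE y in distr \<Omega> borel (Ys k). enc (dec y) = y" unfolding Ysd \<mu>'_def .
    then show ?thesis by (subst (asm) AE_distr_iff) (simp_all add: Z_def)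
  qed
  have nnC: "(\<integral>\<^sup>+ \<omega>. ennreal ((norm (Z k \<omega>))\<^sup>2) \<partial>\<Omega>) \<le> ennreal C" for k
  proof -
    have "(\<integral>\<^sup>+ \<omega>. ennreal ((norm (Z k \<omega>))\<^sup>2) \<partial>\<Omega>) = (\<integral>\<^sup>+ z. ennreal ((norm z)\<^sup>2) \<partial>distr \<Omega> borel (Z k))"
      by (subst nn_integral_distr) auto
    also have "\<dots> = ennreal (LINT z|\<mu> (r k). (norm z)\<^sup>2)"
      unfolding Zd by (rule nn_integral_eq_integral[OF int]) simp
    also have "\<dots> \<le> ennreal C" by (intro ennreal_leI C)
    finally show ?thesis .
  qed
  have liminf: "(\<integral>\<^sup>+ \<omega>. liminf (\<lambda>k. ennreal ((norm (Z k \<omega>))\<^sup>2)) \<partial>\<Omega>) \<le> ennreal C"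
    by (rule order_trans[OF nn_integral_liminf]) (auto intro!: Liminf_le always_eventually nnC)
  then have fin: "AE \<omega> in \<Omega>. liminf (\<lambda>k. ennreal ((norm (Z k \<omega>))\<^sup>2)) \<noteq> \<infinity>"
    by (intro nn_integral_PInf_AE) (auto simp: top_unique)
  \<comment> \<open>The codes may tend to a number that is not itself a code, so the limit is formed
    among the decoded points.\<close>
  define W where "W \<omega> = lim (\<lambda>k. Z k \<omega>)" for \<omega>
  have W [measurable]: "W \<in> borel_measurable \<Omega>"
    unfolding W_def by (rule borel_measurable_lim_metric) (rule Z)
  have "AE \<omega> in \<Omega>. \<forall>k. enc (Z k \<omega>) = Ys k \<omega>" by (simp add: AE_all_countable encZ)
  then have conv: "AE \<omega> in \<Omega>. (\<lambda>k. Z k \<omega>) \<longlonglongrightarrow> W \<omega>"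
    using fin AE_space
  proof eventually_elim
    case (elim \<omega>)
    have "convergent (\<lambda>k. enc (Z k \<omega>))" using elim Yc[of \<omega>] by (auto intro: convergentI)
    moreover obtain c where "liminf (\<lambda>k. ennreal ((norm (Z k \<omega>))\<^sup>2)) < ennreal c" "0 \<le> c"
    proof -
      obtain c0 where "0 \<le> c0" "liminf (\<lambda>k. ennreal ((norm (Z k \<omega>))\<^sup>2)) = ennreal c0"
        using elim(2) by (cases "liminf (\<lambda>k. ennreal ((norm (Z k \<omega>))\<^sup>2))") auto
      then show ?thesis using that[of "c0 + 1"] by (auto simp: ennreal_less_iff)
    qed
    then have "\<exists>\<^sub>F k in sequentially. norm (Z k \<omega>) \<le> sqrt c"
    proof -
      have "\<not> (\<forall>\<^sub>F k in sequentially. ennreal c \<le> ennreal ((norm (Z k \<omega>))\<^sup>2))"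
        using Liminf_bounded[of "ennreal c" "\<lambda>k. ennreal ((norm (Z k \<omega>))\<^sup>2)" sequentially]
          \<open>liminf (\<lambda>k. ennreal ((norm (Z k \<omega>))\<^sup>2)) < ennreal c\<close> by (auto simp: not_le)
      then have "\<exists>\<^sub>F k in sequentially. (norm (Z k \<omega>))\<^sup>2 < c"
        unfolding frequently_def by (auto simp: not_less elim: eventually_mono intro: ennreal_leI)
      then show ?thesis by (rule frequently_elim1) (simp add: real_le_rsqrt)
    qed
    ultimately have "convergent (\<lambda>k. Z k \<omega>)" by (intro enc_convergent)
    then show ?case by (simp add: W_def convergent_LIMSEQ_iff)
  qed
  define \<nu> where "\<nu> = distr \<Omega> borel W"
  have nu: "(\<integral>\<^sup>+ z. ennreal ((norm z)\<^sup>2) \<partial>\<nu>) \<le> ennreal C"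
  proof -
    have "(\<integral>\<^sup>+ z. ennreal ((norm z)\<^sup>2) \<partial>\<nu>) = (\<integral>\<^sup>+ \<omega>. ennreal ((norm (W \<omega>))\<^sup>2) \<partial>\<Omega>)"
      unfolding \<nu>_def by (subst nn_integral_distr) auto
    also have "\<dots> \<le> (\<integral>\<^sup>+ \<omega>. liminf (\<lambda>k. ennreal ((norm (Z k \<omega>))\<^sup>2)) \<partial>\<Omega>)"
    proof (rule nn_integral_mono_AE)
      show "AE \<omega> in \<Omega>. ennreal ((norm (W \<omega>))\<^sup>2) \<le> liminf (\<lambda>k. ennreal ((norm (Z k \<omega>))\<^sup>2))"
        using conv
      proof eventually_elim
        case (elim \<omega>)
        then have "(\<lambda>k. ennreal ((norm (Z k \<omega>))\<^sup>2)) \<longlonglongrightarrow> ennreal ((norm (W \<omega>))\<^sup>2)"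
          by (intro tendsto_ennrealI tendsto_intros)
        then have "liminf (\<lambda>k. ennreal ((norm (Z k \<omega>))\<^sup>2)) = ennreal ((norm (W \<omega>))\<^sup>2)"
          by (rule lim_imp_Liminf[rotated]) simp
        then show ?case by simp
      qed
    qed
    finally show ?thesis using liminf by simp
  qed
  have "0 \<le> (LINT z|\<mu> 0. (norm z)\<^sup>2)" by (rule integral_nonneg_AE) simp
  then have C0: "0 \<le> C" using C[of 0] by linarith
  have int\<nu>: "integrable \<nu> (\<lambda>z. (norm z)\<^sup>2)"
  proof (rule integrableI_bounded)
    show "(\<lambda>z. (norm z)\<^sup>2) \<in> borel_measurable \<nu>" by (simp add: \<nu>_def)
    show "(\<integral>\<^sup>+ x. ennreal (norm ((norm x)\<^sup>2)) \<partial>\<nu>) < \<infinity>"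
      using nu by (simp add: le_less_trans)
  qed
  show ?thesis
  proof (intro exI conjI)
    have "prob_space \<nu>" unfolding \<nu>_def by (rule prob_space_distr) simp
    then show "\<nu> \<in> P2" using int\<nu> by (simp add: P2_def \<nu>_def)
    show "(LINT z|\<nu>. (norm z)\<^sup>2) \<le> C"
      using nu nn_integral_eq_integral[OF int\<nu>] C0 by simp
    show "product_converges (\<lambda>k. \<mu> (r k)) \<nu>"
      unfolding product_converges_def
    proof (intro allI impI)
      fix H :: "real^2 \<Rightarrow> real^2 \<Rightarrow> real" and B
      assume "continuous_on UNIV (\<lambda>p. H (fst p) (snd p))" "\<forall>z w. \<bar>H z w\<bar> \<le> B"
      then have "(\<lambda>k. LINT z|distr \<Omega> borel (Z k). LINT w|distr \<Omega> borel (Z k). H z w)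
          \<longlonglongrightarrow> (LINT z|distr \<Omega> borel W. LINT w|distr \<Omega> borel W. H z w)"
        by (intro iterated_integral_tendsto[where B = B]) (use \<Omega> Z W conv in blast)+
      then show "(\<lambda>k. LINT z|\<mu> (r k). LINT w|\<mu> (r k). H z w) \<longlonglongrightarrow> (LINT z|\<nu>. LINT w|\<nu>. H z w)"
        by (simp only: Zd \<nu>_def)
    qed
  qed (rule r)
qed

text \<open>Subsequence principle: the indices that stay \<epsilon> away from \<open>l\<close>,
  enumerated in increasing order, would be a subsequence without the required further
  subsequence.\<close>

lemma LIMSEQ_subseq_criterion:
  fixes x :: "nat \<Rightarrow> real"
  assumes "\<And>s. strict_mono (s :: nat \<Rightarrow> nat) \<Longrightarrow> \<exists>q. strict_mono (q :: nat \<Rightarrow> nat) \<and> (\<lambda>k. x (s (q k))) \<longlonglongrightarrow> l"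
  shows "x \<longlonglongrightarrow> l"
proof (rule ccontr)
  assume "\<not> x \<longlonglongrightarrow> l"
  then obtain \<epsilon> where \<epsilon>: "0 < \<epsilon>" "\<And>N. \<exists>k\<ge>N. \<epsilon> \<le> dist (x k) l"
    unfolding lim_sequentially by (meson not_le_imp_less)
  define A where "A = {k. \<epsilon> \<le> dist (x k) l}"
  have "infinite A" unfolding infinite_nat_iff_unbounded_le A_def using \<epsilon>(2) by auto
  then have mono: "strict_mono (enumerate A)" and mem: "\<And>k. enumerate A k \<in> A"
    by (auto intro: strict_mono_enumerate enumerate_in_set)
  obtain q where q: "strict_mono q" "(\<lambda>k. x (enumerate A (q k))) \<longlonglongrightarrow> l" using assms[OF mono] by blast
  from q(2) \<epsilon>(1) obtain N where "dist (x (enumerate A (q N))) l < \<epsilon>"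
    unfolding lim_sequentially by blast
  then show False using mem[of "q N"] by (simp add: A_def)
qed

section \<open>Compactness of curves of measures\<close>

text \<open>A smooth step of slope of order n^2 centred at a + 1/n. The shift by 1/n forces the
  limit 0 at x = a, so the pointwise limit is the indicator of an open half-line; smoothness makes
  the step usable in the one-step estimates.\<close>

definition cutoff :: "nat \<Rightarrow> real \<Rightarrow> real \<Rightarrow> real" where
  "cutoff n a x = 1 / 2 + arctan ((real n)\<^sup>2 * (x - a) - real n) / pi"

lemma cutoff_bounds: "0 \<le> cutoff n a x" "cutoff n a x \<le> 1"
proof -
  have "- (pi / 2) < arctan ((real n)\<^sup>2 * (x - a) - real n)" "arctan ((real n)\<^sup>2 * (x - a) - real n) < pi / 2"
    by (rule arctan_lbound arctan_ubound)+
  then have "- (1 / 2) \<le> arctan ((real n)\<^sup>2 * (x - a) - real n) / pi"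
    "arctan ((real n)\<^sup>2 * (x - a) - real n) / pi \<le> 1 / 2"
    by (simp_all add: field_simps)
  then show "0 \<le> cutoff n a x" "cutoff n a x \<le> 1" unfolding cutoff_def by linarith+
qed

lemma cutoff_tendsto: "(\<lambda>n. cutoff n a x) \<longlonglongrightarrow> (if a < x then 1 else 0)"
proof (cases "a < x")
  case True
  then have "0 < x - a" by simp
  then have "filterlim (\<lambda>n. (real n)\<^sup>2 * (x - a) - real n) at_top sequentially" by real_asymp
  then have "(\<lambda>n. arctan ((real n)\<^sup>2 * (x - a) - real n)) \<longlonglongrightarrow> pi / 2"
    by (rule filterlim_compose[OF tendsto_arctan_at_top])
  then have "(\<lambda>n. cutoff n a x) \<longlonglongrightarrow> 1 / 2 + pi / 2 / pi"
    unfolding cutoff_def by (intro tendsto_intros) simp_all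
  then show ?thesis using True by simp
next
  case False
  have "filterlim (\<lambda>n. - real n) at_bot sequentially" by real_asymp
  then have "filterlim (\<lambda>n. (real n)\<^sup>2 * (x - a) - real n) at_bot sequentially"
    by (rule filterlim_at_bot_mono) (use False in \<open>auto simp: mult_nonneg_nonpos\<close>)
  then have "(\<lambda>n. arctan ((real n)\<^sup>2 * (x - a) - real n)) \<longlonglongrightarrow> - (pi / 2)"
    by (rule filterlim_compose[OF tendsto_arctan_at_bot])
  then have "(\<lambda>n. cutoff n a x) \<longlonglongrightarrow> 1 / 2 + - (pi / 2) / pi"
    unfolding cutoff_def by (intro tendsto_intros) simp_all
  then show ?thesis using False by simp
qed

definition orthant :: "real \<Rightarrow> real \<Rightarrow> (real^2) set" where
  "orthant a b = {z. a < z $ 1 \<and> b < z $ 2}"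

definition orthant_test :: "nat \<Rightarrow> real \<Rightarrow> real \<Rightarrow> real^2 \<Rightarrow> real" where
  "orthant_test n a b z = cutoff n a (z $ 1) * cutoff n b (z $ 2)"

lemma orthant_test_bound: "\<bar>orthant_test n a b z\<bar> \<le> 1"
  using cutoff_bounds mult_mono[of "cutoff n a (z $ 1)" 1 "cutoff n b (z $ 2)" 1]
  by (simp add: orthant_test_def abs_mult)

lemma orthant_test_continuous: "continuous_on A (orthant_test n a b)"
  unfolding orthant_test_def cutoff_def by (intro continuous_intros) auto

lemma orthant_test_measurable [measurable]: "orthant_test n a b \<in> borel_measurable borel"
  by (rule borel_measurable_continuous_onI[OF orthant_test_continuous])

lemma orthant_borel [measurable]: "orthant a b \<in> sets borel"
  unfolding orthant_def by measurable

lemma orthant_test_tendsto: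
  assumes "prob_space \<mu>" and [measurable_cong]: "sets \<mu> = sets borel"
  shows "(\<lambda>n. LINT z|\<mu>. orthant_test n a b z) \<longlonglongrightarrow> measure \<mu> (orthant a b)"
proof -
  interpret prob_space \<mu> by fact
  have "(\<lambda>n. LINT z|\<mu>. orthant_test n a b z) \<longlonglongrightarrow> (LINT z|\<mu>. indicator (orthant a b) z)"
  proof (rule integral_dominated_convergence[where w = "\<lambda>_. 1"])
    have "(\<lambda>n. orthant_test n a b z) \<longlonglongrightarrow> indicator (orthant a b) z" for z
      using tendsto_mult[OF cutoff_tendsto[of a "z $ 1"] cutoff_tendsto[of b "z $ 2"]]
      by (auto simp: orthant_test_def orthant_def indicator_def split: if_splits)
    then show "AE z in \<mu>. (\<lambda>n. orthant_test n a b z) \<longlonglongrightarrow> indicator (orthant a b) z" by simp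
  qed (use orthant_test_bound in auto)
  then show ?thesis by simp
qed

definition rational_orthants :: "(real^2) set set" where
  "rational_orthants = {orthant a b |a b. a \<in> \<rat> \<and> b \<in> \<rat>}"

lemma Int_stable_rational_orthants: "Int_stable rational_orthants"
proof (rule Int_stableI)
  fix A B assume "A \<in> rational_orthants" "B \<in> rational_orthants"
  then obtain a b a' b' where "A = orthant a b" "B = orthant a' b'" "a \<in> \<rat>" "b \<in> \<rat>" "a' \<in> \<rat>" "b' \<in> \<rat>"
    by (auto simp: rational_orthants_def)
  moreover from this have "A \<inter> B = orthant (max a a') (max b b')" by (auto simp: orthant_def)
  ultimately show "A \<inter> B \<in> rational_orthants"
    unfolding rational_orthants_def by (auto simp: max_def)
qed

text \<open>A coordinate half-space is a countable union of orthants with rational corners.\<close>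

lemma sigma_rational_orthants: "sets borel = sigma_sets UNIV rational_orthants"
proof (rule antisym)
  show "sigma_sets UNIV rational_orthants \<subseteq> sets borel"
    by (rule sets.sigma_sets_subset') (auto simp: rational_orthants_def)
  have UN: "(\<Union>i\<in>I. A i) \<in> sigma_sets UNIV rational_orthants"
    if "countable I" "\<And>i. i \<in> I \<Longrightarrow> A i \<in> sigma_sets UNIV rational_orthants" for I :: "real set" and A
    by (rule sigma_sets_UNION) (use that in auto)
  show "sets borel \<subseteq> sigma_sets UNIV rational_orthants"
    unfolding borel_eq_halfspace_greater sets_measure_of_conv
  proof (simp, rule sigma_sets_mono, safe)
    fix c :: real and i :: "real^2" assume "i \<in> Basis"
    then obtain m :: 2 where "i = axis m 1" by (auto simp: Basis_vec_def)
    then consider "i = axis 1 1" | "i = axis 2 1" using exhaust_2[of m] by auto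
    moreover have cnt: "countable {a \<in> \<rat>. c < a}" by (rule countable_subset[OF _ countable_rat]) auto
    ultimately have "{x. c < x \<bullet> i} \<in> sigma_sets UNIV rational_orthants"
    proof cases
      case 1
      have "{x. c < x \<bullet> i} = (\<Union>a\<in>{a\<in>\<rat>. c < a}. \<Union>b\<in>\<rat>. orthant a b)"
      proof safe
        fix x :: "real^2" assume "c < x \<bullet> i"
        then obtain a b where "a \<in> \<rat>" "c < a" "a < x $ 1" "b \<in> \<rat>" "b < x $ 2"
          using Rats_dense_in_real[of c "x $ 1"] Rats_dense_in_real[of "x $ 2 - 1" "x $ 2"]
          by (auto simp: 1 inner_axis)
        then show "x \<in> (\<Union>a\<in>{a\<in>\<rat>. c < a}. \<Union>b\<in>\<rat>. orthant a b)" by (auto simp: orthant_def)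
      qed (auto simp: orthant_def 1 inner_axis)
      also have "\<dots> \<in> sigma_sets UNIV rational_orthants"
        by (intro UN countable_rat sigma_sets.Basic cnt)
          (auto simp: rational_orthants_def)
      finally show ?thesis .
    next
      case 2
      have "{x. c < x \<bullet> i} = (\<Union>b\<in>{b\<in>\<rat>. c < b}. \<Union>a\<in>\<rat>. orthant a b)"
      proof safe
        fix x :: "real^2" assume "c < x \<bullet> i"
        then obtain a b where "b \<in> \<rat>" "c < b" "b < x $ 2" "a \<in> \<rat>" "a < x $ 1"
          using Rats_dense_in_real[of c "x $ 2"] Rats_dense_in_real[of "x $ 1 - 1" "x $ 1"]
          by (auto simp: 2 inner_axis)
        then show "x \<in> (\<Union>b\<in>{b\<in>\<rat>. c < b}. \<Union>a\<in>\<rat>. orthant a b)" by (auto simp: orthant_def)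
      qed (auto simp: orthant_def 2 inner_axis)
      also have "\<dots> \<in> sigma_sets UNIV rational_orthants"
        by (intro UN countable_rat sigma_sets.Basic cnt)
          (auto simp: rational_orthants_def)
      finally show ?thesis .
    qed
    then show "{x. c < x \<bullet> i} \<in> sigma_sets UNIV rational_orthants" .
  qed
qed

text \<open>The tests approximate indicators of a countable generating class stable under
  intersection, so countably many integrals determine a probability measure. This makes a diagonal
  argument possible.\<close>

lemma prob_eqI_orthant_test:
  assumes M: "prob_space M" "sets M = sets borel" and N: "prob_space N" "sets N = sets borel"
    and eq: "\<And>n a b. a \<in> \<rat> \<Longrightarrow> b \<in> \<rat> \<Longrightarrow> (LINT z|M. orthant_test n a b z) = (LINT z|N. orthant_test n a b z)"
  shows "M = N"
proof (rule measure_eqI_generator_eq)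
  interpret M: prob_space M by fact
  interpret N: prob_space N by fact
  show "emeasure M X = emeasure N X" if X: "X \<in> rational_orthants" for X
  proof -
    obtain a b where ab: "a \<in> \<rat>" "b \<in> \<rat>" "X = orthant a b" using X by (auto simp: rational_orthants_def)
    have "measure M X = measure N X"
      using LIMSEQ_unique[OF orthant_test_tendsto[OF M, of a b]] orthant_test_tendsto[OF N, of a b]
      by (simp add: ab eq)
    then show ?thesis by (simp add: M.emeasure_eq_measure N.emeasure_eq_measure)
  qed
  show "range (\<lambda>i. orthant (- real i) (- real i)) \<subseteq> rational_orthants"
  proof safe
    fix i :: nat
    have "- real i \<in> \<rat>" by simp
    then show "orthant (- real i) (- real i) \<in> rational_orthants"
      unfolding rational_orthants_def by blast
  qed
  show "emeasure M (orthant (- real i) (- real i)) \<noteq> \<infinity>" for i by simp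
  show "(\<Union>i. orthant (- real i) (- real i)) = UNIV"
  proof safe
    fix z :: "real^2"
    obtain i where "max (- (z $ 1)) (- (z $ 2)) < real i" using reals_Archimedean2 by blast
    then show "z \<in> (\<Union>i. orthant (- real i) (- real i))" by (intro UN_I[of i]) (auto simp: orthant_def)
  qed simp
qed (use M(2) N(2) in \<open>auto simp: sigma_rational_orthants Int_stable_rational_orthants\<close>)

lemma P2D: "\<mu> \<in> P2 \<Longrightarrow> prob_space \<mu>" "\<mu> \<in> P2 \<Longrightarrow> sets \<mu> = sets borel"
  "\<mu> \<in> P2 \<Longrightarrow> integrable \<mu> (\<lambda>z. (norm z)\<^sup>2)"
  by (simp_all add: P2_def)

text \<open>An argument of Arzela-Ascoli type. A diagonal subsequence converges for countably many
  tests at rational times, and equicontinuity extends this to all times. At a fixed time,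
  \<open>second_moment_compactness\<close> gives limit points; the tests show that they coincide, so
  the whole subsequence converges against all two-point functions. The error \<open>e k\<close>
  admits curves with time jumps. It is gone in the limit, whose tests are therefore Lipschitz in
  time, and this gives measurability.\<close>

theorem P2_curve_compactness:
  fixes \<mu> :: "nat \<Rightarrow> real \<Rightarrow> (real^2) measure"
  assumes S: "0 < S" and P2: "\<And>k t. t \<in> {0..S} \<Longrightarrow> \<mu> k t \<in> P2"
    and C: "\<And>k t. t \<in> {0..S} \<Longrightarrow> (LINT z|\<mu> k t. (norm z)\<^sup>2) \<le> C"
    and equi: "\<And>n a b. \<exists>L e. e \<longlonglongrightarrow> 0 \<and> (\<forall>k. \<forall>s\<in>{0..S}. \<forall>t\<in>{0..S}.
      \<bar>(LINT z|\<mu> k t. orthant_test n a b z) - (LINT z|\<mu> k s. orthant_test n a b z)\<bar> \<le> L * \<bar>t - s\<bar> + e k)"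
  shows "\<exists>r \<rho>. strict_mono (r :: nat \<Rightarrow> nat) \<and> P2_curve S \<rho> \<and>
    (\<forall>t\<in>{0..S}. product_converges (\<lambda>k. \<mu> (r k) t) (\<rho> t))"
proof -
  define I where "I k t n a b = (LINT z|\<mu> k t. orthant_test n a b z)" for k t n a b
  have lint_bound: "\<bar>LINT z|M. orthant_test n a b z\<bar> \<le> 1" if "M \<in> P2" for M n a b
  proof -
    interpret prob_space M using that by (rule P2D)
    have [measurable_cong]: "sets M = sets borel" using that by (rule P2D)
    have "\<bar>LINT z|M. orthant_test n a b z\<bar> \<le> (LINT z|M. 1)"
      by (rule integral_abs_bound[THEN order_trans], rule integral_mono)
        (auto intro!: integrable_const_bound[where B = 1] simp: orthant_test_bound)
    then show ?thesis by (simp add: prob_space)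
  qed
  have dbl: "(LINT z|M. LINT w|M. orthant_test n a b z) = (LINT z|M. orthant_test n a b z)" if "M \<in> P2" for M n a b
    using prob_space.prob_space[OF P2D(1)[OF that]] by simp
  have test_H: "continuous_on UNIV (\<lambda>p :: (real^2) \<times> (real^2). orthant_test n a b (fst p))" for n a b
    by (rule continuous_on_compose2[OF orthant_test_continuous[of UNIV]]) (auto intro: continuous_intros)
  have pc_test: "(\<lambda>k. LINT z|M k. LINT w|M k. orthant_test n a b z) \<longlonglongrightarrow> (LINT z|\<nu>. LINT w|\<nu>. orthant_test n a b z)"
    if "product_converges M \<nu>" for M \<nu> n a b
    using that[unfolded product_converges_def, rule_format, of "\<lambda>z w. orthant_test n a b z" 1]
      test_H orthant_test_bound by blast
  have equi_I: "\<exists>L e. e \<longlonglongrightarrow> 0 \<and> (\<forall>k. \<forall>s\<in>{0..S}. \<forall>t\<in>{0..S}. \<bar>I k t n a b - I k s n a b\<bar> \<le> L * \<bar>t - s\<bar> + e k)" for n a b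
    unfolding I_def by (rule equi)
  define J where "J = (\<rat> \<inter> {0..S}) \<times> (UNIV :: nat set) \<times> (\<rat> :: real set) \<times> (\<rat> :: real set)"
  have "countable J" unfolding J_def by (intro countable_SIGMA countable_Int1 countable_rat) auto
  moreover have "norm (case x of (q, n, a, b) \<Rightarrow> I k q n a b) \<le> 1" if "x \<in> J" for k x
    using that P2 by (auto simp: J_def I_def intro!: lint_bound)
  ultimately obtain r where r: "strict_mono r"
    and rJ: "\<And>x. x \<in> J \<Longrightarrow> \<exists>l. (\<lambda>k. case x of (q, n, a, b) \<Rightarrow> I (r k) q n a b) \<longlonglongrightarrow> l"
    using function_convergent_subsequence[of J "\<lambda>k x. case x of (q, n, a, b) \<Rightarrow> I k q n a b" 1] by blast
  have conv_I: "convergent (\<lambda>k. I (r k) t n a b)" if t: "t \<in> {0..S}" and ab: "a \<in> \<rat>" "b \<in> \<rat>" for t n a b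
  proof -
    obtain L e where e: "e \<longlonglongrightarrow> 0" and Le: "\<And>k s t. s \<in> {0..S} \<Longrightarrow> t \<in> {0..S} \<Longrightarrow>
        \<bar>I k t n a b - I k s n a b\<bar> \<le> L * \<bar>t - s\<bar> + e k"
      using equi_I[of n a b] by blast
    have "Cauchy (\<lambda>k. I (r k) t n a b)"
    proof (rule metric_CauchyI)
      fix \<epsilon> :: real assume \<epsilon>: "0 < \<epsilon>"
      \<comment> \<open>Five errors share \<epsilon>: the passage from \<open>t\<close> to
        \<open>q\<close> for each of the two indices, the two values of \<open>e\<close>, and the
        Cauchy difference at \<open>q\<close>. The added 1 covers L = 0.\<close>
      define \<eta> where "\<eta> = \<epsilon> / (5 * (\<bar>L\<bar> + 1))"
      have \<eta>: "0 < \<eta>" using \<epsilon> by (simp add: \<eta>_def)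
      have "max 0 (t - \<eta>) < min S (t + \<eta>)" using t S \<eta> by auto
      then obtain q where q: "q \<in> \<rat>" "max 0 (t - \<eta>) < q" "q < min S (t + \<eta>)" using Rats_dense_in_real by blast
      then have qS: "q \<in> {0..S}" and tq: "\<bar>t - q\<bar> \<le> \<eta>" by auto
      have "L * \<bar>t - q\<bar> \<le> (\<bar>L\<bar> + 1) * \<eta>" using tq by (intro mult_mono) auto
      also have "\<dots> = \<epsilon> / 5" by (simp add: \<eta>_def field_simps)
      finally have Lq: "L * \<bar>t - q\<bar> \<le> \<epsilon> / 5" .
      obtain l where "(\<lambda>k. I (r k) q n a b) \<longlonglongrightarrow> l" using rJ[of "(q, n, a, b)"] q(1) qS ab by (auto simp: J_def)
      then have "Cauchy (\<lambda>k. I (r k) q n a b)" by (rule LIMSEQ_imp_Cauchy)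
      then obtain N1 where N1: "\<And>k l. k \<ge> N1 \<Longrightarrow> l \<ge> N1 \<Longrightarrow> \<bar>I (r k) q n a b - I (r l) q n a b\<bar> < \<epsilon> / 5"
        using \<epsilon> unfolding Cauchy_def dist_real_def by (meson divide_pos_pos zero_less_numeral)
      obtain N2 where N2: "\<And>k. k \<ge> N2 \<Longrightarrow> \<bar>e (r k)\<bar> < \<epsilon> / 5"
        using LIMSEQ_D[OF LIMSEQ_subseq_LIMSEQ[OF e r], of "\<epsilon> / 5"] \<epsilon> by (auto simp: o_def)
      have "dist (I (r k) t n a b) (I (r l) t n a b) < \<epsilon>" if "k \<ge> max N1 N2" "l \<ge> max N1 N2" for k l
        using Le[OF qS t, of "r k"] Le[OF qS t, of "r l"] N1[of k l] N2[of k] N2[of l] Lq that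
        unfolding dist_real_def by linarith
      then show "\<exists>M. \<forall>k\<ge>M. \<forall>l\<ge>M. dist (I (r k) t n a b) (I (r l) t n a b) < \<epsilon>" by blast
    qed
    then show ?thesis by (rule Cauchy_convergent)
  qed
  have ex: "\<exists>\<nu>. \<nu> \<in> P2 \<and> (\<forall>n. \<forall>a\<in>\<rat>. \<forall>b\<in>\<rat>. (\<lambda>k. I (r k) t n a b) \<longlonglongrightarrow> (LINT z|\<nu>. orthant_test n a b z))"
    if t: "t \<in> {0..S}" for t
  proof -
    obtain r' \<nu> where r': "strict_mono r'" and \<nu>: "\<nu> \<in> P2"
      and pc: "product_converges (\<lambda>k. \<mu> (r (r' k)) t) \<nu>"
      using second_moment_compactness[of "\<lambda>k. \<mu> (r k) t" C, OF P2[OF t] C[OF t]] by blast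
    have "(\<lambda>k. I (r k) t n a b) \<longlonglongrightarrow> (LINT z|\<nu>. orthant_test n a b z)" if ab: "a \<in> \<rat>" "b \<in> \<rat>" for n a b
    proof -
      have "(\<lambda>k. I (r (r' k)) t n a b) \<longlonglongrightarrow> (LINT z|\<nu>. orthant_test n a b z)"
        using pc_test[OF pc] by (simp only: dbl \<nu> P2[OF t] I_def)
      moreover obtain l where l: "(\<lambda>k. I (r k) t n a b) \<longlonglongrightarrow> l" using conv_I[OF t ab] by (auto simp: convergent_def)
      moreover have "(\<lambda>k. I (r (r' k)) t n a b) \<longlonglongrightarrow> l" using LIMSEQ_subseq_LIMSEQ[OF l r'] by (simp add: o_def)
      ultimately show ?thesis using LIMSEQ_unique by metis
    qed
    then show ?thesis using \<nu> by blast
  qed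
  define \<rho> where "\<rho> t = (SOME \<nu>. \<nu> \<in> P2 \<and> (\<forall>n. \<forall>a\<in>\<rat>. \<forall>b\<in>\<rat>. (\<lambda>k. I (r k) t n a b) \<longlonglongrightarrow> (LINT z|\<nu>. orthant_test n a b z)))" for t
  have \<rho>: "\<rho> t \<in> P2" and \<rho>_lim: "\<And>n a b. a \<in> \<rat> \<Longrightarrow> b \<in> \<rat> \<Longrightarrow> (\<lambda>k. I (r k) t n a b) \<longlonglongrightarrow> (LINT z|\<rho> t. orthant_test n a b z)"
    if "t \<in> {0..S}" for t
    using someI_ex[OF ex[OF that]] unfolding \<rho>_def[symmetric] by auto
  have "product_converges (\<lambda>k. \<mu> (r k) t) (\<rho> t)" if t: "t \<in> {0..S}" for t
    unfolding product_converges_def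
  proof (intro allI impI, rule LIMSEQ_subseq_criterion)
    fix H :: "real^2 \<Rightarrow> real^2 \<Rightarrow> real" and B and s :: "nat \<Rightarrow> nat"
    assume H: "continuous_on UNIV (\<lambda>p. H (fst p) (snd p))" "\<forall>z w. \<bar>H z w\<bar> \<le> B" and s: "strict_mono s"
    obtain q \<nu> where q: "strict_mono q" and \<nu>: "\<nu> \<in> P2"
      and pc: "product_converges (\<lambda>k. \<mu> (r (s (q k))) t) \<nu>"
      using second_moment_compactness[of "\<lambda>k. \<mu> (r (s k)) t" C, OF P2[OF t] C[OF t]] by blast
    have "\<nu> = \<rho> t"
    proof (rule prob_eqI_orthant_test)
      fix n a b assume ab: "a \<in> (\<rat> :: real set)" "b \<in> (\<rat> :: real set)"
      have "(\<lambda>k. I (r (s (q k))) t n a b) \<longlonglongrightarrow> (LINT z|\<nu>. orthant_test n a b z)"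
        using pc_test[OF pc] by (simp only: dbl \<nu> P2[OF t] I_def)
      moreover have "(\<lambda>k. I (r (s (q k))) t n a b) \<longlonglongrightarrow> (LINT z|\<rho> t. orthant_test n a b z)"
        using LIMSEQ_subseq_LIMSEQ[OF LIMSEQ_subseq_LIMSEQ[OF \<rho>_lim[OF t ab] s] q] by (simp add: o_def)
      ultimately show "(LINT z|\<nu>. orthant_test n a b z) = (LINT z|\<rho> t. orthant_test n a b z)"
        by (rule LIMSEQ_unique)
    qed (use \<nu> \<rho>[OF t] in \<open>auto dest: P2D\<close>)
    then show "\<exists>q. strict_mono q \<and> (\<lambda>k. LINT z|\<mu> (r (s (q k))) t. LINT w|\<mu> (r (s (q k))) t. H z w)
        \<longlonglongrightarrow> (LINT z|\<rho> t. LINT w|\<rho> t. H z w)"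
      using q pc H unfolding product_converges_def by blast
  qed
  moreover have "P2_curve S \<rho>"
    unfolding P2_curve_def
  proof (intro conjI ballI \<rho>)
    show "\<rho> \<in> measurable (restrict_space borel {0..S}) (subprob_algebra borel)"
    \<comment> \<open>Measurability in time is only required on a generating class stable under
      intersection, where the masses are limits of functions continuous in time.\<close>
    proof (rule measurable_subprob_algebra_generated[OF sigma_rational_orthants Int_stable_rational_orthants])
      show "subprob_space (\<rho> t)" "sets (\<rho> t) = sets borel" if "t \<in> space (restrict_space borel {0..S})" for t
        using P2D[OF \<rho>[of t]] that prob_space_imp_subprob_space by (auto simp: space_restrict_space)
      show "(\<lambda>t. emeasure (\<rho> t) UNIV) \<in> borel_measurable (restrict_space borel {0..S})"
      proof (rule measurable_cong[THEN iffD1, of _ "\<lambda>_. 1"])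
        show "1 = emeasure (\<rho> t) UNIV" if "t \<in> space (restrict_space borel {0..S})" for t
        proof -
          have "\<rho> t \<in> P2" using \<rho>[of t] that by (simp add: space_restrict_space)
          from prob_space.emeasure_space_1[OF P2D(1)[OF this]] sets_eq_imp_space_eq[OF P2D(2)[OF this]]
          show ?thesis by simp
        qed
      qed simp
      fix A assume "A \<in> rational_orthants"
      then obtain a b where ab: "a \<in> \<rat>" "b \<in> \<rat>" "A = orthant a b" by (auto simp: rational_orthants_def)
      have "(\<lambda>t. LINT z|\<rho> t. orthant_test n a b z) \<in> borel_measurable (restrict_space borel {0..S})" for n
      proof (rule borel_measurable_continuous_on_restrict)
        obtain L e where e: "e \<longlonglongrightarrow> 0" and Le: "\<And>k s t. s \<in> {0..S} \<Longrightarrow> t \<in> {0..S} \<Longrightarrow>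
            \<bar>I k t n a b - I k s n a b\<bar> \<le> L * \<bar>t - s\<bar> + e k"
          using equi_I[of n a b] by blast
        have "(max L 0)-lipschitz_on {0..S} (\<lambda>t. LINT z|\<rho> t. orthant_test n a b z)"
        proof (rule lipschitz_onI)
          fix t s assume ts: "t \<in> {0..S}" "s \<in> {0..S}"
          have "\<bar>(LINT z|\<rho> t. orthant_test n a b z) - (LINT z|\<rho> s. orthant_test n a b z)\<bar> \<le> L * \<bar>t - s\<bar> + 0"
          proof (rule LIMSEQ_le)
            show "(\<lambda>k. \<bar>I (r k) t n a b - I (r k) s n a b\<bar>) \<longlonglongrightarrow>
                \<bar>(LINT z|\<rho> t. orthant_test n a b z) - (LINT z|\<rho> s. orthant_test n a b z)\<bar>"
              by (intro tendsto_intros \<rho>_lim ts ab)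
            show "(\<lambda>k. L * \<bar>t - s\<bar> + e (r k)) \<longlonglongrightarrow> L * \<bar>t - s\<bar> + 0"
              using LIMSEQ_subseq_LIMSEQ[OF e r] by (intro tendsto_intros) (simp add: o_def)
          qed (use Le ts in auto)
          also have "L * \<bar>t - s\<bar> + 0 \<le> max L 0 * \<bar>t - s\<bar>" by (simp add: mult_right_mono)
          finally show "dist (LINT z|\<rho> t. orthant_test n a b z) (LINT z|\<rho> s. orthant_test n a b z) \<le> max L 0 * dist t s"
            by (simp add: dist_real_def)
        qed simp
        then show "continuous_on {0..S} (\<lambda>t. LINT z|\<rho> t. orthant_test n a b z)" by (rule lipschitz_on_continuous_on)
      qed
      then have "(\<lambda>t. measure (\<rho> t) A) \<in> borel_measurable (restrict_space borel {0..S})"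
      proof (rule borel_measurable_LIMSEQ_real[rotated])
        show "(\<lambda>n. LINT z|\<rho> t. orthant_test n a b z) \<longlonglongrightarrow> measure (\<rho> t) A" if "t \<in> space (restrict_space borel {0..S})" for t
        proof -
          have "\<rho> t \<in> P2" using \<rho>[of t] that by (simp add: space_restrict_space)
          then show ?thesis unfolding ab(3) by (intro orthant_test_tendsto P2D)
        qed
      qed
      then have "(\<lambda>t. ennreal (measure (\<rho> t) A)) \<in> borel_measurable (restrict_space borel {0..S})" by simp
      then show "(\<lambda>t. emeasure (\<rho> t) A) \<in> borel_measurable (restrict_space borel {0..S})"
      proof (rule measurable_cong[THEN iffD1, rotated])
        show "ennreal (measure (\<rho> t) A) = emeasure (\<rho> t) A" if "t \<in> space (restrict_space borel {0..S})" for t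
        proof -
          have "\<rho> t \<in> P2" using \<rho>[of t] that by (simp add: space_restrict_space)
          then interpret prob_space "\<rho> t" by (rule P2D)
          show ?thesis by (simp add: emeasure_eq_measure)
        qed
      qed
    qed (auto simp: rational_orthants_def)
  qed
  ultimately show ?thesis using r by blast
qed

section \<open>Piecewise constant densities\<close>

definition pt :: "real \<Rightarrow> real \<Rightarrow> real^2" where
  "pt a b = (\<chi> m. if m = 1 then a else b)"

lemma pt_nth [simp]: "pt a b $ 1 = a" "pt a b $ 2 = b"
  by (simp_all add: pt_def)

lemma norm_real2_power2: "(norm (z :: real^2))\<^sup>2 = (z $ 1)\<^sup>2 + (z $ 2)\<^sup>2"
  unfolding power2_norm_eq_inner inner_vec_def sum_2 by (simp add: power2_eq_square)

lemma norm_real2_le: "norm (z :: real^2) \<le> \<bar>z $ 1\<bar> + \<bar>z $ 2\<bar>"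
  using norm_le_l1_cart[of z] by (simp add: sum_2)

lemma cell_iff:
  assumes "0 < dx" "0 < dy"
  shows "z \<in> cell dx dy i j \<longleftrightarrow> \<lfloor>z $ 1 / dx\<rfloor> = i \<and> \<lfloor>z $ 2 / dy\<rfloor> = j"
  using assms by (auto simp: cell_def floor_eq_iff field_simps)

lemma cell_borel [measurable]: "cell dx dy i j \<in> sets borel"
  unfolding cell_def by measurable

lemma emeasure_cell:
  assumes "0 < dx" "0 < dy"
  shows "emeasure lborel (cell dx dy i j) = ennreal (dx * dy)"
proof -
  let ?a = "pt (of_int i * dx) (of_int j * dy)" and ?b = "pt (of_int (i + 1) * dx) (of_int (j + 1) * dy)"
  have le: "?a $ m \<le> ?b $ m" for m using assms exhaust_2[of m] by (auto simp: algebra_simps)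
  have "cbox ?a ?b \<noteq> {}" using le by (simp add: interval_ne_empty_cart)
  then have "measure lborel (cbox ?a ?b) = (\<Prod>m\<in>UNIV. ?b $ m - ?a $ m)" by (rule content_cbox_cart)
  also have "\<dots> = dx * dy" by (simp add: UNIV_2 algebra_simps)
  finally have c: "emeasure lborel (cbox ?a ?b) = ennreal (dx * dy)"
    using emeasure_eq_ennreal_measure[of lborel "cbox ?a ?b"] emeasure_lborel_cbox_finite[of ?a ?b] by simp
  have b: "emeasure lborel (box ?a ?b) = emeasure lborel (cbox ?a ?b)"
    by (simp add: emeasure_lborel_cbox_eq emeasure_lborel_box_eq)
  have "emeasure lborel (cell dx dy i j) \<le> emeasure lborel (cbox ?a ?b)"
    by (rule emeasure_mono) (auto simp: cell_def mem_box_cart forall_2)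
  moreover have "emeasure lborel (box ?a ?b) \<le> emeasure lborel (cell dx dy i j)"
    by (rule emeasure_mono) (auto simp: cell_def mem_box_cart forall_2)
  ultimately show ?thesis using b c by (simp add: antisym)
qed

lemma measure_cell: "0 < dx \<Longrightarrow> 0 < dy \<Longrightarrow> measure lborel (cell dx dy i j) = dx * dy"
  by (simp add: measure_def emeasure_cell)

lemma cell_integrable:
  fixes h :: "real^2 \<Rightarrow> real"
  assumes d: "0 < dx" "0 < dy" and h [measurable]: "h \<in> borel_measurable borel"
    and B: "\<And>z. z \<in> cell dx dy i j \<Longrightarrow> \<bar>h z\<bar> \<le> B"
  shows "set_integrable lborel (cell dx dy i j) h"
    "\<bar>LINT z:cell dx dy i j|lborel. h z\<bar> \<le> dx * dy * B"
proof -
  have c: "integrable lborel (\<lambda>z. indicator (cell dx dy i j) z * B)"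
    using d by (intro integrable_mult_left integrable_real_indicator) (auto simp: emeasure_cell)
  show i: "set_integrable lborel (cell dx dy i j) h"
    unfolding set_integrable_def
    by (rule Bochner_Integration.integrable_bound[OF c]) (auto intro!: AE_I2 simp: indicator_def dest!: B)
  have "\<bar>LINT z:cell dx dy i j|lborel. h z\<bar> \<le> (LINT z|lborel. \<bar>indicator (cell dx dy i j) z *\<^sub>R h z\<bar>)"
    unfolding set_lebesgue_integral_def by (rule integral_abs_bound)
  also have "\<dots> \<le> (LINT z|lborel. indicator (cell dx dy i j) z * B)"
    using i c B unfolding set_integrable_def
    by (intro integral_mono) (auto simp: indicator_def)
  also have "\<dots> = dx * dy * B" using d by (simp add: measure_cell)
  finally show "\<bar>LINT z:cell dx dy i j|lborel. h z\<bar> \<le> dx * dy * B" .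
qed

lemma cell_integral_shift:
  fixes h :: "real^2 \<Rightarrow> real"
  assumes [measurable]: "h \<in> borel_measurable borel"
  shows "(LINT z:cell dx dy (i + a) (j + b)|lborel. h z)
    = (LINT z:cell dx dy i j|lborel. h (z + pt (of_int a * dx) (of_int b * dy)))"
proof -
  let ?c = "pt (of_int a * dx) (of_int b * dy)"
  have "(LINT z:cell dx dy (i + a) (j + b)|lborel. h z)
      = (LINT z|distr lborel borel ((+) ?c). indicator (cell dx dy (i + a) (j + b)) z *\<^sub>R h z)"
    by (simp only: set_lebesgue_integral_def lborel_distr_plus)
  also have "\<dots> = (LINT z|lborel. indicator (cell dx dy (i + a) (j + b)) (?c + z) *\<^sub>R h (?c + z))"
    by (rule integral_distr) auto
  also have "\<dots> = (LINT z|lborel. indicator (cell dx dy i j) z *\<^sub>R h (z + ?c))"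
    by (intro Bochner_Integration.integral_cong refl)
      (auto simp: indicator_def cell_def add.commute algebra_simps)
  finally show ?thesis by (simp only: set_lebesgue_integral_def)
qed

text \<open>Rounding down the scaled coordinates finds the cell of a point
  (\<open>cell_iff\<close>), so the density is a closed expression and not a sum of
  indicators.\<close>

definition grid_measure :: "real \<Rightarrow> real \<Rightarrow> (int \<Rightarrow> int \<Rightarrow> real) \<Rightarrow> (real^2) measure" where
  "grid_measure dx dy \<rho> = density lborel (\<lambda>z. ennreal (\<rho> \<lfloor>z $ 1 / dx\<rfloor> \<lfloor>z $ 2 / dy\<rfloor>))"

lemma grid_fun_measurable [measurable]:
  "(\<lambda>z :: real^2. (\<rho> :: int \<Rightarrow> int \<Rightarrow> real) \<lfloor>z $ 1 / dx\<rfloor> \<lfloor>z $ 2 / dy\<rfloor>) \<in> borel_measurable borel"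
proof -
  have "(\<lambda>z :: real^2. (\<lfloor>z $ 1 / dx\<rfloor>, \<lfloor>z $ 2 / dy\<rfloor>)) \<in> measurable borel (count_space UNIV)"
    by measurable
  then show ?thesis
    using measurable_compose[of "\<lambda>z :: real^2. (\<lfloor>z $ 1 / dx\<rfloor>, \<lfloor>z $ 2 / dy\<rfloor>)" borel "count_space UNIV"
        "\<lambda>(i, j). \<rho> i j" borel] by simp
qed

lemma sets_grid_measure [measurable_cong]: "sets (grid_measure dx dy \<rho>) = sets borel"
  by (simp add: grid_measure_def)

lemma space_grid_measure [simp]: "space (grid_measure dx dy \<rho>) = UNIV"
  by (simp add: grid_measure_def)

locale grid_density =
  fixes dx dy :: real and \<rho> :: "int \<Rightarrow> int \<Rightarrow> real"
  assumes dx: "0 < dx" and dy: "0 < dy" and \<rho>: "gint \<rho>" and \<rho>_nonneg: "\<And>i j. 0 \<le> \<rho> i j"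
    and mass: "dx * dy * gsum \<rho> = 1"
begin

text \<open>Fubini for Lebesgue measure and the counting measure on index pairs. The bound
  \<open>B i j\<close> may grow with the cell, as the second moment requires.\<close>

lemma grid_integral:
  fixes h :: "real^2 \<Rightarrow> real"
  assumes h [measurable]: "h \<in> borel_measurable borel"
    and B: "gint (\<lambda>i j. \<rho> i j * B i j)" and hB: "\<And>i j z. z \<in> cell dx dy i j \<Longrightarrow> \<bar>h z\<bar> \<le> B i j"
  shows "integrable (grid_measure dx dy \<rho>) h"
    and "gint (\<lambda>i j. \<rho> i j * (LINT z:cell dx dy i j|lborel. h z))"
    and "(LINT z|grid_measure dx dy \<rho>. h z) = gsum (\<lambda>i j. \<rho> i j * (LINT z:cell dx dy i j|lborel. h z))"
proof -
  let ?N = "count_space (UNIV :: (int \<times> int) set)"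
  let ?L = "lborel :: (real^2) measure"
  define f where "f p z = \<rho> (fst p) (snd p) * (indicator (cell dx dy (fst p) (snd p)) z * h z)" for p z
  interpret N: sigma_finite_measure ?N by (rule sigma_finite_measure_count_space_countable) simp
  interpret P: pair_sigma_finite ?N ?L ..
  have fm [measurable]: "(\<lambda>x. f (fst x) (snd x)) \<in> borel_measurable (?N \<Otimes>\<^sub>M ?L)"
  proof -
    have "(\<lambda>(p, z). f p z) \<in> borel_measurable (?N \<Otimes>\<^sub>M ?L)"
      by (rule measurable_pair_measure_countable1) (auto simp: f_def)
    then show ?thesis by (simp add: case_prod_beta')
  qed
  have int_p: "integrable lborel (f p)" for p
    using cell_integrable(1)[OF dx dy h hB, of "fst p" "snd p"]
    unfolding f_def set_integrable_def by (intro integrable_mult_right) simp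
  have abs_p: "\<bar>LINT z|lborel. \<bar>f p z\<bar>\<bar> \<le> dx * dy * (\<rho> (fst p) (snd p) * B (fst p) (snd p))" for p
  proof -
    have "(LINT z|lborel. \<bar>f p z\<bar>) = \<rho> (fst p) (snd p) * (LINT z:cell dx dy (fst p) (snd p)|lborel. \<bar>h z\<bar>)"
      by (simp add: f_def abs_mult \<rho>_nonneg set_lebesgue_integral_def)
    also have "\<bar>\<dots>\<bar> \<le> \<rho> (fst p) (snd p) * (dx * dy * B (fst p) (snd p))"
      unfolding abs_mult using cell_integrable(2)[OF dx dy, of "\<lambda>z. \<bar>h z\<bar>" "fst p" "snd p" "B (fst p) (snd p)"] hB
      by (intro mult_mono) (auto simp: \<rho>_nonneg)
    finally show ?thesis by (simp add: mult_ac)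
  qed
  have count_int: "integrable ?N g \<longleftrightarrow> gint (\<lambda>i j. g (i, j))" for g :: "int \<times> int \<Rightarrow> real"
    using abs_summable_equivalent[of g UNIV]
    by (simp add: gint_abs_iff Infinite_Set_Sum.abs_summable_on_def)
  have count_sum: "integral\<^sup>L ?N g = gsum (\<lambda>i j. g (i, j))" if "gint (\<lambda>i j. g (i, j))" for g :: "int \<times> int \<Rightarrow> real"
    using infsetsum_infsum[of g UNIV] that abs_summable_equivalent[of g UNIV]
    by (simp add: gint_abs_iff infsetsum_def gsum_def)
  have F: "integrable (?N \<Otimes>\<^sub>M ?L) (\<lambda>x. f (fst x) (snd x))"
  proof (rule P.Fubini_integrable[OF fm])
    have "gint (\<lambda>i j. LINT z|lborel. \<bar>f (i, j) z\<bar>)"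
      by (rule gint_bound[OF gint_cmult[OF B, of "dx * dy"]]) (use abs_p in force)
    then show "integrable ?N (\<lambda>p. LINT z|lborel. norm (f (fst (p, z)) (snd (p, z))))"
      by (simp add: count_int)
    show "AE p in ?N. integrable lborel (\<lambda>z. f (fst (p, z)) (snd (p, z)))"
      using int_p by (simp add: AE_count_space)
  qed
  \<comment> \<open>For fixed \<open>z\<close> only the cell that contains \<open>z\<close>
    contributes to the sum.\<close>
  have eval: "integral\<^sup>L ?N (\<lambda>p. f p z) = \<rho> \<lfloor>z $ 1 / dx\<rfloor> \<lfloor>z $ 2 / dy\<rfloor> * h z" for z
  proof -
    let ?p = "(\<lfloor>z $ 1 / dx\<rfloor>, \<lfloor>z $ 2 / dy\<rfloor>)"
    have f0: "f p z = 0" if "p \<noteq> ?p" for p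
      using that by (cases p) (auto simp: f_def indicator_def cell_iff[OF dx dy])
    have fp: "f ?p z = \<rho> \<lfloor>z $ 1 / dx\<rfloor> \<lfloor>z $ 2 / dy\<rfloor> * h z"
      by (simp add: f_def indicator_def cell_iff[OF dx dy])
    have "{p \<in> UNIV. f p z \<noteq> 0} \<subseteq> {?p}" using f0 by blast
    then have "integral\<^sup>L ?N (\<lambda>p. f p z) = (\<Sum>p | p \<in> UNIV \<and> f p z \<noteq> 0. f p z)"
      by (intro lebesgue_integral_count_space_finite_support) (auto intro: finite_subset)
    also have "\<dots> = (\<Sum>p\<in>{?p}. f p z)"
      by (rule sum.mono_neutral_left) (use f0 in auto)
    finally show ?thesis by (simp add: fp)
  qed
  have int_eq: "integral\<^sup>L lborel (f (i, j)) = \<rho> i j * (LINT z:cell dx dy i j|lborel. h z)" for i j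
    by (simp add: f_def[abs_def] set_lebesgue_integral_def)
  have "integrable ?N (\<lambda>p. integral\<^sup>L lborel (f p))" using P.integrable_fst'[OF F] by simp
  then show g: "gint (\<lambda>i j. \<rho> i j * (LINT z:cell dx dy i j|lborel. h z))"
    by (simp add: count_int int_eq)
  have "integrable lborel (\<lambda>z. integral\<^sup>L ?N (\<lambda>p. f p z))"
    using P.integrable_snd[of f] F by (simp add: case_prod_beta')
  then have "integrable lborel (\<lambda>z. \<rho> \<lfloor>z $ 1 / dx\<rfloor> \<lfloor>z $ 2 / dy\<rfloor> * h z)" by (simp add: eval)
  then show "integrable (grid_measure dx dy \<rho>) h"
    unfolding grid_measure_def by (subst integrable_density) (auto simp: \<rho>_nonneg)
  have "(LINT z|grid_measure dx dy \<rho>. h z) = (LINT z|lborel. \<rho> \<lfloor>z $ 1 / dx\<rfloor> \<lfloor>z $ 2 / dy\<rfloor> * h z)"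
    unfolding grid_measure_def by (subst integral_density) (auto simp: \<rho>_nonneg)
  also have "\<dots> = (LINT z|lborel. integral\<^sup>L ?N (\<lambda>p. f p z))" by (simp add: eval)
  also have "\<dots> = (LINT p|?N. LINT z|lborel. f p z)"
    using P.Fubini_integral[of f] F by (simp add: case_prod_beta')
  also have "\<dots> = gsum (\<lambda>i j. \<rho> i j * (LINT z:cell dx dy i j|lborel. h z))"
    using g by (subst count_sum) (simp_all add: int_eq)
  finally show "(LINT z|grid_measure dx dy \<rho>. h z) = gsum (\<lambda>i j. \<rho> i j * (LINT z:cell dx dy i j|lborel. h z))" .
qed

lemma grid_integral_bounded:
  fixes h :: "real^2 \<Rightarrow> real"
  assumes h: "h \<in> borel_measurable borel" and B: "\<And>z. \<bar>h z\<bar> \<le> B"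
  shows "integrable (grid_measure dx dy \<rho>) h"
    and "gint (\<lambda>i j. \<rho> i j * (LINT z:cell dx dy i j|lborel. h z))"
    and "(LINT z|grid_measure dx dy \<rho>. h z) = gsum (\<lambda>i j. \<rho> i j * (LINT z:cell dx dy i j|lborel. h z))"
proof -
  have "gint (\<lambda>i j. \<rho> i j * B)" using gint_cmult[OF \<rho>, of B] by (simp add: mult.commute)
  note g = grid_integral[OF h this B]
  show "integrable (grid_measure dx dy \<rho>) h" by (rule g(1))
  show "gint (\<lambda>i j. \<rho> i j * (LINT z:cell dx dy i j|lborel. h z))" by (rule g(2))
  show "(LINT z|grid_measure dx dy \<rho>. h z) = gsum (\<lambda>i j. \<rho> i j * (LINT z:cell dx dy i j|lborel. h z))"
    by (rule g(3))
qed

lemma prob_space_grid_measure: "prob_space (grid_measure dx dy \<rho>)"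
proof (rule prob_spaceI)
  have one: "(LINT z:cell dx dy i j|lborel. (1 :: real)) = dx * dy" for i j
    using dx dy by (simp add: set_lebesgue_integral_def measure_cell)
  have "integrable (grid_measure dx dy \<rho>) (\<lambda>_. 1 :: real)"
    and i: "(LINT z|grid_measure dx dy \<rho>. 1 :: real) = gsum (\<lambda>i j. \<rho> i j * (dx * dy))"
    using grid_integral_bounded[of "\<lambda>_. 1" 1] by (simp_all add: one)
  then have "emeasure (grid_measure dx dy \<rho>) UNIV = ennreal (LINT z|grid_measure dx dy \<rho>. 1)"
    using nn_integral_eq_integral[of "grid_measure dx dy \<rho>" "\<lambda>_. 1"] by simp
  also have "gsum (\<lambda>i j. \<rho> i j * (dx * dy)) = 1"
    using gsum_cmult[of "dx * dy" \<rho>] mass by (simp add: mult.commute)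
  then have "(LINT z|grid_measure dx dy \<rho>. 1 :: real) = 1" using i by simp
  finally show "emeasure (grid_measure dx dy \<rho>) (space (grid_measure dx dy \<rho>)) = 1" by simp
qed

lemma grid_second_moment:
  assumes V: "gint (\<lambda>i j. \<rho> i j * ((real_of_int i * dx)\<^sup>2 + (real_of_int j * dy)\<^sup>2))"
  shows "grid_measure dx dy \<rho> \<in> P2"
    and "(LINT z|grid_measure dx dy \<rho>. (norm z)\<^sup>2) \<le> 2 * grid_moment dx dy \<rho> + 2 * (dx\<^sup>2 + dy\<^sup>2)"
proof -
  define B where "B i j = 2 * ((real_of_int i * dx)\<^sup>2 + (real_of_int j * dy)\<^sup>2) + 2 * (dx\<^sup>2 + dy\<^sup>2)" for i j
  have gB: "gint (\<lambda>i j. \<rho> i j * B i j)"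
  proof -
    have "(\<lambda>i j. \<rho> i j * B i j) = (\<lambda>i j. 2 * (\<rho> i j * ((real_of_int i * dx)\<^sup>2 + (real_of_int j * dy)\<^sup>2))
        + (2 * (dx\<^sup>2 + dy\<^sup>2)) * \<rho> i j)"
      by (intro ext) (simp add: B_def algebra_simps)
    then show ?thesis by (simp only:) (intro gint_add gint_cmult V \<rho>)
  qed
  have sq: "x\<^sup>2 \<le> 2 * a\<^sup>2 + 2 * d\<^sup>2" if "a \<le> x" "x < a + d" for x a d :: real
  proof -
    have "x = a + (x - a)" by simp
    also have "(a + (x - a))\<^sup>2 \<le> 2 * a\<^sup>2 + 2 * (x - a)\<^sup>2"
      using sum_squares_bound[of a "x - a"] by (simp only: power2_sum)
    also have "(x - a)\<^sup>2 \<le> d\<^sup>2" using that by (intro power_mono) auto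
    finally show ?thesis by simp
  qed
  have hB: "\<bar>(norm z)\<^sup>2\<bar> \<le> B i j" if "z \<in> cell dx dy i j" for i j z
    using that sq[of "real_of_int i * dx" "z $ 1" dx] sq[of "real_of_int j * dy" "z $ 2" dy]
    by (simp add: cell_def norm_real2_power2 B_def algebra_simps)
  note g = grid_integral[where h = "\<lambda>z. (norm z)\<^sup>2", OF _ gB hB, simplified]
  show "grid_measure dx dy \<rho> \<in> P2"
    using prob_space_grid_measure g(1) by (simp add: P2_def sets_grid_measure)
  have "(LINT z|grid_measure dx dy \<rho>. (norm z)\<^sup>2) \<le> gsum (\<lambda>i j. dx * dy * (\<rho> i j * B i j))"
    unfolding g(3)
  proof (rule gsum_mono[OF g(2) gint_cmult[OF gB]])
    fix i j
    have "(LINT z:cell dx dy i j|lborel. (norm z)\<^sup>2) \<le> dx * dy * B i j"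
      using cell_integrable(2)[where h = "\<lambda>z. (norm z)\<^sup>2", OF dx dy _ hB, of i j] by (auto simp: abs_le_iff)
    then have "\<rho> i j * (LINT z:cell dx dy i j|lborel. (norm z)\<^sup>2) \<le> \<rho> i j * (dx * dy * B i j)"
      by (rule mult_left_mono) (rule \<rho>_nonneg)
    then show "\<rho> i j * (LINT z:cell dx dy i j|lborel. (norm z)\<^sup>2) \<le> dx * dy * (\<rho> i j * B i j)"
      by (simp only: mult_ac)
  qed
  also have "\<dots> = gsum (\<lambda>i j. (2 * (dx * dy)) * (\<rho> i j * ((real_of_int i * dx)\<^sup>2 + (real_of_int j * dy)\<^sup>2))
      + (2 * (dx\<^sup>2 + dy\<^sup>2) * (dx * dy)) * \<rho> i j)"
    by (intro arg_cong[where f = gsum] ext) (simp add: B_def algebra_simps)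
  also have "\<dots> = 2 * grid_moment dx dy \<rho> + 2 * (dx\<^sup>2 + dy\<^sup>2) * (dx * dy * gsum \<rho>)"
    by (simp only: gsum_add gsum_cmult gint_cmult V \<rho>) (simp add: grid_moment_def)
  finally show "(LINT z|grid_measure dx dy \<rho>. (norm z)\<^sup>2) \<le> 2 * grid_moment dx dy \<rho> + 2 * (dx\<^sup>2 + dy\<^sup>2)"
    by (simp add: mass)
qed

end

section \<open>Consistency of one step against functions on the plane\<close>

lemma abs_sum4_le:
  fixes x :: real
  assumes "x = a + b + c + d" "\<bar>a\<bar> \<le> A" "\<bar>b\<bar> \<le> B" "\<bar>c\<bar> \<le> C" "\<bar>d\<bar> \<le> D" "T = A + B + C + D"
  shows "\<bar>x\<bar> \<le> T"
  using assms by linarith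

context upwind_step
begin

lemma grid_density: "grid_density dx dy \<rho>"
  by (rule grid_density.intro[OF dx dy \<rho> \<rho>_nonneg mass])

lemma grid_density_new: "grid_density dx dy new"
  by (rule grid_density.intro[OF dx dy new_gint new_nonneg new_mass])

text \<open>Neighbouring cells are translates of each other, so the generator applied to cell
  integrals is the cell integral of the generator applied to translates. The error can then be
  estimated at each point of a single cell.\<close>

lemma gen_cell_integral:
  fixes \<phi> :: "real^2 \<Rightarrow> real"
  assumes \<phi> [measurable]: "\<phi> \<in> borel_measurable borel" and B: "\<And>z. \<bar>\<phi> z\<bar> \<le> B"
  shows "gen (\<lambda>i j. LINT z:cell dx dy i j|lborel. \<phi> z) i j
    = (LINT z:cell dx dy i j|lborel.
        gen (\<lambda>i' j'. \<phi> (z + pt (real_of_int (i' - i) * dx) (real_of_int (j' - j) * dy))) i j)"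
proof -
  let ?C = "cell dx dy i j"
  have int: "set_integrable lborel ?C (\<lambda>z. \<phi> (z + c))" for c
    by (rule cell_integrable(1)[OF dx dy]) (use B in auto)
  have int0: "set_integrable lborel ?C \<phi>" using int[of 0] by simp
  have sh: "(LINT z:cell dx dy (i + a) (j + b)|lborel. \<phi> z)
      = (LINT z:?C|lborel. \<phi> (z + pt (real_of_int a * dx) (real_of_int b * dy)))" for a b
    by (rule cell_integral_shift) simp
  have z0: "pt 0 0 = 0" by (simp add: vec_eq_iff pt_def)
  have d: "set_integrable lborel ?C (\<lambda>z. p * (\<phi> (z + c) - \<phi> z))" for p c
    by (intro set_integrable_mult_right set_integral_diff int int0)
  have e: "(LINT z:?C|lborel. p * (\<phi> (z + c) - \<phi> z))
      = p * ((LINT z:?C|lborel. \<phi> (z + c)) - (LINT z:?C|lborel. \<phi> z))" for p c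
    by (simp add: set_integral_diff int int0)
  have "(LINT z:?C|lborel.
        gen (\<lambda>i' j'. \<phi> (z + pt (real_of_int (i' - i) * dx) (real_of_int (j' - j) * dy))) i j)
    = (LINT z:?C|lborel. pE i j * (\<phi> (z + pt dx 0) - \<phi> z) + pW i j * (\<phi> (z + pt (- dx) 0) - \<phi> z)
        + pN i j * (\<phi> (z + pt 0 dy) - \<phi> z) + pS i j * (\<phi> (z + pt 0 (- dy)) - \<phi> z))"
    by (simp add: gen_def z0)
  also have "\<dots> = pE i j * ((LINT z:?C|lborel. \<phi> (z + pt dx 0)) - (LINT z:?C|lborel. \<phi> z))
      + pW i j * ((LINT z:?C|lborel. \<phi> (z + pt (- dx) 0)) - (LINT z:?C|lborel. \<phi> z))
      + pN i j * ((LINT z:?C|lborel. \<phi> (z + pt 0 dy)) - (LINT z:?C|lborel. \<phi> z))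
      + pS i j * ((LINT z:?C|lborel. \<phi> (z + pt 0 (- dy))) - (LINT z:?C|lborel. \<phi> z))"
    by (simp only: set_integral_add d e)
  also have "\<dots> = gen (\<lambda>i j. LINT z:cell dx dy i j|lborel. \<phi> z) i j"
    using sh[of 1 0] sh[of "-1" 0] sh[of 0 1] sh[of 0 "-1"] by (simp add: gen_def)
  finally show ?thesis by simp
qed

text \<open>Reduces the weak error to a bound inside one cell. After pairing with the density,
  \<open>E0\<close> meets mass one, whereas the part proportional to \<rho>, which comes from the
  quadratic diffusion, meets another \<rho> and becomes the sum of squares controlled by the
  dissipation.\<close>

lemma one_step_consistency:
  fixes \<phi> W :: "real^2 \<Rightarrow> real"
  assumes \<phi> [measurable]: "\<phi> \<in> borel_measurable borel" and B: "\<And>z. \<bar>\<phi> z\<bar> \<le> B"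
    and W [measurable]: "W \<in> borel_measurable borel" and BW: "\<And>z. \<bar>W z\<bar> \<le> B'"
    and err: "\<And>i j z. z \<in> cell dx dy i j \<Longrightarrow>
      \<bar>gen (\<lambda>i' j'. \<phi> (z + pt (real_of_int (i' - i) * dx) (real_of_int (j' - j) * dy))) i j - W z\<bar>
      \<le> E0 + E1 * \<rho> i j"
  shows "\<bar>(LINT z|grid_measure dx dy new. \<phi> z) - (LINT z|grid_measure dx dy \<rho>. \<phi> z)
    - (LINT z|grid_measure dx dy \<rho>. W z)\<bar> \<le> E0 + E1 * grid_l2 dx dy \<rho>"
proof -
  interpret g: grid_density dx dy \<rho> by (rule grid_density)
  interpret n: grid_density dx dy new by (rule grid_density_new)
  let ?\<Psi> = "\<lambda>i j. LINT z:cell dx dy i j|lborel. \<phi> z"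
  let ?W = "\<lambda>i j. LINT z:cell dx dy i j|lborel. W z"
  have \<Psi>B: "\<bar>?\<Psi> i j\<bar> \<le> dx * dy * B" for i j
    by (rule cell_integrable(2)[OF dx dy \<phi>]) (rule B)
  note pair = new_pairing_bounded[OF \<Psi>B]
  have gW: "gint (\<lambda>i j. \<rho> i j * ?W i j)" by (rule g.grid_integral_bounded(2)[OF W BW])
  have "(LINT z|grid_measure dx dy new. \<phi> z) - (LINT z|grid_measure dx dy \<rho>. \<phi> z)
    - (LINT z|grid_measure dx dy \<rho>. W z) = gsum (\<lambda>i j. \<rho> i j * gen ?\<Psi> i j) - gsum (\<lambda>i j. \<rho> i j * ?W i j)"
    unfolding g.grid_integral_bounded(3)[OF \<phi> B] n.grid_integral_bounded(3)[OF \<phi> B]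
      g.grid_integral_bounded(3)[OF W BW] pair(3) by simp
  also have "\<dots> = gsum (\<lambda>i j. \<rho> i j * gen ?\<Psi> i j - \<rho> i j * ?W i j)"
    by (rule gsum_diff[symmetric]) (rule pair(2) gW)+
  finally have eq: "(LINT z|grid_measure dx dy new. \<phi> z) - (LINT z|grid_measure dx dy \<rho>. \<phi> z)
    - (LINT z|grid_measure dx dy \<rho>. W z) = gsum (\<lambda>i j. \<rho> i j * gen ?\<Psi> i j - \<rho> i j * ?W i j)" .
  have "\<bar>gsum (\<lambda>i j. \<rho> i j * gen ?\<Psi> i j - \<rho> i j * ?W i j)\<bar> \<le> gsum (\<lambda>i j. (dx * dy * E0) * \<rho> i j + (dx * dy * E1) * (\<rho> i j)\<^sup>2)"
  proof (rule abs_gsum_le)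
    show "gint (\<lambda>i j. (dx * dy * E0) * \<rho> i j + (dx * dy * E1) * (\<rho> i j)\<^sup>2)"
      by (intro gint_add gint_cmult gint_power2 \<rho>)
    fix i j
    let ?\<gamma> = "\<lambda>z. gen (\<lambda>i' j'. \<phi> (z + pt (real_of_int (i' - i) * dx) (real_of_int (j' - j) * dy))) i j"
    have m [measurable]: "?\<gamma> \<in> borel_measurable borel" unfolding gen_def by measurable
    have i1: "set_integrable lborel (cell dx dy i j) ?\<gamma>"
    proof (rule cell_integrable(1)[OF dx dy m])
      fix z assume "z \<in> cell dx dy i j"
      then show "\<bar>?\<gamma> z\<bar> \<le> E0 + E1 * \<rho> i j + B'" using err[of z i j] BW[of z] by linarith
    qed
    have i2: "set_integrable lborel (cell dx dy i j) W" by (rule cell_integrable(1)[OF dx dy W BW])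
    have "gen ?\<Psi> i j - ?W i j = (LINT z:cell dx dy i j|lborel. ?\<gamma> z - W z)"
      unfolding gen_cell_integral[OF \<phi> B] by (rule set_integral_diff(2)[OF i1 i2, symmetric])
    moreover have "\<bar>LINT z:cell dx dy i j|lborel. ?\<gamma> z - W z\<bar> \<le> dx * dy * (E0 + E1 * \<rho> i j)"
      by (rule cell_integrable(2)[OF dx dy borel_measurable_diff[OF m W] err])
    ultimately have "\<bar>gen ?\<Psi> i j - ?W i j\<bar> \<le> dx * dy * (E0 + E1 * \<rho> i j)" by (simp only:)
    then have "\<rho> i j * \<bar>gen ?\<Psi> i j - ?W i j\<bar> \<le> \<rho> i j * (dx * dy * (E0 + E1 * \<rho> i j))"
      by (rule mult_left_mono) (rule \<rho>_nonneg)
    moreover have "\<bar>\<rho> i j * gen ?\<Psi> i j - \<rho> i j * ?W i j\<bar> = \<rho> i j * \<bar>gen ?\<Psi> i j - ?W i j\<bar>"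
      by (simp add: right_diff_distrib[symmetric] abs_mult \<rho>_nonneg)
    ultimately show "\<bar>\<rho> i j * gen ?\<Psi> i j - \<rho> i j * ?W i j\<bar>
        \<le> (dx * dy * E0) * \<rho> i j + (dx * dy * E1) * (\<rho> i j)\<^sup>2"
      by (simp add: algebra_simps power2_eq_square)
  qed
  also have "\<dots> = E0 * (dx * dy * gsum \<rho>) + E1 * grid_l2 dx dy \<rho>"
  proof -
    have "gsum (\<lambda>i j. (dx * dy * E0) * \<rho> i j + (dx * dy * E1) * (\<rho> i j)\<^sup>2)
        = gsum (\<lambda>i j. (dx * dy * E0) * \<rho> i j) + gsum (\<lambda>i j. (dx * dy * E1) * (\<rho> i j)\<^sup>2)"
      by (rule gsum_add) (intro gint_cmult gint_power2 \<rho>)+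
    also have "\<dots> = (dx * dy * E0) * gsum \<rho> + (dx * dy * E1) * gsum (\<lambda>i j. (\<rho> i j)\<^sup>2)"
      by (simp only: gsum_cmult)
    finally show ?thesis by (simp add: grid_l2_def)
  qed
  finally show ?thesis by (simp only: eq mass mult_1_right)
qed

lemma diffusion_term_bound:
  assumes d: "0 < d" "d \<le> h" and D: "\<bar>D\<bar> \<le> L * d\<^sup>2" and L: "0 \<le> L"
  shows "\<bar>(\<tau> / (2 * d) * f + \<delta> * \<tau> / (2 * d\<^sup>2) * \<rho> i j) * D\<bar> \<le> \<tau> * f * L * h / 2 + \<delta> * \<tau> * L / 2 * \<rho> i j"
proof -
  have nn: "0 \<le> \<tau> / (2 * d) * f + \<delta> * \<tau> / (2 * d\<^sup>2) * \<rho> i j"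
    using d f \<tau> \<delta> \<rho>_nonneg by simp
  have "\<bar>(\<tau> / (2 * d) * f + \<delta> * \<tau> / (2 * d\<^sup>2) * \<rho> i j) * D\<bar>
      \<le> (\<tau> / (2 * d) * f + \<delta> * \<tau> / (2 * d\<^sup>2) * \<rho> i j) * (L * d\<^sup>2)"
    unfolding abs_mult using nn D by (simp add: mult_left_mono)
  also have "\<dots> = \<tau> * f * L / 2 * d + \<delta> * \<tau> * L / 2 * \<rho> i j"
    using d by (simp add: power2_eq_square field_simps)
  also have "\<tau> * f * L / 2 * d \<le> \<tau> * f * L / 2 * h"
    using d f \<tau> L by (intro mult_left_mono) auto
  finally show ?thesis by simp
qed

text \<open>The comparison function is 0 here: the whole generator counts as error. Summed over
  steps, this is the modulus of continuity in time.\<close>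

lemma one_step_lipschitz:
  fixes \<phi> :: "real^2 \<Rightarrow> real"
  assumes \<phi>: "\<phi> \<in> borel_measurable borel" and L: "\<And>z. \<bar>\<phi> z\<bar> \<le> L"
    and L1: "\<And>z d. \<bar>\<phi> (z + pt d 0) - \<phi> z\<bar> \<le> L * \<bar>d\<bar>" "\<And>z d. \<bar>\<phi> (z + pt 0 d) - \<phi> z\<bar> \<le> L * \<bar>d\<bar>"
    and L2: "\<And>z d. \<bar>\<phi> (z + pt d 0) - 2 * \<phi> z + \<phi> (z + pt (- d) 0)\<bar> \<le> L * d\<^sup>2"
      "\<And>z d. \<bar>\<phi> (z + pt 0 d) - 2 * \<phi> z + \<phi> (z + pt 0 (- d))\<bar> \<le> L * d\<^sup>2"
  shows "\<bar>(LINT z|grid_measure dx dy new. \<phi> z) - (LINT z|grid_measure dx dy \<rho>. \<phi> z)\<bar>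
    \<le> \<tau> * f * L * (2 + max dx dy) + \<delta> * \<tau> * L * grid_l2 dx dy \<rho>"
proof -
  have L0: "0 \<le> L" using L[of 0] by linarith
  have z0: "pt 0 0 = 0" by (simp add: vec_eq_iff pt_def)
  have "\<bar>(LINT z|grid_measure dx dy new. \<phi> z) - (LINT z|grid_measure dx dy \<rho>. \<phi> z)
    - (LINT z|grid_measure dx dy \<rho>. 0)\<bar> \<le> \<tau> * f * L * (2 + max dx dy) + \<delta> * \<tau> * L * grid_l2 dx dy \<rho>"
  proof (rule one_step_consistency[where B' = 0, OF \<phi> L])
    fix i j z
    have drift: "\<bar>\<tau> / (2 * d) * (w * D + w' * D')\<bar> \<le> \<tau> * f * L"
      if d: "0 < d" and w: "\<bar>w\<bar> \<le> f" "\<bar>w'\<bar> \<le> f" and D: "\<bar>D\<bar> \<le> L * d" "\<bar>D'\<bar> \<le> L * d" for d w w' D D'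
    proof -
      have "\<bar>w * D\<bar> \<le> f * (L * d)" "\<bar>w' * D'\<bar> \<le> f * (L * d)"
        unfolding abs_mult by (intro mult_mono w D f abs_ge_zero)+
      then have "\<bar>w * D + w' * D'\<bar> \<le> 2 * (f * (L * d))" by linarith
      then have "\<tau> / (2 * d) * \<bar>w * D + w' * D'\<bar> \<le> \<tau> / (2 * d) * (2 * (f * (L * d)))"
        using d \<tau> by (intro mult_left_mono) auto
      then show ?thesis using d \<tau> by (simp add: abs_mult)
    qed
    let ?g = "\<lambda>i' j'. \<phi> (z + pt (real_of_int (i' - i) * dx) (real_of_int (j' - j) * dy))"
    have g: "?g (i + 1) j = \<phi> (z + pt dx 0)" "?g (i - 1) j = \<phi> (z + pt (- dx) 0)" "?g i j = \<phi> z"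
      "?g i (j + 1) = \<phi> (z + pt 0 dy)" "?g i (j - 1) = \<phi> (z + pt 0 (- dy))"
      by (simp_all add: z0)
    have "gen ?g i j - 0 = a_x * (u i j * (\<phi> (z + pt dx 0) - \<phi> z) + u (i - 1) j * (\<phi> z - \<phi> (z + pt (- dx) 0)))
       + a_y * (v i j * (\<phi> (z + pt 0 dy) - \<phi> z) + v i (j - 1) * (\<phi> z - \<phi> (z + pt 0 (- dy))))
       + (a_x * f + b_x * \<rho> i j) * (\<phi> (z + pt dx 0) - 2 * \<phi> z + \<phi> (z + pt (- dx) 0))
       + (a_y * f + b_y * \<rho> i j) * (\<phi> (z + pt 0 dy) - 2 * \<phi> z + \<phi> (z + pt 0 (- dy)))" (is "_ = ?A + ?B + ?C + ?D")
      unfolding gen_split g diff_0_right ..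
    moreover have "\<bar>?A\<bar> \<le> \<tau> * f * L"
      unfolding a_x_def using L1(1)[of z dx] L1(1)[of z "- dx"] dx by (intro drift u) (auto simp: abs_minus_commute)
    moreover have "\<bar>?B\<bar> \<le> \<tau> * f * L"
      unfolding a_y_def using L1(2)[of z dy] L1(2)[of z "- dy"] dy by (intro drift v) (auto simp: abs_minus_commute)
    moreover have "\<bar>?C\<bar> \<le> \<tau> * f * L * max dx dy / 2 + \<delta> * \<tau> * L / 2 * \<rho> i j"
      unfolding a_x_def b_x_def by (intro diffusion_term_bound dx L2 L0) simp
    moreover have "\<bar>?D\<bar> \<le> \<tau> * f * L * max dx dy / 2 + \<delta> * \<tau> * L / 2 * \<rho> i j"
      unfolding a_y_def b_y_def by (intro diffusion_term_bound dy L2 L0) simp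
    moreover have "\<tau> * f * L * (2 + max dx dy) + \<delta> * \<tau> * L * \<rho> i j
        = \<tau> * f * L + \<tau> * f * L + (\<tau> * f * L * max dx dy / 2 + \<delta> * \<tau> * L / 2 * \<rho> i j)
          + (\<tau> * f * L * max dx dy / 2 + \<delta> * \<tau> * L / 2 * \<rho> i j)"
      by (simp add: algebra_simps)
    ultimately show "\<bar>gen ?g i j - 0\<bar> \<le> \<tau> * f * L * (2 + max dx dy) + \<delta> * \<tau> * L * \<rho> i j"
      by (rule abs_sum4_le)
  qed simp_all
  then show ?thesis by simp
qed

text \<open>\<open>K\<close> confines the comparison of discrete and exact velocities to a
  neighbourhood of the support, where a uniform modulus of continuity is available; outside,
  generator and comparison function both vanish. Second differences are obtained by adding two
  first-order expansions, hence the constant 2 L in the diffusive terms.\<close>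

lemma one_step_gradient:
  fixes \<phi> g1 g2 U1 U2 :: "real^2 \<Rightarrow> real"
  assumes \<phi>: "\<phi> \<in> borel_measurable borel" and L: "\<And>z. \<bar>\<phi> z\<bar> \<le> L"
    and m [measurable]: "g1 \<in> borel_measurable borel" "g2 \<in> borel_measurable borel"
      "U1 \<in> borel_measurable borel" "U2 \<in> borel_measurable borel"
    and g: "\<And>z. \<bar>g1 z\<bar> \<le> L" "\<And>z. \<bar>g2 z\<bar> \<le> L"
    and U: "\<And>z. \<bar>U1 z\<bar> \<le> f" "\<And>z. \<bar>U2 z\<bar> \<le> f"
    and L1: "\<And>z d. \<bar>\<phi> (z + pt d 0) - \<phi> z - d * g1 z\<bar> \<le> L * d\<^sup>2"
      "\<And>z d. \<bar>\<phi> (z + pt 0 d) - \<phi> z - d * g2 z\<bar> \<le> L * d\<^sup>2"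
    and K: "\<And>z. z \<notin> K \<Longrightarrow> g1 z = 0 \<and> g2 z = 0 \<and>
      (\<forall>d. \<bar>d\<bar> \<le> max dx dy \<longrightarrow> \<phi> (z + pt d 0) = \<phi> z \<and> \<phi> (z + pt 0 d) = \<phi> z)"
    and \<epsilon>: "0 \<le> \<epsilon>" and near: "\<And>i j z. z \<in> cell dx dy i j \<Longrightarrow> z \<in> K \<Longrightarrow>
      \<bar>u i j - U1 z\<bar> \<le> \<epsilon> \<and> \<bar>u (i - 1) j - U1 z\<bar> \<le> \<epsilon> \<and> \<bar>v i j - U2 z\<bar> \<le> \<epsilon> \<and> \<bar>v i (j - 1) - U2 z\<bar> \<le> \<epsilon>"
  shows "\<bar>(LINT z|grid_measure dx dy new. \<phi> z) - (LINT z|grid_measure dx dy \<rho>. \<phi> z)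
      - \<tau> * (LINT z|grid_measure dx dy \<rho>. g1 z * U1 z + g2 z * U2 z)\<bar>
    \<le> \<tau> * L * (4 * f * max dx dy + 2 * \<epsilon>) + 2 * \<delta> * \<tau> * L * grid_l2 dx dy \<rho>"
proof -
  have L0: "0 \<le> L" using L[of 0] by linarith
  have z0: "pt 0 0 = 0" by (simp add: vec_eq_iff pt_def)
  have h: "dx \<le> max dx dy" "dy \<le> max dx dy" by auto
  have "\<bar>(LINT z|grid_measure dx dy new. \<phi> z) - (LINT z|grid_measure dx dy \<rho>. \<phi> z)
      - (LINT z|grid_measure dx dy \<rho>. \<tau> * (g1 z * U1 z + g2 z * U2 z))\<bar>
    \<le> \<tau> * L * (4 * f * max dx dy + 2 * \<epsilon>) + 2 * \<delta> * \<tau> * L * grid_l2 dx dy \<rho>"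
  proof (rule one_step_consistency[where B' = "\<tau> * (L * f + L * f)", OF \<phi> L])
    show "(\<lambda>z. \<tau> * (g1 z * U1 z + g2 z * U2 z)) \<in> borel_measurable borel" by measurable
    show "\<bar>\<tau> * (g1 z * U1 z + g2 z * U2 z)\<bar> \<le> \<tau> * (L * f + L * f)" for z
    proof -
      have "\<bar>g1 z * U1 z\<bar> \<le> L * f" "\<bar>g2 z * U2 z\<bar> \<le> L * f"
        unfolding abs_mult by (intro mult_mono g U L0 abs_ge_zero)+
      then have "\<bar>g1 z * U1 z + g2 z * U2 z\<bar> \<le> L * f + L * f" by linarith
      then show ?thesis using \<tau> by (simp only: abs_mult abs_of_pos mult_left_mono less_imp_le)
    qed
    fix i j z assume z: "z \<in> cell dx dy i j"
    let ?g = "\<lambda>i' j'. \<phi> (z + pt (real_of_int (i' - i) * dx) (real_of_int (j' - j) * dy))"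
    have gg: "?g (i + 1) j = \<phi> (z + pt dx 0)" "?g (i - 1) j = \<phi> (z + pt (- dx) 0)" "?g i j = \<phi> z"
      "?g i (j + 1) = \<phi> (z + pt 0 dy)" "?g i (j - 1) = \<phi> (z + pt 0 (- dy))"
      by (simp_all add: z0)
    show "\<bar>gen ?g i j - \<tau> * (g1 z * U1 z + g2 z * U2 z)\<bar>
        \<le> \<tau> * L * (4 * f * max dx dy + 2 * \<epsilon>) + 2 * \<delta> * \<tau> * L * \<rho> i j"
    proof (cases "z \<in> K")
      case False
      have "gen ?g i j = 0"
        unfolding gen_split gg using K[OF False] dx dy by simp
      moreover have "0 \<le> \<tau> * L * (4 * f * max dx dy + 2 * \<epsilon>) + 2 * \<delta> * \<tau> * L * \<rho> i j"
        using \<tau> L0 f \<epsilon> \<delta> \<rho>_nonneg dx by (intro add_nonneg_nonneg mult_nonneg_nonneg) auto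
      ultimately show ?thesis using K[OF False] by simp
    next
      case True
      note nz = near[OF z True]
      have drift: "\<bar>\<tau> / (2 * d) * (w * D + w' * D') - \<tau> * (g * U)\<bar> \<le> \<tau> * f * L * max dx dy + \<tau> * L * \<epsilon>"
        if d: "0 < d" "d \<le> max dx dy" and w: "\<bar>w\<bar> \<le> f" "\<bar>w'\<bar> \<le> f"
          and D: "\<bar>D - d * g\<bar> \<le> L * d\<^sup>2" "\<bar>D' - d * g\<bar> \<le> L * d\<^sup>2" and gL: "\<bar>g\<bar> \<le> L"
          and wU: "\<bar>w - U\<bar> \<le> \<epsilon>" "\<bar>w' - U\<bar> \<le> \<epsilon>" for d w w' D D' g U
      proof -
        have one: "\<bar>x * (E - d * g) + (x - U) * (d * g)\<bar> \<le> f * (L * d\<^sup>2) + \<epsilon> * (d * L)"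
          if "\<bar>x\<bar> \<le> f" "\<bar>E - d * g\<bar> \<le> L * d\<^sup>2" "\<bar>x - U\<bar> \<le> \<epsilon>" for x E
        proof -
          have "\<bar>x * (E - d * g)\<bar> \<le> f * (L * d\<^sup>2)"
            unfolding abs_mult using that f by (intro mult_mono) auto
          moreover have "\<bar>(x - U) * (d * g)\<bar> \<le> \<epsilon> * (d * L)"
            unfolding abs_mult using that \<epsilon> d gL by (intro mult_mono) auto
          ultimately show ?thesis by linarith
        qed
        have "\<tau> / (2 * d) * (w * D + w' * D') - \<tau> * (g * U)
          = \<tau> / (2 * d) * ((w * (D - d * g) + (w - U) * (d * g)) + (w' * (D' - d * g) + (w' - U) * (d * g)))"
          using d by (simp add: field_simps)
        also have "\<bar>\<dots>\<bar> \<le> \<tau> / (2 * d) * (2 * (f * (L * d\<^sup>2) + \<epsilon> * (d * L)))"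
          unfolding abs_mult using d \<tau> one[OF w(1) D(1) wU(1)] one[OF w(2) D(2) wU(2)]
          by (intro mult_mono) auto
        also have "\<dots> = \<tau> * f * L * d + \<tau> * L * \<epsilon>"
          using d by (simp add: field_simps power2_eq_square)
        also have "\<tau> * f * L * d \<le> \<tau> * f * L * max dx dy"
          using d \<tau> f L0 by (intro mult_left_mono) auto
        finally show ?thesis by simp
      qed
      have second: "\<bar>a - 2 * b + c\<bar> \<le> 2 * L * d\<^sup>2"
        if "\<bar>a - b - d * g\<bar> \<le> L * d\<^sup>2" "\<bar>c - b - (- d) * g\<bar> \<le> L * (- d)\<^sup>2" for a b c d g
      proof -
        have "a - 2 * b + c = (a - b - d * g) + (c - b - (- d) * g)" by simp
        then show ?thesis using that abs_triangle_ineq[of "a - b - d * g" "c - b - (- d) * g"] by simp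
      qed
      have flip: "\<bar>b - c - d * g\<bar> \<le> L * d\<^sup>2" if "\<bar>c - b - (- d) * g\<bar> \<le> L * (- d)\<^sup>2" for b c d g
      proof -
        have "b - c - d * g = - (c - b - (- d) * g)" by simp
        then show ?thesis using that by (simp only: abs_minus_cancel) simp
      qed
      have "gen ?g i j - \<tau> * (g1 z * U1 z + g2 z * U2 z)
        = (a_x * (u i j * (\<phi> (z + pt dx 0) - \<phi> z) + u (i - 1) j * (\<phi> z - \<phi> (z + pt (- dx) 0))) - \<tau> * (g1 z * U1 z))
         + (a_y * (v i j * (\<phi> (z + pt 0 dy) - \<phi> z) + v i (j - 1) * (\<phi> z - \<phi> (z + pt 0 (- dy)))) - \<tau> * (g2 z * U2 z))
         + (a_x * f + b_x * \<rho> i j) * (\<phi> (z + pt dx 0) - 2 * \<phi> z + \<phi> (z + pt (- dx) 0))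
         + (a_y * f + b_y * \<rho> i j) * (\<phi> (z + pt 0 dy) - 2 * \<phi> z + \<phi> (z + pt 0 (- dy)))" (is "_ = ?A + ?B + ?C + ?D")
        unfolding gen_split gg by (simp add: distrib_left)
      moreover have "\<bar>?A\<bar> \<le> \<tau> * f * L * max dx dy + \<tau> * L * \<epsilon>"
        unfolding a_x_def
        by (rule drift[OF dx h(1) u u L1(1) flip[OF L1(1)] g(1)]) (use nz in auto)
      moreover have "\<bar>?B\<bar> \<le> \<tau> * f * L * max dx dy + \<tau> * L * \<epsilon>"
        unfolding a_y_def
        by (rule drift[OF dy h(2) v v L1(2) flip[OF L1(2)] g(2)]) (use nz in auto)
      moreover have "\<bar>?C\<bar> \<le> \<tau> * f * (2 * L) * max dx dy / 2 + \<delta> * \<tau> * (2 * L) / 2 * \<rho> i j"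
        unfolding a_x_def b_x_def
        by (rule diffusion_term_bound[OF dx h(1) second[OF L1(1) L1(1)]]) (use L0 in simp)
      moreover have "\<bar>?D\<bar> \<le> \<tau> * f * (2 * L) * max dx dy / 2 + \<delta> * \<tau> * (2 * L) / 2 * \<rho> i j"
        unfolding a_y_def b_y_def
        by (rule diffusion_term_bound[OF dy h(2) second[OF L1(2) L1(2)]]) (use L0 in simp)
      moreover have "\<tau> * L * (4 * f * max dx dy + 2 * \<epsilon>) + 2 * \<delta> * \<tau> * L * \<rho> i j
        = (\<tau> * f * L * max dx dy + \<tau> * L * \<epsilon>) + (\<tau> * f * L * max dx dy + \<tau> * L * \<epsilon>)
         + (\<tau> * f * (2 * L) * max dx dy / 2 + \<delta> * \<tau> * (2 * L) / 2 * \<rho> i j)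
         + (\<tau> * f * (2 * L) * max dx dy / 2 + \<delta> * \<tau> * (2 * L) / 2 * \<rho> i j)"
        by (simp add: algebra_simps)
      ultimately show ?thesis by (rule abs_sum4_le)
    qed
  qed
  then show ?thesis by (simp only: integral_mult_right_zero)
qed

end

text \<open>A nonintegrable function has integral 0 by convention, so 0 \<le> B takes the place of
  an integrability assumption.\<close>

lemma integral_abs_le_const:
  fixes h :: "'a \<Rightarrow> real"
  assumes "prob_space M" and B: "\<And>x. x \<in> space M \<Longrightarrow> \<bar>h x\<bar> \<le> B" and "0 \<le> B"
  shows "\<bar>LINT x|M. h x\<bar> \<le> B"
proof (cases "integrable M h")
  case True
  interpret prob_space M by fact
  have "\<bar>LINT x|M. h x\<bar> \<le> (LINT x|M. \<bar>h x\<bar>)" by (rule integral_abs_bound)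
  also have "\<dots> \<le> (LINT x|M. B)" using True B by (intro integral_mono) auto
  finally show ?thesis by (simp add: prob_space)
qed (use assms in \<open>simp add: not_integrable_integral_eq\<close>)

text \<open>The same exchange with the counting measure as in \<open>grid_integral\<close>, now for
  an arbitrary measure: the initial datum may be singular.\<close>

lemma cell_decomposition:
  fixes h :: "real^2 \<Rightarrow> real"
  assumes d: "0 < dx" "0 < dy" and M: "sigma_finite_measure M" and sets [measurable_cong]: "sets M = sets borel"
    and h: "integrable M h"
  shows "gint (\<lambda>i j. LINT z:cell dx dy i j|M. h z)"
    and "(LINT z|M. h z) = gsum (\<lambda>i j. LINT z:cell dx dy i j|M. h z)"
proof -
  let ?N = "count_space (UNIV :: (int \<times> int) set)"
  define f where "f z p = indicator (cell dx dy (fst p) (snd p)) z * h z" for z p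
  interpret M: sigma_finite_measure M by fact
  interpret N: sigma_finite_measure ?N by (rule sigma_finite_measure_count_space_countable) simp
  interpret P: pair_sigma_finite M ?N ..
  have hm [measurable]: "h \<in> borel_measurable M" using h by simp
  have fm: "(\<lambda>x. f (fst x) (snd x)) \<in> borel_measurable (M \<Otimes>\<^sub>M ?N)"
  proof -
    have "(\<lambda>(p, z). f z p) \<in> borel_measurable (?N \<Otimes>\<^sub>M M)"
      by (rule measurable_pair_measure_countable1) (auto simp: f_def)
    from measurable_compose[OF measurable_pair_swap' this] show ?thesis by (simp add: case_prod_beta')
  qed
  have f0: "f z p = 0" if "p \<noteq> (\<lfloor>z $ 1 / dx\<rfloor>, \<lfloor>z $ 2 / dy\<rfloor>)" for z p
    using that by (cases p) (auto simp: f_def indicator_def cell_iff[OF d])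
  have fp: "f z (\<lfloor>z $ 1 / dx\<rfloor>, \<lfloor>z $ 2 / dy\<rfloor>) = h z" for z
    by (simp add: f_def indicator_def cell_iff[OF d])
  have fin: "finite {p. f z p \<noteq> 0}" for z
    by (rule finite_subset[of _ "{(\<lfloor>z $ 1 / dx\<rfloor>, \<lfloor>z $ 2 / dy\<rfloor>)}"]) (use f0 in blast)+
  have eval: "integral\<^sup>L ?N (\<lambda>p. g (f z p)) = g (h z)" if "g 0 = 0" for g :: "real \<Rightarrow> real" and z
  proof -
    have "finite {p \<in> UNIV. g (f z p) \<noteq> 0}"
      by (rule finite_subset[OF _ fin[of z]]) (use that in auto)
    then have "integral\<^sup>L ?N (\<lambda>p. g (f z p)) = (\<Sum>p | p \<in> UNIV \<and> g (f z p) \<noteq> 0. g (f z p))"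
      by (rule lebesgue_integral_count_space_finite_support)
    also have "\<dots> = (\<Sum>p\<in>{(\<lfloor>z $ 1 / dx\<rfloor>, \<lfloor>z $ 2 / dy\<rfloor>)}. g (f z p))"
    proof (rule sum.mono_neutral_left)
      show "{p \<in> UNIV. g (f z p) \<noteq> 0} \<subseteq> {(\<lfloor>z $ 1 / dx\<rfloor>, \<lfloor>z $ 2 / dy\<rfloor>)}"
      proof
        fix p assume "p \<in> {p \<in> UNIV. g (f z p) \<noteq> 0}"
        then have "f z p \<noteq> 0" using that by auto
        then show "p \<in> {(\<lfloor>z $ 1 / dx\<rfloor>, \<lfloor>z $ 2 / dy\<rfloor>)}" using f0[of p z] by blast
      qed
    qed auto
    finally show ?thesis by (simp add: fp)
  qed
  have F: "integrable (M \<Otimes>\<^sub>M ?N) (\<lambda>x. f (fst x) (snd x))"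
  proof (rule P.Fubini_integrable[OF fm])
    show "integrable M (\<lambda>z. LINT p|?N. norm (f (fst (z, p)) (snd (z, p))))"
      using h eval[of abs] by simp
    have "integrable ?N (f z)" for z
    proof -
      have "(\<lambda>p. norm (f z p)) summable_on UNIV"
        by (rule finite_nonzero_values_imp_summable_on) (use fin[of z] in simp)
      then show ?thesis
        using abs_summable_equivalent[of "f z" UNIV] by (simp add: Infinite_Set_Sum.abs_summable_on_def)
    qed
    then show "AE z in M. integrable ?N (\<lambda>p. f (fst (z, p)) (snd (z, p)))" by simp
  qed
  have int_eq: "integral\<^sup>L M (\<lambda>z. f z (i, j)) = (LINT z:cell dx dy i j|M. h z)" for i j
    by (simp add: f_def set_lebesgue_integral_def)
  have int: "integrable ?N (\<lambda>p. LINT z|M. f z p)"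
    using P.integrable_snd[of f] F by (simp add: case_prod_beta')
  have count_int: "gint (\<lambda>i j. g (i, j))" and count_sum: "integral\<^sup>L ?N g = gsum (\<lambda>i j. g (i, j))"
    if "integrable ?N g" for g :: "int \<times> int \<Rightarrow> real"
    using that infsetsum_infsum[of g UNIV] abs_summable_equivalent[of g UNIV]
    by (simp_all add: gint_abs_iff Infinite_Set_Sum.abs_summable_on_def infsetsum_def gsum_def)
  show "gint (\<lambda>i j. LINT z:cell dx dy i j|M. h z)"
    using count_int[OF int] by (simp add: int_eq)
  have "(LINT z|M. h z) = (LINT z|M. LINT p|?N. f z p)" using eval[of "\<lambda>x. x"] by simp
  also have "\<dots> = (LINT p|?N. LINT z|M. f z p)"
    using P.Fubini_integral[of f] F by (simp add: case_prod_beta')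
  also have "\<dots> = gsum (\<lambda>i j. LINT z:cell dx dy i j|M. h z)"
    using count_sum[OF int] by (simp add: int_eq)
  finally show "(LINT z|M. h z) = gsum (\<lambda>i j. LINT z:cell dx dy i j|M. h z)" .
qed

section \<open>The velocity field\<close>

locale bounded_force =
  fixes F :: "real^2 \<Rightarrow> real^2^2 \<Rightarrow> real^2" and T :: "real^2 \<Rightarrow> real^2^2" and f :: real
  assumes F_cont: "continuous_on UNIV (\<lambda>p. F (fst p) (T (snd p)))"
    and F_bound: "\<And>v z. norm (F v (T z)) \<le> f"
begin

lemma f_nonneg: "0 \<le> f"
  using F_bound[of 0 0] norm_ge_zero order_trans by blast

definition fc :: "2 \<Rightarrow> real^2 \<Rightarrow> real^2 \<Rightarrow> real" where
  "fc m z w = F (z - w) (T z) $ m"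

lemma fc_bound: "\<bar>fc m z w\<bar> \<le> f"
  unfolding fc_def using component_le_norm_cart[of "F (z - w) (T z)" m] F_bound[of "z - w" z] by linarith

lemma fc_continuous: "continuous_on A (\<lambda>p. fc m (fst p) (snd p))"
proof -
  have "continuous_on A (\<lambda>p. F (fst (fst p - snd p, fst p)) (T (snd (fst p - snd p, fst p))))"
    by (rule continuous_on_compose2[OF F_cont, of A "\<lambda>p. (fst p - snd p, fst p)"]) (auto intro!: continuous_intros)
  then show ?thesis unfolding fc_def by (auto intro!: continuous_intros)
qed

lemma fc_measurable [measurable]: "(\<lambda>(z, w). fc m z w) \<in> borel_measurable (borel \<Otimes>\<^sub>M borel)"
  using borel_measurable_continuous_onI[OF fc_continuous[of UNIV m]] by (simp add: borel_prod case_prod_beta')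

lemma fc_measurable1 [measurable]: "(\<lambda>w. fc m z w) \<in> borel_measurable borel"
proof -
  have "continuous_on UNIV (\<lambda>w. fc m (fst (z, w)) (snd (z, w)))"
    by (rule continuous_on_compose2[OF fc_continuous[of UNIV m]]) (auto intro!: continuous_intros)
  then show ?thesis by (intro borel_measurable_continuous_onI) simp
qed

lemma fc_measurable2 [measurable]: "(\<lambda>z. fc m z w) \<in> borel_measurable borel"
proof -
  have "continuous_on UNIV (\<lambda>z. fc m (fst (z, w)) (snd (z, w)))"
    by (rule continuous_on_compose2[OF fc_continuous[of UNIV m]]) (auto intro!: continuous_intros)
  then show ?thesis by (intro borel_measurable_continuous_onI) simp
qed

lemma fc_integrable:
  assumes "prob_space \<mu>" and [measurable_cong]: "sets \<mu> = sets borel"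
  shows "integrable \<mu> (fc m z)"
proof -
  interpret prob_space \<mu> by fact
  show ?thesis by (rule integrable_const_bound[where B = f]) (auto simp: fc_bound)
qed

lemma force_convolution_nth:
  assumes \<mu>: "prob_space \<mu>" and [measurable_cong]: "sets \<mu> = sets borel"
  shows "force_convolution F T \<mu> z $ m = (LINT w|\<mu>. fc m z w)"
proof -
  interpret prob_space \<mu> by fact
  have "continuous_on UNIV (\<lambda>w. F (fst (z - w, z)) (T (snd (z - w, z))))"
    by (rule continuous_on_compose2[OF F_cont]) (auto intro!: continuous_intros)
  then have [measurable]: "(\<lambda>w. F (z - w) (T z)) \<in> borel_measurable borel"
    by (intro borel_measurable_continuous_onI) simp
  have "integrable \<mu> (\<lambda>w. F (z - w) (T z))"
    by (rule integrable_const_bound[where B = f]) (auto simp: F_bound)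
  then show ?thesis
    unfolding force_convolution_def fc_def
    by (rule integral_bounded_linear[OF bounded_linear_vec_nth, symmetric])
qed

lemma force_convolution_bound:
  assumes "prob_space \<mu>" "sets \<mu> = sets borel"
  shows "\<bar>force_convolution F T \<mu> z $ m\<bar> \<le> f"
  unfolding force_convolution_nth[OF assms]
  by (rule integral_abs_le_const[OF assms(1) fc_bound f_nonneg])

lemma force_convolution_measurable:
  assumes "prob_space \<mu>" and [measurable_cong]: "sets \<mu> = sets borel"
  shows "(\<lambda>z. force_convolution F T \<mu> z $ m) \<in> borel_measurable borel"
proof -
  interpret prob_space \<mu> by fact
  show ?thesis
    unfolding force_convolution_nth[OF assms]
    by (rule borel_measurable_lebesgue_integral) measurable
qed

text \<open>Summing over source cells with weights \<rho> is integration against the grid measure.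
  After exchanging the integrals, the velocity of the scheme is the cell average of the exact
  convolution with the piecewise constant density, so the source variable causes no quadrature
  error.\<close>

lemma velocity_eq:
  assumes "grid_density dx dy \<rho>"
  shows "velocity F T dx dy \<rho> m i j
    = 1 / (dx * dy) * (LINT z:cell dx dy i j|lborel. force_convolution F T (grid_measure dx dy \<rho>) z $ m)"
proof -
  interpret grid_density dx dy \<rho> by fact
  let ?g = "grid_measure dx dy \<rho>" and ?C = "cell dx dy i j"
  interpret G: prob_space ?g by (rule prob_space_grid_measure)
  interpret P: pair_sigma_finite ?g "lborel :: (real^2) measure" ..
  have cell_fc: "(LINT z:?C|lborel. F (z - w) (T z) $ m) = (LINT z:?C|lborel. fc m z w)" for w
    by (simp add: fc_def)
  have F: "integrable (?g \<Otimes>\<^sub>M lborel) (\<lambda>x. indicator ?C (snd x) * fc m (snd x) (fst x))"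
  proof (rule P.Fubini_integrable)
    show m1: "(\<lambda>x. indicator ?C (snd x) * fc m (snd x) (fst x)) \<in> borel_measurable (?g \<Otimes>\<^sub>M lborel)"
      by measurable
    have i: "set_integrable lborel ?C (\<lambda>z. fc m z w)" for w
      by (rule cell_integrable(1)[OF dx dy _ fc_bound]) measurable
    then show "AE w in ?g. integrable lborel (\<lambda>z. indicator ?C (snd (w, z)) * fc m (snd (w, z)) (fst (w, z)))"
      by (simp add: set_integrable_def)
    have "(\<lambda>w. LINT z|lborel. norm (indicator ?C z * fc m z w)) \<in> borel_measurable ?g"
      by (rule lborel.borel_measurable_lebesgue_integral) measurable
    moreover have "norm (LINT z|lborel. norm (indicator ?C z * fc m z w)) \<le> dx * dy * f" for w
    proof -
      have "(LINT z|lborel. norm (indicator ?C z * fc m z w)) = (LINT z:?C|lborel. \<bar>fc m z w\<bar>)"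
        by (simp add: set_lebesgue_integral_def abs_mult)
      also have "norm (LINT z:?C|lborel. \<bar>fc m z w\<bar>) \<le> dx * dy * f"
        using cell_integrable(2)[OF dx dy, of "\<lambda>z. \<bar>fc m z w\<bar>" i j f] fc_bound by simp
      finally show ?thesis .
    qed
    ultimately show "integrable ?g (\<lambda>w. LINT z|lborel. norm (indicator ?C (snd (w, z)) * fc m (snd (w, z)) (fst (w, z))))"
      by (intro G.integrable_const_bound[where B = "dx * dy * f"]) auto
  qed
  have m2: "(\<lambda>w. LINT z:?C|lborel. fc m z w) \<in> borel_measurable borel"
    unfolding set_lebesgue_integral_def by (rule lborel.borel_measurable_lebesgue_integral) measurable
  have b2: "\<bar>LINT z:?C|lborel. fc m z w\<bar> \<le> dx * dy * f" for w
    by (rule cell_integrable(2)[OF dx dy _ fc_bound]) measurable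
  have "(\<Sum>\<^sub>\<infinity>(k, l)\<in>UNIV. \<rho> k l * cell_force F T dx dy m i j k l)
      = gsum (\<lambda>k l. \<rho> k l * (LINT w:cell dx dy k l|lborel. (LINT z:?C|lborel. fc m z w)))"
    by (simp add: gsum_def cell_force_def cell_fc case_prod_beta')
  also have "\<dots> = (LINT w|?g. (LINT z:?C|lborel. fc m z w))"
    by (rule grid_integral_bounded(3)[OF m2 b2, symmetric])
  also have "\<dots> = (LINT w|?g. LINT z|lborel. indicator ?C z * fc m z w)"
    by (simp add: set_lebesgue_integral_def)
  also have "\<dots> = (LINT z|lborel. LINT w|?g. indicator ?C z * fc m z w)"
    using P.Fubini_integral[of "\<lambda>w z. indicator ?C z * fc m z w"] F by (simp add: case_prod_beta')
  also have "\<dots> = (LINT z:?C|lborel. force_convolution F T ?g z $ m)"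
    by (simp add: set_lebesgue_integral_def force_convolution_nth[OF prob_space_grid_measure sets_grid_measure])
  finally show ?thesis by (simp add: velocity_def)
qed

lemma velocity_near:
  assumes "grid_density dx dy \<rho>"
    and near: "\<And>z. z \<in> cell dx dy i j \<Longrightarrow> \<bar>force_convolution F T (grid_measure dx dy \<rho>) z $ m - c\<bar> \<le> \<epsilon>"
  shows "\<bar>velocity F T dx dy \<rho> m i j - c\<bar> \<le> \<epsilon>"
proof -
  interpret grid_density dx dy \<rho> by fact
  let ?U = "\<lambda>z. force_convolution F T (grid_measure dx dy \<rho>) z $ m" and ?C = "cell dx dy i j"
  have U: "?U \<in> borel_measurable borel"
    by (rule force_convolution_measurable[OF prob_space_grid_measure sets_grid_measure])
  have iU: "set_integrable lborel ?C ?U"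
    by (rule cell_integrable(1)[OF dx dy U force_convolution_bound[OF prob_space_grid_measure sets_grid_measure]])
  have ic: "set_integrable lborel ?C (\<lambda>_. c)" by (rule cell_integrable(1)[OF dx dy, where B = "\<bar>c\<bar>"]) auto
  have "(LINT z:?C|lborel. ?U z - c) = (LINT z:?C|lborel. ?U z) - dx * dy * c"
    using set_integral_diff(2)[OF iU ic] dx dy by (simp add: set_lebesgue_integral_def measure_cell)
  then have eq: "velocity F T dx dy \<rho> m i j - c = (LINT z:?C|lborel. ?U z - c) / (dx * dy)"
    unfolding velocity_eq[OF assms(1)] using dx dy by (simp add: field_simps)
  moreover have "\<bar>LINT z:?C|lborel. ?U z - c\<bar> \<le> dx * dy * \<epsilon>"
    by (rule cell_integrable(2)[OF dx dy _ near]) (use U in auto)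
  moreover have "0 < dx * dy" using dx dy by simp
  ultimately show ?thesis
    unfolding eq abs_divide by (simp only: abs_of_pos pos_divide_le_eq mult.commute)
qed

lemma velocity_bound:
  assumes "grid_density dx dy \<rho>"
  shows "\<bar>velocity F T dx dy \<rho> m i j\<bar> \<le> f"
proof -
  interpret grid_density dx dy \<rho> by fact
  show ?thesis
    using velocity_near[OF assms, of i j m 0 f]
      force_convolution_bound[OF prob_space_grid_measure sets_grid_measure] by simp
qed

definition vel_x :: "real \<Rightarrow> real \<Rightarrow> (int \<Rightarrow> int \<Rightarrow> real) \<Rightarrow> int \<Rightarrow> int \<Rightarrow> real" where
  "vel_x dx dy \<rho> i j = (velocity F T dx dy \<rho> 1 i j + velocity F T dx dy \<rho> 1 (i + 1) j) / 2"

definition vel_y :: "real \<Rightarrow> real \<Rightarrow> (int \<Rightarrow> int \<Rightarrow> real) \<Rightarrow> int \<Rightarrow> int \<Rightarrow> real" where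
  "vel_y dx dy \<rho> i j = (velocity F T dx dy \<rho> 2 i j + velocity F T dx dy \<rho> 2 i (j + 1)) / 2"

lemma scheme_step_upwind:
  assumes g: "grid_density dx dy \<rho>" and \<delta>: "0 < \<delta>" and \<tau>: "0 < \<tau>"
    and cfl: "(2 * f * (1 / dx + 1 / dy) + \<delta> * (SUP (i, j)\<in>UNIV. \<rho> i j) * (1 / dx\<^sup>2 + 1 / dy\<^sup>2)) * \<tau> \<le> 1"
  shows "upwind_step dx dy f \<delta> \<tau> \<rho> (vel_x dx dy \<rho>) (vel_y dx dy \<rho>)"
    and "scheme_step F T f dx dy \<delta> \<tau> \<rho> = upwind_step.new dx dy f \<delta> \<tau> \<rho> (vel_x dx dy \<rho>) (vel_y dx dy \<rho>)"
proof -
  interpret grid_density dx dy \<rho> by fact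
  have avg: "\<bar>(a + b) / 2\<bar> \<le> f" if "\<bar>a\<bar> \<le> f" "\<bar>b\<bar> \<le> f" for a b :: real
  proof -
    have "\<bar>a + b\<bar> \<le> 2 * f" using that by linarith
    then show ?thesis by simp
  qed
  show u: "upwind_step dx dy f \<delta> \<tau> \<rho> (vel_x dx dy \<rho>) (vel_y dx dy \<rho>)"
  proof
    fix i j
    note vb = velocity_bound[OF g]
    show "\<bar>vel_x dx dy \<rho> i j\<bar> \<le> f" unfolding vel_x_def by (intro avg vb)
    show "\<bar>vel_y dx dy \<rho> i j\<bar> \<le> f" unfolding vel_y_def by (intro avg vb)
    have "bdd_above (range (\<lambda>(i, j). \<rho> i j))"
      by (rule bdd_aboveI[of _ "gsum \<rho>"]) (use le_gsum[OF \<rho> \<rho>_nonneg] in auto)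
    then have "\<rho> i j \<le> (SUP (i, j)\<in>UNIV. \<rho> i j)"
      using cSUP_upper[of "(i, j)" UNIV "\<lambda>(i, j). \<rho> i j"] by simp
    then have "(2 * f * (1 / dx + 1 / dy) + \<delta> * \<rho> i j * (1 / dx\<^sup>2 + 1 / dy\<^sup>2)) * \<tau>
        \<le> (2 * f * (1 / dx + 1 / dy) + \<delta> * (SUP (i, j)\<in>UNIV. \<rho> i j) * (1 / dx\<^sup>2 + 1 / dy\<^sup>2)) * \<tau>"
      using \<delta> \<tau> by (intro mult_right_mono add_left_mono mult_left_mono) auto
    then show "(2 * f * (1 / dx + 1 / dy) + \<delta> * \<rho> i j * (1 / dx\<^sup>2 + 1 / dy\<^sup>2)) * \<tau> \<le> 1"
      using cfl by (rule order_trans)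
  qed (use dx dy f_nonneg \<delta> \<tau> \<rho> \<rho>_nonneg mass in auto)
  show "scheme_step F T f dx dy \<delta> \<tau> \<rho> = upwind_step.new dx dy f \<delta> \<tau> \<rho> (vel_x dx dy \<rho>) (vel_y dx dy \<rho>)"
    by (intro ext) (simp only: scheme_step_def upwind_step.new_eq[OF u] flux_x_def flux_y_def vel_x_def vel_y_def
        diff_add_cancel)
qed

text \<open>The force is only continuous, so a modulus independent of the measure needs a compact
  set of sources. Sources outside radius \<open>R\<close> carry little mass by Chebyshev's
  inequality, while on a bounded set of targets and sources \<open>fc\<close> is uniformly
  continuous.\<close>

lemma force_modulus:
  assumes K: "compact K" and \<epsilon>: "0 < \<epsilon>" and C: "0 \<le> C"
  shows "\<exists>\<eta>>0. \<forall>\<mu>. \<mu> \<in> P2 \<longrightarrow> (LINT w|\<mu>. (norm w)\<^sup>2) \<le> C \<longrightarrow> (\<forall>z\<in>K. \<forall>z'. dist z' z < \<eta> \<longrightarrow>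
    (\<forall>m. \<bar>force_convolution F T \<mu> z' $ m - force_convolution F T \<mu> z $ m\<bar> \<le> \<epsilon>))"
proof -
  obtain R0 where R0: "\<And>z. z \<in> K \<Longrightarrow> norm z \<le> R0"
    using compact_imp_bounded[OF K] unfolding bounded_iff by blast
  \<comment> \<open>The fraction makes the far sources cost at most \<epsilon> / 2; the added 1
    ensures R \<le> R * R.\<close>
  define R where "R = 1 + 4 * f * C / \<epsilon>"
  have R: "1 \<le> R" using f_nonneg C \<epsilon> by (simp add: R_def)
  have "4 * f * C / \<epsilon> \<le> R" by (simp add: R_def)
  also have "R \<le> R * R" using R mult_left_mono[of 1 R R] by simp
  finally have "4 * f * C / \<epsilon> \<le> R * R" .
  then have Reps: "2 * f / R\<^sup>2 * C \<le> \<epsilon> / 2" using \<epsilon> R by (simp add: field_simps power2_eq_square)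
  let ?D = "cball (0 :: real^2) (R0 + 1) \<times> cball (0 :: real^2) R"
  have "\<exists>\<eta>>0. \<forall>p\<in>?D. \<forall>p'\<in>?D. dist p' p < \<eta> \<longrightarrow> dist (fc m (fst p') (snd p')) (fc m (fst p) (snd p)) < \<epsilon> / 2" for m
    using compact_uniformly_continuous[OF fc_continuous[of ?D m] compact_Times[OF compact_cball compact_cball]] \<epsilon>
    unfolding uniformly_continuous_on_def by (meson half_gt_zero)
  then obtain \<eta> where \<eta>: "\<And>m. 0 < \<eta> m" "\<And>m p p'. p \<in> ?D \<Longrightarrow> p' \<in> ?D \<Longrightarrow> dist p' p < \<eta> m \<Longrightarrow>
      dist (fc m (fst p') (snd p')) (fc m (fst p) (snd p)) < \<epsilon> / 2"
    by metis
  define \<eta>0 where "\<eta>0 = min 1 (min (\<eta> 1) (\<eta> 2))"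
  have \<eta>0: "0 < \<eta>0" "\<eta>0 \<le> 1" "\<eta>0 \<le> \<eta> m" for m
    using \<eta>(1) exhaust_2[of m] by (auto simp: \<eta>0_def)
  have "\<bar>force_convolution F T \<mu> z' $ m - force_convolution F T \<mu> z $ m\<bar> \<le> \<epsilon>"
    if \<mu>: "\<mu> \<in> P2" and C\<mu>: "(LINT w|\<mu>. (norm w)\<^sup>2) \<le> C" and z: "z \<in> K" "dist z' z < \<eta>0" for \<mu> z z' m
  proof -
    note p = P2D(1)[OF \<mu>] P2D(2)[OF \<mu>]
    interpret prob_space \<mu> by (rule p)
    have zz: "z \<in> cball 0 (R0 + 1)" "z' \<in> cball 0 (R0 + 1)"
    proof -
      have "norm z \<le> R0" using R0[of z] z by auto
      moreover have "norm z' \<le> norm z + dist z' z" by (simp add: dist_norm norm_triangle_sub)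
      ultimately show "z \<in> cball 0 (R0 + 1)" "z' \<in> cball 0 (R0 + 1)" using z \<eta>0(2) by auto
    qed
    have pt: "\<bar>fc m z' w - fc m z w\<bar> \<le> \<epsilon> / 2 + 2 * f / R\<^sup>2 * (norm w)\<^sup>2" for w
    proof (cases "norm w \<le> R")
      case True
      have "dist (z', w) (z, w) < \<eta> m" using z \<eta>0(3)[of m] by (simp add: dist_Pair_Pair)
      then have "dist (fc m z' w) (fc m z w) < \<epsilon> / 2"
        using \<eta>(2)[of "(z, w)" "(z', w)" m] zz True by simp
      moreover have "0 \<le> 2 * f / R\<^sup>2 * (norm w)\<^sup>2" using f_nonneg by simp
      ultimately show ?thesis unfolding dist_real_def by linarith
    next
      case False
      then have "R\<^sup>2 \<le> (norm w)\<^sup>2" using R by (intro power_mono) auto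
      then have "2 * f * 1 \<le> 2 * f * ((norm w)\<^sup>2 / R\<^sup>2)"
        using R f_nonneg by (intro mult_left_mono) auto
      then show ?thesis using fc_bound[of m z' w] fc_bound[of m z w] \<epsilon> by simp
    qed
    have "\<bar>force_convolution F T \<mu> z' $ m - force_convolution F T \<mu> z $ m\<bar> = \<bar>LINT w|\<mu>. fc m z' w - fc m z w\<bar>"
      unfolding force_convolution_nth[OF p] by (simp add: fc_integrable[OF p])
    also have "\<dots> \<le> (LINT w|\<mu>. \<bar>fc m z' w - fc m z w\<bar>)" by (rule integral_abs_bound)
    also have "\<dots> \<le> (LINT w|\<mu>. \<epsilon> / 2 + 2 * f / R\<^sup>2 * (norm w)\<^sup>2)"
      by (intro integral_mono pt Bochner_Integration.integrable_add integrable_mult_right P2D(3)[OF \<mu>] integrable_abs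
          Bochner_Integration.integrable_diff fc_integrable[OF p]) simp
    also have "\<dots> = \<epsilon> / 2 + 2 * f / R\<^sup>2 * (LINT w|\<mu>. (norm w)\<^sup>2)"
      using P2D(3)[OF \<mu>] by (simp add: prob_space)
    also have "\<dots> \<le> \<epsilon> / 2 + 2 * f / R\<^sup>2 * C"
      using C\<mu> f_nonneg by (intro add_left_mono mult_left_mono) auto
    finally show ?thesis using Reps by linarith
  qed
  then show ?thesis using \<eta>0(1) by blast
qed

end

section \<open>A single discretisation\<close>

locale discretised = bounded_force +
  fixes \<rho>in :: "(real^2) measure" and S dx dy \<delta> :: real and dt :: "nat \<Rightarrow> real"
  assumes adm: "admissible_discretisation F T f \<rho>in S dx dy \<delta> dt" and \<rho>in: "\<rho>in \<in> P2" and S: "0 < S"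
begin

abbreviation h :: real where "h \<equiv> max dx dy"
abbreviation r :: "nat \<Rightarrow> int \<Rightarrow> int \<Rightarrow> real" where "r \<equiv> scheme F T f \<rho>in dx dy \<delta> dt"
abbreviation tl :: "nat \<Rightarrow> real" where "tl \<equiv> time_level dt"

lemma dx: "0 < dx" and dy: "0 < dy" and \<delta>: "0 < \<delta>" and dt: "0 < dt n"
  and cover: "{0..S} \<subseteq> (\<Union>n. {tl n..<tl (Suc n)})"
  and cfl: "(2 * f * (1 / dx + 1 / dy) + \<delta> * (SUP (i, j)\<in>UNIV. r n i j) * (1 / dx\<^sup>2 + 1 / dy\<^sup>2)) * dt n \<le> 1"
  using adm by (auto simp: admissible_discretisation_def)

lemma \<rho>in_prob: "prob_space \<rho>in" and \<rho>in_sets [measurable_cong]: "sets \<rho>in = sets borel"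
  and \<rho>in_moment: "integrable \<rho>in (\<lambda>z. (norm z)\<^sup>2)"
  using P2D[OF \<rho>in] .

lemma \<rho>in_decomposition:
  assumes "integrable \<rho>in g"
  shows "gint (\<lambda>i j. LINT z:cell dx dy i j|\<rho>in. g z)" "(LINT z|\<rho>in. g z) = gsum (\<lambda>i j. LINT z:cell dx dy i j|\<rho>in. g z)"
proof -
  interpret R: prob_space \<rho>in by (rule \<rho>in_prob)
  show "gint (\<lambda>i j. LINT z:cell dx dy i j|\<rho>in. g z)" "(LINT z|\<rho>in. g z) = gsum (\<lambda>i j. LINT z:cell dx dy i j|\<rho>in. g z)"
    by (rule cell_decomposition[OF dx dy R.sigma_finite_measure_axioms \<rho>in_sets assms])+
qed

lemma \<rho>in_cell_const: "(LINT z:cell dx dy i j|\<rho>in. c) = measure \<rho>in (cell dx dy i j) * (c :: real)"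
proof -
  interpret R: prob_space \<rho>in by (rule \<rho>in_prob)
  have "space \<rho>in = UNIV" using sets_eq_imp_space_eq[OF \<rho>in_sets] by simp
  then show ?thesis by (simp add: set_lebesgue_integral_def)
qed

lemma initial_density: "grid_density dx dy (r 0)"
proof
  interpret R: prob_space \<rho>in by (rule \<rho>in_prob)
  have one: "integrable \<rho>in (\<lambda>_. 1 :: real)" by simp
  have g: "gint (\<lambda>i j. measure \<rho>in (cell dx dy i j))" and s: "gsum (\<lambda>i j. measure \<rho>in (cell dx dy i j)) = 1"
    using \<rho>in_decomposition[OF one] by (simp_all add: \<rho>in_cell_const R.prob_space)
  show "gint (r 0)" using gint_cmult[OF g, of "1 / (dx * dy)"] by simp
  have "gsum (r 0) = 1 / (dx * dy)"
    using gsum_cmult[of "1 / (dx * dy)" "\<lambda>i j. measure \<rho>in (cell dx dy i j)"] s by simp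
  then show "dx * dy * gsum (r 0) = 1" using dx dy by simp
qed (use dx dy in auto)

text \<open>The discrete moment is the integral under \<open>\<rho>in\<close> of the squared corner
  position \<open>g\<close> of the cell of a point, and \<open>g\<close> is compared with the
  squared norm pointwise.\<close>

lemma initial_moment:
  shows "gint (\<lambda>i j. r 0 i j * ((real_of_int i * dx)\<^sup>2 + (real_of_int j * dy)\<^sup>2))"
    and "grid_moment dx dy (r 0) \<le> 2 * (LINT z|\<rho>in. (norm z)\<^sup>2) + 2 * (dx\<^sup>2 + dy\<^sup>2)"
proof -
  interpret R: prob_space \<rho>in by (rule \<rho>in_prob)
  define \<Psi> where "\<Psi> i j = (real_of_int i * dx)\<^sup>2 + (real_of_int j * dy)\<^sup>2" for i j
  define g where "g z = \<Psi> \<lfloor>z $ 1 / dx\<rfloor> \<lfloor>z $ 2 / dy\<rfloor>" for z :: "real^2"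
  have gm [measurable]: "g \<in> borel_measurable borel" unfolding g_def by (rule grid_fun_measurable)
  have sq: "(real_of_int \<lfloor>x / d\<rfloor> * d)\<^sup>2 \<le> 2 * x\<^sup>2 + 2 * d\<^sup>2" if d: "0 < d" for x d :: real
  proof -
    define a where "a = real_of_int \<lfloor>x / d\<rfloor> * d"
    have a: "a \<le> x" "x < a + d"
      using floor_divide_lower[OF d, of x] floor_divide_upper[OF d, of x] by (simp_all add: a_def algebra_simps)
    have "a = x + (a - x)" by simp
    then have "a\<^sup>2 \<le> 2 * x\<^sup>2 + 2 * (a - x)\<^sup>2"
      using sum_squares_bound[of x "a - x"] power2_sum[of x "a - x"] by simp
    moreover have "(a - x)\<^sup>2 \<le> d\<^sup>2" using a by (auto simp: abs_le_square_iff[symmetric])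
    ultimately show ?thesis by (simp add: a_def)
  qed
  have gle: "g z \<le> 2 * (norm z)\<^sup>2 + 2 * (dx\<^sup>2 + dy\<^sup>2)" for z
    using sq[OF dx, of "z $ 1"] sq[OF dy, of "z $ 2"] by (simp add: g_def \<Psi>_def norm_real2_power2)
  have g0: "0 \<le> g z" for z by (simp add: g_def \<Psi>_def)
  have bint: "integrable \<rho>in (\<lambda>z. 2 * (norm z)\<^sup>2 + 2 * (dx\<^sup>2 + dy\<^sup>2))"
    using \<rho>in_moment by auto
  have gi: "integrable \<rho>in g"
    by (rule Bochner_Integration.integrable_bound[OF bint]) (use gle g0 in \<open>auto intro!: AE_I2\<close>)
  have cell_g: "(LINT z:cell dx dy i j|\<rho>in. g z) = measure \<rho>in (cell dx dy i j) * \<Psi> i j" for i j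
  proof -
    have "(LINT z:cell dx dy i j|\<rho>in. g z) = (LINT z:cell dx dy i j|\<rho>in. \<Psi> i j)"
      by (rule set_lebesgue_integral_cong) (auto simp: g_def cell_iff[OF dx dy])
    then show ?thesis by (simp add: \<rho>in_cell_const)
  qed
  have eq: "(\<lambda>i j. r 0 i j * ((real_of_int i * dx)\<^sup>2 + (real_of_int j * dy)\<^sup>2))
      = (\<lambda>i j. 1 / (dx * dy) * (LINT z:cell dx dy i j|\<rho>in. g z))"
    by (intro ext) (simp add: cell_g \<Psi>_def)
  show "gint (\<lambda>i j. r 0 i j * ((real_of_int i * dx)\<^sup>2 + (real_of_int j * dy)\<^sup>2))"
    unfolding eq by (rule gint_cmult[OF \<rho>in_decomposition(1)[OF gi]])
  have "grid_moment dx dy (r 0) = (LINT z|\<rho>in. g z)"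
    unfolding grid_moment_def eq gsum_cmult \<rho>in_decomposition(2)[OF gi] using dx dy by simp
  also have "\<dots> \<le> (LINT z|\<rho>in. 2 * (norm z)\<^sup>2 + 2 * (dx\<^sup>2 + dy\<^sup>2))"
    by (rule integral_mono[OF gi bint gle])
  also have "\<dots> = 2 * (LINT z|\<rho>in. (norm z)\<^sup>2) + 2 * (dx\<^sup>2 + dy\<^sup>2)"
    using \<rho>in_moment by (simp add: R.prob_space)
  finally show "grid_moment dx dy (r 0) \<le> 2 * (LINT z|\<rho>in. (norm z)\<^sup>2) + 2 * (dx\<^sup>2 + dy\<^sup>2)" .
qed

text \<open>Both measures give each cell the same mass, so only \<phi> and its cell average are
  compared. Across a cell \<phi> varies by at most L h in each coordinate direction.\<close>

lemma initial_consistency: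
  fixes \<phi> :: "real^2 \<Rightarrow> real"
  assumes \<phi> [measurable]: "\<phi> \<in> borel_measurable borel" and L: "\<And>z. \<bar>\<phi> z\<bar> \<le> L"
    and L1: "\<And>z d. \<bar>\<phi> (z + pt d 0) - \<phi> z\<bar> \<le> L * \<bar>d\<bar>" "\<And>z d. \<bar>\<phi> (z + pt 0 d) - \<phi> z\<bar> \<le> L * \<bar>d\<bar>"
  shows "\<bar>(LINT z|grid_measure dx dy (r 0). \<phi> z) - (LINT z|\<rho>in. \<phi> z)\<bar> \<le> 2 * L * h"
proof -
  interpret R: prob_space \<rho>in by (rule \<rho>in_prob)
  interpret G: grid_density dx dy "r 0" by (rule initial_density)
  have L0: "0 \<le> L" using L[of 0] by linarith
  have i\<phi>: "integrable \<rho>in \<phi>" by (rule R.integrable_const_bound[where B = L]) (use L in auto)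
  define A where "A i j = (LINT z:cell dx dy i j|lborel. \<phi> z) / (dx * dy)" for i j
  have osc: "\<bar>\<phi> z' - \<phi> z\<bar> \<le> 2 * L * h" if "z \<in> cell dx dy i j" "z' \<in> cell dx dy i j" for z z' i j
  proof -
    define d1 where "d1 = z' $ 1 - z $ 1"
    define d2 where "d2 = z' $ 2 - z $ 2"
    have "\<bar>d1\<bar> \<le> dx" "\<bar>d2\<bar> \<le> dy" using that by (auto simp: cell_def d1_def d2_def algebra_simps)
    then have "L * \<bar>d1\<bar> \<le> L * h" "L * \<bar>d2\<bar> \<le> L * h" using L0 by (auto intro!: mult_left_mono)
    moreover have "z' = (z + pt d1 0) + pt 0 d2" by (simp add: vec_eq_iff forall_2 d1_def d2_def)
    moreover have "2 * L * h = L * h + L * h" by simp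
    ultimately show ?thesis
      using L1(1)[of z d1] L1(2)[of "z + pt d1 0" d2] by (simp only:) linarith
  qed
  have near: "\<bar>\<phi> z - A i j\<bar> \<le> 2 * L * h" if z: "z \<in> cell dx dy i j" for z i j
  proof -
    have i1: "set_integrable lborel (cell dx dy i j) \<phi>" by (rule cell_integrable(1)[OF dx dy \<phi> L])
    have i2: "set_integrable lborel (cell dx dy i j) (\<lambda>_. \<phi> z)" by (rule cell_integrable(1)[OF dx dy, where B = L]) (use L in auto)
    have "(LINT z':cell dx dy i j|lborel. \<phi> z' - \<phi> z) = (LINT z':cell dx dy i j|lborel. \<phi> z') - dx * dy * \<phi> z"
      using set_integral_diff(2)[OF i1 i2] dx dy by (simp add: set_lebesgue_integral_def measure_cell)
    then have eq: "A i j - \<phi> z = (LINT z':cell dx dy i j|lborel. \<phi> z' - \<phi> z) / (dx * dy)"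
      using dx dy by (simp add: A_def diff_divide_distrib)
    have "\<bar>LINT z':cell dx dy i j|lborel. \<phi> z' - \<phi> z\<bar> \<le> dx * dy * (2 * L * h)"
      by (rule cell_integrable(2)[OF dx dy]) (use osc[OF z] in auto)
    moreover have "0 < dx * dy" using dx dy by simp
    ultimately have "\<bar>A i j - \<phi> z\<bar> \<le> 2 * L * h"
      unfolding eq abs_divide by (simp only: abs_of_pos pos_divide_le_eq mult.commute)
    then show ?thesis by (simp add: abs_minus_commute)
  qed
  define w where "w i j = measure \<rho>in (cell dx dy i j)" for i j
  have gw: "gint w" "gsum w = 1"
  proof -
    have one: "integrable \<rho>in (\<lambda>_. 1 :: real)" by simp
    show "gint w" "gsum w = 1" unfolding w_def
      using \<rho>in_decomposition[OF one] by (simp_all add: \<rho>in_cell_const R.prob_space)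
  qed
  have A_bd: "\<bar>A i j\<bar> \<le> L" for i j
  proof -
    have "\<bar>LINT z:cell dx dy i j|lborel. \<phi> z\<bar> \<le> dx * dy * L" by (rule cell_integrable(2)[OF dx dy \<phi> L])
    moreover have "0 < dx * dy" using dx dy by simp
    ultimately show ?thesis unfolding A_def abs_divide by (simp only: abs_of_pos pos_divide_le_eq mult.commute)
  qed
  have "(LINT z|grid_measure dx dy (r 0). \<phi> z) = gsum (\<lambda>i j. w i j * A i j)"
    unfolding G.grid_integral_bounded(3)[OF \<phi> L] by (simp add: w_def A_def)
  moreover have "gint (\<lambda>i j. w i j * A i j)" by (rule gint_mult_bounded(1)[OF gw(1) A_bd])
  ultimately have eq: "(LINT z|grid_measure dx dy (r 0). \<phi> z) - (LINT z|\<rho>in. \<phi> z)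
      = gsum (\<lambda>i j. w i j * A i j - (LINT z:cell dx dy i j|\<rho>in. \<phi> z))"
    using \<rho>in_decomposition[OF i\<phi>] by (simp add: gsum_diff)
  have "\<bar>gsum (\<lambda>i j. w i j * A i j - (LINT z:cell dx dy i j|\<rho>in. \<phi> z))\<bar> \<le> gsum (\<lambda>i j. (2 * L * h) * w i j)"
  proof (rule abs_gsum_le[OF gint_cmult[OF gw(1)]])
    fix i j
    have i1: "set_integrable \<rho>in (cell dx dy i j) \<phi>"
      unfolding set_integrable_def by (rule R.integrable_const_bound[where B = L]) (use L L0 in \<open>auto simp: indicator_def\<close>)
    have i2: "set_integrable \<rho>in (cell dx dy i j) (\<lambda>_. A i j)"
      unfolding set_integrable_def by (rule R.integrable_const_bound[where B = L]) (use A_bd L0 in \<open>auto simp: indicator_def\<close>)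
    have i3: "set_integrable \<rho>in (cell dx dy i j) (\<lambda>_. 2 * L * h)"
      unfolding set_integrable_def by (rule R.integrable_const_bound[where B = "\<bar>2 * L * h\<bar>"]) (auto simp: indicator_def)
    have "w i j * A i j - (LINT z:cell dx dy i j|\<rho>in. \<phi> z) = (LINT z:cell dx dy i j|\<rho>in. A i j - \<phi> z)"
      using set_integral_diff(2)[OF i2 i1] by (simp add: \<rho>in_cell_const w_def)
    then have "\<bar>w i j * A i j - (LINT z:cell dx dy i j|\<rho>in. \<phi> z)\<bar>
        \<le> (LINT z|\<rho>in. \<bar>indicator (cell dx dy i j) z *\<^sub>R (A i j - \<phi> z)\<bar>)"
      unfolding set_lebesgue_integral_def by (simp only: integral_abs_bound)
    also have "\<dots> \<le> (LINT z|\<rho>in. indicator (cell dx dy i j) z *\<^sub>R (2 * L * h))"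
      using set_integral_diff(1)[OF i2 i1] i3 near
      unfolding set_integrable_def by (intro integral_mono integrable_abs) (auto simp: indicator_def abs_minus_commute)
    also have "\<dots> = (2 * L * h) * w i j"
      using \<rho>in_cell_const[of i j "2 * L * h"] by (simp add: w_def set_lebesgue_integral_def)
    finally show "\<bar>w i j * A i j - (LINT z:cell dx dy i j|\<rho>in. \<phi> z)\<bar> \<le> (2 * L * h) * w i j" .
  qed
  then show ?thesis by (simp only: eq gsum_cmult gw(2) mult_1_right)
qed

lemma density: "grid_density dx dy (r n)"
proof (induction n)
  case (Suc n)
  note u = scheme_step_upwind[OF Suc \<delta> dt cfl]
  show ?case using upwind_step.grid_density_new[OF u(1)] by (simp add: u(2))
qed (rule initial_density)

lemma step: "upwind_step dx dy f \<delta> (dt n) (r n) (vel_x dx dy (r n)) (vel_y dx dy (r n))"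
  and step_new: "r (Suc n) = upwind_step.new dx dy f \<delta> (dt n) (r n) (vel_x dx dy (r n)) (vel_y dx dy (r n))"
  using scheme_step_upwind[OF density \<delta> dt cfl] by simp_all

lemma tl_0 [simp]: "tl 0 = 0" and tl_Suc: "tl (Suc n) = tl n + dt n"
  by (simp_all add: time_level_def)

lemma tl_mono: "m \<le> n \<Longrightarrow> tl m \<le> tl n"
  unfolding time_level_def using dt by (intro sum_mono2) (auto intro: less_imp_le)

lemma tl_nonneg: "0 \<le> tl n"
  using tl_mono[of 0 n] by simp

text \<open>On \<open>{0..S}\<close> the covering condition makes this the index of the time
  interval that contains \<open>t\<close>.\<close>

definition level :: "real \<Rightarrow> nat" where
  "level t = (LEAST n. t < tl (Suc n))"

lemma level_bounds:
  assumes "t \<in> {0..S}"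
  shows "tl (level t) \<le> t" "t < tl (Suc (level t))"
proof -
  obtain n where n: "tl n \<le> t" "t < tl (Suc n)" using cover assms by fastforce
  show l: "t < tl (Suc (level t))" unfolding level_def by (rule LeastI[of _ n]) (rule n)
  show "tl (level t) \<le> t"
  proof (cases "level t")
    case (Suc m)
    then have "\<not> t < tl (Suc m)" using not_less_Least[of m "\<lambda>n. t < tl (Suc n)"] by (simp add: level_def)
    then show ?thesis using Suc by simp
  qed (use assms in simp)
qed

lemma level_eqI:
  assumes "tl n \<le> t" "t < tl (Suc n)"
  shows "level t = n"
proof (rule antisym)
  show "level t \<le> n" unfolding level_def by (rule Least_le) (rule assms)
  show "n \<le> level t"
  proof (rule ccontr)
    assume "\<not> n \<le> level t"
    then have "tl (Suc (level t)) \<le> tl n" by (intro tl_mono) simp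
    moreover have "t < tl (Suc (level t))" unfolding level_def by (rule LeastI[of _ n]) (rule assms)
    ultimately show False using assms by simp
  qed
qed

text \<open>The time intervals and the cells are disjoint, so each of the three nested infinite sums
  has a single nonzero term.\<close>

lemma reconstruction_eq:
  assumes "t \<in> {0..S}"
  shows "reconstruction F T f \<rho>in dx dy \<delta> dt t z = r (level t) \<lfloor>z $ 1 / dx\<rfloor> \<lfloor>z $ 2 / dy\<rfloor>"
proof -
  have single: "infsum g UNIV = g a" if "\<And>x. x \<noteq> a \<Longrightarrow> g x = 0" for g :: "'x \<Rightarrow> real" and a
  proof -
    have "infsum g UNIV = infsum g {a}" by (rule infsum_cong_neutral) (use that in auto)
    then show ?thesis by simp
  qed
  have t_iff: "t \<in> {tl n..<tl (Suc n)} \<longleftrightarrow> n = level t" for n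
    using level_eqI[of n t] level_bounds[OF assms] by auto
  let ?g = "\<lambda>n i j. r n i j * indicator ({tl n..<tl (Suc n)} \<times> cell dx dy i j) (t, z)"
  have g: "?g n i j = (if n = level t \<and> i = \<lfloor>z $ 1 / dx\<rfloor> \<and> j = \<lfloor>z $ 2 / dy\<rfloor> then r n i j else 0)" for n i j
    unfolding indicator_def mem_Times_iff fst_conv snd_conv t_iff cell_iff[OF dx dy] by auto
  have "reconstruction F T f \<rho>in dx dy \<delta> dt t z = (\<Sum>\<^sub>\<infinity>n. \<Sum>\<^sub>\<infinity>i. \<Sum>\<^sub>\<infinity>j. ?g n i j)"
    by (simp only: reconstruction_def)
  also have "\<dots> = (\<Sum>\<^sub>\<infinity>i. \<Sum>\<^sub>\<infinity>j. ?g (level t) i j)" by (rule single) (simp add: g)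
  also have "\<dots> = (\<Sum>\<^sub>\<infinity>j. ?g (level t) \<lfloor>z $ 1 / dx\<rfloor> j)" by (rule single) (simp add: g)
  also have "\<dots> = ?g (level t) \<lfloor>z $ 1 / dx\<rfloor> \<lfloor>z $ 2 / dy\<rfloor>" by (rule single) (simp add: g)
  finally show ?thesis by (simp add: g)
qed

text \<open>The bound of \<open>dissipation_sum\<close> with the elapsed time replaced by
  \<open>S\<close>. The parameter \<kappa> stays free and is chosen only along the sequence,
  depending on \<delta>.\<close>

definition diss :: "real \<Rightarrow> real" where
  "diss \<kappa> = S * (\<delta> / \<kappa> ^ 4 + 32 * (4 * (\<delta> + 5 * f * \<kappa> + 3 * f * h)\<^sup>2 * \<kappa> ^ 4 / \<delta> + f * \<kappa>)) + 32 * \<kappa>\<^sup>2"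

lemma grid_l2_nonneg: "0 \<le> grid_l2 dx dy \<rho>"
  using dx dy by (auto simp: grid_l2_def intro!: mult_nonneg_nonneg gsum_nonneg)

lemma dissipation:
  assumes N: "tl N \<le> S" and \<kappa>: "0 < \<kappa>"
  shows "(\<Sum>n<N. \<delta> * dt n * grid_l2 dx dy (r n)) \<le> diss \<kappa>"
proof -
  let ?c = "\<delta> / \<kappa> ^ 4 + 32 * (4 * (\<delta> + 5 * f * \<kappa> + 3 * f * h)\<^sup>2 * \<kappa> ^ 4 / \<delta> + f * \<kappa>)"
  have "(\<Sum>n<N. \<delta> * dt n * grid_l2 dx dy (r n)) \<le> (\<Sum>n<N. dt n) * ?c + 32 * \<kappa>\<^sup>2"
    by (rule dissipation_sum[where \<rho> = r and dt = dt and u = "\<lambda>n. vel_x dx dy (r n)" and v = "\<lambda>n. vel_y dx dy (r n)", OF step step_new \<kappa> refl])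
  also have "\<dots> \<le> S * ?c + 32 * \<kappa>\<^sup>2"
    using N \<delta> \<kappa> f_nonneg by (intro add_right_mono mult_right_mono) (auto simp: time_level_def)
  finally show ?thesis by (simp add: diss_def)
qed

lemma grid_moment_bound:
  assumes N: "tl N \<le> S" and \<kappa>: "0 < \<kappa>"
  shows "gint (\<lambda>i j. r N i j * ((real_of_int i * dx)\<^sup>2 + (real_of_int j * dy)\<^sup>2))"
    and "grid_moment dx dy (r N) \<le> exp (f * S) * (2 * (LINT z|\<rho>in. (norm z)\<^sup>2) + 2 * (dx\<^sup>2 + dy\<^sup>2)
      + f * S * (2 + 4 * h) + 2 * diss \<kappa>)"
proof -
  have V0: "0 \<le> grid_moment dx dy (r 0)"
    using dx dy by (auto simp: grid_moment_def intro!: mult_nonneg_nonneg gsum_nonneg)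
  note m = moment_sum[where \<rho> = r and dt = dt and u = "\<lambda>n. vel_x dx dy (r n)" and v = "\<lambda>n. vel_y dx dy (r n)", OF step step_new initial_moment(1) V0, of N N]
  show "gint (\<lambda>i j. r N i j * ((real_of_int i * dx)\<^sup>2 + (real_of_int j * dy)\<^sup>2))" using m by simp
  have "grid_moment dx dy (r N) \<le> exp (f * tl N) * (grid_moment dx dy (r 0)
      + f * tl N * (2 + 4 * h) + 2 * (\<Sum>i<N. \<delta> * dt i * grid_l2 dx dy (r i)))"
    using m by (simp add: time_level_def)
  also have "\<dots> \<le> exp (f * S) * (2 * (LINT z|\<rho>in. (norm z)\<^sup>2) + 2 * (dx\<^sup>2 + dy\<^sup>2) + f * S * (2 + 4 * h) + 2 * diss \<kappa>)"
  proof (rule mult_mono)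
    show "exp (f * tl N) \<le> exp (f * S)" using N f_nonneg by (simp add: mult_left_mono)
    have "f * tl N * (2 + 4 * h) \<le> f * S * (2 + 4 * h)"
      using N f_nonneg dx by (intro mult_right_mono mult_left_mono) auto
    then show "grid_moment dx dy (r 0) + f * tl N * (2 + 4 * h) + 2 * (\<Sum>i<N. \<delta> * dt i * grid_l2 dx dy (r i))
        \<le> 2 * (LINT z|\<rho>in. (norm z)\<^sup>2) + 2 * (dx\<^sup>2 + dy\<^sup>2) + f * S * (2 + 4 * h) + 2 * diss \<kappa>"
      using initial_moment(2) dissipation[OF N \<kappa>] by linarith
    show "0 \<le> grid_moment dx dy (r 0) + f * tl N * (2 + 4 * h) + 2 * (\<Sum>i<N. \<delta> * dt i * grid_l2 dx dy (r i))"
      using V0 f_nonneg tl_nonneg[of N] dx \<delta> dt grid_l2_nonneg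
      by (intro add_nonneg_nonneg mult_nonneg_nonneg sum_nonneg) (auto intro: less_imp_le)
  qed (use dx f_nonneg S in auto)
  finally show "grid_moment dx dy (r N) \<le> exp (f * S) * (2 * (LINT z|\<rho>in. (norm z)\<^sup>2) + 2 * (dx\<^sup>2 + dy\<^sup>2)
      + f * S * (2 + 4 * h) + 2 * diss \<kappa>)" .
qed

definition sol :: "real \<Rightarrow> (real^2) measure" where
  "sol t = grid_measure dx dy (r (level t))"

lemma sol_P2:
  assumes "t \<in> {0..S}"
  shows "sol t \<in> P2"
  unfolding sol_def
  using level_bounds[OF assms] assms
  by (intro grid_density.grid_second_moment(1)[OF density] grid_moment_bound(1)[where \<kappa> = 1]) auto

lemma sol_moment:
  assumes "t \<in> {0..S}" "0 < \<kappa>"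
  shows "(LINT z|sol t. (norm z)\<^sup>2) \<le> 2 * (exp (f * S) * (2 * (LINT z|\<rho>in. (norm z)\<^sup>2) + 2 * (dx\<^sup>2 + dy\<^sup>2)
      + f * S * (2 + 4 * h) + 2 * diss \<kappa>)) + 2 * (dx\<^sup>2 + dy\<^sup>2)"
proof -
  have N: "tl (level t) \<le> S" using level_bounds[OF assms(1)] assms(1) by auto
  show ?thesis
    unfolding sol_def
    using grid_density.grid_second_moment(2)[OF density grid_moment_bound(1)[OF N assms(2)]]
      grid_moment_bound(2)[OF N assms(2)] by linarith
qed

lemma step_speed: "dt n * f \<le> h / 4"
  by (rule upwind_step.step_times_speed[OF step])

text \<open>The time between the two levels exceeds t - s by at most one step, and a step satisfies
  dt * f \<le> h / 4. This and the accumulated dissipation are the errors that do not shrink with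
  the time difference but vanish along the sequence.\<close>

lemma equicontinuity:
  fixes \<phi> :: "real^2 \<Rightarrow> real"
  assumes \<phi>: "\<phi> \<in> borel_measurable borel" and L: "\<And>z. \<bar>\<phi> z\<bar> \<le> L"
    and L1: "\<And>z d. \<bar>\<phi> (z + pt d 0) - \<phi> z\<bar> \<le> L * \<bar>d\<bar>" "\<And>z d. \<bar>\<phi> (z + pt 0 d) - \<phi> z\<bar> \<le> L * \<bar>d\<bar>"
    and L2: "\<And>z d. \<bar>\<phi> (z + pt d 0) - 2 * \<phi> z + \<phi> (z + pt (- d) 0)\<bar> \<le> L * d\<^sup>2"
      "\<And>z d. \<bar>\<phi> (z + pt 0 d) - 2 * \<phi> z + \<phi> (z + pt 0 (- d))\<bar> \<le> L * d\<^sup>2"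
    and st: "s \<in> {0..S}" "t \<in> {0..S}" and \<kappa>: "0 < \<kappa>"
  shows "\<bar>(LINT z|sol t. \<phi> z) - (LINT z|sol s. \<phi> z)\<bar> \<le> L * (2 + h) * (f * \<bar>t - s\<bar> + h / 4) + L * diss \<kappa>"
proof -
  have L0: "0 \<le> L" using L[of 0] by linarith
  have mono: "\<bar>(LINT z|sol t. \<phi> z) - (LINT z|sol s. \<phi> z)\<bar> \<le> L * (2 + h) * (f * (t - s) + h / 4) + L * diss \<kappa>"
    if st: "s \<in> {0..S}" "t \<in> {0..S}" and le: "s \<le> t" for s t
  proof -
    let ?G = "\<lambda>n. LINT z|grid_measure dx dy (r n). \<phi> z"
    let ?e = "\<lambda>n. dt n * f * L * (2 + h) + \<delta> * dt n * L * grid_l2 dx dy (r n)"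
    have e0: "0 \<le> ?e n" for n
      using dt[of n] f_nonneg L0 dx \<delta> grid_l2_nonneg by (intro add_nonneg_nonneg mult_nonneg_nonneg) auto
    have one: "\<bar>?G (Suc n) - ?G n\<bar> \<le> ?e n" for n
      unfolding step_new by (rule upwind_step.one_step_lipschitz[OF step \<phi> L L1 L2])
    have lev: "level s \<le> level t"
    proof (rule ccontr)
      assume "\<not> level s \<le> level t"
      then have "tl (Suc (level t)) \<le> tl (level s)" by (intro tl_mono) simp
      then show False using level_bounds[OF st(1)] level_bounds[OF st(2)] le by simp
    qed
    have tele: "\<bar>?G (m + k) - ?G m\<bar> \<le> (\<Sum>n\<in>{m..<m + k}. ?e n)" for m k
    proof (induction k)
      case (Suc k)
      then show ?case using one[of "m + k"] by simp
    qed simp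
    have "\<bar>(LINT z|sol t. \<phi> z) - (LINT z|sol s. \<phi> z)\<bar> \<le> (\<Sum>n\<in>{level s..<level t}. ?e n)"
      using tele[of "level s" "level t - level s"] lev by (simp add: sol_def)
    also have "\<dots> = L * (2 + h) * (f * (\<Sum>n\<in>{level s..<level t}. dt n))
        + L * (\<Sum>n\<in>{level s..<level t}. \<delta> * dt n * grid_l2 dx dy (r n))"
      by (simp add: sum.distrib sum_distrib_left mult_ac)
    also have "\<dots> \<le> L * (2 + h) * (f * (t - s) + h / 4) + L * diss \<kappa>"
    proof (intro add_mono mult_left_mono)
      have "f * (\<Sum>n\<in>{level s..<level t}. dt n) = f * (tl (level t) - tl (level s))"
        using lev unfolding time_level_def by (simp add: sum_diff_nat_ivl[of 0, unfolded atLeast0LessThan])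
      also have "\<dots> \<le> f * (t - (s - dt (level s)))"
        using level_bounds[OF st(1)] level_bounds[OF st(2)] f_nonneg by (intro mult_left_mono) (auto simp: tl_Suc)
      also have "\<dots> = f * (t - s) + dt (level s) * f" by (simp add: algebra_simps)
      also have "\<dots> \<le> f * (t - s) + h / 4" using step_speed by simp
      finally show "f * (\<Sum>n\<in>{level s..<level t}. dt n) \<le> f * (t - s) + h / 4" .
      have "(\<Sum>n\<in>{level s..<level t}. \<delta> * dt n * grid_l2 dx dy (r n)) \<le> (\<Sum>n<level t. \<delta> * dt n * grid_l2 dx dy (r n))"
        using \<delta> dt grid_l2_nonneg by (intro sum_mono2) (auto intro!: mult_nonneg_nonneg intro: less_imp_le)
      also have "\<dots> \<le> diss \<kappa>"
        using level_bounds[OF st(2)] st by (intro dissipation \<kappa>) auto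
      finally show "(\<Sum>n\<in>{level s..<level t}. \<delta> * dt n * grid_l2 dx dy (r n)) \<le> diss \<kappa>" .
    qed (use L0 dx in auto)
    finally show ?thesis .
  qed
  show ?thesis
  proof (cases "s \<le> t")
    case True
    then show ?thesis using mono[OF st True] by simp
  next
    case False
    then show ?thesis using mono[OF st(2,1)] by (simp add: abs_minus_commute)
  qed
qed

end

section \<open>Weak form with test functions\<close>

lemma interval_integral_bound:
  fixes h :: "real \<Rightarrow> real"
  assumes "a \<le> b" and B: "\<And>s. s \<in> {a..<b} \<Longrightarrow> \<bar>h s\<bar> \<le> B" and "0 \<le> B"
  shows "\<bar>LINT s:{a..<b}|lborel. h s\<bar> \<le> (b - a) * B"
proof (cases "set_integrable lborel {a..<b} h")
  case True
  have c: "integrable lborel (\<lambda>s. indicator {a..<b} s * B)"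
    using assms(1) by (intro integrable_mult_left integrable_real_indicator) auto
  have "\<bar>LINT s:{a..<b}|lborel. h s\<bar> \<le> (LINT s|lborel. \<bar>indicator {a..<b} s *\<^sub>R h s\<bar>)"
    unfolding set_lebesgue_integral_def by (rule integral_abs_bound)
  also have "\<dots> \<le> (LINT s|lborel. indicator {a..<b} s * B)"
    using True c B unfolding set_integrable_def
    by (intro integral_mono integrable_abs) (auto simp: indicator_def)
  also have "\<dots> = (b - a) * B" using assms(1) by simp
  finally show ?thesis .
next
  case False
  then show ?thesis using assms
    by (simp add: set_lebesgue_integral_def set_integrable_def not_integrable_integral_eq)
qed

lemma interval_integrable:
  fixes h :: "real \<Rightarrow> real"
  assumes [measurable]: "h \<in> borel_measurable borel" and B: "\<And>s. \<bar>h s\<bar> \<le> B"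
  shows "set_integrable lborel {a..<b} h"
proof -
  have c: "integrable lborel (\<lambda>s. indicator {a..<b} s * B)"
    by (intro integrable_mult_left integrable_real_indicator)
      (cases "a \<le> b"; simp)+
  show ?thesis unfolding set_integrable_def
    by (rule Bochner_Integration.integrable_bound[OF c])
      (auto intro!: AE_I2 order_trans[OF B abs_ge_self] simp: indicator_def)
qed

lemma integral_Ico_FTC:
  fixes g :: "real \<Rightarrow> real"
  assumes "a \<le> b" and deriv: "\<And>s. (g has_real_derivative g' s) (at s)" and cont: "continuous_on UNIV g'"
  shows "(LINT s:{a..<b}|lborel. g' s) = g b - g a"
proof -
  have m [measurable]: "g' \<in> borel_measurable borel" by (rule borel_measurable_continuous_onI[OF cont])
  have "(LINT s:{a..<b}|lborel. g' s) = (LINT s:{a..b}|lborel. g' s)"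
    unfolding set_lebesgue_integral_def
  proof (rule integral_cong_AE)
    show "AE s in lborel. indicator {a..<b} s *\<^sub>R g' s = indicator {a..b} s *\<^sub>R g' s"
      using AE_lborel_singleton[of b] by eventually_elim (auto simp: indicator_def)
  qed measurable
  also have "\<dots> = (LBINT s. g' s * indicator {a..b} s)"
    by (simp add: set_lebesgue_integral_def mult.commute)
  also have "\<dots> = g b - g a"
    by (rule integral_FTC_Icc_real[OF assms(1)])
      (use deriv cont in \<open>auto intro: has_field_derivative_at_within simp: continuous_on_eq_continuous_at\<close>)
  finally show ?thesis .
qed

lemma index_diff_bound:
  fixes i k :: int and a b d :: real
  assumes "of_int i * d \<le> a" "a < of_int (i + 1) * d" "of_int k * d \<le> b" "b < of_int (k + 1) * d" "0 \<le> d"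
  shows "\<bar>b - a\<bar> \<le> (1 + \<bar>of_int (k - i)\<bar>) * d"
proof -
  have "b - a \<le> (1 + of_int (k - i)) * d" "a - b \<le> (1 + of_int (i - k)) * d"
    using assms by (simp_all add: algebra_simps)
  moreover have "(1 + of_int (k - i)) * d \<le> (1 + \<bar>of_int (k - i)\<bar>) * d"
    "(1 + of_int (i - k)) * d \<le> (1 + \<bar>of_int (k - i)\<bar>) * d"
    using assms(5) by (auto intro!: mult_right_mono)
  ultimately show ?thesis by linarith
qed

text \<open>Exactly what the consistency estimates consume, with one constant \<open>L\<close>; the
  derivatives are separate functions tied to \<phi> by finite-difference bounds.
  \<open>vanish\<close> covers all times from S on because the last time interval may reach beyond
  S.\<close>

locale spacetime_test =
  fixes \<phi> \<phi>t g1 g2 :: "real \<Rightarrow> real^2 \<Rightarrow> real" and S L :: real and K0 :: "(real^2) set"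
  assumes S_pos: "0 < S"
    and cont: "continuous_on UNIV (\<lambda>p. \<phi> (fst p) (snd p))" "continuous_on UNIV (\<lambda>p. \<phi>t (fst p) (snd p))"
      "continuous_on UNIV (\<lambda>p. g1 (fst p) (snd p))" "continuous_on UNIV (\<lambda>p. g2 (fst p) (snd p))"
    and bound: "\<And>t z. \<bar>\<phi> t z\<bar> \<le> L" "\<And>t z. \<bar>\<phi>t t z\<bar> \<le> L" "\<And>t z. \<bar>g1 t z\<bar> \<le> L" "\<And>t z. \<bar>g2 t z\<bar> \<le> L"
    and lipschitz: "\<And>t z d. \<bar>\<phi> t (z + pt d 0) - \<phi> t z\<bar> \<le> L * \<bar>d\<bar>" "\<And>t z d. \<bar>\<phi> t (z + pt 0 d) - \<phi> t z\<bar> \<le> L * \<bar>d\<bar>"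
    and expansion: "\<And>t z d. \<bar>\<phi> t (z + pt d 0) - \<phi> t z - d * g1 t z\<bar> \<le> L * d\<^sup>2"
      "\<And>t z d. \<bar>\<phi> t (z + pt 0 d) - \<phi> t z - d * g2 t z\<bar> \<le> L * d\<^sup>2"
    and time_lipschitz: "\<And>s t z. \<bar>g1 t z - g1 s z\<bar> \<le> L * \<bar>t - s\<bar>" "\<And>s t z. \<bar>g2 t z - g2 s z\<bar> \<le> L * \<bar>t - s\<bar>"
    and deriv: "\<And>t z. ((\<lambda>s. \<phi> s z) has_real_derivative \<phi>t t z) (at t)"
    and vanish: "\<And>t z. S \<le> t \<Longrightarrow> \<phi> t z = 0 \<and> g1 t z = 0 \<and> g2 t z = 0"
    and K0: "compact K0" and supp: "\<And>t z. z \<notin> K0 \<Longrightarrow> \<phi> t z = 0 \<and> g1 t z = 0 \<and> g2 t z = 0"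
begin

lemma L_nonneg: "0 \<le> L"
  using bound(1)[of 0 0] by linarith

lemma joint_measurable:
  "(\<lambda>(s, z). \<phi> s z) \<in> borel_measurable (borel \<Otimes>\<^sub>M borel)" "(\<lambda>(s, z). \<phi>t s z) \<in> borel_measurable (borel \<Otimes>\<^sub>M borel)"
  "(\<lambda>(s, z). g1 s z) \<in> borel_measurable (borel \<Otimes>\<^sub>M borel)" "(\<lambda>(s, z). g2 s z) \<in> borel_measurable (borel \<Otimes>\<^sub>M borel)"
  using cont[THEN borel_measurable_continuous_onI] by (simp_all add: borel_prod case_prod_beta')

lemma slice_continuous:
  assumes "continuous_on UNIV (\<lambda>p. q (fst p) (snd p))"
  shows "continuous_on UNIV (q (t :: real) :: real^2 \<Rightarrow> real)" "continuous_on UNIV (\<lambda>s. q s (z :: real^2) :: real)"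
proof -
  have "continuous_on UNIV (\<lambda>z. q (fst (t, z)) (snd (t, z)))"
    by (rule continuous_on_compose2[OF assms]) (auto intro!: continuous_intros)
  then show "continuous_on UNIV (q t)" by simp
  have "continuous_on UNIV (\<lambda>s. q (fst (s, z)) (snd (s, z)))"
    by (rule continuous_on_compose2[OF assms]) (auto intro!: continuous_intros)
  then show "continuous_on UNIV (\<lambda>s. q s z)" by simp
qed

lemma slice_measurable [measurable]:
  "\<phi> t \<in> borel_measurable borel" "\<phi>t t \<in> borel_measurable borel" "g1 t \<in> borel_measurable borel" "g2 t \<in> borel_measurable borel"
  using cont[THEN slice_continuous(1)] by (auto intro: borel_measurable_continuous_onI)

end

locale discretised_test = discretised F T f \<rho>in S dx dy \<delta> dt + spacetime_test \<phi> \<phi>t g1 g2 S L K0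
  for F T f \<rho>in S dx dy \<delta> dt \<phi> \<phi>t g1 g2 L K0
begin

abbreviation gm :: "nat \<Rightarrow> (real^2) measure" where "gm n \<equiv> grid_measure dx dy (r n)"

definition U :: "2 \<Rightarrow> nat \<Rightarrow> real^2 \<Rightarrow> real" where
  "U m n z = force_convolution F T (gm n) z $ m"

definition G :: "nat \<Rightarrow> real \<Rightarrow> real" where
  "G n s = (LINT z|gm n. \<phi> s z)"

definition P :: "nat \<Rightarrow> real \<Rightarrow> real" where
  "P n s = (LINT z|gm n. \<phi>t s z)"

definition J :: "nat \<Rightarrow> real \<Rightarrow> real" where
  "J n s = (LINT z|gm n. g1 s z * U 1 n z + g2 s z * U 2 n z)"

lemma gm_prob: "prob_space (gm n)"
  by (rule grid_density.prob_space_grid_measure[OF density])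

lemma U_measurable [measurable]: "U m n \<in> borel_measurable borel"
  unfolding U_def by (rule force_convolution_measurable[OF gm_prob sets_grid_measure])

lemma U_bound: "\<bar>U m n z\<bar> \<le> f"
  unfolding U_def by (rule force_convolution_bound[OF gm_prob sets_grid_measure])

lemma flux_bound: "\<bar>g1 s z * U 1 n z + g2 s z * U 2 n z\<bar> \<le> 2 * L * f"
proof -
  have "\<bar>g1 s z * U 1 n z\<bar> \<le> L * f" "\<bar>g2 s z * U 2 n z\<bar> \<le> L * f"
    unfolding abs_mult by (intro mult_mono bound U_bound L_nonneg abs_ge_zero)+
  then show ?thesis by linarith
qed

lemma integrable_gm:
  fixes q :: "real^2 \<Rightarrow> real"
  assumes "q \<in> borel_measurable borel" "\<And>z. \<bar>q z\<bar> \<le> B"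
  shows "integrable (gm n) q"
  by (rule grid_density.grid_integral_bounded(1)[OF density assms])

lemma integrable_flux: "integrable (gm n) (\<lambda>z. g1 s z * U 1 n z + g2 s z * U 2 n z)"
  by (rule integrable_gm[OF _ flux_bound]) measurable

lemma P_bound: "\<bar>P n s\<bar> \<le> L"
  unfolding P_def by (rule integral_abs_le_const[OF gm_prob bound(2) L_nonneg])

lemma J_bound: "\<bar>J n s\<bar> \<le> 2 * L * f"
  unfolding J_def using L_nonneg f_nonneg by (intro integral_abs_le_const[OF gm_prob flux_bound]) auto

lemma P_measurable [measurable]: "P n \<in> borel_measurable borel"
proof -
  interpret prob_space "gm n" by (rule gm_prob)
  show ?thesis unfolding P_def
    by (rule borel_measurable_lebesgue_integral) (use joint_measurable(2) in \<open>simp cong: measurable_cong_sets\<close>)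
qed

lemma J_measurable [measurable]: "J n \<in> borel_measurable borel"
proof -
  interpret prob_space "gm n" by (rule gm_prob)
  note [measurable] = joint_measurable(3,4)
  show ?thesis unfolding J_def
    by (rule borel_measurable_lebesgue_integral) measurable
qed

text \<open>The measure is frozen at level n, so only the test function moves: the fundamental
  theorem of calculus at each point, followed by Fubini.\<close>

lemma G_increment:
  assumes "a \<le> b"
  shows "G n b - G n a = (LINT s:{a..<b}|lborel. P n s)"
proof -
  interpret g: prob_space "gm n" by (rule gm_prob)
  interpret pair_sigma_finite "lborel :: real measure" "gm n" ..
  note [measurable] = joint_measurable(2)
  have F: "integrable (lborel \<Otimes>\<^sub>M gm n) (\<lambda>x. indicator {a..<b} (fst x) * \<phi>t (fst x) (snd x))"
  proof (rule Fubini_integrable)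
    show "(\<lambda>x. indicator {a..<b} (fst x) * \<phi>t (fst x) (snd x)) \<in> borel_measurable (lborel \<Otimes>\<^sub>M gm n)"
      using measurable_compose[OF _ joint_measurable(2), of "\<lambda>x. (fst x, snd x)" "lborel \<Otimes>\<^sub>M gm n"]
      by (intro borel_measurable_times) (auto simp: case_prod_beta')
    have i: "integrable (gm n) (\<lambda>z. indicator {a..<b} s * \<phi>t s z)" for s
      by (intro integrable_mult_right integrable_gm[OF slice_measurable(2) bound(2)])
    then show "AE s in lborel. integrable (gm n) (\<lambda>z. indicator {a..<b} (fst (s, z)) * \<phi>t (fst (s, z)) (snd (s, z)))"
      by simp
    have q: "(\<lambda>s. LINT z|gm n. \<bar>\<phi>t s z\<bar>) \<in> borel_measurable borel"
      by (rule g.borel_measurable_lebesgue_integral) measurable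
    have "\<bar>LINT z|gm n. \<bar>\<phi>t s z\<bar>\<bar> \<le> L" for s
      by (rule integral_abs_le_const[OF gm_prob _ L_nonneg]) (use bound(2) in auto)
    then have "set_integrable lborel {a..<b} (\<lambda>s. LINT z|gm n. \<bar>\<phi>t s z\<bar>)" by (rule interval_integrable[OF q])
    then show "integrable lborel (\<lambda>s. LINT z|gm n. norm (indicator {a..<b} (fst (s, z)) * \<phi>t (fst (s, z)) (snd (s, z))))"
      by (simp add: set_integrable_def abs_mult)
  qed
  have "(LINT s:{a..<b}|lborel. P n s) = (LINT s|lborel. LINT z|gm n. indicator {a..<b} s * \<phi>t s z)"
    by (simp add: P_def set_lebesgue_integral_def)
  also have "\<dots> = (LINT z|gm n. LINT s|lborel. indicator {a..<b} s * \<phi>t s z)"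
    using Fubini_integral[of "\<lambda>s z. indicator {a..<b} s * \<phi>t s z"] F by (simp add: case_prod_beta')
  also have "\<dots> = (LINT z|gm n. \<phi> b z - \<phi> a z)"
    using integral_Ico_FTC[OF assms deriv slice_continuous(2)[OF cont(2)]]
    by (simp add: set_lebesgue_integral_def)
  also have "\<dots> = G n b - G n a"
    unfolding G_def by (rule Bochner_Integration.integral_diff) (rule integrable_gm[OF slice_measurable(1) bound(1)])+
  finally show ?thesis by simp
qed

lemma J_time:
  assumes "0 \<le> b - s" "(b - s) * f \<le> h / 4"
  shows "\<bar>J n b - J n s\<bar> \<le> L * h / 2"
proof -
  have "J n b - J n s = (LINT z|gm n. (g1 b z * U 1 n z + g2 b z * U 2 n z) - (g1 s z * U 1 n z + g2 s z * U 2 n z))"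
    unfolding J_def by (rule Bochner_Integration.integral_diff[symmetric]) (rule integrable_flux)+
  moreover have "\<bar>LINT z|gm n. (g1 b z * U 1 n z + g2 b z * U 2 n z) - (g1 s z * U 1 n z + g2 s z * U 2 n z)\<bar> \<le> L * h / 2"
  proof (rule integral_abs_le_const[OF gm_prob])
    show "0 \<le> L * h / 2" using L_nonneg dx by simp
    fix z
    have "\<bar>(g1 b z - g1 s z) * U 1 n z\<bar> \<le> (L * \<bar>b - s\<bar>) * f" "\<bar>(g2 b z - g2 s z) * U 2 n z\<bar> \<le> (L * \<bar>b - s\<bar>) * f"
      unfolding abs_mult by (intro mult_mono time_lipschitz U_bound mult_nonneg_nonneg L_nonneg abs_ge_zero)+
    moreover have "(L * \<bar>b - s\<bar>) * f \<le> L * (h / 4)"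
      using mult_left_mono[OF assms(2) L_nonneg] assms(1) by (simp add: mult.assoc)
    moreover have "(g1 b z * U 1 n z + g2 b z * U 2 n z) - (g1 s z * U 1 n z + g2 s z * U 2 n z)
        = (g1 b z - g1 s z) * U 1 n z + (g2 b z - g2 s z) * U 2 n z" by (simp add: algebra_simps)
    ultimately show "\<bar>(g1 b z * U 1 n z + g2 b z * U 2 n z) - (g1 s z * U 1 n z + g2 s z * U 2 n z)\<bar> \<le> L * h / 2"
      by (simp only:)
  qed
  ultimately show ?thesis by simp
qed

text \<open>The one-step estimate evaluates the flux at the right end of an interval, whereas the
  weak form integrates it over the interval. Interval lengths times \<open>f\<close> are at most h /
  4, which makes the difference small.\<close>

lemma J_average:
  assumes "tl n \<le> S"
  shows "\<bar>(LINT s:{tl n..<min (tl (Suc n)) S}|lborel. J n s) - (min (tl (Suc n)) S - tl n) * J n (min (tl (Suc n)) S)\<bar>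
    \<le> (min (tl (Suc n)) S - tl n) * (L * h / 2)"
proof -
  let ?a = "tl n" and ?b = "min (tl (Suc n)) S"
  have ab: "?a \<le> ?b" using assms dt[of n] by (simp add: tl_Suc)
  have c: "set_integrable lborel {?a..<?b} (\<lambda>_. J n ?b)" by (rule interval_integrable[where B = "2 * L * f"]) (use J_bound in auto)
  have i: "set_integrable lborel {?a..<?b} (J n)" by (rule interval_integrable[OF J_measurable J_bound])
  have cc: "(LINT s:{?a..<?b}|lborel. J n ?b) = (?b - ?a) * J n ?b"
    using ab by (simp add: set_lebesgue_integral_def)
  have "(LINT s:{?a..<?b}|lborel. J n s) - (?b - ?a) * J n ?b = (LINT s:{?a..<?b}|lborel. J n s - J n ?b)"
    unfolding cc[symmetric] by (rule set_integral_diff(2)[OF i c, symmetric])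
  moreover have "\<bar>LINT s:{?a..<?b}|lborel. J n s - J n ?b\<bar> \<le> (?b - ?a) * (L * h / 2)"
  proof (rule interval_integral_bound[OF ab])
    show "0 \<le> L * h / 2" using L_nonneg dx by simp
    fix s assume s: "s \<in> {?a..<?b}"
    then have "(?b - s) * f \<le> dt n * f" using f_nonneg by (intro mult_right_mono) (auto simp: tl_Suc)
    also note step_speed
    finally have "\<bar>J n ?b - J n s\<bar> \<le> L * h / 2" using s by (intro J_time) auto
    then show "\<bar>J n s - J n ?b\<bar> \<le> L * h / 2" by (simp add: abs_minus_commute)
  qed
  ultimately show ?thesis by (simp only:)
qed

text \<open>Two points in cells that coincide or share an edge differ by at most 2 h in one
  coordinate and h in the other, hence the radius 3 h.\<close>

definition good :: "(real^2) set \<Rightarrow> real \<Rightarrow> nat \<Rightarrow> bool" where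
  "good K \<epsilon> n \<longleftrightarrow> (\<forall>z\<in>K. \<forall>z'. dist z' z \<le> 3 * h \<longrightarrow> (\<forall>m. \<bar>U m n z' - U m n z\<bar> \<le> \<epsilon>))"

text \<open>For h \<le> 1 a shift by one mesh width from outside this unit neighbourhood cannot
  reach \<open>K0\<close>.\<close>

definition K1 :: "(real^2) set" where
  "K1 = {x + y |x y. x \<in> K0 \<and> y \<in> cball 0 1}"

lemma compact_K1: "compact K1"
  unfolding K1_def by (rule compact_sums[OF K0 compact_cball])

lemma one_step_weak:
  assumes h1: "h \<le> 1" and \<epsilon>: "0 \<le> \<epsilon>" and gd: "good K1 \<epsilon> n"
  shows "\<bar>G (Suc n) s - G n s - dt n * J n s\<bar> \<le> dt n * L * (4 * f * h + 2 * \<epsilon>) + 2 * \<delta> * dt n * L * grid_l2 dx dy (r n)"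
  unfolding G_def J_def step_new
proof (rule upwind_step.one_step_gradient[OF step slice_measurable(1) bound(1) slice_measurable(3,4) U_measurable U_measurable
      bound(3,4) U_bound U_bound expansion _ \<epsilon>])
  show "g1 s z = 0 \<and> g2 s z = 0 \<and> (\<forall>d. \<bar>d\<bar> \<le> h \<longrightarrow> \<phi> s (z + pt d 0) = \<phi> s z \<and> \<phi> s (z + pt 0 d) = \<phi> s z)"
    if z: "z \<notin> K1" for z
  proof -
    have out: "z + y \<notin> K0" if "norm y \<le> 1" for y
    proof
      assume "z + y \<in> K0"
      then have "(z + y) + (- y) \<in> K1" unfolding K1_def using that
        by (intro CollectI exI[of _ "z + y"] exI[of _ "- y"]) auto
      then show False using z by simp
    qed
    have np: "norm (pt d 0) \<le> \<bar>d\<bar>" "norm (pt 0 d) \<le> \<bar>d\<bar>" for d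
      using norm_real2_le[of "pt d 0"] norm_real2_le[of "pt 0 d"] by simp_all
    have "z \<notin> K0" using out[of 0] by simp
    moreover have "z + pt d 0 \<notin> K0" "z + pt 0 d \<notin> K0" if "\<bar>d\<bar> \<le> h" for d
      using out[of "pt d 0"] out[of "pt 0 d"] np[of d] that h1 by auto
    ultimately show ?thesis using supp by auto
  qed
next
  fix i j z assume z: "z \<in> cell dx dy i j" and K: "z \<in> K1"
  have near: "\<bar>velocity F T dx dy (r n) m i' j' - U m n z\<bar> \<le> \<epsilon>"
    if ij: "\<bar>i' - i\<bar> \<le> 1" "\<bar>j' - j\<bar> \<le> 1" "i' = i \<or> j' = j" for m i' j'
  proof (rule velocity_near[OF density])
    fix z' assume z': "z' \<in> cell dx dy i' j'"
    have ex: "\<bar>z' $ 1 - z $ 1\<bar> \<le> (1 + \<bar>real_of_int (i' - i)\<bar>) * dx"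
      by (rule index_diff_bound) (use z z' dx in \<open>auto simp: cell_def\<close>)
    have ey: "\<bar>z' $ 2 - z $ 2\<bar> \<le> (1 + \<bar>real_of_int (j' - j)\<bar>) * dy"
      by (rule index_diff_bound) (use z z' dy in \<open>auto simp: cell_def\<close>)
    have "dist z' z \<le> \<bar>z' $ 1 - z $ 1\<bar> + \<bar>z' $ 2 - z $ 2\<bar>"
      using norm_real2_le[of "z' - z"] by (simp add: dist_norm)
    also have "\<dots> \<le> (1 + \<bar>real_of_int (i' - i)\<bar>) * h + (1 + \<bar>real_of_int (j' - j)\<bar>) * h"
      using ex ey by (intro add_mono) (auto elim!: order_trans intro!: mult_left_mono)
    also have "\<dots> \<le> 3 * h"
    proof -
      have "\<bar>real_of_int (i' - i)\<bar> + \<bar>real_of_int (j' - j)\<bar> \<le> 1" using ij by auto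
      then have "(2 + (\<bar>real_of_int (i' - i)\<bar> + \<bar>real_of_int (j' - j)\<bar>)) * h \<le> 3 * h"
        using dx by (intro mult_right_mono) auto
      then show ?thesis by (simp add: algebra_simps)
    qed
    finally show "\<bar>force_convolution F T (gm n) z' $ m - U m n z\<bar> \<le> \<epsilon>"
      using gd K unfolding good_def U_def by blast
  qed
  have avg: "\<bar>(a + b) / 2 - c\<bar> \<le> \<epsilon>" if "\<bar>a - c\<bar> \<le> \<epsilon>" "\<bar>b - c\<bar> \<le> \<epsilon>" for a b c
    using that by (simp add: abs_le_iff field_simps)
  show "\<bar>vel_x dx dy (r n) i j - U 1 n z\<bar> \<le> \<epsilon> \<and> \<bar>vel_x dx dy (r n) (i - 1) j - U 1 n z\<bar> \<le> \<epsilon> \<and>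
      \<bar>vel_y dx dy (r n) i j - U 2 n z\<bar> \<le> \<epsilon> \<and> \<bar>vel_y dx dy (r n) i (j - 1) - U 2 n z\<bar> \<le> \<epsilon>"
    unfolding vel_x_def vel_y_def by (intro conjI avg near) auto
qed

text \<open>The measure is changed at the fixed time \<open>tl (Suc n)\<close> and the time at the
  fixed level n. If the interval ends after S, the test function and its gradient vanish at the
  right ends involved, so no step is compared. This matters because \<open>dissipation\<close>
  controls only the steps that end by time S.\<close>

lemma interval_weak:
  assumes h1: "h \<le> 1" and \<epsilon>: "0 \<le> \<epsilon>" and gd: "good K1 \<epsilon> n" and n: "tl n \<le> S"
  shows "\<bar>G (Suc n) (tl (Suc n)) - G n (tl n) - (LINT s:{tl n..<min (tl (Suc n)) S}|lborel. P n s + J n s)\<bar>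
    \<le> (min (tl (Suc n)) S - tl n) * (L * (4 * f * h + 2 * \<epsilon> + h / 2))
      + (if tl (Suc n) \<le> S then 2 * L * (\<delta> * dt n * grid_l2 dx dy (r n)) else 0)"
proof -
  let ?a = "tl n" and ?b = "min (tl (Suc n)) S"
  have ab: "?a \<le> ?b" using n dt[of n] by (simp add: tl_Suc)
  have split: "(LINT s:{?a..<?b}|lborel. P n s + J n s) = (G n ?b - G n ?a) + (LINT s:{?a..<?b}|lborel. J n s)"
    unfolding G_increment[OF ab]
    by (rule set_integral_add(2)) (rule interval_integrable[OF P_measurable P_bound] interval_integrable[OF J_measurable J_bound])+
  note av = J_average[OF n]
  show ?thesis
  proof (cases "tl (Suc n) \<le> S")
    case True
    then have b: "?b = tl (Suc n)" "?b - ?a = dt n" by (simp_all add: tl_Suc)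
    note w = one_step_weak[OF h1 \<epsilon> gd, of "tl (Suc n)"]
    \<comment> \<open>Inserts the flux at the right end, which separates the one-step error from the
      averaging error.\<close>
    have arith: "x' - x - (y - x + q) = (x' - y - e) - (q - e)" for x x' y q e :: real by simp
    have "\<bar>G (Suc n) (tl (Suc n)) - G n ?a - (G n ?b - G n ?a + (LINT s:{?a..<?b}|lborel. J n s))\<bar>
      \<le> (dt n * L * (4 * f * h + 2 * \<epsilon>) + 2 * \<delta> * dt n * L * grid_l2 dx dy (r n)) + dt n * (L * h / 2)"
      unfolding arith[where e = "dt n * J n (tl (Suc n))"]
      by (rule order_trans[OF abs_triangle_ineq4 add_mono]) (use w av b in auto)
    also have "\<dots> = dt n * (L * (4 * f * h + 2 * \<epsilon> + h / 2)) + 2 * L * (\<delta> * dt n * grid_l2 dx dy (r n))"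
      by (simp add: algebra_simps)
    finally show ?thesis unfolding split using True b by simp
  next
    case False
    then have b: "?b = S" by simp
    have "G (Suc n) (tl (Suc n)) = 0" using vanish[of "tl (Suc n)"] False by (simp add: G_def)
    moreover have "G n ?b = 0" "J n ?b = 0" using vanish[of S] by (simp_all add: b G_def J_def)
    moreover have "\<bar>LINT s:{?a..<?b}|lborel. J n s\<bar> \<le> (?b - ?a) * (L * h / 2)" using av \<open>J n ?b = 0\<close> by simp
    moreover have "(?b - ?a) * (L * h / 2) \<le> (?b - ?a) * (L * (4 * f * h + 2 * \<epsilon> + h / 2))"
    proof -
      have "h / 2 \<le> 4 * f * h + 2 * \<epsilon> + h / 2" using f_nonneg dx \<epsilon> by simp
      then have "L * (h / 2) \<le> L * (4 * f * h + 2 * \<epsilon> + h / 2)" by (rule mult_left_mono[OF _ L_nonneg])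
      then have "L * h / 2 \<le> L * (4 * f * h + 2 * \<epsilon> + h / 2)" by simp
      then show ?thesis using ab by (intro mult_left_mono) auto
    qed
    ultimately show ?thesis unfolding split using False by simp
  qed
qed

definition W :: "real \<Rightarrow> real" where
  "W s = P (level s) s + J (level s) s"

lemma W_sum:
  assumes "n \<le> Suc (level S)"
  shows "set_integrable lborel {0..<min (tl n) S} W \<and>
    (LINT s:{0..<min (tl n) S}|lborel. W s) = (\<Sum>i<n. LINT s:{tl i..<min (tl (Suc i)) S}|lborel. P i s + J i s)"
  using assms
proof (induction n)
  case 0
  then show ?case using S by (simp add: set_integrable_def set_lebesgue_integral_def)
next
  case (Suc n)
  let ?b = "min (tl (Suc n)) S"
  have SS: "S \<in> {0..S}" using S by simp
  have n: "tl n \<le> S" using tl_mono[of n "level S"] level_bounds(1)[OF SS] Suc by simp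
  have ab: "tl n \<le> ?b" using n dt[of n] by (simp add: tl_Suc)
  have IH: "set_integrable lborel {0..<tl n} W"
    "(LINT s:{0..<tl n}|lborel. W s) = (\<Sum>i<n. LINT s:{tl i..<min (tl (Suc i)) S}|lborel. P i s + J i s)"
    using Suc n by (simp_all add: min_absorb1)
  have eq: "W s = P n s + J n s" if "s \<in> {tl n..<?b}" for s
    using level_eqI[of n s] that by (simp add: W_def)
  have i: "set_integrable lborel {tl n..<?b} (\<lambda>s. P n s + J n s)"
    by (intro set_integral_add interval_integrable[OF P_measurable P_bound] interval_integrable[OF J_measurable J_bound])
  have iW: "set_integrable lborel {tl n..<?b} W"
    using i by (subst set_integrable_cong[OF refl refl eq]) auto
  have un: "{0..<?b} = {0..<tl n} \<union> {tl n..<?b}" using ab tl_nonneg[of n] by (simp add: ivl_disj_un)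
  have "(LINT s:{0..<?b}|lborel. W s) = (LINT s:{0..<tl n}|lborel. W s) + (LINT s:{tl n..<?b}|lborel. W s)"
    unfolding un by (rule set_integral_Un[OF _ IH(1) iW]) auto
  also have "(LINT s:{tl n..<?b}|lborel. W s) = (LINT s:{tl n..<?b}|lborel. P n s + J n s)"
    by (rule set_lebesgue_integral_cong) (use eq in auto)
  finally show ?case using IH unfolding un by (auto intro: set_integrable_Un iW)
qed

text \<open>Summed over the intervals meeting \<open>{0..S}\<close>, the increments telescope to
  minus the initial pairing because the test vanishes at the final level. The interval lengths add
  up to S and the quadratic errors to the dissipation.\<close>

lemma weak_consistency:
  assumes h1: "h \<le> 1" and \<epsilon>: "0 \<le> \<epsilon>" and gd: "\<And>n. tl n \<le> S \<Longrightarrow> good K1 \<epsilon> n" and \<kappa>: "0 < \<kappa>"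
  shows "set_integrable lborel {0..<S} W"
    and "\<bar>(LINT s:{0..<S}|lborel. W s) + (LINT z|\<rho>in. \<phi> 0 z)\<bar>
      \<le> S * (L * (4 * f * h + 2 * \<epsilon> + h / 2)) + 2 * L * diss \<kappa> + 2 * L * h"
proof -
  \<comment> \<open>The number of intervals used: the last one contains S and therefore ends
    strictly after it.\<close>
  define N where "N = Suc (level S)"
  have SS: "S \<in> {0..S}" using S by simp
  have tN: "S < tl N" using level_bounds(2)[OF SS] by (simp add: N_def)
  have n_le: "tl n \<le> S" if "n < N" for n
    using tl_mono[of n "level S"] level_bounds(1)[OF SS] that by (simp add: N_def)
  have minN: "min (tl N) S = S" using tN by simp
  note Ws = W_sum[of N, unfolded minN]
  show "set_integrable lborel {0..<S} W" using Ws by (simp add: N_def)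
  let ?I = "\<lambda>n. LINT s:{tl n..<min (tl (Suc n)) S}|lborel. P n s + J n s"
  let ?len = "\<lambda>n. min (tl (Suc n)) S - tl n"
  let ?c = "L * (4 * f * h + 2 * \<epsilon> + h / 2)"
  let ?e = "\<lambda>n. if tl (Suc n) \<le> S then 2 * L * (\<delta> * dt n * grid_l2 dx dy (r n)) else 0"
  have "(\<Sum>n<N. G (Suc n) (tl (Suc n)) - G n (tl n) - ?I n) = G N (tl N) - G 0 0 - (LINT s:{0..<S}|lborel. W s)"
    using Ws sum_lessThan_telescope[of "\<lambda>n. G n (tl n)" N] by (simp add: sum_subtractf N_def)
  moreover have "G N (tl N) = 0" using vanish[of "tl N"] tN by (simp add: G_def)
  ultimately have eq: "(LINT s:{0..<S}|lborel. W s) + G 0 0 = - (\<Sum>n<N. G (Suc n) (tl (Suc n)) - G n (tl n) - ?I n)"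
    by simp
  have "\<bar>\<Sum>n<N. G (Suc n) (tl (Suc n)) - G n (tl n) - ?I n\<bar> \<le> (\<Sum>n<N. ?len n * ?c + ?e n)"
    by (rule order_trans[OF sum_abs sum_mono]) (use interval_weak[OF h1 \<epsilon> gd] n_le in auto)
  also have "\<dots> = (\<Sum>n<N. ?len n) * ?c + (\<Sum>n<N. ?e n)" by (simp add: sum.distrib sum_distrib_right)
  also have "(\<Sum>n<N. ?len n) = S"
  proof -
    have "(\<Sum>n<N. ?len n) = (\<Sum>n<N. min (tl (Suc n)) S - min (tl n) S)"
      by (rule sum.cong) (use n_le in \<open>auto simp: min_absorb1\<close>)
    also have "\<dots> = S" using minN S sum_lessThan_telescope[of "\<lambda>n. min (tl n) S" N] by simp
    finally show ?thesis .
  qed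
  also have "(\<Sum>n<N. ?e n) = 2 * L * (\<Sum>n<level S. \<delta> * dt n * grid_l2 dx dy (r n))"
  proof -
    \<comment> \<open>The entry of the last interval is 0, since that interval ends after S.\<close>
    have "(\<Sum>n<N. ?e n) = (\<Sum>n<level S. ?e n)" using tN by (simp add: N_def)
    also have "\<dots> = (\<Sum>n<level S. 2 * L * (\<delta> * dt n * grid_l2 dx dy (r n)))"
      by (rule sum.cong) (use n_le[of "Suc _"] in \<open>auto simp: N_def\<close>)
    finally show ?thesis by (simp add: sum_distrib_left)
  qed
  finally have b1: "\<bar>\<Sum>n<N. G (Suc n) (tl (Suc n)) - G n (tl n) - ?I n\<bar>
      \<le> S * ?c + 2 * L * (\<Sum>n<level S. \<delta> * dt n * grid_l2 dx dy (r n))" .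
  have "2 * L * (\<Sum>n<level S. \<delta> * dt n * grid_l2 dx dy (r n)) \<le> 2 * L * diss \<kappa>"
    using L_nonneg level_bounds(1)[OF SS] by (intro mult_left_mono dissipation \<kappa>) auto
  moreover have "\<bar>G 0 0 - (LINT z|\<rho>in. \<phi> 0 z)\<bar> \<le> 2 * L * h"
    unfolding G_def by (rule initial_consistency[OF slice_measurable(1) bound(1) lipschitz])
  ultimately show "\<bar>(LINT s:{0..<S}|lborel. W s) + (LINT z|\<rho>in. \<phi> 0 z)\<bar>
      \<le> S * ?c + 2 * L * diss \<kappa> + 2 * L * h"
    using b1 eq by linarith
qed

end

section \<open>Calculus for smooth test functions and for the cutoffs\<close>

lemma real_mean_value:
  fixes g :: "real \<Rightarrow> real"
  assumes "\<And>s. (g has_real_derivative g' s) (at s)"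
  shows "\<exists>\<xi>. \<bar>\<xi>\<bar> \<le> \<bar>d\<bar> \<and> g d - g 0 = d * g' \<xi>"
proof -
  consider "d = 0" | "0 < d" | "d < 0" by linarith
  then show ?thesis
  proof cases
    case 2
    then obtain \<xi> where "0 < \<xi>" "\<xi> < d" "g d - g 0 = (d - 0) * g' \<xi>" using MVT2[of 0 d g g'] assms by blast
    then show ?thesis by (intro exI[of _ \<xi>]) auto
  next
    case 3
    then obtain \<xi> where "d < \<xi>" "\<xi> < 0" "g 0 - g d = (0 - d) * g' \<xi>" using MVT2[of d 0 g g'] assms by blast
    then show ?thesis by (intro exI[of _ \<xi>]) auto
  qed auto
qed

lemma real_lipschitz_bound:
  fixes g :: "real \<Rightarrow> real"
  assumes "\<And>s. (g has_real_derivative g' s) (at s)" "\<And>s. \<bar>g' s\<bar> \<le> B"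
  shows "\<bar>g d - g 0\<bar> \<le> B * \<bar>d\<bar>"
proof -
  obtain \<xi> where "g d - g 0 = d * g' \<xi>" using real_mean_value[OF assms(1)] by blast
  then show ?thesis using mult_right_mono[OF assms(2)[of \<xi>] abs_ge_zero[of d]] by (simp add: abs_mult mult.commute)
qed

text \<open>The mean value point lies within distance |d| of 0, where the Lipschitz condition on the
  derivative applies. Only the order d^2 matters, so the factor 1/2 of the sharp constant is given
  up.\<close>

lemma real_taylor_bound:
  fixes g :: "real \<Rightarrow> real"
  assumes "\<And>s. (g has_real_derivative g' s) (at s)" and lip: "\<And>s. \<bar>g' s - g' 0\<bar> \<le> B * \<bar>s\<bar>" and "0 \<le> B"
  shows "\<bar>g d - g 0 - d * g' 0\<bar> \<le> B * d\<^sup>2"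
proof -
  obtain \<xi> where \<xi>: "\<bar>\<xi>\<bar> \<le> \<bar>d\<bar>" "g d - g 0 = d * g' \<xi>" using real_mean_value[OF assms(1)] by blast
  have "\<bar>g d - g 0 - d * g' 0\<bar> = \<bar>d\<bar> * \<bar>g' \<xi> - g' 0\<bar>"
    unfolding \<xi>(2) abs_mult[symmetric] by (simp add: algebra_simps)
  moreover have "\<bar>g' \<xi> - g' 0\<bar> \<le> B * \<bar>d\<bar>"
    using lip[of \<xi>] mult_left_mono[OF \<xi>(1) assms(3)] by linarith
  ultimately show ?thesis
    using mult_left_mono[of "\<bar>g' \<xi> - g' 0\<bar>" "B * \<bar>d\<bar>" "\<bar>d\<bar>"] by (simp add: power2_eq_square mult.left_commute)
qed

lemma real_second_difference:
  fixes g :: "real \<Rightarrow> real"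
  assumes "\<And>s. (g has_real_derivative g' s) (at s)" "\<And>s. \<bar>g' s - g' 0\<bar> \<le> B * \<bar>s\<bar>" "0 \<le> B"
  shows "\<bar>g d - 2 * g 0 + g (- d)\<bar> \<le> 2 * B * d\<^sup>2"
  using real_taylor_bound[OF assms, of d] real_taylor_bound[OF assms, of "- d"] by (simp add: abs_le_iff)

abbreviation dir_deriv :: "'a::euclidean_space \<Rightarrow> ('a \<Rightarrow> real) \<Rightarrow> 'a \<Rightarrow> real" where
  "dir_deriv v \<phi> \<equiv> \<lambda>x. frechet_derivative \<phi> (at x) v"

lemma smooth_dir_deriv: "smooth \<phi> \<Longrightarrow> smooth (dir_deriv v \<phi>)"
  unfolding smooth_def by (metis Ck.simps(2))

lemma smooth_continuous: "smooth \<phi> \<Longrightarrow> continuous_on UNIV \<phi>"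
  unfolding smooth_def by (metis Ck.simps(1))

lemma smooth_has_derivative: "smooth \<phi> \<Longrightarrow> (\<phi> has_derivative frechet_derivative \<phi> (at x)) (at x)"
  unfolding smooth_def frechet_derivative_works[symmetric] by (metis Ck.simps(2))

lemma smooth_line_deriv:
  assumes "smooth \<phi>"
  shows "((\<lambda>s. \<phi> (x + s *\<^sub>R v)) has_real_derivative dir_deriv v \<phi> (x + s *\<^sub>R v)) (at s)"
proof -
  have "((\<lambda>s. x + s *\<^sub>R v) has_derivative (\<lambda>s. s *\<^sub>R v)) (at s)"
    by (auto intro!: derivative_eq_intros)
  from diff_chain_at[OF this smooth_has_derivative[OF assms]]
  have "((\<lambda>s. \<phi> (x + s *\<^sub>R v)) has_derivative (\<lambda>t. frechet_derivative \<phi> (at (x + s *\<^sub>R v)) (t *\<^sub>R v))) (at s)"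
    by (simp add: o_def)
  then show ?thesis
    using linear_scale[OF has_derivative_linear[OF smooth_has_derivative[OF assms]]]
    by (simp add: has_field_derivative_def mult.commute[of _ "_ :: real"] fun_eq_iff mult_commute_abs)
qed

lemma dir_deriv_support:
  fixes \<phi> :: "'a::euclidean_space \<Rightarrow> real"
  assumes "closed K" and "\<And>x. x \<notin> K \<Longrightarrow> \<phi> x = 0" and "x \<notin> K"
  shows "dir_deriv v \<phi> x = 0"
proof -
  have "(\<phi> has_derivative (\<lambda>_. 0)) (at x)"
    by (rule has_derivative_transform_within_open[OF has_derivative_const, where s = "- K"])
      (use assms in auto)
  from fun_cong[OF frechet_derivative_at[OF this], of v] show ?thesis by simp
qed

lemma compact_support_bounded:
  fixes \<phi> :: "'a::euclidean_space \<Rightarrow> real"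
  assumes "continuous_on UNIV \<phi>" "compact K" "\<And>x. x \<notin> K \<Longrightarrow> \<phi> x = 0"
  shows "\<exists>B. \<forall>x. \<bar>\<phi> x\<bar> \<le> B"
proof -
  have "bounded (\<phi> ` K)"
    using assms by (intro compact_imp_bounded compact_continuous_image continuous_on_subset[OF assms(1)]) auto
  then obtain B where B: "\<And>x. x \<in> K \<Longrightarrow> \<bar>\<phi> x\<bar> \<le> B" by (auto simp: bounded_iff)
  have "\<bar>\<phi> x\<bar> \<le> max B 0" for x using B[of x] assms(3)[of x] by (cases "x \<in> K") auto
  then show ?thesis by blast
qed

lemma finite_common_bound:
  assumes "finite A" "\<And>\<psi>. \<psi> \<in> A \<Longrightarrow> \<exists>B. \<forall>x. \<bar>\<psi> x\<bar> \<le> (B :: real)"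
  shows "\<exists>L. \<forall>\<psi>\<in>A. \<forall>x. \<bar>\<psi> x\<bar> \<le> L"
proof -
  obtain b where b: "\<And>\<psi> x. \<psi> \<in> A \<Longrightarrow> \<bar>\<psi> x\<bar> \<le> b \<psi>" using assms(2) by metis
  have "\<bar>\<psi> x\<bar> \<le> (\<Sum>\<psi>\<in>A. \<bar>b \<psi>\<bar>)" if "\<psi> \<in> A" for \<psi> x
    using b[OF that, of x] member_le_sum[OF that, of "\<lambda>\<psi>. \<bar>b \<psi>\<bar>"] assms(1) by force
  then show ?thesis by blast
qed

lemma time_deriv_dir:
  assumes "smooth \<phi>"
  shows "((\<lambda>s. \<phi> (s, z)) has_real_derivative dir_deriv (1, 0) \<phi> (t, z)) (at t)" "time_deriv \<phi> t z = dir_deriv (1, 0) \<phi> (t, z)"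
proof -
  show "((\<lambda>s. \<phi> (s, z)) has_real_derivative dir_deriv (1, 0) \<phi> (t, z)) (at t)"
    using smooth_line_deriv[OF assms, of "(0, z)" "(1, 0)" t] by simp
  then show "time_deriv \<phi> t z = dir_deriv (1, 0) \<phi> (t, z)" unfolding time_deriv_def by (rule DERIV_imp_deriv)
qed

lemma space_grad_dir:
  assumes "smooth \<phi>"
  shows "space_grad \<phi> t z $ m = dir_deriv (0, axis m 1) \<phi> (t, z)"
proof -
  have "((\<lambda>y. (t, y)) has_derivative (\<lambda>y. (0, y))) (at z)" by (auto intro!: derivative_eq_intros)
  from diff_chain_at[OF this smooth_has_derivative[OF assms]]
  have "((\<lambda>y. \<phi> (t, y)) has_derivative (\<lambda>y. frechet_derivative \<phi> (at (t, z)) (0, y))) (at z)" by (simp add: o_def)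
  from frechet_derivative_at[OF this] show ?thesis by (simp add: space_grad_def fun_eq_iff)
qed

lemma pt_axis: "pt d 0 = d *\<^sub>R axis 1 1" "pt 0 d = d *\<^sub>R axis 2 1"
  by (simp_all add: vec_eq_iff forall_2 axis_def)

text \<open>All derivatives vanish off the compact support and are continuous, hence bounded. Each
  Lipschitz or expansion estimate is then a one-dimensional statement along a coordinate
  line.\<close>

theorem test_function_regularity:
  assumes test: "test_function S \<phi>" and S: "0 < S"
  shows "\<exists>L K0. spacetime_test (\<lambda>t z. \<phi> (t, z)) (time_deriv \<phi>) (\<lambda>t z. space_grad \<phi> t z $ 1) (\<lambda>t z. space_grad \<phi> t z $ 2) S L K0"
proof -
  define K where "K = closure {p. \<phi> p \<noteq> 0}"
  have sm: "smooth \<phi>" and K: "compact K" and KS: "K \<subseteq> {..<S} \<times> UNIV"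
    using test by (auto simp: test_function_def K_def)
  have supp: "\<phi> x = 0" if "x \<notin> K" for x
    using that closure_subset[of "{p. \<phi> p \<noteq> 0}"] unfolding K_def by blast
  have dsupp: "dir_deriv v \<phi> x = 0" if "x \<notin> K" for v x
    by (rule dir_deriv_support[OF compact_imp_closed[OF K] supp that])
  have ddsupp: "dir_deriv w (dir_deriv v \<phi>) x = 0" if "x \<notin> K" for v w x
    by (rule dir_deriv_support[OF compact_imp_closed[OF K] dsupp that])
  define e :: "2 \<Rightarrow> real \<times> (real^2)" where "e m = (0, axis m 1)" for m
  let ?T = "(1, 0) :: real \<times> (real^2)"
  \<comment> \<open>All functions that need a bound: \<phi> and its first derivatives, the pure
    second derivatives in space for the expansions, and the mixed ones for the time Lipschitz bounds
    of the gradient.\<close>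
  let ?A = "{\<phi>, dir_deriv ?T \<phi>, dir_deriv (e 1) \<phi>, dir_deriv (e 2) \<phi>, dir_deriv (e 1) (dir_deriv (e 1) \<phi>),
    dir_deriv (e 2) (dir_deriv (e 2) \<phi>), dir_deriv ?T (dir_deriv (e 1) \<phi>), dir_deriv ?T (dir_deriv (e 2) \<phi>)}"
  have bounded: "\<exists>B. \<forall>x. \<bar>\<psi> x\<bar> \<le> B" if "\<psi> \<in> ?A" for \<psi>
  proof (rule compact_support_bounded[OF _ K])
    show "continuous_on UNIV \<psi>" using that sm by (auto intro!: smooth_continuous smooth_dir_deriv)
    show "\<psi> x = 0" if "x \<notin> K" for x using \<open>\<psi> \<in> ?A\<close>
      by (elim insertE emptyE) (simp_all only: supp[OF that] dsupp[OF that] ddsupp[OF that])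
  qed
  have "\<exists>L. \<forall>\<psi>\<in>?A. \<forall>x. \<bar>\<psi> x\<bar> \<le> L" by (rule finite_common_bound[OF _ bounded]) (intro finite_insert[THEN iffD2] finite.emptyI)
  then obtain L where L': "\<forall>\<psi>\<in>?A. \<forall>x. \<bar>\<psi> x\<bar> \<le> L" ..
  have L: "\<bar>\<psi> x\<bar> \<le> L" if "\<psi> \<in> ?A" for \<psi> x by (rule L'[rule_format, OF that])
  have "0 \<le> \<bar>\<phi> 0\<bar>" by simp
  also have "\<dots> \<le> L" by (rule L) simp
  finally have L0: "0 \<le> L" .
  note grad = space_grad_dir[OF sm, folded e_def]
  have move: "\<psi> (t, z + pt d 0) = \<psi> ((t, z) + d *\<^sub>R e 1)" "\<psi> (t, z + pt 0 d) = \<psi> ((t, z) + d *\<^sub>R e 2)"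
    for \<psi> :: "real \<times> (real^2) \<Rightarrow> real" and t z d by (simp_all add: pt_axis e_def)
  have lip: "\<bar>\<psi> (x + d *\<^sub>R v) - \<psi> x\<bar> \<le> L * \<bar>d\<bar>" if "smooth \<psi>" "dir_deriv v \<psi> \<in> ?A" for \<psi> v x d
  proof -
    have "\<bar>\<psi> (x + d *\<^sub>R v) - \<psi> (x + 0 *\<^sub>R v)\<bar> \<le> L * \<bar>d\<bar>"
      by (rule real_lipschitz_bound[where g = "\<lambda>s. \<psi> (x + s *\<^sub>R v)" and g' = "\<lambda>s. dir_deriv v \<psi> (x + s *\<^sub>R v)"])
        (rule smooth_line_deriv[OF that(1)] L[OF that(2)])+
    then show ?thesis by simp
  qed
  have taylor: "\<bar>\<phi> (x + d *\<^sub>R e m) - \<phi> x - d * dir_deriv (e m) \<phi> x\<bar> \<le> L * d\<^sup>2"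
    if "dir_deriv (e m) (dir_deriv (e m) \<phi>) \<in> ?A" for m x d
  proof -
    have "\<bar>\<phi> (x + d *\<^sub>R e m) - \<phi> (x + 0 *\<^sub>R e m) - d * dir_deriv (e m) \<phi> (x + 0 *\<^sub>R e m)\<bar> \<le> L * d\<^sup>2"
    proof (rule real_taylor_bound[where g = "\<lambda>s. \<phi> (x + s *\<^sub>R e m)" and g' = "\<lambda>s. dir_deriv (e m) \<phi> (x + s *\<^sub>R e m)"])
      show "\<bar>dir_deriv (e m) \<phi> (x + s *\<^sub>R e m) - dir_deriv (e m) \<phi> (x + 0 *\<^sub>R e m)\<bar> \<le> L * \<bar>s\<bar>" for s
        using lip[OF smooth_dir_deriv[OF sm] that, of x s] by simp
    qed (rule smooth_line_deriv[OF sm] L0)+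
    then show ?thesis by simp
  qed
  have cont: "continuous_on UNIV (\<lambda>p. \<psi> (fst p, snd p))" if "smooth \<psi>" for \<psi> :: "real \<times> (real^2) \<Rightarrow> real"
    using smooth_continuous[OF that] by simp
  have tl: "\<bar>dir_deriv (e m) \<phi> (t, z) - dir_deriv (e m) \<phi> (s, z)\<bar> \<le> L * \<bar>t - s\<bar>"
    if "dir_deriv ?T (dir_deriv (e m) \<phi>) \<in> ?A" for m s t z
    using lip[OF smooth_dir_deriv[OF sm] that, of "(s, z)" "t - s"] by simp
  have outS: "(t, z) \<notin> K" if "S \<le> t" for t z using KS that by auto
  have outK: "(t, z) \<notin> K" if "z \<notin> snd ` K" for t z using that by force
  show ?thesis
  proof (intro exI[of _ L] exI[of _ "snd ` K"], unfold_locales, goal_cases)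
    case 1 show ?case by (rule S)
  next case 2 show ?case by (rule cont[OF sm])
  next case 3 show ?case unfolding time_deriv_dir(2)[OF sm] by (rule cont[OF smooth_dir_deriv[OF sm]])
  next case 4 show ?case unfolding grad by (rule cont[OF smooth_dir_deriv[OF sm]])
  next case 5 show ?case unfolding grad by (rule cont[OF smooth_dir_deriv[OF sm]])
  next case 6 show ?case by (rule L[of \<phi>]) simp
  next case 7 show ?case unfolding time_deriv_dir(2)[OF sm] by (rule L[of "dir_deriv ?T \<phi>"]) simp
  next case 8 show ?case unfolding grad by (rule L[of "dir_deriv (e 1) \<phi>"]) simp
  next case 9 show ?case unfolding grad by (rule L[of "dir_deriv (e 2) \<phi>"]) simp
  next case 10 show ?case unfolding move by (rule lip[OF sm]) simp
  next case 11 show ?case unfolding move by (rule lip[OF sm]) simp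
  next case 12 show ?case unfolding move grad by (rule taylor) simp
  next case 13 show ?case unfolding move grad by (rule taylor) simp
  next case 14 show ?case unfolding grad by (rule tl) simp
  next case 15 show ?case unfolding grad by (rule tl) simp
  next case 16 show ?case unfolding time_deriv_dir(2)[OF sm] by (rule time_deriv_dir(1)[OF sm])
  next case 17 then show ?case unfolding grad using supp dsupp outS by simp
  next case 18 show ?case by (rule compact_continuous_image[OF _ K]) (intro continuous_intros)
  next case 19 then show ?case unfolding grad using supp dsupp outK by simp
  qed
qed

text \<open>Factor out y - x; the remaining quotient is at most 1 because 2 |x| \<le> 1 +
  x^2.\<close>

lemma arctan_deriv_lipschitz: "\<bar>inverse (1 + x\<^sup>2) - inverse (1 + y\<^sup>2)\<bar> \<le> \<bar>x - y :: real\<bar>"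
proof -
  have pos: "0 < 1 + x\<^sup>2" "0 < 1 + y\<^sup>2" by (simp_all add: add_pos_nonneg)
  have "inverse (1 + x\<^sup>2) - inverse (1 + y\<^sup>2) = (y - x) * ((x + y) / ((1 + x\<^sup>2) * (1 + y\<^sup>2)))"
    using pos by (simp add: field_simps power2_eq_square)
  moreover have "\<bar>(x + y) / ((1 + x\<^sup>2) * (1 + y\<^sup>2))\<bar> \<le> 1"
  proof -
    have "\<bar>x\<bar> \<le> (1 + x\<^sup>2) / 2" "\<bar>y\<bar> \<le> (1 + y\<^sup>2) / 2"
      using zero_le_power2[of "\<bar>x\<bar> - 1"] zero_le_power2[of "\<bar>y\<bar> - 1"] by (simp_all add: power2_diff)
    then have "\<bar>x + y\<bar> \<le> 1 + x\<^sup>2 / 2 + y\<^sup>2 / 2" using abs_triangle_ineq[of x y] by (simp add: field_simps)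
    also have "\<dots> \<le> 1 + x\<^sup>2 + y\<^sup>2 + x\<^sup>2 * y\<^sup>2"
      using zero_le_power2[of x] zero_le_power2[of y] mult_nonneg_nonneg[of "x\<^sup>2" "y\<^sup>2"] by linarith
    also have "\<dots> = (1 + x\<^sup>2) * (1 + y\<^sup>2)" by (simp add: algebra_simps)
    finally show ?thesis using pos by (simp add: abs_mult)
  qed
  ultimately show ?thesis
    using mult_left_mono[of "\<bar>(x + y) / ((1 + x\<^sup>2) * (1 + y\<^sup>2))\<bar>" 1 "\<bar>y - x\<bar>"]
    by (simp only: abs_mult) (simp add: abs_minus_commute)
qed

lemma cutoff_deriv:
  "((\<lambda>s. cutoff n a (x + s)) has_real_derivative (real n)\<^sup>2 * inverse (1 + ((real n)\<^sup>2 * (x + s - a) - real n)\<^sup>2) / pi) (at s)"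
  unfolding cutoff_def by (auto intro!: derivative_eq_intros)

lemma cutoff_regularity:
  shows "\<bar>cutoff n a (x + d) - cutoff n a x\<bar> \<le> (real n)\<^sup>2 * \<bar>d\<bar>"
    and "\<bar>cutoff n a (x + d) - 2 * cutoff n a x + cutoff n a (x + - d)\<bar> \<le> 2 * real n ^ 4 * d\<^sup>2"
proof -
  have pi1: "1 \<le> pi" using pi_gt3 by linarith
  let ?g = "\<lambda>s. (real n)\<^sup>2 * inverse (1 + ((real n)\<^sup>2 * (x + s - a) - real n)\<^sup>2) / pi"
  have over_pi: "\<bar>q / pi\<bar> \<le> \<bar>q\<bar>" for q
    using pi1 mult_left_mono[of 1 pi "\<bar>q\<bar>"] by (simp add: abs_divide field_simps)
  have b: "\<bar>?g s\<bar> \<le> (real n)\<^sup>2" for s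
  proof -
    have "inverse (1 + ((real n)\<^sup>2 * (x + s - a) - real n)\<^sup>2) \<le> 1" by (simp add: inverse_le_1_iff)
    then have "\<bar>(real n)\<^sup>2 * inverse (1 + ((real n)\<^sup>2 * (x + s - a) - real n)\<^sup>2)\<bar> \<le> (real n)\<^sup>2"
      using mult_left_mono[of "inverse (1 + ((real n)\<^sup>2 * (x + s - a) - real n)\<^sup>2)" 1 "(real n)\<^sup>2"]
      by (simp add: abs_mult)
    then show ?thesis by (rule order_trans[OF over_pi])
  qed
  have l: "\<bar>?g s - ?g 0\<bar> \<le> real n ^ 4 * \<bar>s\<bar>" for s
  proof -
    let ?p = "(real n)\<^sup>2 * (x + s - a) - real n" and ?q = "(real n)\<^sup>2 * (x + 0 - a) - real n"
    have "\<bar>inverse (1 + ?p\<^sup>2) - inverse (1 + ?q\<^sup>2)\<bar> \<le> \<bar>?p - ?q\<bar>" by (rule arctan_deriv_lipschitz)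
    moreover have "?p - ?q = (real n)\<^sup>2 * s" by (simp add: algebra_simps)
    ultimately have "\<bar>inverse (1 + ?p\<^sup>2) - inverse (1 + ?q\<^sup>2)\<bar> \<le> (real n)\<^sup>2 * \<bar>s\<bar>" by (simp only: abs_mult) simp
    then have le: "(real n)\<^sup>2 * \<bar>inverse (1 + ?p\<^sup>2) - inverse (1 + ?q\<^sup>2)\<bar> \<le> (real n)\<^sup>2 * ((real n)\<^sup>2 * \<bar>s\<bar>)"
      by (rule mult_left_mono) simp
    have "(real n)\<^sup>2 * ((real n)\<^sup>2 * \<bar>s\<bar>) = real n ^ 4 * \<bar>s\<bar>" by (simp add: power2_eq_square power4_eq_xxxx)
    then have "\<bar>(real n)\<^sup>2 * (inverse (1 + ?p\<^sup>2) - inverse (1 + ?q\<^sup>2))\<bar> \<le> real n ^ 4 * \<bar>s\<bar>"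
      using le unfolding abs_mult by (simp only: abs_power2 abs_of_nat power_abs)
    note bd = order_trans[OF over_pi this]
    have "?g s - ?g 0 = ((real n)\<^sup>2 * (inverse (1 + ?p\<^sup>2) - inverse (1 + ?q\<^sup>2))) / pi"
      by (simp only: right_diff_distrib diff_divide_distrib)
    then show ?thesis using bd by (simp only:)
  qed
  have "\<bar>cutoff n a (x + d) - cutoff n a (x + 0)\<bar> \<le> (real n)\<^sup>2 * \<bar>d\<bar>"
    by (rule real_lipschitz_bound[where g = "\<lambda>s. cutoff n a (x + s)" and g' = ?g]) (rule cutoff_deriv b)+
  then show "\<bar>cutoff n a (x + d) - cutoff n a x\<bar> \<le> (real n)\<^sup>2 * \<bar>d\<bar>" by simp
  have "\<bar>cutoff n a (x + d) - 2 * cutoff n a (x + 0) + cutoff n a (x + - d)\<bar> \<le> 2 * real n ^ 4 * d\<^sup>2"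
    by (rule real_second_difference[where g = "\<lambda>s. cutoff n a (x + s)" and g' = ?g]) (rule cutoff_deriv l zero_le_power of_nat_0_le_iff)+
  then show "\<bar>cutoff n a (x + d) - 2 * cutoff n a x + cutoff n a (x + - d)\<bar> \<le> 2 * real n ^ 4 * d\<^sup>2" by simp
qed

text \<open>Along a coordinate shift one factor of the product is constant and at most 1. A single
  constant is used because \<open>equicontinuity\<close> asks for the same \<open>L\<close> as sup
  bound, Lipschitz constant and second-difference bound.\<close>

lemma orthant_test_regularity:
  shows "\<bar>orthant_test n a b (z + pt d 0) - orthant_test n a b z\<bar> \<le> (1 + (real n)\<^sup>2 + 2 * real n ^ 4) * \<bar>d\<bar>"
    and "\<bar>orthant_test n a b (z + pt 0 d) - orthant_test n a b z\<bar> \<le> (1 + (real n)\<^sup>2 + 2 * real n ^ 4) * \<bar>d\<bar>"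
    and "\<bar>orthant_test n a b (z + pt d 0) - 2 * orthant_test n a b z + orthant_test n a b (z + pt (- d) 0)\<bar>
      \<le> (1 + (real n)\<^sup>2 + 2 * real n ^ 4) * d\<^sup>2"
    and "\<bar>orthant_test n a b (z + pt 0 d) - 2 * orthant_test n a b z + orthant_test n a b (z + pt 0 (- d))\<bar>
      \<le> (1 + (real n)\<^sup>2 + 2 * real n ^ 4) * d\<^sup>2"
proof -
  let ?L = "1 + (real n)\<^sup>2 + 2 * real n ^ 4"
  have c: "\<bar>cutoff n a x\<bar> \<le> 1" for n a x using cutoff_bounds[of n a x] by simp
  have L: "(real n)\<^sup>2 \<le> ?L" "2 * real n ^ 4 \<le> ?L" by simp_all
  have shrink: "\<bar>p * q\<bar> \<le> ?L * w" if "\<bar>p\<bar> \<le> l * w" "l \<le> ?L" "\<bar>q\<bar> \<le> 1" "0 \<le> w" for p q l w :: real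
    using mult_mono[OF that(1) that(3)] mult_right_mono[OF that(2,4)] that(1) abs_ge_zero[of p] unfolding abs_mult by linarith
  note R = cutoff_regularity
  have "orthant_test n a b (z + pt d 0) - orthant_test n a b z = (cutoff n a (z $ 1 + d) - cutoff n a (z $ 1)) * cutoff n b (z $ 2)"
    by (simp add: orthant_test_def algebra_simps)
  then show "\<bar>orthant_test n a b (z + pt d 0) - orthant_test n a b z\<bar> \<le> ?L * \<bar>d\<bar>"
    using shrink[OF R(1) L(1) c abs_ge_zero] by (simp only:)
  have "orthant_test n a b (z + pt 0 d) - orthant_test n a b z = (cutoff n b (z $ 2 + d) - cutoff n b (z $ 2)) * cutoff n a (z $ 1)"
    by (simp add: orthant_test_def algebra_simps)
  then show "\<bar>orthant_test n a b (z + pt 0 d) - orthant_test n a b z\<bar> \<le> ?L * \<bar>d\<bar>"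
    using shrink[OF R(1) L(1) c abs_ge_zero] by (simp only:)
  have "orthant_test n a b (z + pt d 0) - 2 * orthant_test n a b z + orthant_test n a b (z + pt (- d) 0)
      = (cutoff n a (z $ 1 + d) - 2 * cutoff n a (z $ 1) + cutoff n a (z $ 1 + - d)) * cutoff n b (z $ 2)"
    by (simp add: orthant_test_def algebra_simps)
  then show "\<bar>orthant_test n a b (z + pt d 0) - 2 * orthant_test n a b z + orthant_test n a b (z + pt (- d) 0)\<bar> \<le> ?L * d\<^sup>2"
    using shrink[OF R(2) L(2) c zero_le_power2] by (simp only:)
  have "orthant_test n a b (z + pt 0 d) - 2 * orthant_test n a b z + orthant_test n a b (z + pt 0 (- d))
      = (cutoff n b (z $ 2 + d) - 2 * cutoff n b (z $ 2) + cutoff n b (z $ 2 + - d)) * cutoff n a (z $ 1)"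
    by (simp add: orthant_test_def algebra_simps)
  then show "\<bar>orthant_test n a b (z + pt 0 d) - 2 * orthant_test n a b z + orthant_test n a b (z + pt 0 (- d))\<bar> \<le> ?L * d\<^sup>2"
    using shrink[OF R(2) L(2) c zero_le_power2] by (simp only:)
qed

section \<open>Passage to the limit\<close>

context bounded_force
begin

text \<open>Integrated twice against one probability measure, it gives the spatial part of the weak
  form at a fixed time, with the local term \<open>p\<close> included. The nonlinear flux thus
  becomes a single admissible test in \<open>product_converges\<close>.\<close>

definition flux_kernel :: "(real^2 \<Rightarrow> real) \<Rightarrow> (real^2 \<Rightarrow> real) \<Rightarrow> (real^2 \<Rightarrow> real) \<Rightarrow> real^2 \<Rightarrow> real^2 \<Rightarrow> real" where
  "flux_kernel p g1 g2 z w = p z + (g1 z * fc 1 z w + g2 z * fc 2 z w)"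

lemma flux_kernel_continuous:
  assumes "continuous_on UNIV p" "continuous_on UNIV g1" "continuous_on UNIV g2"
  shows "continuous_on UNIV (\<lambda>x. flux_kernel p g1 g2 (fst x) (snd x))"
proof -
  have "continuous_on UNIV (\<lambda>x. q (fst x))" if "continuous_on UNIV q" for q :: "real^2 \<Rightarrow> real"
    by (rule continuous_on_compose2[OF that]) (auto intro!: continuous_intros)
  then show ?thesis using assms unfolding flux_kernel_def by (intro continuous_intros fc_continuous) auto
qed

lemma flux_kernel_bound:
  assumes "\<And>z. \<bar>p z\<bar> \<le> L" "\<And>z. \<bar>g1 z\<bar> \<le> L" "\<And>z. \<bar>g2 z\<bar> \<le> L"
  shows "\<bar>flux_kernel p g1 g2 z w\<bar> \<le> L + 2 * L * f"
proof -
  have L: "0 \<le> L" using assms(1)[of 0] by linarith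
  have "\<bar>g1 z * fc 1 z w\<bar> \<le> L * f" "\<bar>g2 z * fc 2 z w\<bar> \<le> L * f"
    unfolding abs_mult by (intro mult_mono assms fc_bound L abs_ge_zero)+
  then show ?thesis using assms(1)[of z] unfolding flux_kernel_def by linarith
qed

lemma flux_kernel_integral:
  assumes \<mu>: "prob_space \<mu>" "sets \<mu> = sets borel"
  shows "(LINT w|\<mu>. flux_kernel p g1 g2 z w)
    = p z + (g1 z * force_convolution F T \<mu> z $ 1 + g2 z * force_convolution F T \<mu> z $ 2)"
proof -
  interpret prob_space \<mu> by fact
  note i = fc_integrable[OF \<mu>]
  show ?thesis unfolding flux_kernel_def force_convolution_nth[OF \<mu>]
    using i by (simp add: prob_space)
qed

end

context discretised_test
begin

lemma W_integrable: "set_integrable lborel {0..<S} W"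
proof -
  have "S < tl (Suc (level S))" using level_bounds(2)[of S] S by simp
  then have "min (tl (Suc (level S))) S = S" by simp
  then show ?thesis using W_sum[of "Suc (level S)"] by simp
qed

lemma W_eq: "W s = (LINT z|sol s. LINT w|sol s. flux_kernel (\<phi>t s) (g1 s) (g2 s) z w)"
proof -
  have "W s = (LINT z|gm (level s). \<phi>t s z + (g1 s z * U 1 (level s) z + g2 s z * U 2 (level s) z))"
    unfolding W_def P_def J_def
    by (rule Bochner_Integration.integral_add[symmetric, OF integrable_gm[OF slice_measurable(2) bound(2)] integrable_flux])
  then show ?thesis
    unfolding sol_def flux_kernel_integral[OF gm_prob sets_grid_measure] U_def .
qed

end

section \<open>Vanishing dissipation and compactness along a sequence\<close>

locale discretised_sequence = bounded_force F T f
  for F :: "real^2 \<Rightarrow> real^2^2 \<Rightarrow> real^2" and T f +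
  fixes \<rho>in :: "(real^2) measure" and S :: real and dx dy \<delta> :: "nat \<Rightarrow> real" and dt :: "nat \<Rightarrow> nat \<Rightarrow> real"
  assumes adm: "\<And>k. admissible_discretisation F T f \<rho>in S (dx k) (dy k) (\<delta> k) (dt k)"
    and \<rho>in: "\<rho>in \<in> P2" and S: "0 < S"
    and mesh: "(\<lambda>k. max (dx k) (dy k)) \<longlonglongrightarrow> 0" and diffusion: "\<delta> \<longlonglongrightarrow> 0"
begin

lemma disc: "discretised F T f \<rho>in S (dx k) (dy k) (\<delta> k) (dt k)"
  by (unfold_locales) (rule adm \<rho>in S)+

abbreviation mu :: "nat \<Rightarrow> real \<Rightarrow> (real^2) measure" where
  "mu k \<equiv> discretised.sol F T f \<rho>in (dx k) (dy k) (\<delta> k) (dt k)"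

abbreviation D :: "nat \<Rightarrow> real \<Rightarrow> real" where
  "D k \<equiv> discretised.diss f S (dx k) (dy k) (\<delta> k)"

abbreviation h :: "nat \<Rightarrow> real" where "h k \<equiv> max (dx k) (dy k)"

lemma pos: "0 < dx k" "0 < dy k" "0 < \<delta> k" "0 < h k"
  using adm[of k] by (auto simp: admissible_discretisation_def less_max_iff_disj)

lemma D_eq: "D k \<kappa> = S * (\<delta> k / \<kappa> ^ 4 + 32 * (4 * (\<delta> k + 5 * f * \<kappa> + 3 * f * h k)\<^sup>2 * \<kappa> ^ 4 / \<delta> k + f * \<kappa>)) + 32 * \<kappa>\<^sup>2"
  by (rule discretised.diss_def[OF disc])

lemma D_nonneg: "0 < \<kappa> \<Longrightarrow> 0 \<le> D k \<kappa>"
  unfolding D_eq using S f_nonneg pos[of k] by (intro add_nonneg_nonneg mult_nonneg_nonneg divide_nonneg_nonneg) auto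

text \<open>With \<kappa>^4 = \<delta> M the first term of \<open>D\<close> is the constant S / M =
  \<epsilon> / 2. The dangerous quotient \<kappa>^4 / \<delta> stays equal to M, while the bracket
  squared in front of it and \<kappa> itself tend to zero.\<close>

lemma D_small:
  assumes "0 < \<epsilon>"
  shows "\<forall>\<^sub>F k in sequentially. \<exists>\<kappa>>0. D k \<kappa> < \<epsilon>"
proof -
  define M where "M = 2 * S / \<epsilon>"
  have M: "0 < M" using S assms by (simp add: M_def)
  define \<kappa> where "\<kappa> k = root 4 (\<delta> k * M)" for k
  have \<kappa>: "0 < \<kappa> k" "\<kappa> k ^ 4 = \<delta> k * M" for k
    using pos(3)[of k] M by (simp_all add: \<kappa>_def)
  have "(\<lambda>k. root 4 (\<delta> k * M)) \<longlonglongrightarrow> root 4 (0 * M)"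
    by (intro tendsto_intros diffusion)
  then have lim: "\<kappa> \<longlonglongrightarrow> 0" by (simp add: \<kappa>_def[abs_def])
  have "(\<lambda>k. S * (1 / M + 32 * (4 * (\<delta> k + 5 * f * \<kappa> k + 3 * f * h k)\<^sup>2 * M + f * \<kappa> k)) + 32 * (\<kappa> k)\<^sup>2)
      \<longlonglongrightarrow> S * (1 / M + 32 * (4 * (0 + 5 * f * 0 + 3 * f * 0)\<^sup>2 * M + f * 0)) + 32 * 0\<^sup>2"
    by (intro tendsto_intros diffusion lim mesh)
  moreover have "S * (1 / M + 32 * (4 * (\<delta> k + 5 * f * \<kappa> k + 3 * f * h k)\<^sup>2 * M + f * \<kappa> k)) + 32 * (\<kappa> k)\<^sup>2 = D k (\<kappa> k)" for k
    unfolding D_eq \<kappa>(2) using pos(3)[of k] M by simp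
  ultimately have "(\<lambda>k. D k (\<kappa> k)) \<longlonglongrightarrow> S / M" by simp
  moreover have "S / M < \<epsilon>" using S assms by (simp add: M_def)
  ultimately have "\<forall>\<^sub>F k in sequentially. D k (\<kappa> k) < \<epsilon>" by (rule order_tendstoD(2))
  then show ?thesis by eventually_elim (use \<kappa>(1) in blast)
qed

text \<open>The infimum over \<kappa> tends to zero by \<open>D_small\<close>. It need not be
  attained, hence the slack 1 / (k + 1) in choosing near-minimisers.\<close>

lemma vanishing_dissipation:
  obtains \<kappa> where "\<And>k. 0 < \<kappa> k" "(\<lambda>k. D k (\<kappa> k)) \<longlonglongrightarrow> 0"
proof -
  define E where "E k = Inf (D k ` {0<..})" for k
  have bdd: "bdd_below (D k ` {0<..})" for k by (rule bdd_belowI[of _ 0]) (auto intro: D_nonneg)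
  have ne: "D k ` {0<..} \<noteq> {}" for k by (auto intro!: exI[of _ 1])
  have E0: "0 \<le> E k" for k unfolding E_def by (rule cInf_greatest[OF ne]) (auto intro: D_nonneg)
  have "\<exists>\<kappa>>0. D k \<kappa> < E k + 1 / real (Suc k)" for k
    using cInf_lessD[OF ne, of k "E k + 1 / real (Suc k)"] unfolding E_def[symmetric] by auto
  then obtain \<kappa> where \<kappa>: "\<And>k. 0 < \<kappa> k" "\<And>k. D k (\<kappa> k) < E k + 1 / real (Suc k)" by metis
  have "E \<longlonglongrightarrow> 0"
  proof (rule order_tendstoI)
    fix a :: real assume "a < 0" then show "\<forall>\<^sub>F k in sequentially. a < E k" using E0 by (auto intro: always_eventually less_le_trans)
  next
    fix a :: real assume "0 < a"
    from D_small[OF this] show "\<forall>\<^sub>F k in sequentially. E k < a"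
    proof eventually_elim
      case (elim k)
      then obtain \<kappa> where "0 < \<kappa>" "D k \<kappa> < a" by blast
      moreover have "E k \<le> D k \<kappa>" unfolding E_def by (rule cInf_lower[OF _ bdd]) (use \<open>0 < \<kappa>\<close> in auto)
      ultimately show ?case by linarith
    qed
  qed
  then have "(\<lambda>k. E k + 1 / real (Suc k)) \<longlonglongrightarrow> 0 + 0"
    by (rule tendsto_add[OF _ LIMSEQ_Suc[OF lim_1_over_n]])
  then have "(\<lambda>k. D k (\<kappa> k)) \<longlonglongrightarrow> 0"
    by (intro tendsto_sandwich[OF _ _ tendsto_const, of 0 "\<lambda>k. D k (\<kappa> k)"])
      (use \<kappa> D_nonneg in \<open>auto intro!: always_eventually less_imp_le\<close>)
  then show ?thesis using that \<kappa>(1) by blast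
qed

lemma mesh_x: "dx \<longlonglongrightarrow> 0" and mesh_y: "dy \<longlonglongrightarrow> 0"
  by (rule tendsto_sandwich[OF _ _ tendsto_const mesh]; use pos in \<open>auto intro!: always_eventually less_imp_le\<close>)+

text \<open>With the parameters of \<open>vanishing_dissipation\<close> the right side of
  \<open>sol_moment\<close> converges in k, so it is bounded over all k.\<close>

lemma uniform_moment:
  obtains C where "0 \<le> C" "\<And>k t. t \<in> {0..S} \<Longrightarrow> (LINT z|mu k t. (norm z)\<^sup>2) \<le> C"
proof -
  obtain \<kappa> where \<kappa>: "\<And>k. 0 < \<kappa> k" and lim: "(\<lambda>k. D k (\<kappa> k)) \<longlonglongrightarrow> 0" by (rule vanishing_dissipation) (rule that)
  let ?B = "\<lambda>k. 2 * (exp (f * S) * (2 * (LINT z|\<rho>in. (norm z)\<^sup>2) + 2 * ((dx k)\<^sup>2 + (dy k)\<^sup>2)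
      + f * S * (2 + 4 * h k) + 2 * D k (\<kappa> k))) + 2 * ((dx k)\<^sup>2 + (dy k)\<^sup>2)"
  have "?B \<longlonglongrightarrow> 2 * (exp (f * S) * (2 * (LINT z|\<rho>in. (norm z)\<^sup>2) + 2 * (0\<^sup>2 + 0\<^sup>2)
      + f * S * (2 + 4 * 0) + 2 * 0)) + 2 * (0\<^sup>2 + 0\<^sup>2)"
    by (intro tendsto_intros lim mesh mesh_x mesh_y)
  then have "Bseq ?B" by (rule convergent_imp_Bseq[OF convergentI])
  then obtain C where "0 < C" "\<And>k. \<bar>?B k\<bar> \<le> C" by (auto elim!: BseqE)
  moreover have "(LINT z|mu k t. (norm z)\<^sup>2) \<le> ?B k" if "t \<in> {0..S}" for k t
    by (rule discretised.sol_moment[OF disc that \<kappa>])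
  ultimately show ?thesis using that[of C] by (meson abs_ge_self less_imp_le order_trans)
qed

lemma compactness:
  "\<exists>r \<rho>. strict_mono (r :: nat \<Rightarrow> nat) \<and> P2_curve S \<rho> \<and> (\<forall>t\<in>{0..S}. product_converges (\<lambda>k. mu (r k) t) (\<rho> t))"
proof -
  obtain C where C: "0 \<le> C" "\<And>k t. t \<in> {0..S} \<Longrightarrow> (LINT z|mu k t. (norm z)\<^sup>2) \<le> C"
    by (rule uniform_moment) (rule that)
  show ?thesis
  proof (rule P2_curve_compactness[OF S discretised.sol_P2[OF disc] C(2)])
    fix n a b
    obtain \<kappa> where \<kappa>: "\<And>k. 0 < \<kappa> k" and lim: "(\<lambda>k. D k (\<kappa> k)) \<longlonglongrightarrow> 0" by (rule vanishing_dissipation) (rule that)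
    let ?L = "1 + (real n)\<^sup>2 + 2 * real n ^ 4"
    obtain H where H: "0 < H" "\<And>k. \<bar>h k\<bar> \<le> H"
      using convergent_imp_Bseq[OF convergentI[OF mesh]] by (auto elim!: BseqE)
    define e where "e k = ?L * (2 + H) * (h k / 4) + ?L * D k (\<kappa> k)" for k
    have "e \<longlonglongrightarrow> ?L * (2 + H) * (0 / 4) + ?L * 0" unfolding e_def by (intro tendsto_intros mesh lim) simp
    then have "e \<longlonglongrightarrow> 0" by simp
    moreover have "\<bar>(LINT z|mu k t. orthant_test n a b z) - (LINT z|mu k s. orthant_test n a b z)\<bar>
        \<le> (?L * (2 + H) * f) * \<bar>t - s\<bar> + e k" if st: "s \<in> {0..S}" "t \<in> {0..S}" for k s t
    proof -
      have "\<bar>orthant_test n a b z\<bar> \<le> ?L" for z using orthant_test_bound[of n a b z] by (simp add: add_increasing2)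
      note E = discretised.equicontinuity[OF disc orthant_test_measurable this orthant_test_regularity st \<kappa>, where k1 = k]
      have "?L * (2 + h k) * (f * \<bar>t - s\<bar> + h k / 4) \<le> ?L * (2 + H) * (f * \<bar>t - s\<bar> + h k / 4)"
        using H(2)[of k] pos(4)[of k] f_nonneg
        by (intro mult_right_mono mult_left_mono add_left_mono add_nonneg_nonneg mult_nonneg_nonneg) auto
      also have "\<dots> = (?L * (2 + H) * f) * \<bar>t - s\<bar> + ?L * (2 + H) * (h k / 4)" by (simp add: algebra_simps)
      finally have "?L * (2 + h k) * (f * \<bar>t - s\<bar> + h k / 4) + ?L * D k (\<kappa> k)
          \<le> (?L * (2 + H) * f) * \<bar>t - s\<bar> + e k" unfolding e_def by simp
      with E show ?thesis by (rule order_trans)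
    qed
    ultimately show "\<exists>L e. e \<longlonglongrightarrow> 0 \<and> (\<forall>k. \<forall>s\<in>{0..S}. \<forall>t\<in>{0..S}.
      \<bar>(LINT z|mu k t. orthant_test n a b z) - (LINT z|mu k s. orthant_test n a b z)\<bar> \<le> L * \<bar>t - s\<bar> + e k)"
      by blast
  qed
qed

end

locale sequence_test = discretised_sequence F T f \<rho>in S dx dy \<delta> dt + spacetime_test \<phi> \<phi>t g1 g2 S L K0
  for F T f \<rho>in S dx dy \<delta> dt \<phi> \<phi>t g1 g2 L K0
begin

lemma disc_test: "discretised_test F T f \<rho>in S (dx k) (dy k) (\<delta> k) (dt k) \<phi> \<phi>t g1 g2 L K0"
  by (intro discretised_test.intro disc) unfold_locales

abbreviation Wk :: "nat \<Rightarrow> real \<Rightarrow> real" where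
  "Wk k \<equiv> discretised_test.W F T f \<rho>in (dx k) (dy k) (\<delta> k) (dt k) \<phi>t g1 g2"

text \<open>Each level up to S is attained by the curve \<open>mu k\<close> at its own starting
  time, so the uniform moment bound applies and \<open>force_modulus\<close> gives one radius \<eta>
  for all k and n. The mesh only has to satisfy 3 h < \<eta>.\<close>

lemma eventually_good:
  assumes "0 < \<epsilon>"
  shows "\<forall>\<^sub>F k in sequentially. \<forall>n. time_level (dt k) n \<le> S \<longrightarrow>
    discretised_test.good F T f \<rho>in (dx k) (dy k) (\<delta> k) (dt k) (discretised_test.K1 K0) \<epsilon> n"
proof -
  obtain C where C: "0 \<le> C" "\<And>k t. t \<in> {0..S} \<Longrightarrow> (LINT z|mu k t. (norm z)\<^sup>2) \<le> C"
    by (rule uniform_moment) (rule that)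
  obtain \<eta> where "0 < \<eta>" and \<eta>: "\<And>\<mu> z z' m. \<mu> \<in> P2 \<Longrightarrow> (LINT w|\<mu>. (norm w)\<^sup>2) \<le> C \<Longrightarrow> z \<in> discretised_test.K1 K0 \<Longrightarrow> dist z' z < \<eta> \<Longrightarrow>
      \<bar>force_convolution F T \<mu> z' $ m - force_convolution F T \<mu> z $ m\<bar> \<le> \<epsilon>"
    using force_modulus[OF discretised_test.compact_K1[OF disc_test[of 0]] assms C(1)] by blast
  have "\<forall>\<^sub>F k in sequentially. h k < \<eta> / 3" using order_tendstoD(2)[OF mesh, of "\<eta> / 3"] \<open>0 < \<eta>\<close> by simp
  then show ?thesis
  proof eventually_elim
    case (elim k)
    show ?case
    proof (intro allI impI)
      fix n assume n: "time_level (dt k) n \<le> S"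
      interpret d: discretised_test F T f \<rho>in S "dx k" "dy k" "\<delta> k" "dt k" \<phi> \<phi>t g1 g2 L K0 by (rule disc_test)
      have t: "time_level (dt k) n \<in> {0..S}" using n d.tl_nonneg[of n] by simp
      have "d.level (time_level (dt k) n) = n" by (rule d.level_eqI) (use d.dt[of n] in \<open>auto simp: d.tl_Suc\<close>)
      then have s: "d.sol (time_level (dt k) n) = d.gm n" by (simp add: d.sol_def)
      show "d.good d.K1 \<epsilon> n" unfolding d.good_def d.U_def
        using \<eta>[OF d.sol_P2[OF t] C(2)[OF t]] elim unfolding s by force
    qed
  qed
qed

lemma weak_limit: "(\<lambda>k. (LINT s:{0..<S}|lborel. Wk k s)) \<longlonglongrightarrow> - (LINT z|\<rho>in. \<phi> 0 z)"
proof -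
  obtain \<kappa> where \<kappa>: "\<And>k. 0 < \<kappa> k" and lim: "(\<lambda>k. D k (\<kappa> k)) \<longlonglongrightarrow> 0" by (rule vanishing_dissipation) (rule that)
  let ?I = "\<lambda>k. LINT s:{0..<S}|lborel. Wk k s" and ?c = "LINT z|\<rho>in. \<phi> 0 z"
  have "(\<lambda>k. ?I k + ?c) \<longlonglongrightarrow> 0"
  proof (rule tendstoI)
    fix a :: real assume a: "0 < a"
    \<comment> \<open>Makes S * L * 2 \<epsilon>, the only error that does not tend to zero with k,
      at most a / 2; the added 1 covers L = 0.\<close>
    define \<epsilon> where "\<epsilon> = a / (4 * (S * L + 1))"
    have SL: "0 \<le> S * L" using S L_nonneg by simp
    have \<epsilon>: "0 < \<epsilon>" using a SL by (simp add: \<epsilon>_def)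
    have "S * (L * (2 * \<epsilon>)) = S * L / (S * L + 1) * (a / 2)" using SL by (simp add: \<epsilon>_def field_simps)
    also have "\<dots> \<le> 1 * (a / 2)" using SL a by (intro mult_right_mono) auto
    finally have le: "S * (L * (2 * \<epsilon>)) < a" using a by simp
    have "(\<lambda>k. S * (L * (4 * f * h k + 2 * \<epsilon> + h k / 2)) + 2 * L * D k (\<kappa> k) + 2 * L * h k)
        \<longlonglongrightarrow> S * (L * (4 * f * 0 + 2 * \<epsilon> + 0 / 2)) + 2 * L * 0 + 2 * L * 0"
      by (intro tendsto_intros mesh lim) simp
    then have "\<forall>\<^sub>F k in sequentially. S * (L * (4 * f * h k + 2 * \<epsilon> + h k / 2)) + 2 * L * D k (\<kappa> k) + 2 * L * h k < a"
      by (rule order_tendstoD(2)) (use le in simp)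
    moreover have "\<forall>\<^sub>F k in sequentially. h k < 1" using order_tendstoD(2)[OF mesh, of 1] by simp
    moreover note eventually_good[OF \<epsilon>]
    ultimately show "\<forall>\<^sub>F k in sequentially. dist (?I k + ?c) 0 < a"
    proof eventually_elim
      case (elim k)
      have "\<bar>?I k + ?c\<bar> \<le> S * (L * (4 * f * h k + 2 * \<epsilon> + h k / 2)) + 2 * L * D k (\<kappa> k) + 2 * L * h k"
        by (rule discretised_test.weak_consistency(2)[OF disc_test _ _ _ \<kappa>]) (use elim \<epsilon> in auto)
      with elim show ?case by simp
    qed
  qed
  then have "(\<lambda>k. (?I k + ?c) - ?c) \<longlonglongrightarrow> 0 - ?c" by (intro tendsto_diff tendsto_const)
  then show ?thesis by simp
qed

text \<open>At each time the weak integrand is the double integral of a bounded continuous kernel,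
  so it converges by assumption. It is bounded by L + 2 L f uniformly in k, and dominated
  convergence in time finishes.\<close>

lemma limit_equation:
  assumes r: "strict_mono r" and \<rho>: "\<And>t. t \<in> {0..S} \<Longrightarrow> \<rho> t \<in> P2"
    and conv: "\<And>t. t \<in> {0..S} \<Longrightarrow> product_converges (\<lambda>k. mu (r k) t) (\<rho> t)"
  shows "(LINT t:{0..S}|lborel. LINT z|\<rho> t.
      \<phi>t t z + (g1 t z * force_convolution F T (\<rho> t) z $ 1 + g2 t z * force_convolution F T (\<rho> t) z $ 2))
    = - (LINT z|\<rho>in. \<phi> 0 z)"
proof -
  let ?H = "\<lambda>t. flux_kernel (\<phi>t t) (g1 t) (g2 t)"
  define X where "X t = (LINT z|\<rho> t. LINT w|\<rho> t. ?H t z w)" for t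
  have X: "X t = (LINT z|\<rho> t. \<phi>t t z + (g1 t z * force_convolution F T (\<rho> t) z $ 1 + g2 t z * force_convolution F T (\<rho> t) z $ 2))"
    if "t \<in> {0..S}" for t
    unfolding X_def flux_kernel_integral[OF P2D(1,2)[OF \<rho>[OF that]]] ..
  have Wk: "Wk k t = (LINT z|mu k t. LINT w|mu k t. ?H t z w)" for k t
    by (rule discretised_test.W_eq[OF disc_test])
  have pw: "(\<lambda>k. Wk (r k) t) \<longlonglongrightarrow> X t" if "t \<in> {0..S}" for t
  proof -
    have c: "continuous_on UNIV (\<lambda>x. ?H t (fst x) (snd x))"
      by (intro flux_kernel_continuous slice_continuous(1) cont)
    have "\<bar>?H t z w\<bar> \<le> L + 2 * L * f" for z w by (intro flux_kernel_bound bound)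
    then show ?thesis
      using conv[OF that, unfolded product_converges_def, rule_format, OF c] unfolding Wk X_def by blast
  qed
  have b: "\<bar>Wk k t\<bar> \<le> L + 2 * L * f" if "t \<in> {0..S}" for k t
  proof -
    have P: "prob_space (mu k t)" using discretised.sol_P2[OF disc that] by (rule P2D)
    have n: "0 \<le> L + 2 * L * f" using L_nonneg f_nonneg by simp
    show ?thesis unfolding Wk
      by (intro integral_abs_le_const[OF P] n flux_kernel_bound bound)
  qed
  have m: "(\<lambda>t. indicator {0..<S} t *\<^sub>R Wk k t) \<in> borel_measurable lborel" for k
    using discretised_test.W_integrable[OF disc_test[of k]] unfolding set_integrable_def by (rule borel_measurable_integrable)
  have pw': "(\<lambda>k. indicator {0..<S} t *\<^sub>R Wk (r k) t) \<longlonglongrightarrow> indicator {0..<S} t *\<^sub>R X t" for t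
    using pw[of t] by (cases "t \<in> {0..<S}") auto
  have mX: "(\<lambda>t. indicator {0..<S} t *\<^sub>R X t) \<in> borel_measurable lborel"
    by (rule borel_measurable_LIMSEQ_real[OF pw' m])
  have "(\<lambda>k. LINT t|lborel. indicator {0..<S} t *\<^sub>R Wk (r k) t) \<longlonglongrightarrow> (LINT t|lborel. indicator {0..<S} t *\<^sub>R X t)"
  proof (rule integral_dominated_convergence[where w = "\<lambda>t. indicator {0..<S} t * (L + 2 * L * f)"])
    show "integrable lborel (\<lambda>t. indicator {0..<S} t * (L + 2 * L * f))"
      using S by (intro integrable_mult_left integrable_real_indicator) auto
    show "AE t in lborel. norm (indicator {0..<S} t *\<^sub>R Wk (r k) t) \<le> indicator {0..<S} t * (L + 2 * L * f)" for k
      using b by (auto simp: indicator_def)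
  qed (use m mX pw' in auto)
  moreover have "(\<lambda>k. LINT t|lborel. indicator {0..<S} t *\<^sub>R Wk (r k) t) \<longlonglongrightarrow> - (LINT z|\<rho>in. \<phi> 0 z)"
    using LIMSEQ_subseq_LIMSEQ[OF weak_limit r] by (simp add: set_lebesgue_integral_def o_def)
  ultimately have "(LINT t|lborel. indicator {0..<S} t *\<^sub>R X t) = - (LINT z|\<rho>in. \<phi> 0 z)" by (rule LIMSEQ_unique)
  moreover have "(LINT t|lborel. indicator {0..S} t *\<^sub>R X t) = (LINT t|lborel. indicator {0..<S} t *\<^sub>R X t)"
  proof (rule integral_cong_AE)
    \<comment> \<open>Measurability is known on \<open>{0..<S}\<close> and survives the addition of
      the single point S.\<close>
    have "(\<lambda>t. indicator {0..S} t *\<^sub>R X t) = (\<lambda>t. indicator {0..<S} t *\<^sub>R X t + indicator {S} t * X S)"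
      using S by (auto simp: fun_eq_iff indicator_def)
    then show "(\<lambda>t. indicator {0..S} t *\<^sub>R X t) \<in> borel_measurable lborel"
      using mX by (simp only:) (intro borel_measurable_add borel_measurable_times borel_measurable_indicator borel_measurable_const; simp)
    show "AE t in lborel. indicator {0..S} t *\<^sub>R X t = indicator {0..<S} t *\<^sub>R X t"
      using AE_lborel_singleton[of S] by eventually_elim (auto simp: indicator_def)
  qed (rule mX)
  moreover have "(LINT t:{0..S}|lborel. LINT z|\<rho> t.
      \<phi>t t z + (g1 t z * force_convolution F T (\<rho> t) z $ 1 + g2 t z * force_convolution F T (\<rho> t) z $ 2))
      = (LINT t|lborel. indicator {0..S} t *\<^sub>R X t)"
    unfolding set_lebesgue_integral_def[symmetric] by (rule set_lebesgue_integral_cong) (use X in auto)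
  ultimately show ?thesis by simp
qed

end

context discretised_sequence
begin

theorem limit_is_solution:
  assumes r: "strict_mono r" and \<rho>: "P2_curve S \<rho>"
    and conv: "\<And>t. t \<in> {0..S} \<Longrightarrow> product_converges (\<lambda>k. mu (r k) t) (\<rho> t)"
  shows "aggregation_solution F T \<rho>in S \<rho>"
  unfolding aggregation_solution_def
proof (intro conjI \<rho> allI impI)
  fix \<phi> assume "test_function S \<phi>"
  then obtain L K0 where st: "spacetime_test (\<lambda>t z. \<phi> (t, z)) (time_deriv \<phi>) (\<lambda>t z. space_grad \<phi> t z $ 1) (\<lambda>t z. space_grad \<phi> t z $ 2) S L K0"
    using test_function_regularity S by blast
  interpret sequence_test F T f \<rho>in S dx dy \<delta> dt "\<lambda>t z. \<phi> (t, z)" "time_deriv \<phi>"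
    "\<lambda>t z. space_grad \<phi> t z $ 1" "\<lambda>t z. space_grad \<phi> t z $ 2" L K0
    by (intro sequence_test.intro st) unfold_locales
  have "\<rho> t \<in> P2" if "t \<in> {0..S}" for t using \<rho> that by (simp add: P2_curve_def)
  from limit_equation[OF r this conv]
  show "(LINT t:{0..S}|lborel. LINT z|\<rho> t. time_deriv \<phi> t z + space_grad \<phi> t z \<bullet> force_convolution F T (\<rho> t) z)
      + (LINT z|\<rho>in. \<phi> (0, z)) = 0"
    by (simp add: inner_vec_def sum_2)
qed

end

section \<open>Space-time measures\<close>

abbreviation strip :: "real \<Rightarrow> (real \<times> (real^2)) set" where "strip S \<equiv> {0..S} \<times> UNIV"

lemma strip_borel [measurable]: "strip S \<in> sets borel"
  by (intro borel_closed closed_Times) auto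

lemma P2_curve_prob:
  assumes "P2_curve S \<rho>" "t \<in> {0..S}"
  shows "prob_space (\<rho> t)" "sets (\<rho> t) = sets borel"
  using P2D(1,2)[of "\<rho> t"] assms unfolding P2_curve_def by blast+

lemma P2_curve_kernel:
  assumes "P2_curve S \<rho>"
  shows "(\<lambda>t. distr (\<rho> t) (restrict_space borel (strip S)) (\<lambda>z. (t, z)))
    \<in> measurable (restrict_space lborel {0..S}) (subprob_algebra (restrict_space borel (strip S)))"
proof -
  have \<rho>: "\<rho> \<in> measurable (restrict_space borel {0..S}) (subprob_algebra borel)"
    using assms by (simp add: P2_curve_def)
  have "(\<lambda>p. (fst p, snd p)) \<in> measurable (restrict_space borel {0..S} \<Otimes>\<^sub>M (borel :: (real^2) measure)) (borel \<Otimes>\<^sub>M borel)"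
    by (intro measurable_Pair measurable_compose[OF measurable_fst measurable_restrict_space1[OF measurable_ident_sets[OF refl]]]) measurable
  then have "case_prod Pair \<in> measurable (restrict_space borel {0..S} \<Otimes>\<^sub>M (borel :: (real^2) measure)) (restrict_space borel (strip S))"
    by (intro measurable_restrict_space2) (auto simp: space_pair_measure space_restrict_space borel_prod case_prod_beta')
  from measurable_distr2[OF this \<rho>]
  have "(\<lambda>t. distr (\<rho> t) (restrict_space borel (strip S)) (Pair t))
    \<in> measurable (restrict_space borel {0..S}) (subprob_algebra (restrict_space borel (strip S)))" .
  then show ?thesis
    by (subst measurable_cong_sets[OF sets_restrict_space_cong[OF sets_lborel] refl])
qed

lemma sets_spacetime_measure:
  assumes "0 \<le> S"
  shows "sets (spacetime_measure S \<rho>) = sets (restrict_space borel (strip S))"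
  unfolding spacetime_measure_def using assms by (intro sets_bind) (auto simp: space_restrict_space)

lemma Pair_strip_measurable:
  assumes "t \<in> {0..S}"
  shows "Pair t \<in> measurable (borel :: (real^2) measure) (restrict_space borel (strip S))"
proof -
  have "Pair t \<in> measurable (borel :: (real^2) measure) (borel \<Otimes>\<^sub>M borel)" by measurable
  then show ?thesis using assms by (intro measurable_restrict_space2) (auto simp: borel_prod)
qed

lemma nn_integral_spacetime_measure:
  assumes \<rho>: "P2_curve S \<rho>" and g: "g \<in> borel_measurable (restrict_space borel (strip S))"
  shows "(\<integral>\<^sup>+x. g x \<partial>spacetime_measure S \<rho>) = (\<integral>\<^sup>+t. (\<integral>\<^sup>+z. g (t, z) \<partial>\<rho> t) \<partial>restrict_space lborel {0..S})"
  unfolding spacetime_measure_def nn_integral_bind[OF g P2_curve_kernel[OF \<rho>]]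
proof (rule nn_integral_cong)
  fix t assume "t \<in> space (restrict_space lborel {0..S})"
  then have t: "t \<in> {0..S}" by (simp add: space_restrict_space)
  then have "sets (\<rho> t) = sets borel" by (rule P2_curve_prob(2)[OF \<rho>])
  then show "(\<integral>\<^sup>+x. g x \<partial>distr (\<rho> t) (restrict_space borel (strip S)) (Pair t)) = (\<integral>\<^sup>+z. g (t, z) \<partial>\<rho> t)"
    using Pair_strip_measurable[OF t] g by (subst nn_integral_distr) (simp_all cong: measurable_cong_sets)
qed

lemma emeasure_time_interval: "0 \<le> S \<Longrightarrow> emeasure (restrict_space lborel {0..S}) {0..S} = ennreal S"
  by (simp add: emeasure_restrict_space)

lemma finite_measure_time_interval: "0 \<le> S \<Longrightarrow> finite_measure (restrict_space lborel {0..S :: real})"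
  by (rule finite_measureI) (simp add: space_restrict_space emeasure_time_interval)

lemma finite_spacetime_measure:
  assumes \<rho>: "P2_curve S \<rho>" and S: "0 \<le> S"
  shows "finite_measure (spacetime_measure S \<rho>)"
proof (rule finite_measureI)
  have "emeasure (spacetime_measure S \<rho>) (space (spacetime_measure S \<rho>)) = (\<integral>\<^sup>+x. 1 \<partial>spacetime_measure S \<rho>)" by simp
  also have "\<dots> = (\<integral>\<^sup>+t. (\<integral>\<^sup>+z. 1 \<partial>\<rho> t) \<partial>restrict_space lborel {0..S})"
    by (rule nn_integral_spacetime_measure[OF \<rho>]) simp
  also have "\<dots> = (\<integral>\<^sup>+t. 1 \<partial>restrict_space lborel {0..S})"
  proof (rule nn_integral_cong)
    fix t assume "t \<in> space (restrict_space lborel {0..S})"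
    then have "prob_space (\<rho> t)" by (intro P2_curve_prob(1)[OF \<rho>]) (simp add: space_restrict_space)
    then show "(\<integral>\<^sup>+z. 1 \<partial>\<rho> t) = 1" by (simp add: prob_space.emeasure_space_1)
  qed
  also have "\<dots> = ennreal S" using S by (simp add: space_restrict_space emeasure_restrict_space)
  finally show "emeasure (spacetime_measure S \<rho>) (space (spacetime_measure S \<rho>)) \<noteq> \<infinity>" by simp
qed

text \<open>The bind is unfolded to a \<open>join\<close>, whose integral formula asks for a bounded
  integrand and total masses at most 1.\<close>

lemma integral_spacetime_measure:
  fixes g :: "real \<times> (real^2) \<Rightarrow> real"
  assumes \<rho>: "P2_curve S \<rho>" and S: "0 \<le> S" and g: "g \<in> borel_measurable (restrict_space borel (strip S))"
    and B: "\<And>x. x \<in> strip S \<Longrightarrow> \<bar>g x\<bar> \<le> B"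
  shows "(\<lambda>t. LINT z|\<rho> t. g (t, z)) \<in> borel_measurable (restrict_space lborel {0..S})"
    and "(LINT x|spacetime_measure S \<rho>. g x) = (LINT t|restrict_space lborel {0..S}. LINT z|\<rho> t. g (t, z))"
proof -
  let ?R = "restrict_space borel (strip S)" and ?I = "restrict_space lborel {0..S}"
  let ?N = "\<lambda>t. distr (\<rho> t) ?R (Pair t)"
  interpret I: finite_measure ?I by (rule finite_measure_time_interval[OF S])
  note k = P2_curve_kernel[OF \<rho>]
  have eq: "(LINT x|?N t. g x) = (LINT z|\<rho> t. g (t, z))" if "t \<in> space ?I" for t
  proof -
    have t: "t \<in> {0..S}" using that by (simp add: space_restrict_space)
    then have "sets (\<rho> t) = sets borel" by (rule P2_curve_prob(2)[OF \<rho>])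
    then show ?thesis using Pair_strip_measurable[OF t] by (subst integral_distr[OF _ g]) (simp_all cong: measurable_cong_sets)
  qed
  have "(\<lambda>t. LINT x|?N t. g x) \<in> borel_measurable ?I"
    by (rule measurable_compose[OF k integral_measurable_subprob_algebra[OF g]])
  then show "(\<lambda>t. LINT z|\<rho> t. g (t, z)) \<in> borel_measurable ?I"
    by (subst measurable_cong[OF eq[symmetric]])
  have ne: "space ?I \<noteq> {}" using S by (simp add: space_restrict_space)
  let ?D = "distr ?I (subprob_algebra ?R) ?N"
  have "(LINT x|spacetime_measure S \<rho>. g x) = (LINT x|join ?D. g x)"
    unfolding spacetime_measure_def by (subst bind_nonempty''[OF k ne]) (rule refl)
  also have "\<dots> = (LINT M|?D. LINT x|M. g x)"
  proof (rule integral_join[where B = B and B' = 1])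
    show "g \<in> borel_measurable ?R" by (rule g)
    show "\<bar>g x\<bar> \<le> B" if "x \<in> space ?R" for x using B that by (simp add: space_restrict_space)
    show "sets ?D = sets (subprob_algebra ?R)" by simp
    show "finite_measure ?D" by (rule I.finite_measure_distr[OF k])
    show "AE M in ?D. emeasure M (space M) \<le> ennreal 1"
      by (rule AE_I2) (auto simp: space_subprob_algebra subprob_space.emeasure_space_le_1)
  qed
  also have "\<dots> = (LINT t|?I. LINT x|?N t. g x)"
    by (rule integral_distr[OF k integral_measurable_subprob_algebra[OF g]])
  also have "\<dots> = (LINT t|?I. LINT z|\<rho> t. g (t, z))"
    by (rule Bochner_Integration.integral_cong[OF refl eq])
  finally show "(LINT x|spacetime_measure S \<rho>. g x) = (LINT t|?I. LINT z|\<rho> t. g (t, z))" .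
qed

lemma C0_on_bounded:
  assumes "\<phi> \<in> C0_on X"
  obtains B where "\<And>x. x \<in> X \<Longrightarrow> \<bar>\<phi> x\<bar> \<le> B"
proof -
  have C: "continuous_on X \<phi> \<and> (\<forall>\<epsilon>>0. \<exists>K. compact K \<and> K \<subseteq> X \<and> (\<forall>x\<in>X - K. \<bar>\<phi> x\<bar> < \<epsilon>))"
    using assms unfolding C0_on_def mem_Collect_eq .
  note c = conjunct1[OF C]
  obtain K where K': "compact K \<and> K \<subseteq> X \<and> (\<forall>x\<in>X - K. \<bar>\<phi> x\<bar> < 1)"
    using conjunct2[OF C, rule_format, OF zero_less_one] ..
  then have K: "compact K" "K \<subseteq> X" "\<And>x. x \<in> X - K \<Longrightarrow> \<bar>\<phi> x\<bar> < 1" by simp_all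
  have "bounded (\<phi> ` K)"
    by (rule compact_imp_bounded[OF compact_continuous_image[OF continuous_on_subset[OF c K(2)] K(1)]])
  then obtain b where b: "\<forall>x\<in>\<phi> ` K. norm x \<le> b" unfolding bounded_iff ..
  have "\<bar>\<phi> x\<bar> \<le> max b 1" if "x \<in> X" for x
  proof (cases "x \<in> K")
    case True
    then have "norm (\<phi> x) \<le> b" by (intro b[rule_format] imageI)
    then show ?thesis by simp
  next
    case False
    then show ?thesis using K(3)[of x] that by simp
  qed
  then show ?thesis by (rule that)
qed

text \<open>A C0 function is bounded, so each of its time slices is a test for
  \<open>product_converges\<close> that ignores the second point. Dominated convergence in time does
  the rest.\<close>

theorem spacetime_weak_convergence:
  assumes S: "0 \<le> S" and \<mu>: "\<And>k. P2_curve S (\<mu> k)" and \<rho>: "P2_curve S \<rho>"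
    and conv: "\<And>t. t \<in> {0..S} \<Longrightarrow> product_converges (\<lambda>k. \<mu> k t) (\<rho> t)"
  shows "weakly_converges_Mb (strip S) (\<lambda>k. spacetime_measure S (\<mu> k)) (spacetime_measure S \<rho>)"
  unfolding weakly_converges_Mb_def
proof (intro conjI allI ballI finite_spacetime_measure sets_spacetime_measure \<mu> \<rho> S)
  fix \<phi> :: "real \<times> (real^2) \<Rightarrow> real" assume \<phi>: "\<phi> \<in> C0_on (strip S)"
  then have c: "continuous_on (strip S) \<phi>" by (simp add: C0_on_def)
  obtain B where B: "\<And>x. x \<in> strip S \<Longrightarrow> \<bar>\<phi> x\<bar> \<le> B" by (rule C0_on_bounded[OF \<phi>]) (rule that)
  have m: "\<phi> \<in> borel_measurable (restrict_space borel (strip S))" by (rule borel_measurable_continuous_on_restrict[OF c])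
  let ?I = "restrict_space lborel {0..S}"
  interpret I: finite_measure ?I by (rule finite_measure_time_interval[OF S])
  have prob: "prob_space (\<mu> k t)" "prob_space (\<rho> t)" if "t \<in> {0..S}" for k t
    by (rule P2_curve_prob(1)[OF \<mu> that] P2_curve_prob(1)[OF \<rho> that])+
  have B0: "0 \<le> B" using B[of "(0, 0)"] S by force
  have lim: "(\<lambda>k. LINT z|\<mu> k t. \<phi> (t, z)) \<longlonglongrightarrow> (LINT z|\<rho> t. \<phi> (t, z))" if t: "t \<in> {0..S}" for t
  proof -
    have "continuous_on UNIV (\<lambda>p :: (real^2) \<times> (real^2). \<phi> (t, fst p))"
      by (rule continuous_on_compose2[OF c]) (use t in \<open>auto intro!: continuous_intros\<close>)
    moreover have "\<forall>z w :: real^2. \<bar>\<phi> (t, z)\<bar> \<le> B" using B t by simp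
    ultimately have "(\<lambda>k. LINT z|\<mu> k t. LINT w|\<mu> k t. \<phi> (t, z)) \<longlonglongrightarrow> (LINT z|\<rho> t. LINT w|\<rho> t. \<phi> (t, z))"
      using conv[OF t, unfolded product_converges_def, rule_format, of "\<lambda>z w. \<phi> (t, z)" B] by simp
    then show ?thesis by (simp add: prob_space.prob_space[OF prob(1)[OF t]] prob_space.prob_space[OF prob(2)[OF t]])
  qed
  have e1: "(LINT x|spacetime_measure S (\<mu> k). \<phi> x) = (LINT t|?I. LINT z|\<mu> k t. \<phi> (t, z))" for k
    by (rule integral_spacetime_measure(2)[OF \<mu> S m B])
  have e2: "(LINT x|spacetime_measure S \<rho>. \<phi> x) = (LINT t|?I. LINT z|\<rho> t. \<phi> (t, z))"
    by (rule integral_spacetime_measure(2)[OF \<rho> S m B])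
  show "(\<lambda>k. LINT x|spacetime_measure S (\<mu> k). \<phi> x) \<longlonglongrightarrow> (LINT x|spacetime_measure S \<rho>. \<phi> x)"
    unfolding e1 e2
  proof (rule integral_dominated_convergence[where w = "\<lambda>_. B"])
    show "(\<lambda>t. LINT z|\<rho> t. \<phi> (t, z)) \<in> borel_measurable ?I" by (rule integral_spacetime_measure(1)[OF \<rho> S m B])
    show "(\<lambda>t. LINT z|\<mu> k t. \<phi> (t, z)) \<in> borel_measurable ?I" for k by (rule integral_spacetime_measure(1)[OF \<mu> S m B])
    show "AE t in ?I. (\<lambda>k. LINT z|\<mu> k t. \<phi> (t, z)) \<longlonglongrightarrow> (LINT z|\<rho> t. \<phi> (t, z))"
      by (rule AE_I2) (use lim in \<open>simp add: space_restrict_space\<close>)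
    show "AE t in ?I. norm (LINT z|\<mu> k t. \<phi> (t, z)) \<le> B" for k
    proof (rule AE_I2)
      fix t assume "t \<in> space ?I"
      then have t: "t \<in> {0..S}" by (simp add: space_restrict_space)
      have "\<bar>LINT z|\<mu> k t. \<phi> (t, z)\<bar> \<le> B"
        by (rule integral_abs_le_const[OF prob(1)[OF t] _ B0]) (use B t in auto)
      then show "norm (LINT z|\<mu> k t. \<phi> (t, z)) \<le> B" by simp
    qed
  qed simp
qed

section \<open>The reconstruction as a curve of measures\<close>

context discretised
begin

lemma level_measurable: "level \<in> measurable borel (count_space UNIV)"
  unfolding level_def by measurable

lemma sol_curve: "P2_curve S sol"
  unfolding P2_curve_def
proof (intro conjI ballI sol_P2)
  have "(\<lambda>n. grid_measure dx dy (r n)) \<in> measurable (count_space UNIV) (subprob_algebra borel)"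
    by (auto simp: measurable_count_space_eq1 space_subprob_algebra sets_grid_measure
        intro: prob_space_imp_subprob_space grid_density.prob_space_grid_measure[OF density])
  from measurable_compose[OF level_measurable this]
  have "sol \<in> measurable borel (subprob_algebra borel)" by (simp add: sol_def[abs_def])
  then show "sol \<in> measurable (restrict_space borel {0..S}) (subprob_algebra borel)" by (rule measurable_restrict_space1)
qed

text \<open>By Tonelli, a density over space-time and its disintegration in time give every Borel
  set the same mass. This transfers all results on curves to the reconstruction.\<close>

lemma reconstruction_measure_eq: "reconstruction_measure F T f \<rho>in S dx dy \<delta> dt = spacetime_measure S sol"
proof (rule measure_eqI)
  have S0: "0 \<le> S" using S by simp
  have sb: "sets (restrict_space lborel (strip S)) = sets (restrict_space borel (strip S))"
    by (rule sets_restrict_space_cong[OF sets_lborel])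
  show "sets (reconstruction_measure F T f \<rho>in S dx dy \<delta> dt) = sets (spacetime_measure S sol)"
    unfolding sets_spacetime_measure[OF S0] by (simp add: reconstruction_measure_def sb)
  let ?q = "\<lambda>t (z :: real^2). r (level t) \<lfloor>z $ 1 / dx\<rfloor> \<lfloor>z $ 2 / dy\<rfloor>"
  have qm: "(\<lambda>p. ennreal (?q (fst p) (snd p))) \<in> borel_measurable borel"
  proof -
    have "(\<lambda>p :: real \<times> (real^2). ennreal (r (level (fst p)) \<lfloor>snd p $ 1 / dx\<rfloor> \<lfloor>snd p $ 2 / dy\<rfloor>)) \<in> borel_measurable (borel \<Otimes>\<^sub>M borel)"
    proof (rule measurable_compose_countable[where f = "\<lambda>n p. ennreal (r n \<lfloor>snd p $ 1 / dx\<rfloor> \<lfloor>snd p $ 2 / dy\<rfloor>)" and g = "\<lambda>p. level (fst p)"])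
      show "(\<lambda>p :: real \<times> (real^2). ennreal (r n \<lfloor>snd p $ 1 / dx\<rfloor> \<lfloor>snd p $ 2 / dy\<rfloor>)) \<in> borel_measurable (borel \<Otimes>\<^sub>M borel)" for n
        by (rule measurable_compose[OF measurable_snd measurable_compose[OF grid_fun_measurable[of "r n" dx dy] measurable_ennreal]])
      show "(\<lambda>p :: real \<times> (real^2). level (fst p)) \<in> measurable (borel \<Otimes>\<^sub>M borel) (count_space UNIV)"
        by (rule measurable_compose[OF measurable_fst level_measurable])
    qed
    then show ?thesis unfolding borel_prod .
  qed
  fix A assume "A \<in> sets (reconstruction_measure F T f \<rho>in S dx dy \<delta> dt)"
  then have A: "A \<in> sets (restrict_space borel (strip S))" by (simp add: reconstruction_measure_def sb)
  then have AS: "A \<subseteq> strip S" and Ab [measurable]: "A \<in> sets borel"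
    by (auto simp: sets_restrict_space_iff)
  let ?R = "restrict_space (lborel :: (real \<times> (real^2)) measure) (strip S)"
  let ?rec = "\<lambda>p. ennreal (reconstruction F T f \<rho>in dx dy \<delta> dt (fst p) (snd p))"
  let ?g = "\<lambda>p. ennreal (?q (fst p) (snd p)) * indicator A p * indicator (strip S) p"
  have AR: "A \<in> sets ?R" unfolding sb by (rule A)
  have qR: "(\<lambda>p. ennreal (?q (fst p) (snd p))) \<in> borel_measurable ?R"
    by (rule measurable_restrict_space1) (simp only: measurable_lborel2 qm)
  have rq: "?rec p = ennreal (?q (fst p) (snd p))" if "p \<in> space ?R" for p
    using reconstruction_eq[of "fst p" "snd p"] that by (auto simp: space_restrict_space)
  have rR: "?rec \<in> borel_measurable ?R" by (subst measurable_cong[OF rq]) (assumption, rule qR)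
  have gm: "?g \<in> borel_measurable borel"
    by (intro borel_measurable_times_ennreal qm borel_measurable_indicator Ab strip_borel)
  have "reconstruction_measure F T f \<rho>in S dx dy \<delta> dt = density ?R ?rec"
    unfolding reconstruction_measure_def case_prod_beta' ..
  also have "\<dots> = density ?R (\<lambda>p. ennreal (?q (fst p) (snd p)))"
    by (rule density_cong[OF rR qR AE_I2[OF rq]])
  finally have "emeasure (reconstruction_measure F T f \<rho>in S dx dy \<delta> dt) A
      = (\<integral>\<^sup>+p. ennreal (?q (fst p) (snd p)) * indicator A p \<partial>?R)"
    by (simp only: emeasure_density[OF qR AR])
  also have "\<dots> = (\<integral>\<^sup>+p. ?g p \<partial>lborel)"
    by (rule nn_integral_restrict_space) simp
  also have "\<dots> = (\<integral>\<^sup>+p. ?g p \<partial>(lborel \<Otimes>\<^sub>M lborel))"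
    by (simp only: lborel_prod)
  also have "\<dots> = (\<integral>\<^sup>+t. (\<integral>\<^sup>+z. ?g (t, z) \<partial>lborel) \<partial>lborel)"
    by (rule lborel.nn_integral_fst[symmetric]) (simp only: lborel_prod measurable_lborel2 gm)
  also have "\<dots> = (\<integral>\<^sup>+t. (\<integral>\<^sup>+z. ennreal (?q t z) * indicator A (t, z) \<partial>lborel) * indicator {0..S} t \<partial>lborel)"
    by (rule nn_integral_cong) (auto simp: indicator_def)
  also have "\<dots> = (\<integral>\<^sup>+t. (\<integral>\<^sup>+z. ennreal (?q t z) * indicator A (t, z) \<partial>lborel) \<partial>restrict_space lborel {0..S})"
    by (rule nn_integral_restrict_space[symmetric]) simp
  also have "\<dots> = (\<integral>\<^sup>+t. (\<integral>\<^sup>+z. indicator A (t, z) \<partial>sol t) \<partial>restrict_space lborel {0..S})"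
  proof (rule nn_integral_cong)
    fix t
    have "(\<lambda>z. indicator A (t, z) :: ennreal) \<in> borel_measurable borel"
    proof -
      have "Pair t \<in> measurable (borel :: (real^2) measure) borel" unfolding borel_prod[symmetric] by measurable
      from measurable_compose[OF this borel_measurable_indicator[OF Ab]] show ?thesis .
    qed
    then show "(\<integral>\<^sup>+z. ennreal (?q t z) * indicator A (t, z) \<partial>lborel) = (\<integral>\<^sup>+z. indicator A (t, z) \<partial>sol t)"
      unfolding sol_def grid_measure_def by (subst nn_integral_density) auto
  qed
  also have "\<dots> = (\<integral>\<^sup>+x. indicator A x \<partial>spacetime_measure S sol)"
    by (rule nn_integral_spacetime_measure[OF sol_curve, symmetric]) (use A in simp)
  also have "\<dots> = emeasure (spacetime_measure S sol) A"
    using A by (simp add: sets_spacetime_measure[OF S0])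
  finally show "emeasure (reconstruction_measure F T f \<rho>in S dx dy \<delta> dt) A = emeasure (spacetime_measure S sol) A" .
qed

end

section \<open>Convergence of subsequences and of the whole sequence\<close>

context discretised_sequence
begin

theorem subsequence_convergence:
  "\<exists>\<rho> r. aggregation_solution F T \<rho>in S \<rho> \<and> strict_mono (r :: nat \<Rightarrow> nat) \<and>
    weakly_converges_Mb (strip S)
      (\<lambda>k. reconstruction_measure F T f \<rho>in S (dx (r k)) (dy (r k)) (\<delta> (r k)) (dt (r k))) (spacetime_measure S \<rho>)"
proof -
  obtain r \<rho> where r: "strict_mono (r :: nat \<Rightarrow> nat)" and \<rho>: "P2_curve S \<rho>"
    and conv: "\<And>t. t \<in> {0..S} \<Longrightarrow> product_converges (\<lambda>k. mu (r k) t) (\<rho> t)"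
    using compactness by blast
  have "weakly_converges_Mb (strip S) (\<lambda>k. spacetime_measure S (mu (r k))) (spacetime_measure S \<rho>)"
    using S by (intro spacetime_weak_convergence discretised.sol_curve[OF disc] \<rho> conv) auto
  then have "weakly_converges_Mb (strip S)
      (\<lambda>k. reconstruction_measure F T f \<rho>in S (dx (r k)) (dy (r k)) (\<delta> (r k)) (dt (r k))) (spacetime_measure S \<rho>)"
    by (simp only: discretised.reconstruction_measure_eq[OF disc])
  with limit_is_solution[OF r \<rho> conv] r
  have "aggregation_solution F T \<rho>in S \<rho> \<and> strict_mono r \<and> weakly_converges_Mb (strip S)
      (\<lambda>k. reconstruction_measure F T f \<rho>in S (dx (r k)) (dy (r k)) (\<delta> (r k)) (dt (r k))) (spacetime_measure S \<rho>)"
    by (intro conjI)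
  then show ?thesis by (intro exI)
qed

lemma subsequence:
  assumes "strict_mono s"
  shows "discretised_sequence F T f \<rho>in S (\<lambda>k. dx (s k)) (\<lambda>k. dy (s k)) (\<lambda>k. \<delta> (s k)) (\<lambda>k. dt (s k))"
proof (unfold_locales, rule adm, rule \<rho>in, rule S)
  show "(\<lambda>k. max (dx (s k)) (dy (s k))) \<longlonglongrightarrow> 0" using LIMSEQ_subseq_LIMSEQ[OF mesh assms] by (simp add: o_def)
  show "(\<lambda>k. \<delta> (s k)) \<longlonglongrightarrow> 0" using LIMSEQ_subseq_LIMSEQ[OF diffusion assms] by (simp add: o_def)
qed

text \<open>A subsequence of the discretisations is again admissible, so it has a further
  subsequence that converges to some solution; uniqueness identifies the limit measure. The
  subsequence principle is applied to the integrals of each fixed test function.\<close>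

theorem unique_limit_convergence:
  assumes \<rho>: "the_aggregation_solution F T \<rho>in S \<rho>"
  shows "weakly_converges_Mb (strip S)
    (\<lambda>k. reconstruction_measure F T f \<rho>in S (dx k) (dy k) (\<delta> k) (dt k)) (spacetime_measure S \<rho>)"
proof -
  let ?M = "\<lambda>k. reconstruction_measure F T f \<rho>in S (dx k) (dy k) (\<delta> k) (dt k)"
  have S0: "0 \<le> S" using S by simp
  have curve: "P2_curve S \<rho>" using \<rho> unfolding the_aggregation_solution_def aggregation_solution_def by (elim conjE)
  have M: "?M k = spacetime_measure S (mu k)" for k by (rule discretised.reconstruction_measure_eq[OF disc])
  have fin: "finite_measure (?M k) \<and> sets (?M k) = sets (restrict_space borel (strip S))" for k
    unfolding M by (intro conjI finite_spacetime_measure sets_spacetime_measure S0 discretised.sol_curve[OF disc])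
  have "(\<lambda>k. LINT x|?M k. \<phi> x) \<longlonglongrightarrow> (LINT x|spacetime_measure S \<rho>. \<phi> x)" if \<phi>: "\<phi> \<in> C0_on (strip S)" for \<phi>
  proof (rule LIMSEQ_subseq_criterion)
    fix s :: "nat \<Rightarrow> nat" assume s: "strict_mono s"
    obtain \<rho>' q where \<rho>': "aggregation_solution F T \<rho>in S \<rho>'" and q: "strict_mono (q :: nat \<Rightarrow> nat)"
      and w: "weakly_converges_Mb (strip S) (\<lambda>k. ?M (s (q k))) (spacetime_measure S \<rho>')"
      using discretised_sequence.subsequence_convergence[OF subsequence[OF s]] by (elim exE conjE) (rule that; assumption)
    have "spacetime_measure S \<rho>' = spacetime_measure S \<rho>"
      using \<rho> \<rho>' unfolding the_aggregation_solution_def by (elim conjE allE[of _ \<rho>'] impE)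
    then have "(\<lambda>k. LINT x|?M (s (q k)). \<phi> x) \<longlonglongrightarrow> (LINT x|spacetime_measure S \<rho>. \<phi> x)"
      using w[unfolded weakly_converges_Mb_def, THEN conjunct2, THEN conjunct2, THEN conjunct2, rule_format, OF \<phi>] by (simp only:)
    then show "\<exists>q. strict_mono (q :: nat \<Rightarrow> nat) \<and> (\<lambda>k. LINT x|?M (s (q k)). \<phi> x) \<longlonglongrightarrow> (LINT x|spacetime_measure S \<rho>. \<phi> x)"
      using q by (intro exI[of _ q] conjI)
  qed
  then show ?thesis unfolding weakly_converges_Mb_def
    by (intro conjI allI ballI fin[THEN conjunct1] fin[THEN conjunct2] finite_spacetime_measure[OF curve S0] sets_spacetime_measure[OF S0])
qed

end

text \<open>The argument yields existence of a solution, not its uniqueness, which is why the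
  conclusion is a conjunction. The second conjunct records the subsequence convergence that holds in
  every case.\<close>

theorem theorem3p3:
  fixes s l :: "real^2 \<Rightarrow> real^2"
    and c f S :: real
    and fs fl :: "real \<Rightarrow> real"
    and T :: "real^2 \<Rightarrow> real^2^2"
    and F :: "real^2 \<Rightarrow> real^2^2 \<Rightarrow> real^2"
    and \<rho>in :: "(real^2) measure"
    and dx dy \<delta> :: "nat \<Rightarrow> real"
    and dt :: "nat \<Rightarrow> nat \<Rightarrow> real"
  assumes s_unit: "\<And>z. norm (s z) = 1"
    and l_unit: "\<And>z. norm (l z) = 1"
    and s_orth_l: "\<And>z. s z \<bullet> l z = 0"
    and c_range: "c \<in> {0..1}"
    and T_def: "T = tensor_field c s l"
    and F_form: "\<And>v z. F v (T z) =
      (fs (norm v) * (s z \<bullet> v)) *\<^sub>R s z + (fl (norm v) * (l z \<bullet> v)) *\<^sub>R l z"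
    and F_continuous: "continuous_on (UNIV \<times> range T) (\<lambda>(v, A). F v A)"
    and F_bounded: "\<And>v z. norm (F v (T z)) \<le> f"
    and T_continuous: "continuous_on UNIV T"
    and initial_datum: "\<rho>in \<in> P2"
    and S_pos: "0 < S"
    and discretisation: "\<And>k. admissible_discretisation F T f \<rho>in S (dx k) (dy k) (\<delta> k) (dt k)"
    and mesh_to_0: "(\<lambda>k. max (dx k) (dy k)) \<longlonglongrightarrow> 0"
    and diffusion_to_0: "\<delta> \<longlonglongrightarrow> 0"
  shows "(\<forall>\<rho>. the_aggregation_solution F T \<rho>in S \<rho> \<longrightarrow>
            weakly_converges_Mb ({0..S} \<times> UNIV)
              (\<lambda>k. reconstruction_measure F T f \<rho>in S (dx k) (dy k) (\<delta> k) (dt k))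
              (spacetime_measure S \<rho>)) \<and>
         (\<exists>\<rho> r. aggregation_solution F T \<rho>in S \<rho> \<and> strict_mono r \<and>
            weakly_converges_Mb ({0..S} \<times> UNIV)
              (\<lambda>k. reconstruction_measure F T f \<rho>in S
                     (dx (r k)) (dy (r k)) (\<delta> (r k)) (dt (r k)))
              (spacetime_measure S \<rho>))"
proof -
  \<comment> \<open>The force is continuous on the values taken by the tensor field; composition
    with \<open>T\<close> gives joint continuity in displacement and position.\<close>
  have "continuous_on UNIV (\<lambda>p :: (real^2) \<times> (real^2). (\<lambda>(v, A). F v A) (fst p, T (snd p)))"
    by (rule continuous_on_compose2[OF F_continuous])
      (auto intro!: continuous_intros continuous_on_compose2[OF T_continuous])
  then have F_cont: "continuous_on UNIV (\<lambda>p. F (fst p) (T (snd p)))" by simp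
  interpret discretised_sequence F T f \<rho>in S dx dy \<delta> dt
    by (unfold_locales; fact F_cont F_bounded discretisation initial_datum S_pos mesh_to_0 diffusion_to_0)
  show ?thesis using unique_limit_convergence subsequence_convergence by (intro conjI allI impI)
qed

end
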